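(* Let $Z$ be a Dedekind domain with field of fractions $Q$, let $K$ be a non-zero étale $Q$-algebra with maximal order $\mathcal{O}_K$, and let $S$ be an order in $K$. Then the following hold. (1) For every prime $\mathfrak{p}$ of $S$, \[ \mathrm{type}_{\mathfrak p}(S) = \dim_{S/\mathfrak p} \frac{S^t}{\mathfrak p S^t}. \] (2) If $S\neq \mathcal{O}_K$ then \[ \mathrm{type}(S) + 1 = \max\left\{ \dim_{S/\mathfrak p}\frac{(\mathfrak p:\mathfrak p)}{\mathfrak p} \;:\; \mathfrak p \text{ is a prime of } S \right\}. \] (3) Assume that $\dim_Q(K)>1$. Then the type of every order in $K$ is at most $\dim_Q(K)-1$. Moreover, this bound is attained: if $p$ is a prime of $Z$, then the order $T=Z+p\mathcal{O}_K$ satisfies $\mathrm{type}(T)=\dim_Q(K)-1$.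
   Context: Rings are commutative with unity and non-zero; a Dedekind domain is not a field. An étale $Q$-algebra is one isomorphic to a finite product of finite separable field extensions of $Q$. A lattice in $K$ is a finitely generated sub-$Z$-module of $K$ containing a $Q$-basis of $K$; an order in $K$ is a subring of $K$ that is a lattice. $\mathcal{O}_K$ is the integral closure of $Z$ in $K$; it is the maximal order of $K$. A fractional $S$-ideal is a finitely generated sub-$S$-module of $K$ which is a lattice. A prime of $S$ is a fractional $S$-ideal which is also a prime ideal of $S$ (equivalently, a maximal ideal of $S$); a prime of $Z$ is a non-zero prime ideal. For lattices $I,J$ in $K$, $(I:J)=\{x\in K : xJ\subseteq I\}$. The trace dual of a lattice $L$ is $L^t=\{x\in K : \mathrm{Tr}_{K/Q}(xL)\subseteq Z\}$. For a prime $\mathfrak p$ of $S$, $\hat S_{\mathfrak p}$ is the completion of $S$ at $\mathfrak p$, with residue field $k$, and the (Cohen-Macaulay) type of $S$ at $\mathfrak p$ is $\mathrm{type}_{\mathfrak p}(S)=\dim_k \mathrm{Ext}^1_{\hat S_{\mathfrak p}}(k,\hat S_{\mathfrak p})$. The type of $S$ is $\mathrm{type}(S)=\max_{\mathfrak p}\mathrm{type}_{\mathfrak p}(S)$, the maximum over all primes of $S$. *)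

theory Defs
  imports
    "HOL-Algebra.Finite_Extensions"
    "HOL-Algebra.Chinese_Remainder"
    "HOL-Algebra.Ring_Divisibility"
    "HOL-Algebra.Ideal_Product"
    "Jordan_Normal_Form.Missing_VectorSpace"
begin

text \<open>
  The ambient ring \<^term>\<open>K\<close> is a ring record. A non-zero algebra over a field \<open>Q\<close> contains
  \<open>Q\<close>, so \<open>Q\<close> is taken to be a subfield of \<^term>\<open>K\<close>, and the base ring \<open>Z\<close>, the orders and the
  lattices are subsets of its carrier. A subring \<open>S\<close> viewed as a ring of its own is
  \<open>K\<lparr>carrier := S\<rparr>\<close>. Dimensions over \<open>Q\<close> of subspaces of \<^term>\<open>K\<close> are \<^const>\<open>ring.dim\<close>,
  dimensions of abstract vector spaces are \<^const>\<open>vectorspace.dim\<close>.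
\<close>

section \<open>Modules\<close>

text \<open>The type of module records extends that of rings; the fields \<^const>\<open>monoid.mult\<close> and
  \<^const>\<open>one\<close> of the modules below carry no meaning.\<close>

definition sub_module :: "('a, 'm) ring_scheme \<Rightarrow> 'a set \<Rightarrow> ('a, 'a) module" where
  "sub_module K M =
     \<lparr>carrier = M, monoid.mult = monoid.mult K, one = \<one>\<^bsub>K\<^esub>, zero = \<zero>\<^bsub>K\<^esub>, add = add K,
      smult = monoid.mult K\<rparr>"

definition quot_module :: "('r, 'a, 'm) module_scheme \<Rightarrow> 'a set \<Rightarrow> ('r, 'a set) module" where
  "quot_module M N =
     \<lparr>carrier = a_rcosets\<^bsub>M\<^esub> N, monoid.mult = (\<lambda>_ _. N), one = N, zero = N, add = set_add M,
      smult = (\<lambda>a C. \<Union>x\<in>C. N +>\<^bsub>M\<^esub> (a \<odot>\<^bsub>M\<^esub> x))\<rparr>"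

text \<open>A module over \<open>R\<close> that is annihilated by the ideal \<open>I\<close>, as a module over \<open>R Quot I\<close>:
  all representatives of a coset in \<open>R Quot I\<close> act in the same way.\<close>

definition factor_scalars :: "('r, 'a, 'm) module_scheme \<Rightarrow> ('r set, 'a) module" where
  "factor_scalars M =
     \<lparr>carrier = carrier M, monoid.mult = monoid.mult M, one = \<one>\<^bsub>M\<^esub>, zero = \<zero>\<^bsub>M\<^esub>, add = add M,
      smult = (\<lambda>A x. the_elem ((\<lambda>a. a \<odot>\<^bsub>M\<^esub> x) ` A))\<rparr>"

definition residue_dim :: "('r, 'n) ring_scheme \<Rightarrow> 'r set \<Rightarrow> ('r, 'a, 'm) module_scheme \<Rightarrow> nat" where
  "residue_dim R I M = vectorspace.dim (R Quot I) (factor_scalars M)"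

definition hom_module ::
  "('r, 'n) ring_scheme \<Rightarrow> ('r, 'a, 'm) module_scheme \<Rightarrow> ('r, 'b, 'l) module_scheme
    \<Rightarrow> ('r, 'a \<Rightarrow> 'b) module" where
  "hom_module R M N =
     \<lparr>carrier = module_hom R M N \<inter> extensional (carrier M),
      monoid.mult = (\<lambda>_ _. \<lambda>x\<in>carrier M. \<zero>\<^bsub>N\<^esub>), one = (\<lambda>x\<in>carrier M. \<zero>\<^bsub>N\<^esub>),
      zero = (\<lambda>x\<in>carrier M. \<zero>\<^bsub>N\<^esub>),
      add = (\<lambda>f g. \<lambda>x\<in>carrier M. f x \<oplus>\<^bsub>N\<^esub> g x),
      smult = (\<lambda>a f. \<lambda>x\<in>carrier M. a \<odot>\<^bsub>N\<^esub> f x)\<rparr>"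

text \<open>The free module on a set \<open>B\<close>, realized as the finitely supported functions.\<close>

definition free_module :: "('r, 'n) ring_scheme \<Rightarrow> 'a set \<Rightarrow> ('r, 'a \<Rightarrow> 'r) module" where
  "free_module R B =
     \<lparr>carrier = {f. range f \<subseteq> carrier R \<and> {x. f x \<noteq> \<zero>\<^bsub>R\<^esub>} \<subseteq> B \<and> finite {x. f x \<noteq> \<zero>\<^bsub>R\<^esub>}},
      monoid.mult = (\<lambda>_ _ _. \<zero>\<^bsub>R\<^esub>), one = (\<lambda>_. \<zero>\<^bsub>R\<^esub>), zero = (\<lambda>_. \<zero>\<^bsub>R\<^esub>),
      add = (\<lambda>f g x. f x \<oplus>\<^bsub>R\<^esub> g x),
      smult = (\<lambda>a f x. a \<otimes>\<^bsub>R\<^esub> f x)\<rparr>"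

definition free_eval :: "('r, 'n) ring_scheme \<Rightarrow> ('r, 'a, 'm) module_scheme \<Rightarrow> ('a \<Rightarrow> 'r) \<Rightarrow> 'a" where
  "free_eval R M f = (\<Oplus>\<^bsub>M\<^esub>x\<in>{x. f x \<noteq> \<zero>\<^bsub>R\<^esub>}. f x \<odot>\<^bsub>M\<^esub> x)"

definition syzygy :: "('r, 'n) ring_scheme \<Rightarrow> ('r, 'a, 'm) module_scheme \<Rightarrow> ('r, 'a \<Rightarrow> 'r) module" where
  "syzygy R M =
     (free_module R (carrier M))
       \<lparr>carrier := {f \<in> carrier (free_module R (carrier M)). free_eval R M f = \<zero>\<^bsub>M\<^esub>}\<rparr>"

text \<open>
  With \<open>F\<close> the free module on the underlying set of \<open>M\<close> and \<open>\<Omega>\<close> the kernel of the canonical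
  surjection \<open>F \<rightarrow> M\<close>, the module \<open>Ext\<^sup>1(M, N)\<close> is the cokernel of the restriction map
  \<open>Hom(F, N) \<rightarrow> Hom(\<Omega>, N)\<close>. For a projective resolution \<open>\<dots> \<rightarrow> P\<^sub>2 \<rightarrow> P\<^sub>1 \<rightarrow> F \<rightarrow> M \<rightarrow> 0\<close> this is the
  first cohomology of \<open>Hom(P\<^sub>\<bullet>, N)\<close>, because \<open>Hom(\<Omega>, N)\<close> is the kernel of
  \<open>Hom(P\<^sub>1, N) \<rightarrow> Hom(P\<^sub>2, N)\<close>.
\<close>

definition Ext1 ::
  "('r, 'n) ring_scheme \<Rightarrow> ('r, 'a, 'm) module_scheme \<Rightarrow> ('r, 'b, 'l) module_scheme
    \<Rightarrow> ('r, (('a \<Rightarrow> 'r) \<Rightarrow> 'b) set) module" where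
  "Ext1 R M N =
     quot_module (hom_module R (syzygy R M) N)
       ((\<lambda>f. restrict f (carrier (syzygy R M)))
          ` carrier (hom_module R (free_module R (carrier M)) N))"

section \<open>Completions and the type of a local ring\<close>

text \<open>The inverse limit of the rings \<open>R Quot I\<^sup>n\<close>. A coset of \<open>I\<^sup>n\<^sup>+\<^sup>1\<close> is mapped to a coset of
  \<open>I\<^sup>n\<close> if and only if it is contained in it.\<close>

definition completion :: "('a, 'm) ring_scheme \<Rightarrow> 'a set \<Rightarrow> (nat \<Rightarrow> 'a set) ring" where
  "completion R I =
     (let R' = (\<lambda>n::nat. R Quot (I [^]\<^bsub>ideals_set R\<^esub> n)) in
      \<lparr>carrier = {f. (\<forall>n. f n \<in> carrier (R' n)) \<and> (\<forall>n. f (Suc n) \<subseteq> f n)},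
       monoid.mult = (\<lambda>f g n. f n \<otimes>\<^bsub>R' n\<^esub> g n), one = (\<lambda>n. \<one>\<^bsub>R' n\<^esub>),
       zero = (\<lambda>n. \<zero>\<^bsub>R' n\<^esub>), add = (\<lambda>f g n. f n \<oplus>\<^bsub>R' n\<^esub> g n)\<rparr>)"

definition local_max_ideal :: "('a, 'm) ring_scheme \<Rightarrow> 'a set" where
  "local_max_ideal R = (THE m. maximalideal m R)"

text \<open>\<open>dim\<^sub>k Ext\<^sup>1(k, R)\<close> for a local ring \<open>R\<close> with residue field \<open>k\<close>.\<close>

definition local_type :: "('a, 'm) ring_scheme \<Rightarrow> nat" where
  "local_type R =
     (let m = local_max_ideal R; R_mod = sub_module R (carrier R)
      in residue_dim R m (Ext1 R (quot_module R_mod m) R_mod))"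

section \<open>Etale algebras\<close>

text \<open>Polynomials are lists of coefficients, starting with the leading one.\<close>

definition poly_deriv :: "('a, 'm) ring_scheme \<Rightarrow> 'a list \<Rightarrow> 'a list" where
  "poly_deriv R p =
     ring.normalize R (map (\<lambda>i. [i] \<cdot>\<^bsub>R\<^esub> ring.coeff R p i) (rev [1..<length p]))"

definition separable_poly :: "('a, 'm) ring_scheme \<Rightarrow> 'a set \<Rightarrow> 'a list \<Rightarrow> bool" where
  "separable_poly R F p \<longleftrightarrow>
     (\<exists>u \<in> carrier (univ_poly R F). \<exists>v \<in> carrier (univ_poly R F).
        (u \<otimes>\<^bsub>univ_poly R F\<^esub> p) \<oplus>\<^bsub>univ_poly R F\<^esub> (v \<otimes>\<^bsub>univ_poly R F\<^esub> poly_deriv R p)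
          = \<one>\<^bsub>univ_poly R F\<^esub>)"

definition finite_separable_extension :: "('a, 'm) ring_scheme \<Rightarrow> 'a set \<Rightarrow> bool" where
  "finite_separable_extension L F \<longleftrightarrow>
     field L \<and> subfield F L \<and> ring.finite_dimension L F (carrier L) \<and>
     (\<forall>x \<in> carrier L. separable_poly L F (ring.Irr L F x))"

text \<open>
  The isomorphism \<open>\<phi>\<close> is one of \<open>Q\<close>-algebras when the \<open>i\<close>-th factor is given the \<open>Q\<close>-algebra
  structure \<open>q \<mapsto> \<phi> q ! i\<close>. The factors can be found in the type of \<^term>\<open>K\<close>, as each of them is
  isomorphic to an ideal of \<^term>\<open>K\<close> generated by an idempotent.
\<close>

definition etale_algebra :: "('a, 'm) ring_scheme \<Rightarrow> 'a set \<Rightarrow> bool" where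
  "etale_algebra K Q \<longleftrightarrow>
     cring K \<and> subfield Q K \<and>
     (\<exists>(Ls :: 'a ring list) \<phi>. \<phi> \<in> ring_iso K (RDirProd_list Ls) \<and>
        (\<forall>i < length Ls. finite_separable_extension (Ls ! i) ((\<lambda>q. \<phi> q ! i) ` Q)))"

section \<open>Lattices and orders\<close>

definition integral_over :: "('a, 'm) ring_scheme \<Rightarrow> 'a set \<Rightarrow> 'a \<Rightarrow> bool" where
  "integral_over K Z x \<longleftrightarrow>
     (\<exists>p \<in> carrier (univ_poly K Z). p \<noteq> [] \<and> hd p = \<one>\<^bsub>K\<^esub> \<and> ring.eval K p x = \<zero>\<^bsub>K\<^esub>)"

definition maximal_order :: "('a, 'm) ring_scheme \<Rightarrow> 'a set \<Rightarrow> 'a set" where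
  "maximal_order K Z = {x \<in> carrier K. integral_over K Z x}"

text \<open>\<open>Z\<close> is a Dedekind domain and the subfield \<open>Q\<close> of \<^term>\<open>K\<close> is its field of fractions.\<close>

definition dedekind_with_fractions :: "('a, 'm) ring_scheme \<Rightarrow> 'a set \<Rightarrow> 'a set \<Rightarrow> bool" where
  "dedekind_with_fractions K Q Z \<longleftrightarrow>
     subfield Q K \<and> subring Z K \<and> Z \<subseteq> Q \<and>
     (\<forall>x \<in> Q. \<exists>a \<in> Z. \<exists>b \<in> Z - {\<zero>\<^bsub>K\<^esub>}. x \<otimes>\<^bsub>K\<^esub> b = a) \<and>
     noetherian_domain (K\<lparr>carrier := Z\<rparr>) \<and>
     \<not> field (K\<lparr>carrier := Z\<rparr>) \<and>
     (\<forall>x \<in> Q. integral_over K Z x \<longrightarrow> x \<in> Z) \<and>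
     (\<forall>P. primeideal P (K\<lparr>carrier := Z\<rparr>) \<and> P \<noteq> {\<zero>\<^bsub>K\<^esub>} \<longrightarrow> maximalideal P (K\<lparr>carrier := Z\<rparr>))"

definition basis_over :: "('a, 'm) ring_scheme \<Rightarrow> 'a set \<Rightarrow> 'a list \<Rightarrow> bool" where
  "basis_over K Q Us \<longleftrightarrow> ring.independent K Q Us \<and> ring.Span K Q Us = carrier K"

text \<open>For a subring \<open>R\<close> that need not be a field, \<^const>\<open>ring.Span\<close> still denotes the
  \<open>R\<close>-submodule generated by a list of elements.\<close>

definition fg_submodule :: "('a, 'm) ring_scheme \<Rightarrow> 'a set \<Rightarrow> 'a set \<Rightarrow> bool" where
  "fg_submodule K R M \<longleftrightarrow> (\<exists>Us. set Us \<subseteq> carrier K \<and> M = ring.Span K R Us)"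

definition lattice_in :: "('a, 'm) ring_scheme \<Rightarrow> 'a set \<Rightarrow> 'a set \<Rightarrow> 'a set \<Rightarrow> bool" where
  "lattice_in K Q Z L \<longleftrightarrow> fg_submodule K Z L \<and> (\<exists>Us. set Us \<subseteq> L \<and> basis_over K Q Us)"

definition order_in :: "('a, 'm) ring_scheme \<Rightarrow> 'a set \<Rightarrow> 'a set \<Rightarrow> 'a set \<Rightarrow> bool" where
  "order_in K Q Z S \<longleftrightarrow> subring S K \<and> lattice_in K Q Z S"

definition fractional_ideal ::
  "('a, 'm) ring_scheme \<Rightarrow> 'a set \<Rightarrow> 'a set \<Rightarrow> 'a set \<Rightarrow> 'a set \<Rightarrow> bool" where
  "fractional_ideal K Q Z S I \<longleftrightarrow> fg_submodule K S I \<and> lattice_in K Q Z I"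

definition order_primes :: "('a, 'm) ring_scheme \<Rightarrow> 'a set \<Rightarrow> 'a set \<Rightarrow> 'a set \<Rightarrow> 'a set set" where
  "order_primes K Q Z S = {P. fractional_ideal K Q Z S P \<and> primeideal P (K\<lparr>carrier := S\<rparr>)}"

definition base_primes :: "('a, 'm) ring_scheme \<Rightarrow> 'a set \<Rightarrow> 'a set set" where
  "base_primes K Z = {P. primeideal P (K\<lparr>carrier := Z\<rparr>) \<and> P \<noteq> {\<zero>\<^bsub>K\<^esub>}}"

definition colon :: "('a, 'm) ring_scheme \<Rightarrow> 'a set \<Rightarrow> 'a set \<Rightarrow> 'a set" where
  "colon K I J = {x \<in> carrier K. \<forall>y \<in> J. x \<otimes>\<^bsub>K\<^esub> y \<in> I}"

text \<open>\<open>A j ! i\<close> is the \<open>(i, j)\<close> entry of the matrix of multiplication by \<open>x\<close> in the basis \<open>Us\<close>;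
  the sum of the diagonal entries does not depend on the basis.\<close>

definition algebra_trace :: "('a, 'm) ring_scheme \<Rightarrow> 'a set \<Rightarrow> 'a \<Rightarrow> 'a" where
  "algebra_trace K Q x =
     (THE t. \<exists>Us A. basis_over K Q Us \<and>
        (\<forall>j < length Us. set (A j) \<subseteq> Q \<and> length (A j) = length Us \<and>
           x \<otimes>\<^bsub>K\<^esub> Us ! j = ring.combine K (A j) Us) \<and>
        t = (\<Oplus>\<^bsub>K\<^esub>j\<in>{..<length Us}. A j ! j))"

definition trace_dual :: "('a, 'm) ring_scheme \<Rightarrow> 'a set \<Rightarrow> 'a set \<Rightarrow> 'a set \<Rightarrow> 'a set" where
  "trace_dual K Q Z L = {x \<in> carrier K. \<forall>y \<in> L. algebra_trace K Q (x \<otimes>\<^bsub>K\<^esub> y) \<in> Z}"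

section \<open>The type of an order\<close>

definition type_at :: "('a, 'm) ring_scheme \<Rightarrow> 'a set \<Rightarrow> 'a set \<Rightarrow> nat" where
  "type_at K S P = local_type (completion (K\<lparr>carrier := S\<rparr>) P)"

definition order_type :: "('a, 'm) ring_scheme \<Rightarrow> 'a set \<Rightarrow> 'a set \<Rightarrow> 'a set \<Rightarrow> nat" where
  "order_type K Q Z S = Max (type_at K S ` order_primes K Q Z S)"

text \<open>\<open>dim (M / N)\<close> over \<open>S / P\<close> for \<open>S\<close>-submodules \<open>N \<subseteq> M\<close> of \<^term>\<open>K\<close> with \<open>P M \<subseteq> N\<close>.\<close>

definition quotient_dim :: "('a, 'm) ring_scheme \<Rightarrow> 'a set \<Rightarrow> 'a set \<Rightarrow> 'a set \<Rightarrow> 'a set \<Rightarrow> nat" where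
  "quotient_dim K S P M N =
     residue_dim (K\<lparr>carrier := S\<rparr>) P (quot_module (sub_module K M) N)"

end

theory Submission
  imports Defs
begin

text \<open>
  Let \<open>a \<in> P \<inter> Z\<close> be non-zero. Since \<open>a\<close> is a non-zero-divisor, comparing maps on the syzygy of the
  residue field \<open>k\<close> with their value at the relation between \<open>a\<close> and \<open>1\<close> identifies \<open>Ext\<^sup>1(k, S)\<close> with
  the socle \<open>(aS : P)/aS\<close>, that is with \<open>(S : P)/S\<close>; as a power of \<open>P\<close> lies in \<open>aS\<close> locally at \<open>P\<close>,
  passing to the completion does not change it.

  For the first claim, the form \<open>(u, w) \<mapsto> a Tr(uw)\<close> with \<open>a\<close> a local generator of \<open>p = P \<inter> Z\<close> is a
  perfect pairing of the \<open>Z/p\<close>-spaces \<open>(S : P)/S\<close> and \<open>S\<^sup>t/P S\<^sup>t\<close>, because lattices are equal to their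
  double trace duals. Nondegeneracy of the trace comes from a separability element, an element
  \<open>e \<in> K \<otimes> K\<close> of product \<open>1\<close> with \<open>(x \<otimes> 1) e = (1 \<otimes> x) e\<close>, built from the difference quotients
  \<open>(f(x) - f(y))/(x - y)\<close> of separable polynomials \<open>f\<close>.

  For the second, either \<open>P\<close> is invertible, and \<open>(S : P)/S\<close> and \<open>(P : P)/P = S/P\<close> have dimension one,
  or \<open>(S : P) = (P : P)\<close> and the chain \<open>P \<subseteq> S \<subseteq> (P : P)\<close> gives \<open>dim (P : P)/P = type + 1\<close>. A prime
  containing the conductor of the maximal order is of the second kind. The third claim follows since
  \<open>(P : P)\<close> is a lattice, locally generated by \<open>dim K\<close> elements, and for \<open>T = Z + p OK\<close> the prime
  \<open>P = p OK\<close> has \<open>(P : P) = OK\<close>.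
\<close>

section \<open>Relative bases and dimensions of quotients\<close>

text \<open>No localization and no tensor product is ever built. A statement that holds locally at a
  prime is carried by a multiplier outside the prime, such as \<open>t\<close> with
  \<open>t x\<close> in \<open>aR\<close>; a tensor is a list of pairs that is tested against linear
  functionals. Dimensions of quotients are handled in the same spirit: a relative basis is a family
  in the module itself, so a dimension is transported by transporting a family, from Hom(\<Omega>,
  R) to the socle, from R to its completion, from aS to S.

  The trace pairing has values in Z/p, not in S/P. Both dimensions of the first claim are therefore
  multiplied by [S/P : Z/p], compared over Z/p, and the positive factor is cancelled. The factor
  \<open>a\<close> of the pairing is there because Tr(uw) need not be integral for u in (S : P) and
  w in the dual of S, while a u lies in S.

  That the socle is non-zero serves twice: over Z it produces a local generator of p, over S it
  makes the type positive.\<close>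

definition rel_basis ::
 "('r, 'n) ring_scheme \<Rightarrow> 'r set \<Rightarrow> ('r, 'c, 'm) module_scheme \<Rightarrow> 'c set \<Rightarrow> 'i set \<Rightarrow> ('i \<Rightarrow> 'c) \<Rightarrow> bool"
 where
 "rel_basis R I M N J b \<longleftrightarrow> finite J \<and> b \<in> J \<rightarrow> carrier M \<and>
  (\<forall>x \<in> carrier M. \<exists>c \<in> J \<rightarrow> carrier R. \<exists>n \<in> N. x = (\<Oplus>\<^bsub>M\<^esub>i\<in>J. c i \<odot>\<^bsub>M\<^esub> b i) \<oplus>\<^bsub>M\<^esub> n) \<and>
  (\<forall>c \<in> J \<rightarrow> carrier R. (\<Oplus>\<^bsub>M\<^esub>i\<in>J. c i \<odot>\<^bsub>M\<^esub> b i) \<in> N --> (\<forall>i\<in>J. c i \<in> I))"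

text \<open>Because I M lies in N, scalars that are congruent modulo I move an element into the same
  coset of N. This gives \<open>the_elem\<close> in \<open>factor_scalars\<close> its single
  value.\<close>

locale residue_quotient = module R M + maximalideal I R for R (structure) and M (structure) and I +
 fixes N
 assumes N_sub: "N \<subseteq> carrier M"
  and N_zero: "\<zero>\<^bsub>M\<^esub> \<in> N"
  and N_add: "[|x \<in> N; y \<in> N|] ==> x \<oplus>\<^bsub>M\<^esub> y \<in> N"
  and N_smult: "[|a \<in> carrier R; x \<in> N|] ==> a \<odot>\<^bsub>M\<^esub> x \<in> N"
  and N_annih: "[|a \<in> I; x \<in> carrier M|] ==> a \<odot>\<^bsub>M\<^esub> x \<in> N"
begin

lemma N_minus: "x \<in> N ==> \<ominus>\<^bsub>M\<^esub> x \<in> N"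
 using N_smult[of "\<ominus> \<one>" x] smult_minus_1[of x] N_sub by auto

sublocale NM: abelian_subgroup N M
proof (rule abelian_subgroupI3)
 show "additive_subgroup N M"
  unfolding additive_subgroup_def
  by (rule M.add.subgroupI) (use N_sub N_zero N_add N_minus in \<open>auto simp: a_inv_def\<close>)
qed (rule M.abelian_group_axioms)

abbreviation cs where "cs x \<equiv> N +>\<^bsub>M\<^esub> x"
abbreviation V where "V \<equiv> factor_scalars (quot_module M N)"

lemma carrier_V: "carrier V = a_rcosets\<^bsub>M\<^esub> N"
 by (simp add: factor_scalars_def quot_module_def)

lemma cs_closed: "x \<in> carrier M ==> cs x \<in> carrier V"
 unfolding carrier_V using M.a_rcosetsI[OF N_sub] by simp

lemma cs_cases:
 assumes "C \<in> carrier V"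
 obtains x where "x \<in> carrier M" "C = cs x"
 using assms unfolding carrier_V A_RCOSETS_def' a_r_coset_def' by auto

lemma cs_add: "[|x \<in> carrier M; y \<in> carrier M|] ==> cs x \<oplus>\<^bsub>V\<^esub> cs y = cs (x \<oplus>\<^bsub>M\<^esub> y)"
 by (simp add: factor_scalars_def quot_module_def NM.a_rcos_sum)

lemma cs_eq_iff: "[|x \<in> carrier M; y \<in> carrier M|] ==> cs x = cs y \<longleftrightarrow> x \<ominus>\<^bsub>M\<^esub> y \<in> N"
 by (metis NM.a_rcos_module NM.a_rcos_self NM.a_repr_independence' a_minus_def)

lemma cs_zero_iff: "x \<in> carrier M ==> cs x = N \<longleftrightarrow> x \<in> N"
 using M.a_coset_join2[OF _ NM.a_subgroup, of x] NM.a_rcos_self[of x] by auto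

lemma zero_V: "\<zero>\<^bsub>V\<^esub> = N"
 by (simp add: factor_scalars_def quot_module_def)

lemma quot_smult: "[|a \<in> carrier R; x \<in> carrier M|] ==> a \<odot>\<^bsub>quot_module M N\<^esub> cs x = cs (a \<odot>\<^bsub>M\<^esub> x)"
proof -
 assume a: "a \<in> carrier R" and x: "x \<in> carrier M"
 have "N +>\<^bsub>M\<^esub> (a \<odot>\<^bsub>M\<^esub> y) = cs (a \<odot>\<^bsub>M\<^esub> x)" if y: "y \<in> cs x" for y
 proof -
  obtain n where n: "n \<in> N" "y = n \<oplus>\<^bsub>M\<^esub> x" using y unfolding a_r_coset_def' by auto
  have nM: "n \<in> carrier M" using n N_sub by auto
  have "a \<odot>\<^bsub>M\<^esub> y = a \<odot>\<^bsub>M\<^esub> n \<oplus>\<^bsub>M\<^esub> a \<odot>\<^bsub>M\<^esub> x" using a x n nM by (simp add: smult_r_distr)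
  then have "a \<odot>\<^bsub>M\<^esub> y \<in> cs (a \<odot>\<^bsub>M\<^esub> x)" using N_smult[OF a n(1)] unfolding a_r_coset_def' by auto
  then show ?thesis using NM.a_repr_independence' a x by blast
 qed
 moreover have "x \<in> cs x" using x NM.a_rcos_self by blast
 ultimately have "(\<Union>y\<in>cs x. cs (a \<odot>\<^bsub>M\<^esub> y)) = cs (a \<odot>\<^bsub>M\<^esub> x)" by blast
 then show ?thesis by (simp add: quot_module_def)
qed

lemma rcoset_scalars:
 assumes "A \<in> carrier (R Quot I)"
 obtains a where "a \<in> carrier R" "A = I +> a"
 using assms by (auto simp: FactRing_def A_RCOSETS_def' a_r_coset_def')

lemma cs_smult: "[|a \<in> carrier R; x \<in> carrier M|] ==> (I +> a) \<odot>\<^bsub>V\<^esub> cs x = cs (a \<odot>\<^bsub>M\<^esub> x)"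
proof -
 assume a: "a \<in> carrier R" and x: "x \<in> carrier M"
 have "a' \<odot>\<^bsub>quot_module M N\<^esub> cs x = cs (a \<odot>\<^bsub>M\<^esub> x)" if y: "a' \<in> I +> a" for a'
 proof -
  obtain i where i: "i \<in> I" "a' = i \<oplus> a" using y unfolding a_r_coset_def' by auto
  have iR: "i \<in> carrier R" using i a_subset by auto
  have "a' \<odot>\<^bsub>M\<^esub> x = i \<odot>\<^bsub>M\<^esub> x \<oplus>\<^bsub>M\<^esub> a \<odot>\<^bsub>M\<^esub> x" using a x i iR by (simp add: smult_l_distr)
  then have "a' \<odot>\<^bsub>M\<^esub> x \<in> cs (a \<odot>\<^bsub>M\<^esub> x)" using N_annih[OF i(1) x] unfolding a_r_coset_def' by auto
  then have "cs (a' \<odot>\<^bsub>M\<^esub> x) = cs (a \<odot>\<^bsub>M\<^esub> x)" using NM.a_repr_independence' a x by (metis smult_closed)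
  then show ?thesis using quot_smult[of a' x] i iR a x by simp
 qed
 moreover have "a \<in> I +> a" using a a_rcos_self by blast
 ultimately have "(\<lambda>a. a \<odot>\<^bsub>quot_module M N\<^esub> cs x) ` (I +> a) = {cs (a \<odot>\<^bsub>M\<^esub> x)}" by blast
 then show ?thesis by (simp add: factor_scalars_def)
qed

lemma field_F: "field (R Quot I)"
 using quotient_is_field[OF R.is_cring] .

lemma rcos_hom: "ring_hom_cring R (R Quot I) ((+>) I)"
 using rcos_ring_hom_cring[OF R.is_cring] .

lemma rcos_closed: "a \<in> carrier R ==> I +> a \<in> carrier (R Quot I)"
 using rcos_ring_hom by (rule ring_hom_closed)

lemma rcos_zero_iff: "a \<in> carrier R ==> I +> a = \<zero>\<^bsub>R Quot I\<^esub> \<longleftrightarrow> a \<in> I"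
 using R.a_coset_join2[OF _ a_subgroup, of a] a_rcos_self[of a] by (auto simp: FactRing_def)

lemma vectorspace_V: "vectorspace (R Quot I) V"
proof -
 interpret F: field "R Quot I" by (rule field_F)
 interpret h: ring_hom_cring R "R Quot I" "(+>) I" by (rule rcos_hom)
 have neg: "\<exists>w\<in>carrier V. v \<oplus>\<^bsub>V\<^esub> w = \<zero>\<^bsub>V\<^esub>" if v: "v \<in> carrier V" for v
 proof -
  obtain x where x: "x \<in> carrier M" "v = cs x" using cs_cases[OF v] .
  have "v \<oplus>\<^bsub>V\<^esub> cs (\<ominus>\<^bsub>M\<^esub> x) = cs \<zero>\<^bsub>M\<^esub>" using x by (simp add: cs_add M.r_neg)
  also have "\<dots> = \<zero>\<^bsub>V\<^esub>" using cs_zero_iff[of "\<zero>\<^bsub>M\<^esub>"] N_zero zero_V by simp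
  finally show ?thesis using cs_closed x by blast
 qed
 have "module (R Quot I) V"
 proof (rule module_criteria)
  show "cring (R Quot I)" by (rule F.is_cring)
  show "\<zero>\<^bsub>V\<^esub> \<in> carrier V" using cs_closed[of "\<zero>\<^bsub>M\<^esub>"] cs_zero_iff[of "\<zero>\<^bsub>M\<^esub>"] N_zero zero_V by simp
  show "\<forall>v w. v \<in> carrier V \<and> w \<in> carrier V --> v \<oplus>\<^bsub>V\<^esub> w \<in> carrier V"
   by (metis cs_cases cs_add cs_closed M.a_closed)
  show "\<forall>v\<in>carrier V. \<exists>w\<in>carrier V. v \<oplus>\<^bsub>V\<^esub> w = \<zero>\<^bsub>V\<^esub>" using neg by blast
  show "\<forall>c v. c \<in> carrier (R Quot I) \<and> v \<in> carrier V --> c \<odot>\<^bsub>V\<^esub> v \<in> carrier V"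
   by (metis cs_cases cs_smult cs_closed rcoset_scalars smult_closed)
  show "\<forall>v w. v \<in> carrier V \<and> w \<in> carrier V --> v \<oplus>\<^bsub>V\<^esub> w = w \<oplus>\<^bsub>V\<^esub> v"
   by (metis cs_cases cs_add M.a_comm)
  show "\<forall>v w x. v \<in> carrier V \<and> w \<in> carrier V \<and> x \<in> carrier V --> v \<oplus>\<^bsub>V\<^esub> w \<oplus>\<^bsub>V\<^esub> x = v \<oplus>\<^bsub>V\<^esub> (w \<oplus>\<^bsub>V\<^esub> x)"
  proof (intro allI impI)
   fix v w x assume "v \<in> carrier V \<and> w \<in> carrier V \<and> x \<in> carrier V"
   then obtain a b c where "a \<in> carrier M" "b \<in> carrier M" "c \<in> carrier M" "v = cs a" "w = cs b" "x = cs c"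
    by (metis cs_cases)
   then show "v \<oplus>\<^bsub>V\<^esub> w \<oplus>\<^bsub>V\<^esub> x = v \<oplus>\<^bsub>V\<^esub> (w \<oplus>\<^bsub>V\<^esub> x)" by (simp add: cs_add M.a_assoc)
  qed
  show "\<forall>v\<in>carrier V. v \<oplus>\<^bsub>V\<^esub> \<zero>\<^bsub>V\<^esub> = v"
  proof
   fix v assume "v \<in> carrier V"
   then obtain x where x: "x \<in> carrier M" "v = cs x" using cs_cases by blast
   have "v \<oplus>\<^bsub>V\<^esub> cs \<zero>\<^bsub>M\<^esub> = v" using x by (simp add: cs_add)
   then show "v \<oplus>\<^bsub>V\<^esub> \<zero>\<^bsub>V\<^esub> = v" using cs_zero_iff[of "\<zero>\<^bsub>M\<^esub>"] N_zero zero_V by simp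
  qed
  show "\<forall>a b v. a \<in> carrier (R Quot I) \<and> b \<in> carrier (R Quot I) \<and> v \<in> carrier V -->
    (a \<otimes>\<^bsub>R Quot I\<^esub> b) \<odot>\<^bsub>V\<^esub> v = a \<odot>\<^bsub>V\<^esub> (b \<odot>\<^bsub>V\<^esub> v)"
  proof (intro allI impI)
   fix a b v assume "a \<in> carrier (R Quot I) \<and> b \<in> carrier (R Quot I) \<and> v \<in> carrier V"
   then obtain a' b' x where *: "a' \<in> carrier R" "b' \<in> carrier R" "x \<in> carrier M" "a = I +> a'" "b = I +> b'" "v = cs x"
    by (metis cs_cases rcoset_scalars)
   have "a \<otimes>\<^bsub>R Quot I\<^esub> b = I +> (a' \<otimes> b')" using * by simp
   then show "(a \<otimes>\<^bsub>R Quot I\<^esub> b) \<odot>\<^bsub>V\<^esub> v = a \<odot>\<^bsub>V\<^esub> (b \<odot>\<^bsub>V\<^esub> v)" using *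
    by (simp add: cs_smult smult_assoc1 del: h.hom_mult)
  qed
  show "\<forall>v\<in>carrier V. \<one>\<^bsub>R Quot I\<^esub> \<odot>\<^bsub>V\<^esub> v = v"
   by (metis cs_cases cs_smult h.hom_one R.one_closed smult_one)
  show "\<forall>a b v. a \<in> carrier (R Quot I) \<and> b \<in> carrier (R Quot I) \<and> v \<in> carrier V -->
    (a \<oplus>\<^bsub>R Quot I\<^esub> b) \<odot>\<^bsub>V\<^esub> v = a \<odot>\<^bsub>V\<^esub> v \<oplus>\<^bsub>V\<^esub> b \<odot>\<^bsub>V\<^esub> v"
  proof (intro allI impI)
   fix a b v assume "a \<in> carrier (R Quot I) \<and> b \<in> carrier (R Quot I) \<and> v \<in> carrier V"
   then obtain a' b' x where *: "a' \<in> carrier R" "b' \<in> carrier R" "x \<in> carrier M" "a = I +> a'" "b = I +> b'" "v = cs x"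
    by (metis cs_cases rcoset_scalars)
   have "a \<oplus>\<^bsub>R Quot I\<^esub> b = I +> (a' \<oplus> b')" using * by simp
   then show "(a \<oplus>\<^bsub>R Quot I\<^esub> b) \<odot>\<^bsub>V\<^esub> v = a \<odot>\<^bsub>V\<^esub> v \<oplus>\<^bsub>V\<^esub> b \<odot>\<^bsub>V\<^esub> v" using *
    by (simp add: cs_smult cs_add smult_l_distr del: h.hom_add)
  qed
  show "\<forall>a v w. a \<in> carrier (R Quot I) \<and> v \<in> carrier V \<and> w \<in> carrier V -->
    a \<odot>\<^bsub>V\<^esub> (v \<oplus>\<^bsub>V\<^esub> w) = a \<odot>\<^bsub>V\<^esub> v \<oplus>\<^bsub>V\<^esub> a \<odot>\<^bsub>V\<^esub> w"
  proof (intro allI impI)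
   fix a v w assume "a \<in> carrier (R Quot I) \<and> v \<in> carrier V \<and> w \<in> carrier V"
   then obtain a' x y where *: "a' \<in> carrier R" "y \<in> carrier M" "x \<in> carrier M" "a = I +> a'" "v = cs x" "w = cs y"
    by (metis cs_cases rcoset_scalars)
   then show "a \<odot>\<^bsub>V\<^esub> (v \<oplus>\<^bsub>V\<^esub> w) = a \<odot>\<^bsub>V\<^esub> v \<oplus>\<^bsub>V\<^esub> a \<odot>\<^bsub>V\<^esub> w"
    by (simp add: cs_smult cs_add smult_r_distr)
  qed
 qed
 then show ?thesis unfolding vectorspace_def using field_F by simp
qed

lemma finsum_cs:
 assumes "finite J" "f \<in> J \<rightarrow> carrier M"
 shows "(\<Oplus>\<^bsub>V\<^esub>i\<in>J. cs (f i)) = cs (\<Oplus>\<^bsub>M\<^esub>i\<in>J. f i)"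
proof -
 interpret V: vectorspace "R Quot I" V by (rule vectorspace_V)
 show ?thesis using assms
 proof (induction J)
  case empty
  then show ?case using cs_zero_iff[of "\<zero>\<^bsub>M\<^esub>"] N_zero zero_V by simp
 next
  case (insert x J)
  have "(\<lambda>i. cs (f i)) \<in> J \<rightarrow> carrier V" "cs (f x) \<in> carrier V" using insert.prems cs_closed by auto
  then show ?case using insert by (simp add: V.finsum_insert M.finsum_insert cs_add M.finsum_closed Pi_def)
 qed
qed

text \<open>The cosets of the family form a basis of M/N over R/I. Independence modulo I also makes
  these cosets distinct, so counting indices is the same as counting basis vectors.\<close>

theorem residue_dim_eq:
 fixes J :: "'x set"
 assumes "rel_basis R I M N J b"
 shows "residue_dim R I (quot_module M N) = card J"
proof -
 interpret V: vectorspace "R Quot I" V by (rule vectorspace_V)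
 have fin: "finite J" and b: "b \<in> J \<rightarrow> carrier M"
  and span: "\<And>x. x \<in> carrier M ==> \<exists>c \<in> J \<rightarrow> carrier R. \<exists>n \<in> N. x = (\<Oplus>\<^bsub>M\<^esub>i\<in>J. c i \<odot>\<^bsub>M\<^esub> b i) \<oplus>\<^bsub>M\<^esub> n"
  and ind: "\<And>c. [|c \<in> J \<rightarrow> carrier R; (\<Oplus>\<^bsub>M\<^esub>i\<in>J. c i \<odot>\<^bsub>M\<^esub> b i) \<in> N|] ==> \<forall>i\<in>J. c i \<in> I"
  using assms unfolding rel_basis_def by blast+
 define B where "B = (\<lambda>i. cs (b i)) ` J"
 have inj: "inj_on (\<lambda>i. cs (b i)) J"
 proof (rule inj_onI, rule ccontr)
  fix i j assume ij: "i \<in> J" "j \<in> J" "cs (b i) = cs (b j)" "i \<noteq> j"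
  \<comment> \<open>The relation with coefficients 1 and -1 at two indices of the same coset. It
    lies in N, so independence would put 1 into I.\<close>
  define c where "c = (\<lambda>k. if k = i then \<one> else if k = j then \<ominus> \<one> else \<zero>)"
  have bij: "b i \<in> carrier M" "b j \<in> carrier M" using b ij by auto
  have J: "J = insert i (insert j (J - {i, j}))" using ij by auto
  have z: "(\<Oplus>\<^bsub>M\<^esub>k\<in>J - {i, j}. c k \<odot>\<^bsub>M\<^esub> b k) = \<zero>\<^bsub>M\<^esub>"
   by (rule M.add.finprod_one_eqI) (use b in \<open>auto simp: c_def Pi_iff\<close>)
  have "(\<Oplus>\<^bsub>M\<^esub>k\<in>insert i (insert j (J - {i, j})). c k \<odot>\<^bsub>M\<^esub> b k) = b i \<oplus>\<^bsub>M\<^esub> (\<ominus>\<^bsub>M\<^esub> b j \<oplus>\<^bsub>M\<^esub> \<zero>\<^bsub>M\<^esub>)"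
   using fin b ij z bij by (subst M.finsum_insert; (subst M.finsum_insert)?) (auto simp: c_def smult_minus_1 Pi_iff)
  then have "(\<Oplus>\<^bsub>M\<^esub>k\<in>J. c k \<odot>\<^bsub>M\<^esub> b k) = b i \<ominus>\<^bsub>M\<^esub> b j" using J bij by (simp add: a_minus_def)
  then have "(\<Oplus>\<^bsub>M\<^esub>k\<in>J. c k \<odot>\<^bsub>M\<^esub> b k) \<in> N" using cs_eq_iff ij bij by simp
  moreover have "c \<in> J \<rightarrow> carrier R" by (auto simp: c_def)
  ultimately have "c i \<in> I" using ind ij by blast
  then have "\<one> \<in> I" by (simp add: c_def)
  then show False using one_imp_carrier I_notcarr by blast
 qed
 have finB: "finite B" and BV: "B \<subseteq> carrier V" using fin b cs_closed by (auto simp: B_def)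
 have lin: "V.lincomb A B = cs (\<Oplus>\<^bsub>M\<^esub>i\<in>J. c i \<odot>\<^bsub>M\<^esub> b i)"
  if c: "c \<in> J \<rightarrow> carrier R" "\<And>i. i \<in> J ==> A (cs (b i)) = I +> c i" for A c
 proof -
  have A: "(\<lambda>v. A v \<odot>\<^bsub>V\<^esub> v) \<in> B \<rightarrow> carrier V"
   unfolding B_def using c b cs_closed rcos_closed by (auto intro!: V.smult_closed simp: Pi_def)
  have "V.lincomb A B = (\<Oplus>\<^bsub>V\<^esub>i\<in>J. A (cs (b i)) \<odot>\<^bsub>V\<^esub> cs (b i))"
   unfolding V.lincomb_def using V.add.finprod_reindex[OF _ inj, of "\<lambda>v. A v \<odot>\<^bsub>V\<^esub> v"] A
   unfolding B_def by (simp add: finsum_def comp_def)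
  also have "\<dots> = (\<Oplus>\<^bsub>V\<^esub>i\<in>J. cs (c i \<odot>\<^bsub>M\<^esub> b i))"
   by (rule V.finsum_cong') (use c b cs_smult cs_closed in \<open>auto simp: Pi_def\<close>)
  also have "\<dots> = cs (\<Oplus>\<^bsub>M\<^esub>i\<in>J. c i \<odot>\<^bsub>M\<^esub> b i)"
   by (rule finsum_cs) (use fin c b in \<open>auto simp: Pi_def\<close>)
  finally show ?thesis .
 qed
 have sumM: "(\<Oplus>\<^bsub>M\<^esub>i\<in>J. c i \<odot>\<^bsub>M\<^esub> b i) \<in> carrier M" if "c \<in> J \<rightarrow> carrier R" for c
  using that b by (auto intro!: M.finsum_closed)
 have indpt: "V.lin_indpt B"
 proof (rule V.finite_lin_indpt2[OF finB BV])
  fix A assume A: "A \<in> B \<rightarrow> carrier (R Quot I)" and z: "V.lincomb A B = \<zero>\<^bsub>V\<^esub>"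
  have "\<exists>a\<in>carrier R. A (cs (b i)) = I +> a" if "i \<in> J" for i
   using A that rcoset_scalars[of "A (cs (b i))"] unfolding B_def by blast
  then obtain c where c: "\<And>i. i \<in> J ==> c i \<in> carrier R \<and> A (cs (b i)) = I +> c i" by metis
  then have "cs (\<Oplus>\<^bsub>M\<^esub>i\<in>J. c i \<odot>\<^bsub>M\<^esub> b i) = N" using lin[of c A] z zero_V by auto
  then have "\<forall>i\<in>J. c i \<in> I" using ind[of c] c cs_zero_iff sumM[of c] by auto
  then show "\<forall>v\<in>B. A v = \<zero>\<^bsub>R Quot I\<^esub>" unfolding B_def using c rcos_zero_iff by auto
 qed
 have gen: "V.gen_set B"
 proof
  show "V.span B \<subseteq> carrier V" using V.span_is_subset2[OF BV] .
  show "carrier V \<subseteq> V.span B"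
  proof
   fix v assume "v \<in> carrier V"
   then obtain x where x: "x \<in> carrier M" "v = cs x" using cs_cases by blast
   obtain c n where c: "c \<in> J \<rightarrow> carrier R" "n \<in> N" "x = (\<Oplus>\<^bsub>M\<^esub>i\<in>J. c i \<odot>\<^bsub>M\<^esub> b i) \<oplus>\<^bsub>M\<^esub> n"
    using span[OF x(1)] by blast
   define A where "A = (\<lambda>v. I +> c (the_inv_into J (\<lambda>i. cs (b i)) v))"
   have A: "A (cs (b i)) = I +> c i" if "i \<in> J" for i
    unfolding A_def using the_inv_into_f_f[OF inj that] by simp
   have "n \<in> carrier M" using c N_sub by auto
   then have "x \<ominus>\<^bsub>M\<^esub> (\<Oplus>\<^bsub>M\<^esub>i\<in>J. c i \<odot>\<^bsub>M\<^esub> b i) = n" using sumM[OF c(1)] c(3)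
    by (metis M.add.m_comm M.minus_eq M.add.inv_solve_right' M.add.m_closed a_inv_def)
   then have "v = V.lincomb A B" using lin[OF c(1) A] x c(2) cs_eq_iff[OF x(1) sumM[OF c(1)]] by simp
   moreover have "A \<in> B \<rightarrow> carrier (R Quot I)" unfolding B_def using A c rcos_closed by (auto simp: Pi_iff)
   ultimately show "v \<in> V.span B" unfolding V.span_def using finB by blast
  qed
 qed
 have "V.dim = card B" by (rule V.dim_basis[OF finB]) (use indpt gen BV in \<open>auto simp: V.basis_def\<close>)
 also have "\<dots> = card J" unfolding B_def using card_image[OF inj] .
 finally show ?thesis unfolding residue_dim_def .
qed

end

text \<open>The form of \<open>rel_basis\<close> for submodules of one ambient ring. All sums are
  taken in \<open>K\<close>, so changing the ring of scalars or the submodule does not change the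
  sum that is meant.\<close>

definition rbasis ::
 "('a, 'm) ring_scheme \<Rightarrow> 'a set \<Rightarrow> 'a set \<Rightarrow> 'a set \<Rightarrow> 'a set \<Rightarrow> 'i set \<Rightarrow> ('i \<Rightarrow> 'a) \<Rightarrow> bool"
 where
 "rbasis K A I M N J b \<longleftrightarrow> finite J \<and> b \<in> J \<rightarrow> M \<and>
  (\<forall>x \<in> M. \<exists>c \<in> J \<rightarrow> A. \<exists>n \<in> N. x = (\<Oplus>\<^bsub>K\<^esub>i\<in>J. c i \<otimes>\<^bsub>K\<^esub> b i) \<oplus>\<^bsub>K\<^esub> n) \<and>
  (\<forall>c \<in> J \<rightarrow> A. (\<Oplus>\<^bsub>K\<^esub>i\<in>J. c i \<otimes>\<^bsub>K\<^esub> b i) \<in> N --> (\<forall>i\<in>J. c i \<in> I))"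

lemma sub_module_simps [simp]:
 "carrier (sub_module K M) = M" "zero (sub_module K M) = zero K" "add (sub_module K M) = add K"
 "smult (sub_module K M) = monoid.mult K"
 by (simp_all add: sub_module_def)

section \<open>The module of extensions of the residue field\<close>

text \<open>The same quotient occurs as several records, with different scalars or a different unit;
  \<open>finsum\<close> reads these three fields alone.\<close>

lemma finsum_cong_record:
 fixes G :: "('x, 'u) ring_scheme" and G' :: "('x, 'w) ring_scheme"
 assumes "carrier G = carrier G'" "add G = add G'" "zero G = zero G'"
 shows "finsum G f A = finsum G' f A"
 using assms by (simp add: finsum_def finprod_def)

lemma hom_module_simps:
 "carrier (hom_module R M N) = module_hom R M N \<inter> extensional (carrier M)"
 "f \<oplus>\<^bsub>hom_module R M N\<^esub> g = (\<lambda>x\<in>carrier M. f x \<oplus>\<^bsub>N\<^esub> g x)"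
 "a \<odot>\<^bsub>hom_module R M N\<^esub> f = (\<lambda>x\<in>carrier M. a \<odot>\<^bsub>N\<^esub> f x)"
 "\<zero>\<^bsub>hom_module R M N\<^esub> = (\<lambda>x\<in>carrier M. \<zero>\<^bsub>N\<^esub>)"
 by (simp_all add: hom_module_def)

lemma hom_module_module:
 assumes "module R N"
  and Madd: "\<And>x y. [|x \<in> carrier M; y \<in> carrier M|] ==> x \<oplus>\<^bsub>M\<^esub> y \<in> carrier M"
  and Msm: "\<And>a x. [|a \<in> carrier R; x \<in> carrier M|] ==> a \<odot>\<^bsub>M\<^esub> x \<in> carrier M"
 shows "module R (hom_module R M N)"
proof -
 interpret N: module R N by fact
 let ?H = "hom_module R M N"
 have cl: "f x \<in> carrier N" if "f \<in> carrier ?H" "x \<in> carrier M" for f x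
  using that by (auto simp: hom_module_simps module_hom_def)
 have homa: "f (x \<oplus>\<^bsub>M\<^esub> y) = f x \<oplus>\<^bsub>N\<^esub> f y" if "f \<in> carrier ?H" "x \<in> carrier M" "y \<in> carrier M" for f x y
  using that by (auto simp: hom_module_simps module_hom_def)
 have homs: "f (a \<odot>\<^bsub>M\<^esub> x) = a \<odot>\<^bsub>N\<^esub> f x" if "f \<in> carrier ?H" "a \<in> carrier R" "x \<in> carrier M" for f a x
  using that by (auto simp: hom_module_simps module_hom_def)
 have memI: "f \<in> carrier ?H"
  if "f \<in> extensional (carrier M)" "\<And>x. x \<in> carrier M ==> f x \<in> carrier N"
   "\<And>x y. [|x \<in> carrier M; y \<in> carrier M|] ==> f (x \<oplus>\<^bsub>M\<^esub> y) = f x \<oplus>\<^bsub>N\<^esub> f y"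
   "\<And>a x. [|a \<in> carrier R; x \<in> carrier M|] ==> f (a \<odot>\<^bsub>M\<^esub> x) = a \<odot>\<^bsub>N\<^esub> f x" for f
  using that by (auto simp: hom_module_simps module_hom_def)
 have eqI: "f = g" if "f \<in> extensional (carrier M)" "g \<in> extensional (carrier M)"
   "\<And>x. x \<in> carrier M ==> f x = g x" for f g
  using that by (rule extensionalityI)
 have ext: "f \<in> extensional (carrier M)" if "f \<in> carrier ?H" for f
  using that by (auto simp: hom_module_simps)
 have smc: "a \<odot>\<^bsub>?H\<^esub> f \<in> carrier ?H" if "a \<in> carrier R" "f \<in> carrier ?H" for a f
 proof (rule memI)
  fix c x assume cx: "c \<in> carrier R" "x \<in> carrier M"
  have "a \<odot>\<^bsub>N\<^esub> (c \<odot>\<^bsub>N\<^esub> f x) = c \<odot>\<^bsub>N\<^esub> (a \<odot>\<^bsub>N\<^esub> f x)"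
   using that cx cl by (metis N.smult_assoc1 N.R.m_comm)
  then show "(a \<odot>\<^bsub>?H\<^esub> f) (c \<odot>\<^bsub>M\<^esub> x) = c \<odot>\<^bsub>N\<^esub> (a \<odot>\<^bsub>?H\<^esub> f) x"
   using that cx by (simp add: hom_module_simps(3) Msm homs)
 qed (use that in \<open>auto simp: hom_module_simps(3) Madd cl homa N.smult_r_distr\<close>)
 show ?thesis
 proof (rule module_criteria)
  show "cring R" by (rule N.R.is_cring)
  show "\<zero>\<^bsub>?H\<^esub> \<in> carrier ?H" by (rule memI) (auto simp: hom_module_simps(4) Madd Msm)
  show "\<forall>v w. v \<in> carrier ?H \<and> w \<in> carrier ?H --> v \<oplus>\<^bsub>?H\<^esub> w \<in> carrier ?H"
  proof (intro allI impI, rule memI)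
   fix v w x y assume "v \<in> carrier ?H \<and> w \<in> carrier ?H" "x \<in> carrier M" "y \<in> carrier M"
   then show "(v \<oplus>\<^bsub>?H\<^esub> w) (x \<oplus>\<^bsub>M\<^esub> y) = (v \<oplus>\<^bsub>?H\<^esub> w) x \<oplus>\<^bsub>N\<^esub> (v \<oplus>\<^bsub>?H\<^esub> w) y"
    by (simp add: hom_module_simps(2) Madd homa cl N.M.add.m_ac)
  qed (auto simp: hom_module_simps(2) cl Msm homs N.smult_r_distr)
  show "\<forall>v\<in>carrier ?H. \<exists>w\<in>carrier ?H. v \<oplus>\<^bsub>?H\<^esub> w = \<zero>\<^bsub>?H\<^esub>"
  proof
   fix v assume v: "v \<in> carrier ?H"
   have "v x \<oplus>\<^bsub>N\<^esub> (\<ominus>\<^bsub>R\<^esub> \<one>\<^bsub>R\<^esub>) \<odot>\<^bsub>N\<^esub> v x = \<zero>\<^bsub>N\<^esub>" if "x \<in> carrier M" for x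
    using cl[OF v that] by (simp add: N.smult_minus_1 N.M.r_neg)
   then have "v \<oplus>\<^bsub>?H\<^esub> ((\<ominus>\<^bsub>R\<^esub> \<one>\<^bsub>R\<^esub>) \<odot>\<^bsub>?H\<^esub> v) = \<zero>\<^bsub>?H\<^esub>"
    by (intro eqI) (simp_all add: hom_module_simps(2,3,4))
   then show "\<exists>w\<in>carrier ?H. v \<oplus>\<^bsub>?H\<^esub> w = \<zero>\<^bsub>?H\<^esub>" using smc[OF _ v] by blast
  qed
  show "\<forall>c v. c \<in> carrier R \<and> v \<in> carrier ?H --> c \<odot>\<^bsub>?H\<^esub> v \<in> carrier ?H" using smc by blast
 qed (auto intro!: eqI simp: hom_module_simps(2,3,4) ext cl N.M.add.m_ac N.smult_assoc1 N.smult_l_distr N.smult_r_distr)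
qed

lemma (in cring) sub_module_module:
 assumes M: "M \<subseteq> carrier R" "\<zero> \<in> M" "\<And>x y. [|x \<in> M; y \<in> M|] ==> x \<oplus> y \<in> M"
  and A: "cring (R\<lparr>carrier := A\<rparr>)" "A \<subseteq> carrier R" "\<ominus> \<one> \<in> A" "\<And>a x. [|a \<in> A; x \<in> M|] ==> a \<otimes> x \<in> M"
 shows "module (R\<lparr>carrier := A\<rparr>) (sub_module R M)"
proof (rule module_criteria[OF A(1)])
 show "\<forall>v\<in>carrier (sub_module R M). \<exists>w\<in>carrier (sub_module R M). v \<oplus>\<^bsub>sub_module R M\<^esub> w = \<zero>\<^bsub>sub_module R M\<^esub>"
 proof
  fix v assume v: "v \<in> carrier (sub_module R M)"
  then have vR: "v \<in> carrier R" using M by auto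
  have "v \<oplus> \<ominus> \<one> \<otimes> v = \<zero>" using vR by (simp add: l_minus r_neg)
  then show "\<exists>w\<in>carrier (sub_module R M). v \<oplus>\<^bsub>sub_module R M\<^esub> w = \<zero>\<^bsub>sub_module R M\<^esub>"
   using A(3,4) v by (metis sub_module_simps)
 qed
qed (use M A in \<open>auto simp: subset_iff a_ac m_assoc l_distr r_distr\<close>)

text \<open>Locality of R is not assumed: the same setting is used for the completion, where Ext is
  computed, and for an order itself, where the resulting socle is described by elements.\<close>

locale residue_ext = maximalideal m R + cring R for m and R (structure) +
 fixes a
 assumes a_m: "a \<in> m" and a_nzd: "[|y \<in> carrier R; a \<otimes> y = \<zero>|] ==> y = \<zero>"
begin

abbreviation Rm where "Rm \<equiv> sub_module R (carrier R)"
abbreviation k where "k \<equiv> quot_module Rm m"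
abbreviation F where "F \<equiv> free_module R (carrier k)"
abbreviation \<Omega> where "\<Omega> \<equiv> syzygy R k"
abbreviation H where "H \<equiv> hom_module R \<Omega> Rm"
abbreviation Res where "Res \<equiv> (\<lambda>f. restrict f (carrier \<Omega>)) ` carrier (hom_module R F Rm)"

text \<open>\<open>pa\<close> is the principal ideal aR and \<open>cm\<close> the ideal (aR : m), so
  that \<open>cm\<close> modulo \<open>pa\<close> is the part of R/aR killed by m, its socle at
  m.\<close>

definition pa where "pa = {a \<otimes> y | y. y \<in> carrier R}"
definition cm where "cm = {x \<in> carrier R. \<forall>y\<in>m. x \<otimes> y \<in> pa}"

lemma a_R [simp]: "a \<in> carrier R" using a_m a_subset by auto

lemma m_R: "x \<in> m ==> x \<in> carrier R" using a_subset by auto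

lemma a_cancel: "[|x \<in> carrier R; y \<in> carrier R; a \<otimes> x = a \<otimes> y|] ==> x = y"
proof -
 assume x: "x \<in> carrier R" and y: "y \<in> carrier R" and e: "a \<otimes> x = a \<otimes> y"
 have "a \<otimes> (x \<ominus> y) = a \<otimes> x \<ominus> a \<otimes> y" using x y a_R by algebra
 also have "\<dots> = \<zero>" using e x y by (simp add: a_minus_def r_neg)
 finally show "x = y" using a_nzd[of "x \<ominus> y"] x y by simp
qed

lemma module_Rm: "module R Rm"
 using sub_module_module[of "carrier R" "carrier R"] is_cring by simp

sublocale rq: residue_quotient R Rm m m
proof (intro residue_quotient.intro residue_quotient_axioms.intro)
 show "module R Rm" by (rule module_Rm)
 show "maximalideal m R" by (rule maximalideal_axioms)
qed (use m_R I_l_closed I_r_closed in auto)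

text \<open>Representatives of the residue classes. The class of 1 is represented by 1 itself, which
  makes s times the basis vector at that class evaluate to exactly s.\<close>

definition rep where "rep x = (if x = rq.cs \<one> then \<one> else if x \<in> carrier k then (SOME r. r \<in> carrier R \<and> x = rq.cs r) else \<zero>)"

lemma carrier_k: "carrier k = carrier rq.V" by (simp add: factor_scalars_def)

lemma rep_ex: "x \<in> carrier k ==> \<exists>r. r \<in> carrier R \<and> x = rq.cs r"
 unfolding carrier_k using rq.cs_cases by (metis sub_module_simps(1))

lemma rep_closed [simp]: "rep x \<in> carrier R"
 using someI_ex[OF rep_ex[of x]] by (auto simp: rep_def)

lemma rep_cs: "x \<in> carrier k ==> rq.cs (rep x) = x"
 using someI_ex[OF rep_ex[of x]] by (auto simp: rep_def)

lemma rep_one: "rep (rq.cs \<one>) = \<one>" by (simp add: rep_def)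

lemma F_simps:
 "f \<in> carrier F \<longleftrightarrow> (\<forall>x. f x \<in> carrier R) \<and> {x. f x \<noteq> \<zero>} \<subseteq> carrier k \<and> finite {x. f x \<noteq> \<zero>}"
 "f \<oplus>\<^bsub>F\<^esub> g = (\<lambda>x. f x \<oplus> g x)" "s \<odot>\<^bsub>F\<^esub> f = (\<lambda>x. s \<otimes> f x)"
 by (auto simp: free_module_def)

lemma Omega_simps:
 "f \<oplus>\<^bsub>\<Omega>\<^esub> g = (\<lambda>x. f x \<oplus> g x)" "s \<odot>\<^bsub>\<Omega>\<^esub> f = (\<lambda>x. s \<otimes> f x)"
 by (auto simp: free_module_def syzygy_def)

lemma F_add: "[|f \<in> carrier F; g \<in> carrier F|] ==> (\<lambda>x. f x \<oplus> g x) \<in> carrier F"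
proof -
 assume f: "f \<in> carrier F" and g: "g \<in> carrier F"
 have "{x. f x \<oplus> g x \<noteq> \<zero>} \<subseteq> {x. f x \<noteq> \<zero>} \<union> {x. g x \<noteq> \<zero>}" using f g by (auto simp: F_simps)
 then show ?thesis using f g unfolding F_simps by (auto intro: finite_subset)
qed

lemma F_smult: "[|s \<in> carrier R; f \<in> carrier F|] ==> (\<lambda>x. s \<otimes> f x) \<in> carrier F"
proof -
 assume s: "s \<in> carrier R" and f: "f \<in> carrier F"
 have "{x. s \<otimes> f x \<noteq> \<zero>} \<subseteq> {x. f x \<noteq> \<zero>}" using f s by (auto simp: F_simps)
 then show ?thesis using f s unfolding F_simps by (auto intro: finite_subset)
qed

text \<open>A lift of the evaluation F \<rightarrow> k to a linear map F \<rightarrow> R along the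
  chosen representatives. The syzygy becomes the preimage of m under it, and computing with cosets
  is avoided from then on.\<close>

definition eps where "eps f = (\<Oplus>x\<in>{x. f x \<noteq> \<zero>}. f x \<otimes> rep x)"

lemma eps_extend:
 assumes "f \<in> carrier F" "finite T" "{x. f x \<noteq> \<zero>} \<subseteq> T"
 shows "eps f = (\<Oplus>x\<in>T. f x \<otimes> rep x)"
 unfolding eps_def
 by (rule add.finprod_mono_neutral_cong_left) (use assms in \<open>auto simp: F_simps\<close>)

lemma eps_closed: "f \<in> carrier F ==> eps f \<in> carrier R"
 unfolding eps_def by (rule finsum_closed) (auto simp: F_simps)

lemma eps_add: "[|f \<in> carrier F; g \<in> carrier F|] ==> eps (\<lambda>x. f x \<oplus> g x) = eps f \<oplus> eps g"
proof -
 assume f: "f \<in> carrier F" and g: "g \<in> carrier F"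
 let ?T = "{x. f x \<noteq> \<zero>} \<union> {x. g x \<noteq> \<zero>}"
 have T: "finite ?T" using f g by (auto simp: F_simps)
 have fg: "\<And>x. f x \<in> carrier R" "\<And>x. g x \<in> carrier R" using f g by (auto simp: F_simps)
 have "eps (\<lambda>x. f x \<oplus> g x) = (\<Oplus>x\<in>?T. (f x \<oplus> g x) \<otimes> rep x)"
  by (rule eps_extend) (use F_add[OF f g] T fg in auto)
 also have "\<dots> = (\<Oplus>x\<in>?T. f x \<otimes> rep x \<oplus> g x \<otimes> rep x)"
  by (rule finsum_cong') (use fg in \<open>auto simp: l_distr\<close>)
 also have "\<dots> = (\<Oplus>x\<in>?T. f x \<otimes> rep x) \<oplus> (\<Oplus>x\<in>?T. g x \<otimes> rep x)"
  by (rule finsum_addf) (use fg in auto)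
 also have "\<dots> = eps f \<oplus> eps g" using eps_extend[OF f T] eps_extend[OF g T] by auto
 finally show ?thesis .
qed

lemma eps_smult: "[|s \<in> carrier R; f \<in> carrier F|] ==> eps (\<lambda>x. s \<otimes> f x) = s \<otimes> eps f"
proof -
 assume s: "s \<in> carrier R" and f: "f \<in> carrier F"
 let ?T = "{x. f x \<noteq> \<zero>}"
 have T: "finite ?T" using f by (auto simp: F_simps)
 have fg: "\<And>x. f x \<in> carrier R" using f by (auto simp: F_simps)
 have "eps (\<lambda>x. s \<otimes> f x) = (\<Oplus>x\<in>?T. (s \<otimes> f x) \<otimes> rep x)"
  by (rule eps_extend) (use F_smult[OF s f] T s in auto)
 also have "\<dots> = (\<Oplus>x\<in>?T. s \<otimes> (f x \<otimes> rep x))"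
  by (rule finsum_cong') (use fg s in \<open>auto simp: m_assoc\<close>)
 also have "\<dots> = s \<otimes> eps f" unfolding eps_def
  by (rule finsum_rdistr[symmetric]) (use fg s T in auto)
 finally show ?thesis .
qed

text \<open>Each term f(x) x of the evaluation is the coset of f(x) \<open>rep x\<close>, so the
  evaluation of f is the coset of \<open>eps f\<close>, and this vanishes exactly when
  \<open>eps f\<close> is in m.\<close>

lemma Omega_iff: "f \<in> carrier \<Omega> \<longleftrightarrow> f \<in> carrier F \<and> eps f \<in> m"
proof -
 have "free_eval R k f = rq.cs (eps f)" if f: "f \<in> carrier F"
 proof -
  have fR: "\<And>x. f x \<in> carrier R" and fin: "finite {x. f x \<noteq> \<zero>}" and sub: "\<And>x. f x \<noteq> \<zero> ==> x \<in> carrier k"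
   using f by (auto simp: F_simps)
  interpret V: vectorspace "R Quot m" rq.V by (rule rq.vectorspace_V)
  have "free_eval R k f = (\<Oplus>\<^bsub>rq.V\<^esub>x\<in>{x. f x \<noteq> \<zero>}. f x \<odot>\<^bsub>k\<^esub> x)"
   unfolding free_eval_def by (rule finsum_cong_record) (simp_all add: factor_scalars_def)
  also have "\<dots> = (\<Oplus>\<^bsub>rq.V\<^esub>x\<in>{x. f x \<noteq> \<zero>}. rq.cs (f x \<otimes> rep x))"
  proof (rule V.finsum_cong')
   show "(\<lambda>x. rq.cs (f x \<otimes> rep x)) \<in> {x. f x \<noteq> \<zero>} \<rightarrow> carrier rq.V" using rq.cs_closed fR by auto
   show "f x \<odot>\<^bsub>k\<^esub> x = rq.cs (f x \<otimes> rep x)" if "x \<in> {x. f x \<noteq> \<zero>}" for x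
    using rq.quot_smult[of "f x" "rep x"] rep_cs[OF sub] that fR by simp
  qed simp
  also have "\<dots> = rq.cs (\<Oplus>\<^bsub>Rm\<^esub>x\<in>{x. f x \<noteq> \<zero>}. f x \<otimes> rep x)"
   by (rule rq.finsum_cs) (use fin fR in auto)
  also have "(\<Oplus>\<^bsub>Rm\<^esub>x\<in>{x. f x \<noteq> \<zero>}. f x \<otimes> rep x) = eps f"
   unfolding eps_def by (rule finsum_cong_record) simp_all
  finally show ?thesis .
 qed
 moreover have "\<zero>\<^bsub>k\<^esub> = m" by (simp add: quot_module_def)
 ultimately show ?thesis using rq.cs_zero_iff[of "eps f"] eps_closed[of f]
  by (auto simp: syzygy_def)
qed

lemma Omega_F: "f \<in> carrier \<Omega> ==> f \<in> carrier F" by (simp add: Omega_iff)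

lemma Omega_add: "[|f \<in> carrier \<Omega>; g \<in> carrier \<Omega>|] ==> (\<lambda>x. f x \<oplus> g x) \<in> carrier \<Omega>"
 using F_add eps_add unfolding Omega_iff by auto

lemma Omega_smult: "[|s \<in> carrier R; f \<in> carrier \<Omega>|] ==> (\<lambda>x. s \<otimes> f x) \<in> carrier \<Omega>"
 using F_smult eps_smult I_l_closed unfolding Omega_iff by auto

text \<open>s times the basis vector of F at the class of 1. For s in m it is an element of the
  syzygy; \<open>del a\<close> is the element at which homomorphisms are going to be
  evaluated.\<close>

definition del where "del s = (\<lambda>x. if x = rq.cs \<one> then s else \<zero>)"

lemma del_F: "s \<in> carrier R ==> del s \<in> carrier F"
proof -
 assume s: "s \<in> carrier R"
 have "rq.cs \<one> \<in> carrier k" unfolding carrier_k by (rule rq.cs_closed) simp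
 moreover have "{x. del s x \<noteq> \<zero>} \<subseteq> {rq.cs \<one>}" by (auto simp: del_def)
 moreover have "\<forall>x. del s x \<in> carrier R" using s by (auto simp: del_def)
 ultimately show ?thesis unfolding F_simps by (meson finite.emptyI finite.insertI finite_subset empty_subsetI insert_subset subset_trans)
qed

lemma del_add: "[|s \<in> carrier R; t \<in> carrier R|] ==> del (s \<oplus> t) = (\<lambda>x. del s x \<oplus> del t x)"
 by (auto simp: del_def)

lemma del_smult: "[|s \<in> carrier R; t \<in> carrier R|] ==> del (s \<otimes> t) = (\<lambda>x. s \<otimes> del t x)"
 by (auto simp: del_def)

lemma eps_del: "s \<in> carrier R ==> eps (del s) = s"
proof -
 assume s: "s \<in> carrier R"
 have "eps (del s) = (\<Oplus>x\<in>{rq.cs \<one>}. del s x \<otimes> rep x)"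
  by (rule eps_extend) (use del_F[OF s] in \<open>auto simp: del_def\<close>)
 then show ?thesis using s by (simp add: del_def rep_one)
qed

lemma del_Omega: "s \<in> m ==> del s \<in> carrier \<Omega>"
 using del_F eps_del m_R unfolding Omega_iff by simp

lemma module_H: "module R H"
 by (rule hom_module_module[OF module_Rm]) (auto simp: Omega_simps Omega_add Omega_smult)

sublocale H: module R H by (rule module_H)

lemma H_D:
 assumes "\<alpha> \<in> carrier H"
 shows "\<And>f. f \<in> carrier \<Omega> ==> \<alpha> f \<in> carrier R"
  "\<And>f g. [|f \<in> carrier \<Omega>; g \<in> carrier \<Omega>|] ==> \<alpha> (\<lambda>x. f x \<oplus> g x) = \<alpha> f \<oplus> \<alpha> g"
  "\<And>s f. [|s \<in> carrier R; f \<in> carrier \<Omega>|] ==> \<alpha> (\<lambda>x. s \<otimes> f x) = s \<otimes> \<alpha> f"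
 using assms by (auto simp: hom_module_simps module_hom_def Omega_simps)

lemma H_I:
 assumes "\<alpha> \<in> extensional (carrier \<Omega>)"
  "\<And>f. f \<in> carrier \<Omega> ==> \<alpha> f \<in> carrier R"
  "\<And>f g. [|f \<in> carrier \<Omega>; g \<in> carrier \<Omega>|] ==> \<alpha> (\<lambda>x. f x \<oplus> g x) = \<alpha> f \<oplus> \<alpha> g"
  "\<And>s f. [|s \<in> carrier R; f \<in> carrier \<Omega>|] ==> \<alpha> (\<lambda>x. s \<otimes> f x) = s \<otimes> \<alpha> f"
 shows "\<alpha> \<in> carrier H"
 using assms by (auto simp: hom_module_simps module_hom_def Omega_simps)

lemma HF_iff: "\<beta> \<in> carrier (hom_module R F Rm) \<longleftrightarrow> \<beta> \<in> extensional (carrier F) \<and>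
  (\<forall>f \<in> carrier F. \<beta> f \<in> carrier R) \<and>
  (\<forall>f \<in> carrier F. \<forall>g \<in> carrier F. \<beta> (\<lambda>x. f x \<oplus> g x) = \<beta> f \<oplus> \<beta> g) \<and>
  (\<forall>s \<in> carrier R. \<forall>f \<in> carrier F. \<beta> (\<lambda>x. s \<otimes> f x) = s \<otimes> \<beta> f)"
 by (auto simp: hom_module_simps module_hom_def F_simps(2,3))

text \<open>For y in m the element \<open>del (a y)\<close> of the syzygy is a multiple both of
  \<open>del a\<close> and of \<open>del y\<close>, whence y \<alpha>(del a) = a \<alpha>(del
  y).\<close>

lemma tau_cm: "\<alpha> \<in> carrier H ==> \<alpha> (del a) \<in> cm"
proof -
 assume \<alpha>: "\<alpha> \<in> carrier H"
 note D = H_D[OF \<alpha>]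
 have "\<alpha> (del a) \<otimes> y \<in> pa" if y: "y \<in> m" for y
 proof -
  have "\<alpha> (del a) \<otimes> y = y \<otimes> \<alpha> (del a)" using D(1)[OF del_Omega[OF a_m]] m_R[OF y] by (rule m_comm)
  also have "\<dots> = \<alpha> (del (y \<otimes> a))" using D(3)[OF m_R[OF y] del_Omega[OF a_m]] del_smult m_R[OF y] by simp
  also have "del (y \<otimes> a) = del (a \<otimes> y)" using m_R[OF y] by (simp add: m_comm)
  also have "\<alpha> \<dots> = a \<otimes> \<alpha> (del y)" using D(3)[OF a_R del_Omega[OF y]] del_smult m_R[OF y] by simp
  finally show ?thesis using D(1)[OF del_Omega[OF y]] unfolding pa_def by auto
 qed
 then show ?thesis using D(1)[OF del_Omega[OF a_m]] unfolding cm_def by auto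
qed

definition psi where "psi b y = (SOME w. w \<in> carrier R \<and> a \<otimes> w = b \<otimes> y)"

lemma psi: "[|b \<in> cm; y \<in> m|] ==> psi b y \<in> carrier R \<and> a \<otimes> psi b y = b \<otimes> y"
proof -
 assume "b \<in> cm" "y \<in> m"
 then have "b \<otimes> y \<in> pa" by (simp add: cm_def)
 then have "\<exists>w. w \<in> carrier R \<and> a \<otimes> w = b \<otimes> y" unfolding pa_def by force
 then show ?thesis unfolding psi_def by (rule someI_ex)
qed

text \<open>The homomorphism f \<mapsto> b eps(f) / a. Its value at \<open>del a\<close> is b, so it
  is the section that shows evaluation at \<open>del a\<close> to be onto (aR : m).\<close>

definition al where "al b = (\<lambda>f\<in>carrier \<Omega>. psi b (eps f))"

lemma al_H: assumes b: "b \<in> cm" shows "al b \<in> carrier H"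
proof (rule H_I)
 have bR: "b \<in> carrier R" using b by (simp add: cm_def)
 have E: "eps f \<in> m" if "f \<in> carrier \<Omega>" for f using that by (simp add: Omega_iff)
 show "al b f \<in> carrier R" if "f \<in> carrier \<Omega>" for f using psi[OF b E[OF that]] that by (simp add: al_def)
 show "al b (\<lambda>x. f x \<oplus> g x) = al b f \<oplus> al b g" if f: "f \<in> carrier \<Omega>" and g: "g \<in> carrier \<Omega>" for f g
 proof -
  note fg = Omega_add[OF f g]
  note e = eps_add[OF Omega_F[OF f] Omega_F[OF g]]
  note p = psi[OF b E[OF f]] psi[OF b E[OF g]] psi[OF b E[OF fg]]
  have "a \<otimes> psi b (eps (\<lambda>x. f x \<oplus> g x)) = a \<otimes> (psi b (eps f) \<oplus> psi b (eps g))"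
   using p e bR m_R[OF E[OF f]] m_R[OF E[OF g]] by (simp add: r_distr)
  then show ?thesis using a_cancel p f g fg by (simp add: al_def)
 qed
 show "al b (\<lambda>x. s \<otimes> f x) = s \<otimes> al b f" if s: "s \<in> carrier R" and f: "f \<in> carrier \<Omega>" for s f
 proof -
  note fg = Omega_smult[OF s f]
  note e = eps_smult[OF s Omega_F[OF f]]
  note p = psi[OF b E[OF f]] psi[OF b E[OF fg]]
  have "a \<otimes> psi b (eps (\<lambda>x. s \<otimes> f x)) = b \<otimes> (s \<otimes> eps f)" using p e by simp
  also have "\<dots> = s \<otimes> (b \<otimes> eps f)" using s bR m_R[OF E[OF f]] by (simp add: m_lcomm)
  also have "\<dots> = s \<otimes> (a \<otimes> psi b (eps f))" using p by simp
  also have "\<dots> = a \<otimes> (s \<otimes> psi b (eps f))" by (rule m_lcomm) (use p s in auto)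
  finally show ?thesis using a_cancel p f s fg by (simp add: al_def)
 qed
qed (auto simp: al_def)

lemma tau_al: "b \<in> cm ==> al b (del a) = b"
proof -
 assume b: "b \<in> cm"
 then have bR: "b \<in> carrier R" by (simp add: cm_def)
 have "al b (del a) = psi b a" using del_Omega[OF a_m] eps_del by (simp add: al_def)
 moreover have "a \<otimes> psi b a = a \<otimes> b" using psi[OF b a_m] bR by (simp add: m_comm)
 ultimately show ?thesis using a_cancel psi[OF b a_m] bR by auto
qed

lemma Res_H: "\<alpha> \<in> Res ==> \<alpha> \<in> carrier H"
 by (erule imageE, hypsubst, rule H_I) (auto simp: HF_iff Omega_F Omega_add Omega_smult)

text \<open>A homomorphism defined on all of F takes a value at \<open>del 1\<close>, and a times it
  is the value at \<open>del a\<close>. Conversely, if \<alpha>(del a) = a c, cancelling a gives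
  \<alpha>(del r) = r c for all r in m, so sending \<open>del 1\<close> to c is consistent with
  \<alpha>.\<close>

lemma Res_iff:
 assumes \<alpha>: "\<alpha> \<in> carrier H"
 shows "\<alpha> \<in> Res \<longleftrightarrow> \<alpha> (del a) \<in> pa"
proof
 assume "\<alpha> \<in> Res"
 then obtain \<beta> where \<beta>: "\<beta> \<in> carrier (hom_module R F Rm)" "\<alpha> = restrict \<beta> (carrier \<Omega>)" by blast
 have "\<alpha> (del a) = \<beta> (del (a \<otimes> \<one>))" using del_Omega[OF a_m] \<beta> by simp
 also have "\<dots> = a \<otimes> \<beta> (del \<one>)" using \<beta>(1) del_smult[of a \<one>] del_F[of \<one>] by (simp add: HF_iff)
 finally show "\<alpha> (del a) \<in> pa" using \<beta>(1) del_F[of \<one>] unfolding pa_def HF_iff by auto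
next
 note D = H_D[OF \<alpha>]
 assume "\<alpha> (del a) \<in> pa"
 then obtain c where c: "c \<in> carrier R" "\<alpha> (del a) = a \<otimes> c" unfolding pa_def by auto
 have h: "\<alpha> (del r) = r \<otimes> c" if r: "r \<in> m" for r
 proof (rule a_cancel)
  have "a \<otimes> \<alpha> (del r) = \<alpha> (del (r \<otimes> a))"
   using D(3)[OF a_R del_Omega[OF r]] del_smult[OF a_R m_R[OF r]] m_R[OF r] by (simp add: m_comm)
  also have "\<dots> = r \<otimes> (a \<otimes> c)" using D(3)[OF m_R[OF r] del_Omega[OF a_m]] del_smult[OF m_R[OF r] a_R] c by simp
  also have "\<dots> = a \<otimes> (r \<otimes> c)" using m_R[OF r] c by (simp add: m_lcomm)
  finally show "a \<otimes> \<alpha> (del r) = a \<otimes> (r \<otimes> c)" .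
 qed (use D(1)[OF del_Omega[OF r]] m_R[OF r] c in auto)
 \<comment> \<open>F is the direct sum of the kernel of \<open>eps\<close> and the multiples of
   \<open>del 1\<close>; this is the projection to the kernel, which lies in the syzygy.\<close>
 define pr where "pr f = (\<lambda>x. f x \<oplus> \<ominus> \<one> \<otimes> del (eps f) x)" for f
 have delc: "del s x \<in> carrier R" if "s \<in> carrier R" for s x using that by (auto simp: del_def)
 have pr: "pr f \<in> carrier \<Omega>" if f: "f \<in> carrier F" for f
 proof -
  note e = eps_closed[OF f]
  have F: "(\<lambda>x. \<ominus> \<one> \<otimes> del (eps f) x) \<in> carrier F" by (rule F_smult) (use del_F[OF e] in auto)
  have "eps (pr f) = eps f \<oplus> \<ominus> \<one> \<otimes> eps f" unfolding pr_def
   using eps_add[OF f F] eps_smult[of "\<ominus> \<one>" "del (eps f)"] del_F[OF e] eps_del[OF e] by simp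
  also have "\<dots> = \<zero>" using e by (simp add: l_minus r_neg)
  finally show ?thesis using F_add[OF f F] unfolding Omega_iff pr_def by simp
 qed
 \<comment> \<open>The extension is \<alpha> on the kernel of \<open>eps\<close> and multiplication
   by c on the multiples of \<open>del 1\<close>.\<close>
 define \<beta> where "\<beta> = (\<lambda>f\<in>carrier F. \<alpha> (pr f) \<oplus> c \<otimes> eps f)"
 have fx: "f x \<in> carrier R" if "f \<in> carrier F" for f x using that by (auto simp: F_simps)
 have "\<beta> \<in> carrier (hom_module R F Rm)"
  unfolding HF_iff
 proof (intro conjI ballI)
  show "\<beta> \<in> extensional (carrier F)" by (simp add: \<beta>_def)
  show "\<beta> f \<in> carrier R" if "f \<in> carrier F" for f
   using that D(1)[OF pr[OF that]] c eps_closed[OF that] by (simp add: \<beta>_def)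
  show "\<beta> (\<lambda>x. f x \<oplus> g x) = \<beta> f \<oplus> \<beta> g" if f: "f \<in> carrier F" and g: "g \<in> carrier F" for f g
  proof -
   note fg = F_add[OF f g]
   note e = eps_add[OF f g] eps_closed[OF f] eps_closed[OF g]
   have "pr (\<lambda>x. f x \<oplus> g x) = (\<lambda>x. pr f x \<oplus> pr g x)"
   proof
    fix x
    show "pr (\<lambda>x. f x \<oplus> g x) x = pr f x \<oplus> pr g x"
     using fx[OF f, of x] fx[OF g, of x] delc[OF e(2), of x] delc[OF e(3), of x] unfolding pr_def e(1)
     by (simp add: del_add[OF e(2,3)]) algebra
   qed
   then have "\<alpha> (pr (\<lambda>x. f x \<oplus> g x)) = \<alpha> (pr f) \<oplus> \<alpha> (pr g)" using D(2)[OF pr[OF f] pr[OF g]] by simp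
   then show ?thesis using f g fg e c D(1)[OF pr[OF f]] D(1)[OF pr[OF g]]
    by (simp add: \<beta>_def) algebra
  qed
  show "\<beta> (\<lambda>x. s \<otimes> f x) = s \<otimes> \<beta> f" if s: "s \<in> carrier R" and f: "f \<in> carrier F" for s f
  proof -
   note fg = F_smult[OF s f]
   note e = eps_smult[OF s f] eps_closed[OF f]
   have "pr (\<lambda>x. s \<otimes> f x) = (\<lambda>x. s \<otimes> pr f x)"
   proof
    fix x
    show "pr (\<lambda>x. s \<otimes> f x) x = s \<otimes> pr f x"
     using fx[OF f, of x] s delc[OF e(2), of x] unfolding pr_def e(1)
     by (simp add: del_smult[OF s e(2)]) algebra
   qed
   then have "\<alpha> (pr (\<lambda>x. s \<otimes> f x)) = s \<otimes> \<alpha> (pr f)" using D(3)[OF s pr[OF f]] by simp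
   then show ?thesis using f s fg e c D(1)[OF pr[OF f]]
    by (simp add: \<beta>_def) algebra
  qed
 qed
 moreover have "\<alpha> = restrict \<beta> (carrier \<Omega>)"
 proof (rule extensionalityI[of _ "carrier \<Omega>"])
  show "\<alpha> \<in> extensional (carrier \<Omega>)" using \<alpha> by (simp add: hom_module_simps)
  fix f assume f: "f \<in> carrier \<Omega>"
  have e: "eps f \<in> m" "eps f \<in> carrier R" using f m_R by (auto simp: Omega_iff)
  have O: "(\<lambda>x. \<ominus> \<one> \<otimes> del (eps f) x) \<in> carrier \<Omega>" by (rule Omega_smult) (use del_Omega[OF e(1)] in auto)
  have "\<alpha> (pr f) = \<alpha> f \<oplus> \<ominus> \<one> \<otimes> (eps f \<otimes> c)"
   unfolding pr_def using D(2)[OF f O] D(3)[of "\<ominus> \<one>" "del (eps f)"] del_Omega[OF e(1)] h[OF e(1)] by simp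
  then have "\<alpha> (pr f) \<oplus> c \<otimes> eps f = \<alpha> f" using D(1)[OF f] e(2) c(1) by simp algebra
  then show "\<alpha> f = restrict \<beta> (carrier \<Omega>) f" using f Omega_F by (simp add: \<beta>_def)
 qed simp
 ultimately show "\<alpha> \<in> Res" by blast
qed

lemma pa_ideal:
 "pa \<subseteq> carrier R" "\<zero> \<in> pa" "[|x \<in> pa; y \<in> pa|] ==> x \<oplus> y \<in> pa" "[|s \<in> carrier R; x \<in> pa|] ==> s \<otimes> x \<in> pa"
proof -
 show "pa \<subseteq> carrier R" unfolding pa_def by auto
 show "\<zero> \<in> pa" unfolding pa_def using r_null[OF a_R] by force
 show "x \<oplus> y \<in> pa" if xy: "x \<in> pa" "y \<in> pa" for x y
 proof -
  obtain u where "u \<in> carrier R" "x = a \<otimes> u" using xy(1) unfolding pa_def by auto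
  moreover obtain v where "v \<in> carrier R" "y = a \<otimes> v" using xy(2) unfolding pa_def by auto
  ultimately have "x \<oplus> y = a \<otimes> (u \<oplus> v)" "u \<oplus> v \<in> carrier R" by (auto simp: r_distr)
  then show ?thesis unfolding pa_def by blast
 qed
 show "s \<otimes> x \<in> pa" if sx: "s \<in> carrier R" "x \<in> pa" for s x
 proof -
  obtain u where "u \<in> carrier R" "x = a \<otimes> u" using sx unfolding pa_def by auto
  then have "s \<otimes> x = a \<otimes> (s \<otimes> u)" "s \<otimes> u \<in> carrier R" using sx by (auto simp: m_lcomm)
  then show ?thesis unfolding pa_def by blast
 qed
qed

lemma H_ops:
 "[|\<alpha> \<in> carrier H; \<beta> \<in> carrier H|] ==> (\<alpha> \<oplus>\<^bsub>H\<^esub> \<beta>) (del a) = \<alpha> (del a) \<oplus> \<beta> (del a)"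
 "(s \<odot>\<^bsub>H\<^esub> \<alpha>) (del a) = s \<otimes> \<alpha> (del a)"
 "\<zero>\<^bsub>H\<^esub> (del a) = \<zero>"
 using del_Omega[OF a_m] by (simp_all add: hom_module_simps)

sublocale rH: residue_quotient R H m Res
proof (intro residue_quotient.intro residue_quotient_axioms.intro)
 show "module R H" by (rule module_H)
 show "maximalideal m R" by (rule maximalideal_axioms)
 show "Res \<subseteq> carrier H" using Res_H by blast
 show "\<zero>\<^bsub>H\<^esub> \<in> Res" using Res_iff[of "\<zero>\<^bsub>H\<^esub>"] H_ops pa_ideal by simp
 show "\<alpha> \<oplus>\<^bsub>H\<^esub> \<beta> \<in> Res" if "\<alpha> \<in> Res" "\<beta> \<in> Res" for \<alpha> \<beta>
  using that Res_iff[of "\<alpha> \<oplus>\<^bsub>H\<^esub> \<beta>"] Res_H Res_iff[of \<alpha>] Res_iff[of \<beta>] H_ops pa_ideal by simp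
 show "s \<odot>\<^bsub>H\<^esub> \<alpha> \<in> Res" if "s \<in> carrier R" "\<alpha> \<in> Res" for s \<alpha>
  using that Res_iff[of "s \<odot>\<^bsub>H\<^esub> \<alpha>"] Res_H Res_iff[of \<alpha>] H_ops pa_ideal by simp
 show "s \<odot>\<^bsub>H\<^esub> \<alpha> \<in> Res" if "s \<in> m" "\<alpha> \<in> carrier H" for s \<alpha>
 proof -
  have "\<alpha> (del a) \<in> cm" using tau_cm that by simp
  then have "s \<otimes> \<alpha> (del a) \<in> pa" using that m_R unfolding cm_def by (auto simp: m_comm)
  then show ?thesis using that m_R Res_iff[of "s \<odot>\<^bsub>H\<^esub> \<alpha>"] H_ops by simp
 qed
qed

text \<open>Evaluation at \<open>del a\<close> is onto (aR : m), and by \<open>Res_iff\<close> the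
  preimage of aR is the image of restriction. It thus induces an isomorphism of Ext with the socle;
  \<open>al\<close> carries a relative basis back.\<close>

theorem residue_dim_Ext1:
 assumes "rbasis R (carrier R) m cm pa J b"
 shows "residue_dim R m (Ext1 R k Rm) = card J"
proof -
 have fin: "finite J" and b: "b \<in> J \<rightarrow> cm"
  and span: "\<And>x. x \<in> cm ==> \<exists>c \<in> J \<rightarrow> carrier R. \<exists>n \<in> pa. x = (\<Oplus>i\<in>J. c i \<otimes> b i) \<oplus> n"
  and ind: "\<And>c. [|c \<in> J \<rightarrow> carrier R; (\<Oplus>i\<in>J. c i \<otimes> b i) \<in> pa|] ==> \<forall>i\<in>J. c i \<in> m"
  using assms unfolding rbasis_def by blast+
 have alb: "(\<lambda>i. al (b i)) \<in> J \<rightarrow> carrier H" using b al_H by auto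
 have sum: "(\<Oplus>\<^bsub>H\<^esub>i\<in>J. c i \<odot>\<^bsub>H\<^esub> al (b i)) \<in> carrier H \<and>
   (\<Oplus>\<^bsub>H\<^esub>i\<in>J. c i \<odot>\<^bsub>H\<^esub> al (b i)) (del a) = (\<Oplus>i\<in>J. c i \<otimes> b i)"
  if c: "c \<in> J \<rightarrow> carrier R" for c
 proof
  show "(\<Oplus>\<^bsub>H\<^esub>i\<in>J. c i \<odot>\<^bsub>H\<^esub> al (b i)) \<in> carrier H" using alb c by (auto intro!: H.M.finsum_closed)
  show "(\<Oplus>\<^bsub>H\<^esub>i\<in>J. c i \<odot>\<^bsub>H\<^esub> al (b i)) (del a) = (\<Oplus>i\<in>J. c i \<otimes> b i)"
   using fin alb c b
  proof (induction J)
   case empty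
   then show ?case using H_ops by simp
  next
   case (insert j J)
   have h1: "(\<lambda>i. c i \<odot>\<^bsub>H\<^esub> al (b i)) \<in> J \<rightarrow> carrier H" "c j \<odot>\<^bsub>H\<^esub> al (b j) \<in> carrier H"
    using insert.prems by auto
   have bR: "(\<lambda>i. c i \<otimes> b i) \<in> J \<rightarrow> carrier R" "c j \<otimes> b j \<in> carrier R"
    using insert.prems by (auto simp: cm_def Pi_iff)
   have "b j \<in> cm" using insert.prems by auto
   then show ?case using insert h1 bR
    by (simp add: H.M.finsum_insert finsum_insert H_ops H.M.finsum_closed tau_al Pi_iff)
  qed
 qed
 have "rel_basis R m H Res J (\<lambda>i. al (b i))"
  unfolding rel_basis_def
 proof (intro conjI ballI impI)
  show "finite J" by fact
  show "(\<lambda>i. al (b i)) \<in> J \<rightarrow> carrier H" by fact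
  fix \<alpha> assume \<alpha>: "\<alpha> \<in> carrier H"
  obtain c n where c: "c \<in> J \<rightarrow> carrier R" "n \<in> pa" "\<alpha> (del a) = (\<Oplus>i\<in>J. c i \<otimes> b i) \<oplus> n"
   using span[OF tau_cm[OF \<alpha>]] by blast
  define \<beta> where "\<beta> = (\<Oplus>\<^bsub>H\<^esub>i\<in>J. c i \<odot>\<^bsub>H\<^esub> al (b i))"
  have \<beta>: "\<beta> \<in> carrier H" "\<beta> (del a) = (\<Oplus>i\<in>J. c i \<otimes> b i)" using sum[OF c(1)] unfolding \<beta>_def by auto
  have r: "(\<ominus> \<one>) \<odot>\<^bsub>H\<^esub> \<beta> \<in> carrier H" using \<beta> by simp
  \<comment> \<open>\<alpha> minus the combination of the \<open>al (b i)\<close>; its value at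
    \<open>del a\<close> is the remainder n in aR, so it is a restriction.\<close>
  define \<nu> where "\<nu> = \<alpha> \<oplus>\<^bsub>H\<^esub> (\<ominus> \<one>) \<odot>\<^bsub>H\<^esub> \<beta>"
  have \<nu>: "\<nu> \<in> carrier H" using \<alpha> r unfolding \<nu>_def by simp
  have \<beta>R: "\<beta> (del a) \<in> carrier R" using H_D(1)[OF \<beta>(1) del_Omega[OF a_m]] .
  have nR: "n \<in> carrier R" using c(2) pa_ideal by auto
  have "\<nu> (del a) = (\<beta> (del a) \<oplus> n) \<oplus> \<ominus> \<one> \<otimes> \<beta> (del a)"
   unfolding \<nu>_def using H_ops(1)[OF \<alpha> r] H_ops(2) c(3) \<beta>(2) by simp
  also have "\<dots> = n" using \<beta>R nR by algebra
  finally have "\<nu> \<in> Res" using Res_iff[OF \<nu>] c(2) by simp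
  moreover have "\<alpha> = \<beta> \<oplus>\<^bsub>H\<^esub> \<nu>"
   unfolding \<nu>_def using \<alpha> \<beta>(1) by (simp add: H.smult_minus_1 H.M.add.m_lcomm H.M.r_neg)
  ultimately show "\<exists>c\<in>J \<rightarrow> carrier R. \<exists>n\<in>Res. \<alpha> = (\<Oplus>\<^bsub>H\<^esub>i\<in>J. c i \<odot>\<^bsub>H\<^esub> al (b i)) \<oplus>\<^bsub>H\<^esub> n"
   using c(1) unfolding \<beta>_def by blast
 next
  fix c i assume c: "c \<in> J \<rightarrow> carrier R" "(\<Oplus>\<^bsub>H\<^esub>i\<in>J. c i \<odot>\<^bsub>H\<^esub> al (b i)) \<in> Res" and i: "i \<in> J"
  then have "(\<Oplus>i\<in>J. c i \<otimes> b i) \<in> pa" using sum[OF c(1)] Res_iff by auto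
  then show "c i \<in> m" using ind[OF c(1)] i by blast
 qed
 then show ?thesis unfolding Ext1_def by (rule rH.residue_dim_eq)
qed

end

section \<open>The completion at a maximal ideal\<close>

lemma (in ring) add_minus_cancel: "[|x \<in> carrier R; y \<in> carrier R|] ==> (x \<oplus> y) \<ominus> y = x"
 by algebra

locale completed = maximalideal P R + cring R for P and R (structure)
begin

lemma maximalideal_inverse:
 assumes x: "x \<in> carrier R" "x \<notin> P"
 shows "\<exists>y\<in>carrier R. x \<otimes> y \<ominus> \<one> \<in> P"
proof -
 have z: "\<zero>\<^bsub>R Quot P\<^esub> = P" and c: "carrier (R Quot P) = a_rcosets P" by (simp_all add: FactRing_def)
 have field: "field (R Quot P)" by (rule quotient_is_field[OF is_cring])
 have hom: "ring_hom_cring R (R Quot P) ((+>) P)" by (rule rcos_ring_hom_cring[OF is_cring])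
 interpret F: field "R Quot P" by (rule field)
 interpret h: ring_hom_cring R "R Quot P" "(+>) P" by (rule hom)
 have "P +> x \<noteq> P" using x(2) a_rcos_self[OF x(1)] by blast
 then have "P +> x \<in> Units (R Quot P)"
  unfolding F.field_Units z using h.hom_closed[OF x(1)] by blast
 then obtain Y where Y: "Y \<in> carrier (R Quot P)" "(P +> x) \<otimes>\<^bsub>R Quot P\<^esub> Y = \<one>\<^bsub>R Quot P\<^esub>"
  using F.Units_r_inv_ex by blast
 have "Y \<in> a_rcosets P" using Y(1) c by blast
 then obtain y where y: "y \<in> carrier R" "Y = P +> y"
  unfolding A_RCOSETS_def' a_r_coset_def' by blast
 then have "P +> (x \<otimes> y) = P +> \<one>"
  using Y(2) h.hom_mult[OF x(1) y(1)] h.hom_one by simp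
 then have "x \<otimes> y \<ominus> \<one> \<in> P"
  using quotient_eq_iff_same_a_r_cos[OF is_ideal, of "x \<otimes> y" "\<one>"] x(1) y(1) by simp
 then show ?thesis using y(1) by blast
qed

definition Pn :: "nat \<Rightarrow> 'a set" where "Pn n = P [^]\<^bsub>ideals_set R\<^esub> n"

lemma Pn_0: "Pn 0 = carrier R" by (simp add: Pn_def nat_pow_def ideals_set_def)

lemma Pn_Suc: "Pn (Suc n) = ideal_prod R (Pn n) P" by (simp add: Pn_def nat_pow_def ideals_set_def)

lemma Pn_ideal: "ideal (Pn n) R"
 by (induction n) (auto simp: Pn_0 Pn_Suc oneideal intro!: ideal_prod_is_ideal is_ideal)

lemma Pn_1: "Pn 1 = P"
 using ideal_prod_one[OF is_ideal] ideal_prod_commute[OF oneideal is_ideal] by (simp add: Pn_Suc Pn_0)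

lemma Pn_plus: "Pn (m + n) = ideal_prod R (Pn m) (Pn n)"
 by (induction n)
  (simp_all add: Pn_0 Pn_Suc ideal_prod_one[OF Pn_ideal] ideal_prod_assoc[OF Pn_ideal Pn_ideal is_ideal])

lemma Pn_Suc_sub: "Pn (Suc n) \<subseteq> Pn n"
 using ideal_prod_inter[OF Pn_ideal is_ideal, of n] by (simp add: Pn_Suc)

lemma Pn_mono: "m \<le> n ==> Pn n \<subseteq> Pn m"
 by (rule lift_Suc_antimono_le[of Pn]) (rule Pn_Suc_sub)

lemma Pn_closed:
 "x \<in> Pn n ==> x \<in> carrier R"
 "\<zero> \<in> Pn n"
 "[|x \<in> Pn n; y \<in> Pn n|] ==> x \<oplus> y \<in> Pn n"
 "[|x \<in> Pn n; y \<in> Pn n|] ==> x \<ominus> y \<in> Pn n"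
 "x \<in> Pn n ==> \<ominus> x \<in> Pn n"
 "[|s \<in> carrier R; x \<in> Pn n|] ==> s \<otimes> x \<in> Pn n"
 "[|s \<in> carrier R; x \<in> Pn n|] ==> x \<otimes> s \<in> Pn n"
proof -
 interpret I: ideal "Pn n" R by (rule Pn_ideal)
 show "x \<in> Pn n ==> x \<in> carrier R" "\<zero> \<in> Pn n" "[|x \<in> Pn n; y \<in> Pn n|] ==> x \<oplus> y \<in> Pn n"
  "x \<in> Pn n ==> \<ominus> x \<in> Pn n"
  "[|x \<in> Pn n; y \<in> Pn n|] ==> x \<ominus> y \<in> Pn n"
  "[|s \<in> carrier R; x \<in> Pn n|] ==> s \<otimes> x \<in> Pn n"
  "[|s \<in> carrier R; x \<in> Pn n|] ==> x \<otimes> s \<in> Pn n"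
  by (auto simp: a_minus_def I.I_l_closed I.I_r_closed I.a_Hcarr)
qed

lemma P_R: "x \<in> P ==> x \<in> carrier R" using a_subset by auto

lemma P_add: "[|x \<in> P; y \<in> P|] ==> x \<oplus> y \<in> P"
 using Pn_closed(3)[of x 1 y] Pn_1 by simp

lemma inv_mod_P: "[|x \<in> carrier R; x \<notin> P|] ==> \<exists>y\<in>carrier R. \<exists>q\<in>P. x \<otimes> y = \<one> \<oplus> q"
proof -
 assume x: "x \<in> carrier R" "x \<notin> P"
 obtain y where y: "y \<in> carrier R" "x \<otimes> y \<ominus> \<one> \<in> P"
  using maximalideal_inverse[OF x] by blast
 have "x \<otimes> y = \<one> \<oplus> (x \<otimes> y \<ominus> \<one>)" using x y by algebra
 then show ?thesis using y by blast
qed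

text \<open>With s s' = 1 + q and q in P one has w = s' (s w) - w q. The second term gains one power
  of P over w, so membership in the powers up to n is climbed one by one.\<close>

lemma Pn_cancel:
 assumes s: "s \<in> carrier R" "s \<notin> P" and w: "w \<in> carrier R" and sw: "s \<otimes> w \<in> Pn n"
 shows "w \<in> Pn n"
proof -
 obtain s' q where s': "s' \<in> carrier R" "q \<in> P" "s \<otimes> s' = \<one> \<oplus> q" using inv_mod_P[OF s] by blast
 have qR: "q \<in> carrier R" using s' P_R by auto
 have "j \<le> n ==> w \<in> Pn j" for j
 proof (induction j)
  case 0 then show ?case using w by (simp add: Pn_0)
 next
  case (Suc j)
  have "(\<one> \<oplus> q) \<otimes> w = s' \<otimes> (s \<otimes> w)" using s' s w by (metis m_assoc m_comm)
  moreover have "w = (\<one> \<oplus> q) \<otimes> w \<ominus> w \<otimes> q" using w qR by algebra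
  ultimately have "w = s' \<otimes> (s \<otimes> w) \<ominus> w \<otimes> q" by simp
  moreover have "s' \<otimes> (s \<otimes> w) \<in> Pn (Suc j)" using Pn_closed(6)[OF s'(1) sw] Pn_mono[OF Suc.prems] by blast
  moreover have "w \<otimes> q \<in> Pn (Suc j)" unfolding Pn_Suc by (rule ideal_prod.prod) (use Suc s' in auto)
  ultimately show ?case using Pn_closed(4) by metis
 qed
 then show ?thesis by simp
qed

text \<open>If 1 - xy lies in the n-th power of P and 1 - xz in P, their product lies in the next
  power and is again of the form 1 - x(...).\<close>

lemma inv_mod_Pn: "[|x \<in> carrier R; x \<notin> P|] ==> \<exists>y\<in>carrier R. \<one> \<ominus> x \<otimes> y \<in> Pn n"
proof (induction n)
 case 0 then show ?case by (auto simp: Pn_0)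
next
 case (Suc n)
 then obtain y where y: "y \<in> carrier R" "\<one> \<ominus> x \<otimes> y \<in> Pn n" by blast
 obtain z q where z: "z \<in> carrier R" "q \<in> P" "x \<otimes> z = \<one> \<oplus> q" using inv_mod_P Suc.prems by blast
 have q: "q \<in> carrier R" using z P_R by auto
 have "\<one> \<ominus> x \<otimes> z \<in> P"
 proof -
  have "\<one> \<ominus> x \<otimes> z = \<ominus> q" unfolding z(3) using q by algebra
  then show ?thesis using z a_inv_closed by simp
 qed
 then have "(\<one> \<ominus> x \<otimes> y) \<otimes> (\<one> \<ominus> x \<otimes> z) \<in> Pn (Suc n)" unfolding Pn_Suc using y by (intro ideal_prod.prod) auto
 moreover have "(\<one> \<ominus> x \<otimes> y) \<otimes> (\<one> \<ominus> x \<otimes> z) = \<one> \<ominus> x \<otimes> (y \<oplus> z \<ominus> x \<otimes> y \<otimes> z)"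
  using Suc.prems(1) y(1) z(1) by algebra
 ultimately show ?case using y z Suc.prems by (metis a_closed m_closed minus_closed)
qed

text \<open>Coherent sequences of representatives, which \<open>mk\<close> turns into elements of
  the inverse limit. Computations in the completion are made with such sequences in R; equality is
  congruence modulo the n-th power of P at each level n.\<close>

definition coh where "coh = {x. (\<forall>n. x n \<in> carrier R) \<and> (\<forall>n. x (Suc n) \<ominus> x n \<in> Pn n)}"
definition mk where "mk x = (\<lambda>n. Pn n +> x n)"
abbreviation C where "C \<equiv> completion R P"

lemma cohI: "[|\<And>n. x n \<in> carrier R; \<And>n. x (Suc n) \<ominus> x n \<in> Pn n|] ==> x \<in> coh"
 by (simp add: coh_def)

lemma coh_R: "x \<in> coh ==> x n \<in> carrier R" by (simp add: coh_def)

lemma coh_diff: "x \<in> coh ==> n \<le> m ==> x m \<ominus> x n \<in> Pn n"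
proof (induction m)
 case 0
 have "x 0 \<ominus> x 0 = \<zero>" using coh_R[OF 0(1)] by algebra
 then show ?case using 0 Pn_closed by simp
next
 case (Suc m)
 show ?case
 proof (cases "n = Suc m")
  case True
  have "x n \<ominus> x n = \<zero>" using coh_R[OF Suc.prems(1)] by algebra
  then show ?thesis using True Pn_closed by simp
 next
  case False
  then have "x m \<ominus> x n \<in> Pn n" "x (Suc m) \<ominus> x m \<in> Pn n"
   using Suc Pn_mono[of n m] by (auto simp: coh_def)
  moreover have "x (Suc m) \<ominus> x n = (x (Suc m) \<ominus> x m) \<oplus> (x m \<ominus> x n)"
   using coh_R[OF Suc.prems(1), of m] coh_R[OF Suc.prems(1), of n] coh_R[OF Suc.prems(1), of "Suc m"] by algebra
  ultimately show ?thesis using Pn_closed by simp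
 qed
qed

lemma coset_eq: "[|x \<in> carrier R; y \<in> carrier R|] ==> Pn n +> x = Pn n +> y \<longleftrightarrow> x \<ominus> y \<in> Pn n"
 using quotient_eq_iff_same_a_r_cos[OF Pn_ideal] by blast

lemma mk_eq: "[|x \<in> coh; y \<in> coh|] ==> mk x = mk y \<longleftrightarrow> (\<forall>n. x n \<ominus> y n \<in> Pn n)"
 unfolding mk_def fun_eq_iff using coset_eq coh_R by blast

text \<open>The completion is defined by inclusion of cosets; this turns the inclusion into a
  congruence between representatives.\<close>

lemma coset_sub:
 assumes "x \<in> carrier R" "y \<in> carrier R"
 shows "Pn (Suc n) +> x \<subseteq> Pn n +> y \<longleftrightarrow> x \<ominus> y \<in> Pn n"
proof -
 interpret I: ideal "Pn n" R by (rule Pn_ideal)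
 interpret I': ideal "Pn (Suc n)" R by (rule Pn_ideal)
 have mem: "z \<in> Pn n +> y \<longleftrightarrow> z \<ominus> y \<in> Pn n" if "z \<in> carrier R" for z
  using I.a_rcos_module_minus[OF ring_axioms assms(2) that] .
 show ?thesis
 proof
  assume "Pn (Suc n) +> x \<subseteq> Pn n +> y"
  then show "x \<ominus> y \<in> Pn n" using I'.a_rcos_self[OF assms(1)] mem[OF assms(1)] by blast
 next
  assume d: "x \<ominus> y \<in> Pn n"
  show "Pn (Suc n) +> x \<subseteq> Pn n +> y"
  proof
   fix z assume "z \<in> Pn (Suc n) +> x"
   then obtain p where p: "p \<in> Pn (Suc n)" "z = p \<oplus> x" by (auto simp: a_r_coset_def')
   have pR: "p \<in> carrier R" "p \<in> Pn n" using p Pn_Suc_sub Pn_closed by auto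
   have "z \<ominus> y = p \<oplus> (x \<ominus> y)" unfolding p(2) using pR(1) assms by algebra
   then show "z \<in> Pn n +> y" using mem p pR assms d Pn_closed by simp
  qed
 qed
qed

lemma carrier_C: "carrier C = {f. (\<forall>n. f n \<in> carrier (R Quot Pn n)) \<and> (\<forall>n. f (Suc n) \<subseteq> f n)}"
 by (simp add: completion_def Let_def Pn_def)

lemma mk_closed: "x \<in> coh ==> mk x \<in> carrier C"
proof -
 assume x: "x \<in> coh"
 have "mk x n \<in> carrier (R Quot Pn n)" for n
  using a_rcosetsI[of "Pn n" "x n"] coh_R[OF x] Pn_closed(1) by (auto simp: mk_def FactRing_def)
 moreover have "mk x (Suc n) \<subseteq> mk x n" for n
  using coset_sub[OF coh_R[OF x] coh_R[OF x]] x by (auto simp: mk_def coh_def)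
 ultimately show ?thesis unfolding carrier_C by blast
qed

lemma C_cases:
 assumes "f \<in> carrier C"
 obtains x where "x \<in> coh" "f = mk x"
proof -
 have "\<exists>y. y \<in> carrier R \<and> f n = Pn n +> y" for n
 proof -
  have "f n \<in> a_rcosets (Pn n)" using assms unfolding carrier_C by (simp add: FactRing_def)
  then show ?thesis unfolding A_RCOSETS_def' a_r_coset_def' by blast
 qed
 then obtain x where x: "\<And>n. x n \<in> carrier R \<and> f n = Pn n +> x n" by metis
 have "x (Suc n) \<ominus> x n \<in> Pn n" for n
 proof -
  have "f (Suc n) \<subseteq> f n" using assms unfolding carrier_C by blast
  then have "Pn (Suc n) +> x (Suc n) \<subseteq> Pn n +> x n" using x[of n] x[of "Suc n"] by metis
  then show ?thesis using coset_sub[of "x (Suc n)" "x n" n] x[of n] x[of "Suc n"] by blast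
 qed
 then have "x \<in> coh" using x by (intro cohI) auto
 moreover have "f = mk x" using x by (auto simp: mk_def)
 ultimately show ?thesis using that by blast
qed

lemma coh_add: "[|x \<in> coh; y \<in> coh|] ==> (\<lambda>n. x n \<oplus> y n) \<in> coh"
proof (rule cohI)
 fix n assume xy: "x \<in> coh" "y \<in> coh"
 have "(x (Suc n) \<oplus> y (Suc n)) \<ominus> (x n \<oplus> y n) = (x (Suc n) \<ominus> x n) \<oplus> (y (Suc n) \<ominus> y n)"
  using coh_R[OF xy(1), of n] coh_R[OF xy(1), of "Suc n"] coh_R[OF xy(2), of n] coh_R[OF xy(2), of "Suc n"] by algebra
 then show "(x (Suc n) \<oplus> y (Suc n)) \<ominus> (x n \<oplus> y n) \<in> Pn n" using xy Pn_closed(3) by (simp add: coh_def)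
qed (auto simp: coh_R)

lemma coh_mult: "[|x \<in> coh; y \<in> coh|] ==> (\<lambda>n. x n \<otimes> y n) \<in> coh"
proof (rule cohI)
 fix n assume xy: "x \<in> coh" "y \<in> coh"
 have "(x (Suc n) \<otimes> y (Suc n)) \<ominus> (x n \<otimes> y n) = x (Suc n) \<otimes> (y (Suc n) \<ominus> y n) \<oplus> y n \<otimes> (x (Suc n) \<ominus> x n)"
  using coh_R[OF xy(1), of n] coh_R[OF xy(1), of "Suc n"] coh_R[OF xy(2), of n] coh_R[OF xy(2), of "Suc n"] by algebra
 then show "(x (Suc n) \<otimes> y (Suc n)) \<ominus> (x n \<otimes> y n) \<in> Pn n"
  using xy Pn_closed(3,6) by (simp add: coh_def)
qed (auto simp: coh_R)

lemma coh_const: "x \<in> carrier R ==> (\<lambda>n. x) \<in> coh"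
proof (rule cohI)
 fix n assume "x \<in> carrier R"
 then have "x \<ominus> x = \<zero>" by algebra
 then show "x \<ominus> x \<in> Pn n" using Pn_closed by simp
qed auto

lemma mk_add: "[|x \<in> coh; y \<in> coh|] ==> mk x \<oplus>\<^bsub>C\<^esub> mk y = mk (\<lambda>n. x n \<oplus> y n)"
proof
 fix n assume xy: "x \<in> coh" "y \<in> coh"
 interpret I: ideal "Pn n" R by (rule Pn_ideal)
 show "(mk x \<oplus>\<^bsub>C\<^esub> mk y) n = mk (\<lambda>n. x n \<oplus> y n) n"
  using I.a_rcos_sum[of "x n" "y n"] coh_R xy by (simp add: completion_def Let_def mk_def Pn_def FactRing_def)
qed

lemma mk_mult: "[|x \<in> coh; y \<in> coh|] ==> mk x \<otimes>\<^bsub>C\<^esub> mk y = mk (\<lambda>n. x n \<otimes> y n)"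
proof
 fix n assume xy: "x \<in> coh" "y \<in> coh"
 interpret I: ideal "Pn n" R by (rule Pn_ideal)
 show "(mk x \<otimes>\<^bsub>C\<^esub> mk y) n = mk (\<lambda>n. x n \<otimes> y n) n"
  using I.rcoset_mult_add[of "x n" "y n"] coh_R xy by (simp add: completion_def Let_def mk_def Pn_def FactRing_def)
qed

lemma one_C: "\<one>\<^bsub>C\<^esub> = mk (\<lambda>_. \<one>)" by (simp add: completion_def Let_def mk_def Pn_def FactRing_def)

lemma zero_C: "\<zero>\<^bsub>C\<^esub> = mk (\<lambda>_. \<zero>)"
proof -
 have "Pn n +> \<zero> = Pn n" for n
  using a_coset_add_zero[of "Pn n"] Pn_closed(1) by blast
 then show ?thesis unfolding completion_def Let_def mk_def FactRing_def Pn_def by simp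
qed

lemma mk_congI: "(\<And>n. x n = y n) ==> mk x = mk y" by (simp add: mk_def)

lemma cring_C: "cring C"
proof (rule cringI[OF abelian_groupI comm_monoidI])
 show "\<zero>\<^bsub>C\<^esub> \<in> carrier C" "\<one>\<^bsub>C\<^esub> \<in> carrier C" unfolding zero_C one_C by (auto intro!: mk_closed coh_const)
next
 fix f g h assume fg: "f \<in> carrier C" "g \<in> carrier C" "h \<in> carrier C"
 obtain x where x: "x \<in> coh" "f = mk x" using C_cases[OF fg(1)] .
 obtain y where y: "y \<in> coh" "g = mk y" using C_cases[OF fg(2)] .
 obtain z where z: "z \<in> coh" "h = mk z" using C_cases[OF fg(3)] .
 note xyz = x(1) y(1) z(1) and fgh = x(2) y(2) z(2)
 note R = coh_R[OF xyz(1)] coh_R[OF xyz(2)] coh_R[OF xyz(3)]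
 note S = mk_add mk_mult coh_add coh_mult xyz
 show "f \<oplus>\<^bsub>C\<^esub> g \<oplus>\<^bsub>C\<^esub> h = f \<oplus>\<^bsub>C\<^esub> (g \<oplus>\<^bsub>C\<^esub> h)"
  unfolding fgh by (simp add: S) (rule mk_congI, simp add: a_assoc R)
 show "f \<otimes>\<^bsub>C\<^esub> g \<otimes>\<^bsub>C\<^esub> h = f \<otimes>\<^bsub>C\<^esub> (g \<otimes>\<^bsub>C\<^esub> h)"
  unfolding fgh by (simp add: S) (rule mk_congI, simp add: m_assoc R)
 show "(f \<oplus>\<^bsub>C\<^esub> g) \<otimes>\<^bsub>C\<^esub> h = f \<otimes>\<^bsub>C\<^esub> h \<oplus>\<^bsub>C\<^esub> g \<otimes>\<^bsub>C\<^esub> h"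
  unfolding fgh by (simp add: S) (rule mk_congI, simp add: l_distr R)
next
 fix f g assume fg: "f \<in> carrier C" "g \<in> carrier C"
 obtain x where "x \<in> coh" "f = mk x" using C_cases[OF fg(1)] .
 moreover obtain y where "y \<in> coh" "g = mk y" using C_cases[OF fg(2)] .
 ultimately obtain x y where xyz: "x \<in> coh" "y \<in> coh" and fgh: "f = mk x" "g = mk y"
  by blast
 note R = coh_R[OF xyz(1)] coh_R[OF xyz(2)]
 show "f \<oplus>\<^bsub>C\<^esub> g \<in> carrier C" "f \<otimes>\<^bsub>C\<^esub> g \<in> carrier C"
  unfolding fgh using xyz by (auto simp: mk_add mk_mult intro: mk_closed coh_add coh_mult)
 show "f \<oplus>\<^bsub>C\<^esub> g = g \<oplus>\<^bsub>C\<^esub> f"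
  unfolding fgh by (simp add: mk_add xyz) (rule mk_congI, simp add: a_comm R)
 show "f \<otimes>\<^bsub>C\<^esub> g = g \<otimes>\<^bsub>C\<^esub> f"
  unfolding fgh by (simp add: mk_mult xyz) (rule mk_congI, simp add: m_comm R)
next
 fix f assume "f \<in> carrier C"
 then obtain x where x: "x \<in> coh" and f: "f = mk x" by (rule C_cases)
 note R = coh_R[OF x]
 show "\<zero>\<^bsub>C\<^esub> \<oplus>\<^bsub>C\<^esub> f = f"
  unfolding f zero_C using mk_add[OF coh_const x, of \<zero>] R by simp
 show "\<one>\<^bsub>C\<^esub> \<otimes>\<^bsub>C\<^esub> f = f"
  unfolding f one_C using mk_mult[OF coh_const x, of \<one>] R by simp
 have m: "(\<lambda>n. \<ominus> \<one> \<otimes> x n) \<in> coh" using coh_mult[OF coh_const x, of "\<ominus> \<one>"] by simp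
 have "mk (\<lambda>n. \<ominus> \<one> \<otimes> x n) \<oplus>\<^bsub>C\<^esub> f = \<zero>\<^bsub>C\<^esub>"
  unfolding f zero_C mk_add[OF m x] by (rule mk_congI) (use R in \<open>simp add: l_minus l_neg\<close>)
 then show "\<exists>y\<in>carrier C. y \<oplus>\<^bsub>C\<^esub> f = \<zero>\<^bsub>C\<^esub>" using mk_closed[OF m] by blast
qed

sublocale C: cring C by (rule cring_C)

definition io where "io x = mk (\<lambda>_::nat. x)"

lemma io_hom: "ring_hom_cring R C io"
proof (rule ring_hom_cring.intro[OF is_cring cring_C ring_hom_cring_axioms.intro], rule ring_hom_memI)
 fix x y assume xy: "x \<in> carrier R" "y \<in> carrier R"
 show "io (x \<otimes> y) = io x \<otimes>\<^bsub>C\<^esub> io y" unfolding io_def using mk_mult[OF coh_const coh_const] xy by simp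
 show "io (x \<oplus> y) = io x \<oplus>\<^bsub>C\<^esub> io y" unfolding io_def using mk_add[OF coh_const coh_const] xy by simp
qed (auto simp: io_def one_C intro!: mk_closed coh_const)

sublocale io: ring_hom_cring R C io by (rule io_hom)

lemma mk_minus: "[|x \<in> coh; y \<in> coh|] ==> (\<lambda>n. x n \<ominus> y n) \<in> coh \<and> mk x \<ominus>\<^bsub>C\<^esub> mk y = mk (\<lambda>n. x n \<ominus> y n)"
proof -
 assume xy: "x \<in> coh" "y \<in> coh"
 note R = coh_R[OF xy(1)] coh_R[OF xy(2)]
 have eq: "x n \<ominus> y n = x n \<oplus> \<ominus> \<one> \<otimes> y n" for n using R[of n] by algebra
 have m: "(\<lambda>n. \<ominus> \<one> \<otimes> y n) \<in> coh" using coh_mult[OF coh_const xy(2), of "\<ominus> \<one>"] by simp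
 have c: "(\<lambda>n. x n \<ominus> y n) \<in> coh" unfolding eq using coh_add[OF xy(1) m] .
 have p: "(x n \<ominus> y n) \<oplus> y n = x n" for n using R[of n] by algebra
 have e: "mk x = mk (\<lambda>n. x n \<ominus> y n) \<oplus>\<^bsub>C\<^esub> mk y"
  unfolding mk_add[OF c xy(2)] by (rule mk_congI) (rule p[symmetric])
 have "mk x \<ominus>\<^bsub>C\<^esub> mk y = mk (\<lambda>n. x n \<ominus> y n)"
  unfolding e by (rule C.add_minus_cancel[OF mk_closed[OF c] mk_closed[OF xy(2)]])
 then show ?thesis using c by simp
qed

text \<open>At each level a later term is an equally good representative. This is used to discard
  the first few terms of a sequence, and to have levels in reserve before a division by a.\<close>

lemma coh_shift:
 assumes x: "x \<in> coh" and \<mu>: "\<And>n. n \<le> \<mu> n" "\<And>n. \<mu> n \<le> \<mu> (Suc n)"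
 shows "(\<lambda>n. x (\<mu> n)) \<in> coh" "mk (\<lambda>n. x (\<mu> n)) = mk x"
proof -
 show c: "(\<lambda>n. x (\<mu> n)) \<in> coh"
 proof (rule cohI)
  fix n
  have "x (\<mu> (Suc n)) \<ominus> x (\<mu> n) \<in> Pn (\<mu> n)" using coh_diff[OF x \<mu>(2)] .
  then show "x (\<mu> (Suc n)) \<ominus> x (\<mu> n) \<in> Pn n" using Pn_mono[OF \<mu>(1)] by blast
 qed (rule coh_R[OF x])
 show "mk (\<lambda>n. x (\<mu> n)) = mk x" using mk_eq[OF c x] coh_diff[OF x \<mu>(1)] by blast
qed

text \<open>Level 1 is the residue field R/P; level 0 is the zero ring and carries no
  information.\<close>

definition mm where "mm = {mk x | x. x \<in> coh \<and> x 1 \<in> P}"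

lemma mk_mm_iff: "x \<in> coh ==> mk x \<in> mm \<longleftrightarrow> x 1 \<in> P"
proof
 assume x: "x \<in> coh" and "mk x \<in> mm"
 then obtain y where y: "y \<in> coh" "y 1 \<in> P" "mk x = mk y" unfolding mm_def by auto
 then have "x 1 \<ominus> y 1 \<in> P" using mk_eq[OF x y(1)] Pn_1 by metis
 moreover have "x 1 = (x 1 \<ominus> y 1) \<oplus> y 1" using coh_R[OF x, of 1] coh_R[OF y(1), of 1] by algebra
 ultimately show "x 1 \<in> P" using y(2) P_add by metis
qed (auto simp: mm_def)

lemma mm_ideal: "ideal mm C"
proof (rule idealI)
 show "ring C" by (rule C.ring_axioms)
 have sub: "mm \<subseteq> carrier C" unfolding mm_def using mk_closed by auto
 have "mk (\<lambda>_. \<zero>) \<in> mm" using mk_mm_iff[OF coh_const] by simp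
 then have ne: "mm \<noteq> {}" by blast
 have inv: "\<ominus>\<^bsub>C\<^esub> f \<in> mm" if f: "f \<in> mm" for f
 proof -
  obtain x where x: "x \<in> coh" "x 1 \<in> P" "f = mk x" using f unfolding mm_def by auto
  have z: "(\<lambda>_. \<zero>) \<in> coh" by (rule coh_const) simp
  have "\<ominus>\<^bsub>C\<^esub> f = \<zero>\<^bsub>C\<^esub> \<ominus>\<^bsub>C\<^esub> f" using f sub by (auto simp: C.minus_eq)
  also have "\<dots> = mk (\<lambda>n. \<zero> \<ominus> x n)" unfolding zero_C x(3) using mk_minus[OF z x(1)] by simp
  also have "\<dots> \<in> mm" using mk_minus[OF z x(1)] x(2) mk_mm_iff coh_R[OF x(1)] by (auto simp: a_minus_def)
  finally show ?thesis .
 qed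
 have add: "f \<oplus>\<^bsub>C\<^esub> g \<in> mm" if fg: "f \<in> mm" "g \<in> mm" for f g
 proof -
  obtain x where x: "x \<in> coh" "x 1 \<in> P" "f = mk x" using fg(1) unfolding mm_def by blast
  obtain y where y: "y \<in> coh" "y 1 \<in> P" "g = mk y" using fg(2) unfolding mm_def by blast
  show ?thesis unfolding x(3) y(3) mk_add[OF x(1) y(1)] mk_mm_iff[OF coh_add[OF x(1) y(1)]]
   using P_add[OF x(2) y(2)] .
 qed
 show "subgroup mm (add_monoid C)"
  by (rule C.add.subgroupI) (use sub ne inv add in \<open>auto simp: a_inv_def\<close>)
next
 fix f g assume "f \<in> mm" "g \<in> carrier C"
 then obtain x y where x: "x \<in> coh" "x 1 \<in> P" "f = mk x" and y: "y \<in> coh" "g = mk y"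
  unfolding mm_def by (auto elim: C_cases)
 show "g \<otimes>\<^bsub>C\<^esub> f \<in> mm" using x y mk_mult coh_mult mk_mm_iff coh_R I_l_closed by simp
 show "f \<otimes>\<^bsub>C\<^esub> g \<in> mm" using x y mk_mult coh_mult mk_mm_iff coh_R I_r_closed by simp
qed

text \<open>Inverses are chosen level by level. They are coherent: x(n) (y(n+1) - y(n)) lies in the
  n-th power of P, and x(n) is outside P, so it may be cancelled. At level 0 every choice is an
  inverse.\<close>

lemma unit_C:
 assumes f: "f \<in> carrier C" "f \<notin> mm"
 shows "\<exists>g\<in>carrier C. f \<otimes>\<^bsub>C\<^esub> g = \<one>\<^bsub>C\<^esub>"
proof -
 obtain x where x: "x \<in> coh" "f = mk x" using f C_cases by blast
 have x1: "x 1 \<notin> P" using x f mk_mm_iff by blast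
 have xn: "x n \<notin> P" if "n \<ge> 1" for n
 proof
  assume "x n \<in> P"
  moreover have "x n \<ominus> x 1 \<in> P" using coh_diff[OF x(1) that] Pn_1 by simp
  moreover have "x 1 = x n \<ominus> (x n \<ominus> x 1)" using coh_R[OF x(1), of 1] coh_R[OF x(1), of n] by algebra
  ultimately show False using x1 Pn_closed(4)[of _ 1] Pn_1 by metis
 qed
 have "\<exists>y. y \<in> carrier R \<and> \<one> \<ominus> x n \<otimes> y \<in> Pn n" for n
 proof (cases "n = 0")
  case True then show ?thesis using coh_R[OF x(1)] by (auto simp: Pn_0)
 next
  case False then show ?thesis using inv_mod_Pn[OF coh_R[OF x(1)] xn, of n n] by auto
 qed
 then obtain y where y: "\<And>n. y n \<in> carrier R \<and> \<one> \<ominus> x n \<otimes> y n \<in> Pn n" by metis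
 have yc: "y \<in> coh"
 proof (rule cohI)
  fix n
  note R = coh_R[OF x(1), of n] coh_R[OF x(1), of "Suc n"] conjunct1[OF y[of n]] conjunct1[OF y[of "Suc n"]]
  show "y (Suc n) \<ominus> y n \<in> Pn n"
  proof (cases "n = 0")
   case True then show ?thesis using R by (simp add: Pn_0)
  next
   case False
   have "x n \<otimes> (y (Suc n) \<ominus> y n) = (\<one> \<ominus> x n \<otimes> y n) \<ominus> (\<one> \<ominus> x (Suc n) \<otimes> y (Suc n)) \<ominus> y (Suc n) \<otimes> (x (Suc n) \<ominus> x n)"
    using R by algebra
   moreover have "\<one> \<ominus> x (Suc n) \<otimes> y (Suc n) \<in> Pn n" using y[of "Suc n"] Pn_Suc_sub by blast
   moreover have "y (Suc n) \<otimes> (x (Suc n) \<ominus> x n) \<in> Pn n" using Pn_closed(6) R x(1) by (simp add: coh_def)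
   ultimately have "x n \<otimes> (y (Suc n) \<ominus> y n) \<in> Pn n" using y[of n] Pn_closed(4) by simp
   then show ?thesis using Pn_cancel[OF R(1) xn, of "y (Suc n) \<ominus> y n" n] R False by simp
  qed
 qed (use y in auto)
 have "\<one>\<^bsub>C\<^esub> = mk x \<otimes>\<^bsub>C\<^esub> mk y"
  unfolding one_C mk_mult[OF x(1) yc] using mk_eq[OF coh_const coh_mult[OF x(1) yc], of \<one>] y by simp
 then show ?thesis using mk_closed[OF yc] x by metis
qed

lemma mm_maximal: "maximalideal mm C"
proof (rule maximalidealI[OF mm_ideal])
 have "\<one> \<notin> P" using one_imp_carrier I_notcarr by blast
 then show "carrier C \<noteq> mm" using mk_mm_iff[OF coh_const, of \<one>] C.one_closed one_C by auto
 fix J assume J: "ideal J C" "mm \<subseteq> J" "J \<subseteq> carrier C"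
 interpret J: ideal J C by fact
 show "J = mm \<or> J = carrier C"
 proof (rule ccontr)
  assume "\<not> ?thesis"
  then obtain f where f: "f \<in> J" "f \<notin> mm" "J \<noteq> carrier C" using J by blast
  then obtain g where "g \<in> carrier C" "f \<otimes>\<^bsub>C\<^esub> g = \<one>\<^bsub>C\<^esub>" using unit_C J by blast
  then have "\<one>\<^bsub>C\<^esub> \<in> J" using f J.I_r_closed by metis
  then show False using J.one_imp_carrier f by blast
 qed
qed

lemma local_max_ideal_C: "local_max_ideal C = mm"
 unfolding local_max_ideal_def
proof (rule the_equality)
 show "maximalideal mm C" by (rule mm_maximal)
 fix J assume J: "maximalideal J C"
 interpret J: maximalideal J C by fact
 have "J \<subseteq> mm"
 proof
  fix f assume f: "f \<in> J"
  show "f \<in> mm"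
  proof (rule ccontr)
   assume "f \<notin> mm"
   then obtain g where "g \<in> carrier C" "f \<otimes>\<^bsub>C\<^esub> g = \<one>\<^bsub>C\<^esub>" using unit_C[of f] f J.a_Hcarr by blast
   then have "\<one>\<^bsub>C\<^esub> \<in> J" using f J.I_r_closed by metis
   then show False using J.one_imp_carrier J.I_notcarr by blast
  qed
 qed
 moreover have "mm \<noteq> carrier C" using mm_maximal by (metis maximalideal.I_notcarr)
 ultimately show "J = mm" using J.I_maximal[OF mm_ideal] ideal.Icarr[OF mm_ideal] by blast
qed

end

section \<open>Comparison of the socle of a ring with the socle of its completion\<close>

lemma (in residue_ext) pa_finsum:
 "[|finite J; \<And>i. i \<in> J ==> f i \<in> pa|] ==> (\<Oplus>i\<in>J. f i) \<in> pa"
proof (induction J rule: finite_induct)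
 case empty then show ?case using pa_ideal by simp
next
 case (insert j J)
 have "f \<in> J \<rightarrow> carrier R" "f j \<in> carrier R" using insert pa_ideal(1) by auto
 then show ?case using insert pa_ideal(3) by (simp add: finsum_insert)
qed

lemma (in residue_ext) pa_iff: "x \<in> pa \<longleftrightarrow> (\<exists>y\<in>carrier R. x = a \<otimes> y)"
 unfolding pa_def by blast

lemma (in residue_ext) cm_smult: "[|s \<in> carrier R; x \<in> cm|] ==> s \<otimes> x \<in> cm"
 unfolding cm_def using pa_ideal(4) m_R by (simp add: m_assoc)

lemma (in residue_ext) cm_R: "x \<in> cm ==> x \<in> carrier R"
 unfolding cm_def by simp

lemma (in residue_ext) cm_mult: "[|x \<in> cm; y \<in> m|] ==> x \<otimes> y \<in> pa"
 unfolding cm_def by simp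

lemma (in residue_ext) cm_finsum:
 "[|finite J; \<And>i. i \<in> J ==> f i \<in> cm|] ==> (\<Oplus>i\<in>J. f i) \<in> cm"
proof (induction J rule: finite_induct)
 case empty
 have "\<zero> \<otimes> y \<in> pa" if "y \<in> m" for y using that m_R pa_ideal(2) by simp
 then show ?case by (simp add: cm_def)
next
 case (insert j J)
 have "f \<in> J \<rightarrow> carrier R" "f j \<in> carrier R" using insert cm_R by auto
 moreover have "(x \<oplus> y) \<in> cm" if "x \<in> cm" "y \<in> cm" for x y
  using that m_R pa_ideal(3) unfolding cm_def by (simp add: l_distr)
 ultimately show ?case using insert by (simp add: finsum_insert)
qed

text \<open>That t is outside P and maps the n0-th power of P into aR says that this power lies in
  aR after localization at P. Hence R/aR is, locally at P, unaffected by the completion.\<close>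

locale completed_nzd = completed +
 fixes a t n0
 assumes a_P: "a \<in> P" and a_nzd: "[|y \<in> carrier R; a \<otimes> y = \<zero>|] ==> y = \<zero>"
  and t_R: "t \<in> carrier R" and t_P: "t \<notin> P"
  and t_dvd: "x \<in> Pn n0 ==> \<exists>y\<in>carrier R. t \<otimes> x = a \<otimes> y"
begin

lemma residue_ext_R: "residue_ext P R a"
 by (rule residue_ext.intro[OF maximalideal_axioms is_cring residue_ext_axioms.intro]) (rule a_P a_nzd; assumption)+

abbreviation Epa where "Epa \<equiv> residue_ext.pa R a"
abbreviation Ecm where "Ecm \<equiv> residue_ext.cm P R a"

lemmas E_pa_iff = residue_ext.pa_iff[OF residue_ext_R]
lemmas E_cm_R = residue_ext.cm_R[OF residue_ext_R]
lemmas E_cm_mult = residue_ext.cm_mult[OF residue_ext_R]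
lemmas E_cm_def = residue_ext.cm_def[OF residue_ext_R]
lemmas E_cm_finsum = residue_ext.cm_finsum[OF residue_ext_R]
lemmas E_cm_smult = residue_ext.cm_smult[OF residue_ext_R]
lemmas E_a_cancel = residue_ext.a_cancel[OF residue_ext_R]

lemma a_R: "a \<in> carrier R" using a_P P_R by auto

lemma pow_dvd: "x \<in> Pn (n0 * N) ==> \<exists>y\<in>carrier R. t [^] N \<otimes> x = a [^] N \<otimes> y"
proof (induction N arbitrary: x)
 case 0 then show ?case by (auto simp: Pn_0)
next
 case (Suc N)
 have "n0 * Suc N = n0 * N + n0" by simp
 then have "x \<in> ideal_prod R (Pn (n0 * N)) (Pn n0)" using Suc.prems Pn_plus by metis
 then show ?case
 proof (induction rule: ideal_prod.induct)
  case (prod i j)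
  obtain y where y: "y \<in> carrier R" "t [^] N \<otimes> i = a [^] N \<otimes> y" using Suc.IH[OF prod(1)] by blast
  obtain z where z: "z \<in> carrier R" "t \<otimes> j = a \<otimes> z" using t_dvd[OF prod(2)] by blast
  have ij: "i \<in> carrier R" "j \<in> carrier R" using prod Pn_closed(1) by auto
  have tN: "t [^] N \<in> carrier R" "a [^] N \<in> carrier R" using t_R a_R by auto
  have "t [^] Suc N \<otimes> (i \<otimes> j) = (t [^] N \<otimes> i) \<otimes> (t \<otimes> j)" using t_R ij tN by (simp add: m_ac)
  also have "\<dots> = (a [^] N \<otimes> y) \<otimes> (a \<otimes> z)" using y z by simp
  also have "\<dots> = a [^] Suc N \<otimes> (y \<otimes> z)" using a_R y z tN by (simp add: m_ac)
  finally show ?case using y z by blast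
 next
  case (sum s1 s2)
  then obtain y z where yz: "y \<in> carrier R" "z \<in> carrier R"
   "t [^] Suc N \<otimes> s1 = a [^] Suc N \<otimes> y" "t [^] Suc N \<otimes> s2 = a [^] Suc N \<otimes> z" by blast
  have s: "s1 \<in> carrier R" "s2 \<in> carrier R"
   using sum(1,2) ideal_prod_in_carrier[OF Pn_ideal Pn_ideal] by auto
  have "t [^] Suc N \<otimes> (s1 \<oplus> s2) = a [^] Suc N \<otimes> (y \<oplus> z)"
   using yz s t_R a_R by (simp add: r_distr del: nat_pow_Suc)
  then show ?case using yz by blast
 qed
qed

lemma pow_notin_P: "s \<in> carrier R ==> s \<notin> P ==> s [^] (n::nat) \<notin> P"
proof (induction n)
 case 0 then show ?case using one_imp_carrier I_notcarr by auto
next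
 case (Suc n)
 then show ?case using primeideal.I_prime[OF maximalideal_prime[OF maximalideal_axioms], of "s [^] n" s] by auto
qed

lemma a_pow_Pn: "a [^] (n::nat) \<in> Pn n"
 by (induction n) (auto simp: Pn_0 Pn_Suc intro: ideal_prod.prod a_P)

text \<open>Multiplying by a power of t turns a w into a multiple of the power N + 1 of a. One
  factor a is cancelled, the remaining N factors put the multiple of w into the N-th power of P, and
  the power of t is cancelled by \<open>Pn_cancel\<close>. The product in the exponent provides N +
  1 factors a, the added N gives M \<ge> N.\<close>

lemma a_cancel_Pn: "\<exists>M\<ge>N. \<forall>w\<in>carrier R. a \<otimes> w \<in> Pn M --> w \<in> Pn N"
proof (intro exI[of _ "n0 * Suc N + N"] conjI ballI impI)
 fix w assume w: "w \<in> carrier R" "a \<otimes> w \<in> Pn (n0 * Suc N + N)"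
 then have "a \<otimes> w \<in> Pn (n0 * Suc N)" using Pn_mono[of "n0 * Suc N" "n0 * Suc N + N"] by auto
 then obtain y where y: "y \<in> carrier R" "t [^] Suc N \<otimes> (a \<otimes> w) = a [^] Suc N \<otimes> y" using pow_dvd by blast
 have tN: "t [^] Suc N \<in> carrier R" "a [^] N \<in> carrier R" using t_R a_R by auto
 have "a \<otimes> (t [^] Suc N \<otimes> w) = t [^] Suc N \<otimes> (a \<otimes> w)" using w a_R tN(1) by (rule_tac m_lcomm) auto
 also have "\<dots> = a \<otimes> (a [^] N \<otimes> y)" unfolding y(2) using a_R y(1) tN(2) by (simp add: m_ac)
 finally have "t [^] Suc N \<otimes> w = a [^] N \<otimes> y" using E_a_cancel tN w y by simp
 then have "t [^] Suc N \<otimes> w \<in> Pn N" using Pn_closed(7)[OF y(1) a_pow_Pn] by simp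
 then show "w \<in> Pn N" using Pn_cancel[OF tN(1) pow_notin_P[OF t_R t_P] w(1)] by blast
qed simp

definition mu where "mu = (SOME \<mu>. \<forall>N. \<mu> N \<ge> N \<and> \<mu> N \<le> \<mu> (Suc N) \<and>
 (\<forall>w\<in>carrier R. a \<otimes> w \<in> Pn (\<mu> N) --> w \<in> Pn N))"

lemma mu:
 "N \<le> mu N" "mu N \<le> mu (Suc N)" "[|w \<in> carrier R; a \<otimes> w \<in> Pn (mu N)|] ==> w \<in> Pn N"
proof -
 obtain M where M: "\<And>N. M N \<ge> N \<and> (\<forall>w\<in>carrier R. a \<otimes> w \<in> Pn (M N) --> w \<in> Pn N)"
  using a_cancel_Pn by metis
 \<comment> \<open>Partial sums of the individual bounds dominate them and are monotone, as
   \<open>coh_shift\<close> requires.\<close>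
 define \<mu> where "\<mu> N = (\<Sum>i\<le>N. M i)" for N
 have "M N \<le> \<mu> N" for N unfolding \<mu>_def by (rule member_le_sum) auto
 then have "\<forall>N. \<mu> N \<ge> N \<and> \<mu> N \<le> \<mu> (Suc N) \<and> (\<forall>w\<in>carrier R. a \<otimes> w \<in> Pn (\<mu> N) --> w \<in> Pn N)"
  using M Pn_mono by (auto simp: \<mu>_def intro: order_trans) (meson M subsetD)
 from someI[of "\<lambda>\<mu>. \<forall>N. \<mu> N \<ge> N \<and> \<mu> N \<le> \<mu> (Suc N) \<and>
   (\<forall>w\<in>carrier R. a \<otimes> w \<in> Pn (\<mu> N) --> w \<in> Pn N)", OF this]
 show "N \<le> mu N" "mu N \<le> mu (Suc N)" "[|w \<in> carrier R; a \<otimes> w \<in> Pn (mu N)|] ==> w \<in> Pn N"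
  unfolding mu_def by blast+
qed

text \<open>Multiplication by \<open>a\<close> is strict for the \<open>P\<close>-adic filtration up to the shift \<open>mu\<close>, so quotients
 by \<open>a\<close> taken level by level converge.\<close>

lemma division:
 assumes \<rho>: "\<rho> \<in> coh" and w: "w \<in> carrier R" and dvd: "\<And>j. w \<otimes> \<rho> j \<in> Epa"
 shows "\<exists>d\<in>carrier C. io w \<otimes>\<^bsub>C\<^esub> mk \<rho> = io a \<otimes>\<^bsub>C\<^esub> d"
proof -
 obtain y where y: "\<And>j. y j \<in> carrier R \<and> w \<otimes> \<rho> j = a \<otimes> y j" using dvd unfolding E_pa_iff by metis
 have R: "\<rho> j \<in> carrier R" "y j \<in> carrier R" for j using coh_R[OF \<rho>] y by auto
 let ?x = "\<lambda>n. y (mu n)"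
 have xc: "?x \<in> coh"
 proof (rule cohI)
  fix n
  have "a \<otimes> (y (mu (Suc n)) \<ominus> y (mu n)) = w \<otimes> \<rho> (mu (Suc n)) \<ominus> w \<otimes> \<rho> (mu n)"
   using y[of "mu n"] y[of "mu (Suc n)"] a_R by (simp add: a_minus_def r_distr r_minus)
  also have "\<dots> = w \<otimes> (\<rho> (mu (Suc n)) \<ominus> \<rho> (mu n))" using w R(1) by algebra
  also have "\<dots> \<in> Pn (mu n)" using Pn_closed(6)[OF w coh_diff[OF \<rho> mu(2)]] .
  finally show "y (mu (Suc n)) \<ominus> y (mu n) \<in> Pn n" using mu(3) R by simp
 qed (rule R(2))
 have sh: "(\<lambda>n. \<rho> (mu n)) \<in> coh" "mk (\<lambda>n. \<rho> (mu n)) = mk \<rho>" by (rule coh_shift[OF \<rho> mu(1,2)])+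
 have "io w \<otimes>\<^bsub>C\<^esub> mk \<rho> = mk (\<lambda>n. w \<otimes> \<rho> (mu n))"
  unfolding sh(2)[symmetric] io_def by (rule mk_mult[OF coh_const[OF w] sh(1)])
 also have "\<dots> = mk (\<lambda>n. a \<otimes> y (mu n))" by (rule mk_congI) (use y in blast)
 also have "\<dots> = io a \<otimes>\<^bsub>C\<^esub> mk ?x" unfolding io_def by (rule mk_mult[OF coh_const[OF a_R] xc, symmetric])
 finally show ?thesis using mk_closed[OF xc] by blast
qed

text \<open>If a x(n) is in the n-th power of P for all n, then looking at index \<open>mu n\<close>
  puts x(mu n) into the n-th power, and coherence returns this to x(n).\<close>

lemma io_a_nzd: "[|f \<in> carrier C; io a \<otimes>\<^bsub>C\<^esub> f = \<zero>\<^bsub>C\<^esub>|] ==> f = \<zero>\<^bsub>C\<^esub>"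
proof -
 assume f: "f \<in> carrier C" and z: "io a \<otimes>\<^bsub>C\<^esub> f = \<zero>\<^bsub>C\<^esub>"
 obtain x where x: "x \<in> coh" "f = mk x" using C_cases[OF f] .
 have c0: "(\<lambda>_. \<zero>) \<in> coh" by (rule coh_const) simp
 have "mk (\<lambda>n. a \<otimes> x n) = mk (\<lambda>_. \<zero>)"
  using z unfolding x(2) zero_C io_def mk_mult[OF coh_const[OF a_R] x(1)] .
 then have "a \<otimes> x n \<ominus> \<zero> \<in> Pn n" for n
  using mk_eq[OF coh_mult[OF coh_const[OF a_R] x(1)] c0] by blast
 then have an: "a \<otimes> x n \<in> Pn n" for n using coh_R[OF x(1)] a_R by (simp add: a_minus_def)
 have "x n \<ominus> \<zero> \<in> Pn n" for n
 proof -
  have "x (mu n) \<in> Pn n" using mu(3)[OF coh_R[OF x(1)] an] .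
  moreover have "x (mu n) \<ominus> x n \<in> Pn n" using coh_diff[OF x(1) mu(1)] .
  moreover have "x n \<ominus> \<zero> = x (mu n) \<ominus> (x (mu n) \<ominus> x n)" using coh_R[OF x(1), of n] coh_R[OF x(1), of "mu n"] by algebra
  ultimately show ?thesis using Pn_closed(4) by simp
 qed
 then show "f = \<zero>\<^bsub>C\<^esub>" unfolding x(2) zero_C using mk_eq[OF x(1) c0] by blast
qed

lemma io_mm: "x \<in> carrier R ==> io x \<in> mm \<longleftrightarrow> x \<in> P"
 unfolding io_def using mk_mm_iff[OF coh_const] by blast

lemma residue_ext_C: "residue_ext mm C (io a)"
proof (rule residue_ext.intro[OF mm_maximal cring_C residue_ext_axioms.intro])
 show "io a \<in> mm" using io_mm[OF a_R] a_P by blast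
qed (rule io_a_nzd; assumption)

abbreviation ECpa where "ECpa \<equiv> residue_ext.pa C (io a)"
abbreviation ECcm where "ECcm \<equiv> residue_ext.cm mm C (io a)"

lemmas EC_pa_iff = residue_ext.pa_iff[OF residue_ext_C]
lemmas EC_cm_R = residue_ext.cm_R[OF residue_ext_C]
lemmas EC_cm_mult = residue_ext.cm_mult[OF residue_ext_C]
lemmas EC_cm_def = residue_ext.cm_def[OF residue_ext_C]
lemmas EC_pa_finsum = residue_ext.pa_finsum[OF residue_ext_C]
lemmas EC_residue_dim_Ext1 = residue_ext.residue_dim_Ext1[OF residue_ext_C]

lemma io_cm: "b \<in> Ecm ==> io b \<in> ECcm"
proof -
 assume b: "b \<in> Ecm"
 then have bR: "b \<in> carrier R" by (rule E_cm_R)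
 have "io b \<otimes>\<^bsub>C\<^esub> r \<in> ECpa" if r: "r \<in> mm" for r
 proof -
  obtain x where x: "x \<in> coh" "x 1 \<in> P" "r = mk x" using r unfolding mm_def by blast
  \<comment> \<open>The term at level 0 is arbitrary, and coherence with level 1 puts all others
    into P; with the shifted index every term is in P and hence is multiplied into aR by b.\<close>
  let ?x = "\<lambda>n. x (max n 1)"
  have sh: "?x \<in> coh" "mk ?x = mk x" by (rule coh_shift[OF x(1)]; simp)+
  have "?x j \<in> P" for j
  proof -
   have "?x j \<ominus> x 1 \<in> P" using coh_diff[OF x(1), of 1 "max j 1"] Pn_1 by simp
   moreover have "?x j = (?x j \<ominus> x 1) \<oplus> x 1" using coh_R[OF x(1), of 1] coh_R[OF x(1), of "max j 1"] by algebra
   ultimately show ?thesis using x(2) P_add by metis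
  qed
  then have "b \<otimes> ?x j \<in> Epa" for j using E_cm_mult[OF b] by blast
  then show ?thesis using division[OF sh(1) bR] unfolding x(3) sh(2) EC_pa_iff by blast
 qed
 then show ?thesis unfolding EC_cm_def using bR by simp
qed

text \<open>Spanning: an element of the completed socle is approximated at level n0, where the
  approximation, multiplied by t, falls into the socle of R, and the remainder is divisible by a.
  Independence: coefficients are replaced by their residues, which are represented in R, and
  divisibility by a is then detected at level n0.\<close>

lemma rbasis_completion:
 assumes "rbasis R (carrier R) P Ecm Epa J b"
 shows "rbasis C (carrier C) mm ECcm ECpa J (\<lambda>i. io (b i))"
proof -
 have fin: "finite J" and b: "b \<in> J \<rightarrow> Ecm"
  and span: "\<And>x. x \<in> Ecm ==> \<exists>c \<in> J \<rightarrow> carrier R. \<exists>n \<in> Epa. x = (\<Oplus>i\<in>J. c i \<otimes> b i) \<oplus> n"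
  and ind: "\<And>c. [|c \<in> J \<rightarrow> carrier R; (\<Oplus>i\<in>J. c i \<otimes> b i) \<in> Epa|] ==> \<forall>i\<in>J. c i \<in> P"
  using assms unfolding rbasis_def by blast+
 have bR: "b i \<in> carrier R" if "i \<in> J" for i using b that E_cm_R by auto
 have io_sum: "io (\<Oplus>i\<in>J. c i \<otimes> b i) = (\<Oplus>\<^bsub>C\<^esub>i\<in>J. io (c i) \<otimes>\<^bsub>C\<^esub> io (b i))"
  if c: "c \<in> J \<rightarrow> carrier R" for c
 proof -
  have "io (\<Oplus>i\<in>J. c i \<otimes> b i) = (\<Oplus>\<^bsub>C\<^esub>i\<in>J. (io \<circ> (\<lambda>i. c i \<otimes> b i)) i)"
   using io.hom_finsum[of "\<lambda>i. c i \<otimes> b i" J] c bR by (auto simp: Pi_iff comp_def)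
  also have "\<dots> = (\<Oplus>\<^bsub>C\<^esub>i\<in>J. io (c i) \<otimes>\<^bsub>C\<^esub> io (b i))"
   by (rule C.finsum_cong') (use c bR in \<open>auto simp: Pi_iff\<close>)
  finally show ?thesis .
 qed
 obtain t' q where t': "t' \<in> carrier R" "q \<in> P" "t \<otimes> t' = \<one> \<oplus> q" using inv_mod_P[OF t_R t_P] by blast
 have qR: "q \<in> carrier R" using t' P_R by auto
 show ?thesis unfolding rbasis_def
 proof (intro conjI ballI impI)
  show "finite J" by fact
  show "(\<lambda>i. io (b i)) \<in> J \<rightarrow> ECcm" using b io_cm by auto
  fix f assume f: "f \<in> ECcm"
  then have fC: "f \<in> carrier C" by (rule EC_cm_R)
  obtain \<gamma> where \<gamma>: "\<gamma> \<in> coh" "f = mk \<gamma>" using C_cases[OF fC] .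
  note \<gamma>R = coh_R[OF \<gamma>(1)]
  \<comment> \<open>\<gamma>(n0) represents f up to an element of the n0-th power of P, and the
    factor t makes such an error a multiple of a. This puts t \<gamma>(n0) into (aR : P).\<close>
  define b0 where "b0 = t \<otimes> \<gamma> n0"
  have b0R: "b0 \<in> carrier R" unfolding b0_def using t_R \<gamma>R by simp
  have "b0 \<otimes> y \<in> Epa" if y: "y \<in> P" for y
  proof -
   have yR: "y \<in> carrier R" using y P_R by auto
   have "f \<otimes>\<^bsub>C\<^esub> io y \<in> ECpa" using EC_cm_mult[OF f] io_mm[OF yR] y by blast
   then obtain d where d: "d \<in> carrier C" "f \<otimes>\<^bsub>C\<^esub> io y = io a \<otimes>\<^bsub>C\<^esub> d" unfolding EC_pa_iff by blast
   obtain \<delta> where \<delta>: "\<delta> \<in> coh" "d = mk \<delta>" using C_cases[OF d(1)] .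
   have "mk (\<lambda>n. \<gamma> n \<otimes> y) = mk (\<lambda>n. a \<otimes> \<delta> n)"
    using d(2) unfolding \<gamma>(2) \<delta>(2) io_def mk_mult[OF \<gamma>(1) coh_const[OF yR]] mk_mult[OF coh_const[OF a_R] \<delta>(1)] .
   then have "\<gamma> n0 \<otimes> y \<ominus> a \<otimes> \<delta> n0 \<in> Pn n0"
    using mk_eq[OF coh_mult[OF \<gamma>(1) coh_const[OF yR]] coh_mult[OF coh_const[OF a_R] \<delta>(1)]] by blast
   then obtain u where u: "u \<in> carrier R" "t \<otimes> (\<gamma> n0 \<otimes> y \<ominus> a \<otimes> \<delta> n0) = a \<otimes> u" using t_dvd by blast
   have "b0 \<otimes> y = t \<otimes> (\<gamma> n0 \<otimes> y \<ominus> a \<otimes> \<delta> n0) \<oplus> a \<otimes> (t \<otimes> \<delta> n0)"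
    unfolding b0_def using t_R a_R yR \<gamma>R[of n0] coh_R[OF \<delta>(1), of n0] by algebra
   also have "\<dots> = a \<otimes> (u \<oplus> t \<otimes> \<delta> n0)" unfolding u(2) using t_R a_R u(1) coh_R[OF \<delta>(1), of n0] by algebra
   finally show ?thesis unfolding E_pa_iff using u(1) t_R coh_R[OF \<delta>(1), of n0] by blast
  qed
  then have "b0 \<in> Ecm" unfolding E_cm_def using b0R by simp
  then obtain c n where c: "c \<in> J \<rightarrow> carrier R" "n \<in> Epa" "b0 = (\<Oplus>i\<in>J. c i \<otimes> b i) \<oplus> n"
   using span by blast
  obtain v where v: "v \<in> carrier R" "n = a \<otimes> v" using c(2) unfolding E_pa_iff by blast
  define s where "s = (\<Oplus>i\<in>J. c i \<otimes> b i)"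
  have sR: "s \<in> carrier R" unfolding s_def using c bR by (auto intro!: finsum_closed)
  let ?\<rho> = "\<lambda>j. \<gamma> (max j n0) \<ominus> \<gamma> n0"
  have sh: "(\<lambda>j. \<gamma> (max j n0)) \<in> coh" "mk (\<lambda>j. \<gamma> (max j n0)) = mk \<gamma>" by (rule coh_shift[OF \<gamma>(1)]; simp)+
  have \<rho>: "?\<rho> \<in> coh" "f \<ominus>\<^bsub>C\<^esub> io (\<gamma> n0) = mk ?\<rho>"
   using mk_minus[OF sh(1) coh_const[OF \<gamma>R[of n0]]] unfolding sh(2) \<gamma>(2) io_def by auto
  have "t \<otimes> ?\<rho> j \<in> Epa" for j
   using t_dvd[OF coh_diff[OF \<gamma>(1), of n0 "max j n0"]] unfolding E_pa_iff by simp
  then obtain d where d: "d \<in> carrier C" "io t \<otimes>\<^bsub>C\<^esub> (f \<ominus>\<^bsub>C\<^esub> io (\<gamma> n0)) = io a \<otimes>\<^bsub>C\<^esub> d"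
   using division[OF \<rho>(1) t_R] unfolding \<rho>(2) by blast
  have "f \<otimes>\<^bsub>C\<^esub> io q \<in> ECpa" using EC_cm_mult[OF f] io_mm[OF qR] t' by blast
  then obtain e where e: "e \<in> carrier C" "f \<otimes>\<^bsub>C\<^esub> io q = io a \<otimes>\<^bsub>C\<^esub> e" unfolding EC_pa_iff by blast
  have io_t': "io t \<otimes>\<^bsub>C\<^esub> io t' = \<one>\<^bsub>C\<^esub> \<oplus>\<^bsub>C\<^esub> io q"
   using t' t_R qR by (metis io.hom_mult io.hom_add io.hom_one one_closed)
  have io_b0: "io t \<otimes>\<^bsub>C\<^esub> io (\<gamma> n0) = io s \<oplus>\<^bsub>C\<^esub> io a \<otimes>\<^bsub>C\<^esub> io v"
   using c(3) v t_R \<gamma>R sR a_R unfolding b0_def s_def[symmetric] by (metis io.hom_mult io.hom_add m_closed)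
  have ioC: "io t \<in> carrier C" "io t' \<in> carrier C" "io q \<in> carrier C" "io (\<gamma> n0) \<in> carrier C"
   "io s \<in> carrier C" "io a \<in> carrier C" "io v \<in> carrier C"
   using t_R t' qR \<gamma>R sR a_R v by auto
  \<comment> \<open>The factor t is undone by t' up to q in P, and f q is divisible by a because f
    lies in the completed socle.\<close>
  have "f = (io t \<otimes>\<^bsub>C\<^esub> io t') \<otimes>\<^bsub>C\<^esub> f \<ominus>\<^bsub>C\<^esub> f \<otimes>\<^bsub>C\<^esub> io q"
   unfolding io_t' using fC ioC(3) by algebra
  also have "\<dots> = io t' \<otimes>\<^bsub>C\<^esub> (io t \<otimes>\<^bsub>C\<^esub> (f \<ominus>\<^bsub>C\<^esub> io (\<gamma> n0)) \<oplus>\<^bsub>C\<^esub> io t \<otimes>\<^bsub>C\<^esub> io (\<gamma> n0)) \<ominus>\<^bsub>C\<^esub> f \<otimes>\<^bsub>C\<^esub> io q"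
   using fC ioC by algebra
  also have "\<dots> = io t' \<otimes>\<^bsub>C\<^esub> (io a \<otimes>\<^bsub>C\<^esub> d \<oplus>\<^bsub>C\<^esub> (io s \<oplus>\<^bsub>C\<^esub> io a \<otimes>\<^bsub>C\<^esub> io v)) \<ominus>\<^bsub>C\<^esub> io a \<otimes>\<^bsub>C\<^esub> e"
   unfolding d(2) e(2) io_b0 ..
  also have "\<dots> = io t' \<otimes>\<^bsub>C\<^esub> io s \<oplus>\<^bsub>C\<^esub> io a \<otimes>\<^bsub>C\<^esub> (io t' \<otimes>\<^bsub>C\<^esub> d \<oplus>\<^bsub>C\<^esub> io t' \<otimes>\<^bsub>C\<^esub> io v \<ominus>\<^bsub>C\<^esub> e)"
   using ioC d(1) e(1) by algebra
  also have "io t' \<otimes>\<^bsub>C\<^esub> io s = (\<Oplus>\<^bsub>C\<^esub>i\<in>J. io t' \<otimes>\<^bsub>C\<^esub> (io (c i) \<otimes>\<^bsub>C\<^esub> io (b i)))"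
   unfolding s_def io_sum[OF c(1)] by (rule C.finsum_rdistr) (use fin ioC c bR in \<open>auto simp: Pi_iff\<close>)
  also have "\<dots> = (\<Oplus>\<^bsub>C\<^esub>i\<in>J. (io t' \<otimes>\<^bsub>C\<^esub> io (c i)) \<otimes>\<^bsub>C\<^esub> io (b i))"
   by (rule C.finsum_cong') (use ioC c bR in \<open>auto simp: Pi_iff C.m_assoc\<close>)
  finally have "f = (\<Oplus>\<^bsub>C\<^esub>i\<in>J. (io t' \<otimes>\<^bsub>C\<^esub> io (c i)) \<otimes>\<^bsub>C\<^esub> io (b i)) \<oplus>\<^bsub>C\<^esub>
    io a \<otimes>\<^bsub>C\<^esub> (io t' \<otimes>\<^bsub>C\<^esub> d \<oplus>\<^bsub>C\<^esub> io t' \<otimes>\<^bsub>C\<^esub> io v \<ominus>\<^bsub>C\<^esub> e)" .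
  moreover have "io a \<otimes>\<^bsub>C\<^esub> (io t' \<otimes>\<^bsub>C\<^esub> d \<oplus>\<^bsub>C\<^esub> io t' \<otimes>\<^bsub>C\<^esub> io v \<ominus>\<^bsub>C\<^esub> e) \<in> ECpa"
   unfolding EC_pa_iff using ioC d(1) e(1) by blast
  moreover have "(\<lambda>i. io t' \<otimes>\<^bsub>C\<^esub> io (c i)) \<in> J \<rightarrow> carrier C" using ioC c by (auto simp: Pi_iff)
  ultimately show "\<exists>c\<in>J \<rightarrow> carrier C. \<exists>n\<in>ECpa. f = (\<Oplus>\<^bsub>C\<^esub>i\<in>J. c i \<otimes>\<^bsub>C\<^esub> io (b i)) \<oplus>\<^bsub>C\<^esub> n"
   by - (rule bexI[rotated], assumption, rule bexI[rotated], assumption+)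
 next
  fix c i assume c: "c \<in> J \<rightarrow> carrier C" "(\<Oplus>\<^bsub>C\<^esub>i\<in>J. c i \<otimes>\<^bsub>C\<^esub> io (b i)) \<in> ECpa" and i: "i \<in> J"
  have "\<exists>x. x \<in> coh \<and> c j = mk x" if "j \<in> J" for j using c(1) that C_cases[of "c j"] by blast
  then obtain \<gamma> where \<gamma>: "\<And>j. j \<in> J ==> \<gamma> j \<in> coh \<and> c j = mk (\<gamma> j)" by metis
  \<comment> \<open>The component at level 1 determines a coefficient modulo the maximal ideal. As
    the b j are in the socle, replacing coefficients by these components changes the sum by a
    multiple of a.\<close>
  define s where "s j = \<gamma> j 1" for j
  have sR: "s j \<in> carrier R" if "j \<in> J" for j unfolding s_def using \<gamma>[OF that] coh_R by blast
  have cC: "c j \<in> carrier C" "io (s j) \<in> carrier C" "io (b j) \<in> carrier C" if "j \<in> J" for j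
   using c(1) sR bR that by auto
  have diff: "(c j \<ominus>\<^bsub>C\<^esub> io (s j)) \<otimes>\<^bsub>C\<^esub> io (b j) \<in> ECpa" if "j \<in> J" for j
  proof -
   have m: "(\<lambda>n. \<gamma> j n \<ominus> s j) \<in> coh" "c j \<ominus>\<^bsub>C\<^esub> io (s j) = mk (\<lambda>n. \<gamma> j n \<ominus> s j)"
    using mk_minus[of "\<gamma> j" "\<lambda>_. s j"] \<gamma>[OF that] coh_const[OF sR[OF that]] unfolding io_def by auto
   have "\<gamma> j 1 \<ominus> s j = \<zero>" using sR[OF that] unfolding s_def by algebra
   then have "c j \<ominus>\<^bsub>C\<^esub> io (s j) \<in> mm" unfolding m(2) using mk_mm_iff[OF m(1)] by simp
   then have "io (b j) \<otimes>\<^bsub>C\<^esub> (c j \<ominus>\<^bsub>C\<^esub> io (s j)) \<in> ECpa" using EC_cm_mult io_cm b that by blast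
   then show ?thesis using cC[OF that] by (metis C.m_comm C.minus_closed)
  qed
  define x where "x = (\<Oplus>j\<in>J. s j \<otimes> b j)"
  have xR: "x \<in> carrier R" unfolding x_def using sR bR by (auto intro!: finsum_closed)
  have xcm: "x \<in> Ecm" unfolding x_def using E_cm_finsum[OF fin] E_cm_smult sR b by (metis (no_types, lifting) Pi_mem)
  have io_x: "io x = (\<Oplus>\<^bsub>C\<^esub>j\<in>J. io (s j) \<otimes>\<^bsub>C\<^esub> io (b j))"
   unfolding x_def by (rule io_sum) (use sR in auto)
  have d: "(\<Oplus>\<^bsub>C\<^esub>j\<in>J. (c j \<ominus>\<^bsub>C\<^esub> io (s j)) \<otimes>\<^bsub>C\<^esub> io (b j)) \<in> ECpa" by (rule EC_pa_finsum[OF fin diff])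
  have "(\<Oplus>\<^bsub>C\<^esub>j\<in>J. c j \<otimes>\<^bsub>C\<^esub> io (b j)) =
    (\<Oplus>\<^bsub>C\<^esub>j\<in>J. io (s j) \<otimes>\<^bsub>C\<^esub> io (b j) \<oplus>\<^bsub>C\<^esub> (c j \<ominus>\<^bsub>C\<^esub> io (s j)) \<otimes>\<^bsub>C\<^esub> io (b j))"
  proof (rule C.finsum_cong')
   show "c j \<otimes>\<^bsub>C\<^esub> io (b j) = io (s j) \<otimes>\<^bsub>C\<^esub> io (b j) \<oplus>\<^bsub>C\<^esub> (c j \<ominus>\<^bsub>C\<^esub> io (s j)) \<otimes>\<^bsub>C\<^esub> io (b j)" if "j \<in> J" for j
    using cC[OF that] by algebra
  qed (use cC in auto)
  also have "\<dots> = io x \<oplus>\<^bsub>C\<^esub> (\<Oplus>\<^bsub>C\<^esub>j\<in>J. (c j \<ominus>\<^bsub>C\<^esub> io (s j)) \<otimes>\<^bsub>C\<^esub> io (b j))"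
   unfolding io_x by (rule C.finsum_addf) (use cC in auto)
  finally have eq: "(\<Oplus>\<^bsub>C\<^esub>j\<in>J. c j \<otimes>\<^bsub>C\<^esub> io (b j)) = io x \<oplus>\<^bsub>C\<^esub> (\<Oplus>\<^bsub>C\<^esub>j\<in>J. (c j \<ominus>\<^bsub>C\<^esub> io (s j)) \<otimes>\<^bsub>C\<^esub> io (b j))" .
  obtain d1 where d1: "d1 \<in> carrier C" "(\<Oplus>\<^bsub>C\<^esub>j\<in>J. c j \<otimes>\<^bsub>C\<^esub> io (b j)) = io a \<otimes>\<^bsub>C\<^esub> d1" using c(2) unfolding EC_pa_iff by blast
  obtain d2 where d2: "d2 \<in> carrier C" "(\<Oplus>\<^bsub>C\<^esub>j\<in>J. (c j \<ominus>\<^bsub>C\<^esub> io (s j)) \<otimes>\<^bsub>C\<^esub> io (b j)) = io a \<otimes>\<^bsub>C\<^esub> d2" using d unfolding EC_pa_iff by blast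
  have ioxa: "io x \<in> carrier C" "io a \<in> carrier C" using xR a_R by auto
  have "io x = (io x \<oplus>\<^bsub>C\<^esub> io a \<otimes>\<^bsub>C\<^esub> d2) \<ominus>\<^bsub>C\<^esub> io a \<otimes>\<^bsub>C\<^esub> d2" using ioxa d2(1) by algebra
  also have "\<dots> = io a \<otimes>\<^bsub>C\<^esub> d1 \<ominus>\<^bsub>C\<^esub> io a \<otimes>\<^bsub>C\<^esub> d2" using eq d1(2) d2(2) by simp
  also have "\<dots> = io a \<otimes>\<^bsub>C\<^esub> (d1 \<ominus>\<^bsub>C\<^esub> d2)" using ioxa d1(1) d2(1) by algebra
  finally obtain d3 where d3: "d3 \<in> carrier C" "io x = io a \<otimes>\<^bsub>C\<^esub> d3" using d1(1) d2(1) C.minus_closed by blast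
  obtain \<delta> where \<delta>: "\<delta> \<in> coh" "d3 = mk \<delta>" using C_cases[OF d3(1)] .
  have "mk (\<lambda>n. x) = mk (\<lambda>n. a \<otimes> \<delta> n)"
   using d3(2) unfolding \<delta>(2) io_def mk_mult[OF coh_const[OF a_R] \<delta>(1)] .
  then have "x \<ominus> a \<otimes> \<delta> n0 \<in> Pn n0"
   using mk_eq[OF coh_const[OF xR] coh_mult[OF coh_const[OF a_R] \<delta>(1)]] by blast
  then obtain u where u: "u \<in> carrier R" "t \<otimes> (x \<ominus> a \<otimes> \<delta> n0) = a \<otimes> u" using t_dvd by blast
  obtain w where w: "w \<in> carrier R" "x \<otimes> q = a \<otimes> w" using E_cm_mult[OF xcm t'(2)] unfolding E_pa_iff by blast
  note R = coh_R[OF \<delta>(1), of n0] t_R t'(1) qR xR a_R u(1) w(1)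
  have "x = (\<one> \<oplus> q) \<otimes> x \<ominus> x \<otimes> q" using R by algebra
  also have "\<dots> = t \<otimes> t' \<otimes> x \<ominus> x \<otimes> q" unfolding t'(3) ..
  also have "\<dots> = t' \<otimes> (t \<otimes> (x \<ominus> a \<otimes> \<delta> n0)) \<oplus> t' \<otimes> (t \<otimes> (a \<otimes> \<delta> n0)) \<ominus> x \<otimes> q" using R by algebra
  also have "\<dots> = a \<otimes> (t' \<otimes> u \<oplus> t' \<otimes> t \<otimes> \<delta> n0 \<ominus> w)" unfolding u(2) w(2) using R by algebra
  finally have "x \<in> Epa" unfolding E_pa_iff using R by blast
  then have "s i \<in> P" using ind[of s] sR i unfolding x_def by blast
  then show "c i \<in> mm" using \<gamma>[OF i] mk_mm_iff unfolding s_def by auto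
 qed
qed

theorem local_type_completion:
 assumes "rbasis R (carrier R) P Ecm Epa J b"
 shows "local_type C = card J"
 using EC_residue_dim_Ext1[OF rbasis_completion[OF assms]]
 unfolding local_type_def Let_def local_max_ideal_C .

text \<open>Take the least n for which some s outside P maps the n-th power of P into aR. It is
  positive since a is in P, and an element x of the preceding power with s x not in aR gives the
  socle element s x.\<close>

lemma socle_nontrivial: "\<exists>x\<in>Ecm. x \<notin> Epa"
proof -
 define T where "T n \<longleftrightarrow> (\<exists>s\<in>carrier R. s \<notin> P \<and> (\<forall>x\<in>Pn n. s \<otimes> x \<in> Epa))" for n
 have "T n0" unfolding T_def using t_R t_P t_dvd by (auto simp: E_pa_iff)
 then have L: "T (LEAST n. T n)" by (rule LeastI)
 have "\<not> T 0"
 proof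
  assume "T 0"
  then obtain s where s: "s \<in> carrier R" "s \<notin> P" "s \<otimes> \<one> \<in> Epa" unfolding T_def Pn_0 by blast
  then obtain y where "y \<in> carrier R" "s = a \<otimes> y" by (auto simp: E_pa_iff)
  then show False using s(2) I_r_closed[OF a_P] by simp
 qed
 then obtain m where m: "(LEAST n. T n) = Suc m" using L by (metis not0_implies_Suc)
 then have "\<not> T m" using not_less_Least[of m T] by simp
 obtain s where s: "s \<in> carrier R" "s \<notin> P" "\<forall>x\<in>Pn (Suc m). s \<otimes> x \<in> Epa" using L m unfolding T_def by auto
 then obtain x where x: "x \<in> Pn m" "s \<otimes> x \<notin> Epa" using \<open>\<not> T m\<close> unfolding T_def by blast
 have xR: "x \<in> carrier R" using x(1) Pn_closed(1) by blast
 have "s \<otimes> x \<otimes> y \<in> Epa" if y: "y \<in> P" for y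
 proof -
  have "x \<otimes> y \<in> Pn (Suc m)" unfolding Pn_Suc using ideal_prod.prod[OF x(1) y] .
  then show ?thesis using s xR P_R[OF y] by (simp add: m_assoc)
 qed
 then have "s \<otimes> x \<in> Ecm" unfolding E_cm_def using s xR by simp
 then show ?thesis using x(2) by blast
qed

end

text \<open>The ideal \<open>G\<close> of the elements killed by a power of \<open>P\<close> modulo \<open>a\<close>, locally at \<open>P\<close>, is the unit
 ideal, as an associated prime of \<open>R / G\<close> would contain \<open>a\<close>.\<close>

lemma (in completed) power_dvd_locally:
 assumes noeth: "noetherian_ring R" and a: "a \<in> carrier R"
  and max: "\<And>q. [|primeideal q R; a \<in> q; q \<noteq> P|] ==> \<not> q \<subseteq> P"
 shows "\<exists>t\<in>carrier R. t \<notin> P \<and> (\<exists>n. \<forall>x\<in>Pn n. \<exists>y\<in>carrier R. t \<otimes> x = a \<otimes> y)"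
proof -
 interpret N: noetherian_ring R by fact
 define pa where "pa = {a \<otimes> y | y. y \<in> carrier R}"
 have pa: "pa \<subseteq> carrier R" "\<And>x s. [|x \<in> pa; s \<in> carrier R|] ==> s \<otimes> x \<in> pa"
  "\<And>x y. [|x \<in> pa; y \<in> pa|] ==> x \<oplus> y \<in> pa" "\<zero> \<in> pa"
 proof -
  show "pa \<subseteq> carrier R" unfolding pa_def using a by auto
  have P: "pa = PIdl a" unfolding pa_def cgenideal_def by (rule Collect_cong) (metis a m_comm)
  interpret I: ideal "PIdl a" R using cgenideal_ideal[OF a] .
  show "s \<otimes> x \<in> pa" if "x \<in> pa" "s \<in> carrier R" for x s using that I.I_l_closed unfolding P by blast
  show "x \<oplus> y \<in> pa" if "x \<in> pa" "y \<in> pa" for x y using that I.a_closed unfolding P by blast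
  show "\<zero> \<in> pa" unfolding P by simp
 qed
 \<comment> \<open>t x times the n-th power of P lies in aR. The ideal \<open>G\<close> collects the
   x for which some t outside P and some n achieve this; the claim is that it contains 1.\<close>
 define good where "good t n x \<longleftrightarrow> (\<forall>y\<in>Pn n. t \<otimes> (x \<otimes> y) \<in> pa)" for t n x
 define G where "G = {x \<in> carrier R. \<exists>t\<in>carrier R. t \<notin> P \<and> (\<exists>n. good t n x)}"
 have good_mono: "good (s \<otimes> t) n' x"
  if g: "good t n x" and st: "s \<in> carrier R" "t \<in> carrier R" and x: "x \<in> carrier R" and n: "n \<le> n'" for s t n n' x
  unfolding good_def
 proof
  fix y assume y: "y \<in> Pn n'"
  then have "y \<in> Pn n" using Pn_mono[OF n] by blast
  then have "s \<otimes> (t \<otimes> (x \<otimes> y)) \<in> pa" using g pa(2) st unfolding good_def by blast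
  then show "s \<otimes> t \<otimes> (x \<otimes> y) \<in> pa" using st x Pn_closed(1)[OF y] by (simp add: m_assoc)
 qed
 have prime: "s \<otimes> t \<notin> P" if "s \<in> carrier R" "t \<in> carrier R" "s \<notin> P" "t \<notin> P" for s t
  using primeideal.I_prime[OF maximalideal_prime[OF maximalideal_axioms]] that by blast
 have good_add: "good t n (x \<oplus> y)" if "good t n x" "good t n y" "x \<in> carrier R" "y \<in> carrier R" "t \<in> carrier R" for t n x y
  unfolding good_def
 proof
  fix z assume z: "z \<in> Pn n"
  have "t \<otimes> ((x \<oplus> y) \<otimes> z) = t \<otimes> (x \<otimes> z) \<oplus> t \<otimes> (y \<otimes> z)"
   using that(3,4,5) Pn_closed(1)[OF z] by algebra
  then show "t \<otimes> ((x \<oplus> y) \<otimes> z) \<in> pa" using that(1,2) z pa(3) unfolding good_def by simp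
 qed
 have good_mult: "good t n (r \<otimes> x)" if "good t n x" "x \<in> carrier R" "r \<in> carrier R" "t \<in> carrier R" for t n x r
  unfolding good_def
 proof
  fix z assume z: "z \<in> Pn n"
  have "t \<otimes> ((r \<otimes> x) \<otimes> z) = r \<otimes> (t \<otimes> (x \<otimes> z))"
   using that(2,3,4) Pn_closed(1)[OF z] by algebra
  then show "t \<otimes> ((r \<otimes> x) \<otimes> z) \<in> pa" using that(1,3) z pa(2) unfolding good_def by simp
 qed
 have G_add: "x \<oplus> y \<in> G" if xy: "x \<in> G" "y \<in> G" for x y
 proof -
  obtain t n where t: "t \<in> carrier R" "t \<notin> P" "good t n x" "x \<in> carrier R" using xy(1) unfolding G_def by blast
  obtain s m where s: "s \<in> carrier R" "s \<notin> P" "good s m y" "y \<in> carrier R" using xy(2) unfolding G_def by blast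
  have "good (s \<otimes> t) (max n m) x" using good_mono[OF t(3) s(1) t(1) t(4)] by simp
  moreover have "good (s \<otimes> t) (max n m) y" using good_mono[OF s(3) t(1) s(1) s(4), of "max n m"] s t by (simp add: m_comm)
  ultimately have "good (s \<otimes> t) (max n m) (x \<oplus> y)" using good_add s t by simp
  then show ?thesis unfolding G_def using s t prime[of s t] by blast
 qed
 have G_mult: "r \<otimes> x \<in> G" if "x \<in> G" "r \<in> carrier R" for x r
  using that good_mult unfolding G_def by blast
 have "\<one> \<notin> P" using one_imp_carrier I_notcarr by blast
 have aG: "a \<otimes> x \<in> G" if "x \<in> carrier R" for x
 proof -
  have "good \<one> 0 (a \<otimes> x)" unfolding good_def Pn_0 pa_def using a that by (auto simp: m_assoc)
  then show ?thesis unfolding G_def using a that \<open>\<one> \<notin> P\<close> by blast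
 qed
 have GR: "G \<subseteq> carrier R" unfolding G_def by blast
 have zG: "\<zero> \<in> G" using aG[of \<zero>] a by simp
 have one: "\<one> \<in> G"
 proof (rule ccontr)
  assume nG: "\<one> \<notin> G"
  define col where "col x = {y \<in> carrier R. x \<otimes> y \<in> G}" for x
  have col_ideal: "ideal (col x) R" if x: "x \<in> carrier R" for x
  proof (rule idealI[OF ring_axioms])
   have inv: "\<ominus> y \<in> col x" if "y \<in> col x" for y
   proof -
    have y: "y \<in> carrier R" "x \<otimes> y \<in> G" using that unfolding col_def by auto
    have "x \<otimes> (\<ominus> y) = \<ominus> \<one> \<otimes> (x \<otimes> y)" using x y(1) by algebra
    then show ?thesis using G_mult[OF y(2), of "\<ominus> \<one>"] y(1) unfolding col_def by simp
   qed
   have "\<zero> \<in> col x" unfolding col_def using zG x by simp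
   moreover have "u \<oplus> v \<in> col x" if "u \<in> col x" "v \<in> col x" for u v
    using that G_add x unfolding col_def by (simp add: r_distr)
   ultimately show "subgroup (col x) (add_monoid R)"
    by (intro add.subgroupI) (use inv in \<open>auto simp: col_def a_inv_def\<close>)
   fix u v assume u: "u \<in> col x" and v: "v \<in> carrier R"
   have "x \<otimes> (v \<otimes> u) = v \<otimes> (x \<otimes> u)" using u v x unfolding col_def by (simp add: m_lcomm)
   then show "v \<otimes> u \<in> col x" using u v G_mult unfolding col_def by simp
   then show "u \<otimes> v \<in> col x" using u v unfolding col_def by (simp add: m_comm)
  qed
  \<comment> \<open>By the chain condition there is a maximal member among the ideals (G : x) with x
    outside G.\<close>
  define F where "F = col ` (carrier R - G)"
  have "\<exists>M\<in>F. \<forall>I\<in>F. M \<subseteq> I --> I = M"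
  proof (rule subset_Zorn_nonempty)
   show "F \<noteq> {}" unfolding F_def using nG by blast
   fix Ch assume Ch: "Ch \<noteq> {}" "subset.chain F Ch"
   have "subset.chain {I. ideal I R} Ch" using Ch(2) col_ideal unfolding subset.chain_def F_def by blast
   then have "\<Union>Ch \<in> Ch" using N.ideal_chain_is_trivial Ch(1) by blast
   then show "\<Union>Ch \<in> F" using Ch(2) unfolding subset.chain_def by blast
  qed
  then obtain x where x: "x \<in> carrier R" "x \<notin> G"
   and xmax: "\<And>y. [|y \<in> carrier R; y \<notin> G; col x \<subseteq> col y|] ==> col y = col x"
   unfolding F_def by blast
  \<comment> \<open>The usual argument for associated primes: if u is not in (G : x), then x u is
    not in G, and (G : x u) contains (G : x), so by maximality the two agree.\<close>
  have prime_q: "primeideal (col x) R"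
  proof (rule primeidealI[OF col_ideal[OF x(1)] is_cring])
   have "\<one> \<notin> col x" unfolding col_def using x by simp
   then show "carrier R \<noteq> col x" by auto
   fix u v assume uv: "u \<in> carrier R" "v \<in> carrier R" "u \<otimes> v \<in> col x"
   show "u \<in> col x \<or> v \<in> col x"
   proof (rule ccontr)
    assume n: "\<not> (u \<in> col x \<or> v \<in> col x)"
    then have xu: "x \<otimes> u \<in> carrier R" "x \<otimes> u \<notin> G" using uv x unfolding col_def by auto
    have "col x \<subseteq> col (x \<otimes> u)"
    proof
     fix w assume w: "w \<in> col x"
     then have "x \<otimes> u \<otimes> w = u \<otimes> (x \<otimes> w)" using x uv unfolding col_def by (simp add: m_ac)
     then show "w \<in> col (x \<otimes> u)" using w G_mult uv unfolding col_def by simp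
    qed
    then have "col (x \<otimes> u) = col x" using xmax[OF xu] by blast
    moreover have "v \<in> col (x \<otimes> u)" using uv x unfolding col_def by (simp add: m_assoc)
    ultimately show False using n by blast
   qed
  qed
  have aq: "a \<in> col x" using aG[OF x(1)] a x(1) unfolding col_def by (simp add: m_comm)
  show False
  proof (cases "col x = P")
   \<comment> \<open>By hypothesis the prime (G : x) is not contained in P. An s in it outside P can
     be moved into the multiplier, which puts x itself into G.\<close>
   case False
   then obtain s where s: "s \<in> col x" "s \<notin> P" using max[OF prime_q aq] by blast
   then have sR: "s \<in> carrier R" and "x \<otimes> s \<in> G" unfolding col_def by auto
   then obtain t n where t: "t \<in> carrier R" "t \<notin> P" "good t n (x \<otimes> s)" unfolding G_def by blast
   have "good (t \<otimes> s) n x" unfolding good_def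
   proof
    fix y assume y: "y \<in> Pn n"
    have "t \<otimes> s \<otimes> (x \<otimes> y) = t \<otimes> (x \<otimes> s \<otimes> y)" using t(1) sR x(1) Pn_closed(1)[OF y] by algebra
    then show "t \<otimes> s \<otimes> (x \<otimes> y) \<in> pa" using t(3) y unfolding good_def by simp
   qed
   then show False using x t sR s(2) prime[of t s] unfolding G_def by blast
  next
   \<comment> \<open>Now P x lies in G. As P is finitely generated, one multiplier t and one
     exponent n serve all of P, so t x is good for the exponent n + 1, and x is in G after
     all.\<close>
   case True
   obtain A where A: "A \<subseteq> carrier R" "finite A" "P = Idl A" using N.finetely_gen[OF is_ideal] by blast
   have AP: "A \<subseteq> P" using A genideal_self by blast
   have "\<exists>t\<in>carrier R. t \<notin> P \<and> (\<exists>n. \<forall>p\<in>B. good t n (x \<otimes> p))" if "B \<subseteq> A" for B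
    using finite_subset[OF that A(2)] that
   proof (induction B)
    case empty then show ?case using \<open>\<one> \<notin> P\<close> by blast
   next
    case (insert p B)
    then obtain t n where t: "t \<in> carrier R" "t \<notin> P" "\<forall>p\<in>B. good t n (x \<otimes> p)" by blast
    have BR: "b \<in> carrier R" if "b \<in> insert p B" for b using insert.prems A(1) that by blast
    have "x \<otimes> p \<in> G" using insert.prems AP True unfolding col_def by blast
    then obtain s m where s: "s \<in> carrier R" "s \<notin> P" "good s m (x \<otimes> p)" unfolding G_def by blast
    have "good (s \<otimes> t) (max n m) (x \<otimes> p)"
     using good_mono[OF s(3) t(1) s(1), of "max n m"] s t x(1) BR by (simp add: m_comm)
    moreover have "good (s \<otimes> t) (max n m) (x \<otimes> b)" if "b \<in> B" for b
     using good_mono[of t n "x \<otimes> b" s "max n m"] s t x(1) BR that by simp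
    ultimately show ?case using s(1) t(1) prime[OF s(1) t(1) s(2) t(2)] by (intro bexI[of _ "s \<otimes> t"]) auto
   qed
   then obtain t n where t: "t \<in> carrier R" "t \<notin> P" "\<And>p. p \<in> A ==> good t n (x \<otimes> p)" by blast
   define D where "D = {p \<in> carrier R. good t n (x \<otimes> p)}"
   have "ideal D R"
   proof (rule idealI[OF ring_axioms])
    have mult: "r \<otimes> p \<in> D" if "p \<in> D" "r \<in> carrier R" for p r
    proof -
     have p: "p \<in> carrier R" "good t n (x \<otimes> p)" using that unfolding D_def by auto
     have "x \<otimes> (r \<otimes> p) = r \<otimes> (x \<otimes> p)" using p x that by (simp add: m_lcomm)
     then show ?thesis using good_mult[OF p(2)] p x t that unfolding D_def by simp
    qed
    have "good t n (x \<otimes> \<zero>)" unfolding good_def using x t Pn_closed(1) pa(4) by simp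
    then have "\<zero> \<in> D" unfolding D_def by simp
    moreover have "u \<oplus> v \<in> D" if "u \<in> D" "v \<in> D" for u v
     using that good_add x t unfolding D_def by (simp add: r_distr)
    moreover have "\<ominus> u \<in> D" if "u \<in> D" for u
     using mult[OF that, of "\<ominus> \<one>"] that unfolding D_def by (simp add: l_minus)
    ultimately show "subgroup D (add_monoid R)"
     by (intro add.subgroupI) (auto simp: D_def a_inv_def)
    show "v \<otimes> u \<in> D" if "u \<in> D" "v \<in> carrier R" for u v using mult that .
    then show "u \<otimes> v \<in> D" if "u \<in> D" "v \<in> carrier R" for u v
     using that unfolding D_def by (metis (no_types, lifting) m_comm mem_Collect_eq)
   qed
   moreover have "A \<subseteq> D" unfolding D_def using t A by blast
   ultimately have PD: "P \<subseteq> D" unfolding A(3) by (rule genideal_minimal)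
   have "t \<otimes> (x \<otimes> z) \<in> pa" if "z \<in> ideal_prod R (Pn n) P" for z
    using that
   proof (induction rule: ideal_prod.induct)
    case (prod i j)
    then have "t \<otimes> (x \<otimes> j \<otimes> i) \<in> pa" using PD unfolding D_def good_def by blast
    then show ?case using prod x t Pn_closed(1) P_R by (simp add: m_ac)
   next
    case (sum z1 z2)
    have "z1 \<in> carrier R" "z2 \<in> carrier R" using sum(1,2) ideal_prod_in_carrier[OF Pn_ideal is_ideal] by auto
    then have "t \<otimes> (x \<otimes> (z1 \<oplus> z2)) = t \<otimes> (x \<otimes> z1) \<oplus> t \<otimes> (x \<otimes> z2)" using x(1) t(1) by algebra
    then show ?case using sum pa(3) by simp
   qed
   then have "good t (Suc n) x" unfolding good_def Pn_Suc by blast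
   then show False using x t unfolding G_def by blast
  qed
 qed
 then obtain t n where t: "t \<in> carrier R" "t \<notin> P" "good t n \<one>" unfolding G_def by blast
 have "\<exists>y\<in>carrier R. t \<otimes> x = a \<otimes> y" if x: "x \<in> Pn n" for x
 proof -
  have "t \<otimes> (\<one> \<otimes> x) \<in> pa" using t(3) x unfolding good_def by blast
  then show ?thesis using Pn_closed(1)[OF x] unfolding pa_def by auto
 qed
 then show ?thesis using t by blast
qed

section \<open>Submodules of a ring\<close>

context cring
begin

text \<open>Modules over Z, over Q, over orders and over the maximal order are all subsets of K with
  the same operations; a predicate with the scalars as a parameter makes it easy to change
  them.\<close>

definition smod where
 "smod A M \<longleftrightarrow> M \<subseteq> carrier R \<and> \<zero> \<in> M \<and> (\<forall>x\<in>M. \<forall>y\<in>M. x \<oplus> y \<in> M) \<and> (\<forall>a\<in>A. \<forall>x\<in>M. a \<otimes> x \<in> M)"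

lemma smodI:
 "[|M \<subseteq> carrier R; \<zero> \<in> M; \<And>x y. [|x \<in> M; y \<in> M|] ==> x \<oplus> y \<in> M; \<And>a x. [|a \<in> A; x \<in> M|] ==> a \<otimes> x \<in> M|] ==> smod A M"
 unfolding smod_def by blast

lemma smodD:
 assumes "smod A M"
 shows "x \<in> M ==> x \<in> carrier R" "\<zero> \<in> M" "[|x \<in> M; y \<in> M|] ==> x \<oplus> y \<in> M" "[|a \<in> A; x \<in> M|] ==> a \<otimes> x \<in> M"
 using assms unfolding smod_def by blast+

lemma smod_minus:
 assumes "smod A M" "subring A R"
 shows "x \<in> M ==> \<ominus> x \<in> M" "[|x \<in> M; y \<in> M|] ==> x \<ominus> y \<in> M"
proof -
 have 1: "\<ominus> x \<in> M" if x: "x \<in> M" for x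
 proof -
  have "\<ominus> \<one> \<in> A" using subringE(3,5)[OF assms(2)] by blast
  then have "\<ominus> \<one> \<otimes> x \<in> M" using smodD(4)[OF assms(1) _ x] by blast
  then show ?thesis using smodD(1)[OF assms(1) x] by (simp add: l_minus)
 qed
 then show "x \<in> M ==> \<ominus> x \<in> M" .
 show "[|x \<in> M; y \<in> M|] ==> x \<ominus> y \<in> M" using 1 smodD(3)[OF assms(1)] by (simp add: a_minus_def)
qed

lemma smod_mono: "smod B M ==> A \<subseteq> B ==> smod A M"
 unfolding smod_def by blast

lemma smod_Int: "smod A M ==> smod A N ==> smod A (M \<inter> N)"
 unfolding smod_def by blast

lemma smod_self: "subring A R ==> smod A A"
proof -
 assume A: "subring A R"
 show ?thesis by (rule smodI) (use subringE(1,2,6,7)[OF A] in auto)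
qed

lemma smod_carrier: "subring A R ==> smod A (carrier R)"
proof -
 assume A: "subring A R"
 show ?thesis by (rule smodI) (use subringE(1)[OF A] in auto)
qed

definition lsum where "lsum J c b = (\<Oplus>i\<in>J. c i \<otimes> b i)"

lemma lsum_closed: "[|\<And>i. i \<in> J ==> c i \<in> carrier R; \<And>i. i \<in> J ==> b i \<in> carrier R|] ==> lsum J c b \<in> carrier R"
 unfolding lsum_def by (rule finsum_closed) auto

lemma lsum_cong: "[|\<And>i. i \<in> J ==> c i \<in> carrier R; \<And>i. i \<in> J ==> b i \<in> carrier R;
  \<And>i. i \<in> J ==> c i \<otimes> b i = c' i \<otimes> b' i|] ==> lsum J c b = lsum J c' b'"
 unfolding lsum_def
proof (rule finsum_cong'[OF refl])
 assume a: "\<And>i. i \<in> J ==> c i \<in> carrier R" "\<And>i. i \<in> J ==> b i \<in> carrier R"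
  "\<And>i. i \<in> J ==> c i \<otimes> b i = c' i \<otimes> b' i"
 show "(\<lambda>i. c' i \<otimes> b' i) \<in> J \<rightarrow> carrier R"
 proof
  fix i assume i: "i \<in> J"
  have "c i \<otimes> b i \<in> carrier R" using a(1)[OF i] a(2)[OF i] by simp
  then show "c' i \<otimes> b' i \<in> carrier R" using a(3)[OF i] by simp
 qed
qed

lemma lsum_empty: "lsum {} c b = \<zero>" by (simp add: lsum_def)

lemma lsum_insert: "[|finite J; j \<notin> J; \<And>i. i \<in> insert j J ==> c i \<in> carrier R; \<And>i. i \<in> insert j J ==> b i \<in> carrier R|]
  ==> lsum (insert j J) c b = c j \<otimes> b j \<oplus> lsum J c b"
 unfolding lsum_def by (rule finsum_insert) auto

lemma lsum_remove: "[|finite J; j \<in> J; \<And>i. i \<in> J ==> c i \<in> carrier R; \<And>i. i \<in> J ==> b i \<in> carrier R|]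
  ==> lsum J c b = c j \<otimes> b j \<oplus> lsum (J - {j}) c b"
 using lsum_insert[of "J - {j}" j c b] by (simp add: insert_absorb)

lemma lsum_mem:
 assumes M: "smod A M" and J: "finite J" "\<And>i. i \<in> J ==> c i \<in> A" "\<And>i. i \<in> J ==> b i \<in> M" and A: "A \<subseteq> carrier R"
 shows "lsum J c b \<in> M"
 using J
proof (induction J rule: finite_induct)
 case empty then show ?case using smodD(2)[OF M] by (simp add: lsum_empty)
next
 case (insert j J)
 have "lsum (insert j J) c b = c j \<otimes> b j \<oplus> lsum J c b"
  by (rule lsum_insert) (use insert A smodD(1)[OF M] in auto)
 then show ?case using insert smodD(3,4)[OF M] by auto
qed

lemma lsum_add: "[|\<And>i. i \<in> J ==> c i \<in> carrier R; \<And>i. i \<in> J ==> c' i \<in> carrier R; \<And>i. i \<in> J ==> b i \<in> carrier R|]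
  ==> lsum J c b \<oplus> lsum J c' b = lsum J (\<lambda>i. c i \<oplus> c' i) b"
proof -
 assume a: "\<And>i. i \<in> J ==> c i \<in> carrier R" "\<And>i. i \<in> J ==> c' i \<in> carrier R" "\<And>i. i \<in> J ==> b i \<in> carrier R"
 have "lsum J (\<lambda>i. c i \<oplus> c' i) b = (\<Oplus>i\<in>J. c i \<otimes> b i \<oplus> c' i \<otimes> b i)"
  unfolding lsum_def by (rule finsum_cong') (use a in \<open>auto simp: l_distr\<close>)
 also have "\<dots> = lsum J c b \<oplus> lsum J c' b" unfolding lsum_def by (rule finsum_addf) (use a in auto)
 finally show ?thesis by simp
qed

lemma lsum_smult: "[|finite J; a \<in> carrier R; \<And>i. i \<in> J ==> c i \<in> carrier R; \<And>i. i \<in> J ==> b i \<in> carrier R|]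
  ==> a \<otimes> lsum J c b = lsum J (\<lambda>i. a \<otimes> c i) b"
proof -
 assume a: "finite J" "a \<in> carrier R" "\<And>i. i \<in> J ==> c i \<in> carrier R" "\<And>i. i \<in> J ==> b i \<in> carrier R"
 have "a \<otimes> lsum J c b = (\<Oplus>i\<in>J. a \<otimes> (c i \<otimes> b i))"
  unfolding lsum_def by (rule finsum_rdistr) (use a in auto)
 also have "\<dots> = lsum J (\<lambda>i. a \<otimes> c i) b"
  unfolding lsum_def by (rule finsum_cong') (use a in \<open>auto simp: m_assoc\<close>)
 finally show ?thesis .
qed

lemma lsum_smult_vec: "[|finite J; a \<in> carrier R; \<And>i. i \<in> J ==> c i \<in> carrier R; \<And>i. i \<in> J ==> b i \<in> carrier R|]
  ==> a \<otimes> lsum J c b = lsum J c (\<lambda>i. a \<otimes> b i)"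
 by (subst lsum_smult) (auto intro!: lsum_cong simp: m_ac)

lemma finsum_swap:
 assumes "finite I" "finite J" "\<And>i j. [|i \<in> I; j \<in> J|] ==> f i j \<in> carrier R"
 shows "(\<Oplus>i\<in>I. \<Oplus>j\<in>J. f i j) = (\<Oplus>j\<in>J. \<Oplus>i\<in>I. f i j)"
 using assms(1,3)
proof (induction I rule: finite_induct)
 case empty
 then show ?case by simp
next
 case (insert i I)
 have c1: "(\<Oplus>j\<in>J. f k j) \<in> carrier R" if "k \<in> insert i I" for k
  using insert.prems that by (intro finsum_closed) auto
 have c2: "(\<Oplus>i\<in>I. f i j) \<in> carrier R" if "j \<in> J" for j
  using insert.prems that by (intro finsum_closed) auto
 have "(\<Oplus>k\<in>insert i I. \<Oplus>j\<in>J. f k j) = (\<Oplus>j\<in>J. f i j) \<oplus> (\<Oplus>k\<in>I. \<Oplus>j\<in>J. f k j)"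
  by (rule finsum_insert) (use insert c1 in auto)
 also have "\<dots> = (\<Oplus>j\<in>J. f i j) \<oplus> (\<Oplus>j\<in>J. \<Oplus>k\<in>I. f k j)" using insert by simp
 also have "\<dots> = (\<Oplus>j\<in>J. f i j \<oplus> (\<Oplus>k\<in>I. f k j))"
  by (rule finsum_addf[symmetric]) (use insert c2 in auto)
 also have "\<dots> = (\<Oplus>j\<in>J. \<Oplus>k\<in>insert i I. f k j)"
 proof (rule finsum_cong')
  show "f i j \<oplus> (\<Oplus>k\<in>I. f k j) = (\<Oplus>k\<in>insert i I. f k j)" if "j \<in> J" for j
   by (rule finsum_insert[symmetric]) (use insert that in auto)
  show "(\<lambda>j. \<Oplus>k\<in>insert i I. f k j) \<in> J \<rightarrow> carrier R"
   using insert.prems by (auto intro!: finsum_closed)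
 qed simp
 finally show ?case .
qed

subsection \<open>Finitely generated submodules\<close>

definition spn where "spn A B = \<Inter>{M. smod A M \<and> B \<subseteq> M}"

lemma spn_superset: "B \<subseteq> spn A B" unfolding spn_def by blast

lemma spn_least: "smod A M ==> B \<subseteq> M ==> spn A B \<subseteq> M" unfolding spn_def by blast

lemma spn_smod:
 assumes "subring A R" "B \<subseteq> carrier R"
 shows "smod A (spn A B)"
proof (rule smodI)
 show "spn A B \<subseteq> carrier R" by (rule spn_least[OF smod_carrier[OF assms(1)] assms(2)])
qed (auto simp: spn_def smod_def)

lemma spn_mono: "[|subring A R; C \<subseteq> carrier R; B \<subseteq> spn A C|] ==> spn A B \<subseteq> spn A C"
 by (rule spn_least[OF spn_smod])

lemma smod_line:
 assumes A: "subring A R" and M: "smod A M" and b: "b \<in> carrier R"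
 shows "smod A {c \<otimes> b \<oplus> x | c x. c \<in> A \<and> x \<in> M}"
proof (rule smodI)
 note AR = subringE(1)[OF A]
 let ?L = "{c \<otimes> b \<oplus> x | c x. c \<in> A \<and> x \<in> M}"
 show "?L \<subseteq> carrier R" using AR smodD(1)[OF M] b by auto
 have "\<zero> \<otimes> b \<oplus> \<zero> \<in> ?L" using subringE(2)[OF A] smodD(2)[OF M] by blast
 then show "\<zero> \<in> ?L" using b by simp
 show "u \<oplus> v \<in> ?L" if uv: "u \<in> ?L" "v \<in> ?L" for u v
 proof -
  obtain c x where u: "u = c \<otimes> b \<oplus> x" "c \<in> A" "x \<in> M" using uv(1) by blast
  obtain d y where v: "v = d \<otimes> b \<oplus> y" "d \<in> A" "y \<in> M" using uv(2) by blast
  have "u \<oplus> v = (c \<oplus> d) \<otimes> b \<oplus> (x \<oplus> y)"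
   unfolding u(1) v(1) using AR u(2) v(2) smodD(1)[OF M u(3)] smodD(1)[OF M v(3)] b by (auto simp: l_distr a_ac subset_iff)
  then show ?thesis using subringE(7)[OF A u(2) v(2)] smodD(3)[OF M u(3) v(3)] by blast
 qed
 show "a \<otimes> u \<in> ?L" if au: "a \<in> A" "u \<in> ?L" for a u
 proof -
  obtain c x where u: "u = c \<otimes> b \<oplus> x" "c \<in> A" "x \<in> M" using au(2) by blast
  have "a \<otimes> u = (a \<otimes> c) \<otimes> b \<oplus> a \<otimes> x"
   unfolding u(1) using AR u(2) au(1) smodD(1)[OF M u(3)] b by (auto simp: r_distr m_assoc subset_iff)
  then show ?thesis using subringE(6)[OF A au(1) u(2)] smodD(4)[OF M au(1) u(3)] by blast
 qed
qed

lemma spn_insert: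
 assumes A: "subring A R" and B: "B \<subseteq> carrier R" and b: "b \<in> carrier R"
 shows "spn A (insert b B) = {c \<otimes> b \<oplus> x | c x. c \<in> A \<and> x \<in> spn A B}" (is "_ = ?L")
proof
 note S = spn_smod[OF A B]
 show "spn A (insert b B) \<subseteq> ?L"
 proof (rule spn_least[OF smod_line[OF A S b]])
  have "\<one> \<otimes> b \<oplus> \<zero> \<in> ?L" using subringE(3)[OF A] smodD(2)[OF S] by blast
  moreover have "\<zero> \<otimes> b \<oplus> x \<in> ?L" if "x \<in> B" for x using subringE(2)[OF A] spn_superset that by blast
  ultimately show "insert b B \<subseteq> ?L" using b B by (auto simp: subset_iff)
 qed
 show "?L \<subseteq> spn A (insert b B)"
 proof -
  note T = spn_smod[OF A, of "insert b B"]
  have "spn A B \<subseteq> spn A (insert b B)" by (rule spn_mono[OF A]) (use B b spn_superset[of "insert b B" A] in auto)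
  moreover have "b \<in> spn A (insert b B)" using spn_superset by blast
  ultimately show ?thesis using T B b unfolding smod_def by blast
 qed
qed

lemma spn_empty: "subring A R ==> spn A {} = {\<zero>}"
proof
 assume A: "subring A R"
 have "smod A {\<zero>}" using subringE(1)[OF A] by (auto simp: smod_def)
 then show "spn A {} \<subseteq> {\<zero>}" by (rule spn_least) simp
 show "{\<zero>} \<subseteq> spn A {}" using smodD(2)[OF spn_smod[OF A]] by simp
qed

lemma spn_lsum:
 assumes A: "subring A R" and "finite B" "B \<subseteq> carrier R" "x \<in> spn A B"
 shows "\<exists>c. (\<forall>v\<in>B. c v \<in> A) \<and> x = lsum B c (\<lambda>v. v)"
 using assms(2-)
proof (induction B arbitrary: x rule: finite_induct)
 case empty then show ?case using spn_empty[OF A] by (simp add: lsum_empty)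
next
 case (insert b B)
 note AR = subringE(1)[OF A]
 obtain a y where ay: "a \<in> A" "y \<in> spn A B" "x = a \<otimes> b \<oplus> y" using spn_insert[OF A] insert.prems by auto
 obtain c where c: "\<forall>v\<in>B. c v \<in> A" "y = lsum B c (\<lambda>v. v)" using insert.IH insert.prems ay by blast
 let ?c = "c(b := a)"
 have "lsum (insert b B) ?c (\<lambda>v. v) = ?c b \<otimes> b \<oplus> lsum B ?c (\<lambda>v. v)"
  by (rule lsum_insert) (use insert ay c AR in auto)
 also have "lsum B ?c (\<lambda>v. v) = y" unfolding c(2) by (rule lsum_cong) (use insert c AR in auto)
 finally show ?case using ay c by (intro exI[of _ ?c]) auto
qed

definition fg where "fg A M \<longleftrightarrow> (\<exists>B. finite B \<and> B \<subseteq> carrier R \<and> M = spn A B)"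

lemma fg_smod: "subring A R ==> fg A M ==> smod A M"
 unfolding fg_def using spn_smod by blast

lemma Span_eq_spn:
 assumes A: "subring A R" and "set Us \<subseteq> carrier R"
 shows "Span A Us = spn A (set Us)"
 using assms(2)
proof (induction Us)
 case Nil then show ?case using spn_empty[OF A] by simp
next
 case (Cons u Us)
 have "Span A (u # Us) = line_extension A u (Span A Us)" by simp
 also have "\<dots> = line_extension A u (spn A (set Us))" using Cons by (simp del: Span.simps)
 also have "\<dots> = {c \<otimes> u \<oplus> x | c x. c \<in> A \<and> x \<in> spn A (set Us)}"
  (is "?l = ?r")
 proof (intro equalityI subsetI)
  fix y assume "y \<in> ?l"
  then have "\<exists>k\<in>A. \<exists>v\<in>spn A (set Us). y = k \<otimes> u \<oplus> v" unfolding line_extension_mem_iff .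
  then show "y \<in> ?r" by blast
 next
  fix y assume "y \<in> ?r"
  then show "y \<in> ?l" unfolding line_extension_mem_iff by blast
 qed
 also have "\<dots> = spn A (set (u # Us))" using spn_insert[OF A, of "set Us" u] Cons.prems by simp
 finally show ?case .
qed

lemma fg_submodule_iff: "subring A R ==> fg_submodule R A M \<longleftrightarrow> fg A M"
 unfolding fg_submodule_def fg_def using Span_eq_spn by (metis List.finite_set finite_list)

lemma fg_change: "[|subring A R; subring A' R; A \<subseteq> A'; smod A' M; fg A M|] ==> fg A' M"
proof -
 assume A: "subring A R" "subring A' R" "A \<subseteq> A'" "smod A' M" and f: "fg A M"
 obtain B where B: "finite B" "B \<subseteq> carrier R" "M = spn A B" using f unfolding fg_def by blast
 have "spn A' B \<subseteq> M" using spn_least[OF A(4)] spn_superset B by metis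
 moreover have "M \<subseteq> spn A' B" unfolding B(3)
  by (rule spn_least[OF smod_mono[OF spn_smod[OF A(2) B(2)] A(3)] spn_superset])
 ultimately show ?thesis using B unfolding fg_def by blast
qed

section \<open>Noetherian coefficient rings\<close>

definition noeth where "noeth A \<longleftrightarrow> (\<forall>I. smod A I \<and> I \<subseteq> A --> fg A I)"

text \<open>The ideal of the coefficients at b that occur in M modulo N. It reduces a submodule of
  the span of b and further generators to an ideal and a submodule of the span of the
  others.\<close>

lemma smod_coeffs:
 assumes A: "subring A R" and M: "smod A M" and N: "smod A N" and b: "b \<in> carrier R"
 shows "smod A {c \<in> A. \<exists>m\<in>M. \<exists>x\<in>N. m = c \<otimes> b \<oplus> x}" (is "smod A ?I")
proof (rule smodI)
 note AR = subringE(1)[OF A]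
 show "?I \<subseteq> carrier R" using AR by blast
 have "\<zero> = \<zero> \<otimes> b \<oplus> \<zero>" using b by simp
 then show "\<zero> \<in> ?I" using smodD(2)[OF M] smodD(2)[OF N] subringE(2)[OF A] by blast
 show "c \<oplus> d \<in> ?I" if cd: "c \<in> ?I" "d \<in> ?I" for c d
 proof -
  obtain m x where c: "c \<in> A" "m \<in> M" "x \<in> N" "m = c \<otimes> b \<oplus> x" using cd(1) by blast
  obtain n y where d: "d \<in> A" "n \<in> M" "y \<in> N" "n = d \<otimes> b \<oplus> y" using cd(2) by blast
  have "m \<oplus> n = (c \<oplus> d) \<otimes> b \<oplus> (x \<oplus> y)"
   unfolding c(4) d(4) using AR c(1) d(1) smodD(1)[OF N c(3)] smodD(1)[OF N d(3)] b by (auto simp: l_distr a_ac subset_iff)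
  then show ?thesis using smodD(3)[OF M c(2) d(2)] smodD(3)[OF N c(3) d(3)] subringE(7)[OF A c(1) d(1)] by blast
 qed
 show "a \<otimes> c \<in> ?I" if ac: "a \<in> A" "c \<in> ?I" for a c
 proof -
  obtain m x where c: "c \<in> A" "m \<in> M" "x \<in> N" "m = c \<otimes> b \<oplus> x" using ac(2) by blast
  have "a \<otimes> m = (a \<otimes> c) \<otimes> b \<oplus> a \<otimes> x"
   unfolding c(4) using AR c(1) ac(1) smodD(1)[OF N c(3)] b by (auto simp: r_distr m_assoc subset_iff)
  then show ?thesis using smodD(4)[OF M ac(1) c(2)] smodD(4)[OF N ac(1) c(3)] subringE(6)[OF A ac(1) c(1)] by blast
 qed
qed

text \<open>Induction on the generators: elements of M whose coefficients at b generate the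
  coefficient ideal, together with generators of the intersection of M with the span of the other
  generators, generate M.\<close>

lemma noeth_spn:
 assumes A: "subring A R" and no: "noeth A"
 shows "[|finite B; B \<subseteq> carrier R; smod A M; M \<subseteq> spn A B|] ==> fg A M"
proof (induction B arbitrary: M rule: finite_induct)
 case empty
 then have "M = {\<zero>}" using spn_empty[OF A] smodD(2) by blast
 then show ?case using spn_empty[OF A] unfolding fg_def by blast
next
 case (insert b B)
 have b: "b \<in> carrier R" and B: "B \<subseteq> carrier R" using insert.prems by auto
 note M = insert.prems(2) and N = spn_smod[OF A B]
 define I where "I = {c \<in> A. \<exists>m\<in>M. \<exists>x\<in>spn A B. m = c \<otimes> b \<oplus> x}"
 have "fg A I" using no smod_coeffs[OF A M N b] unfolding noeth_def I_def by blast
 then obtain C where C: "finite C" "C \<subseteq> carrier R" "I = spn A C" unfolding fg_def by blast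
 have CI: "C \<subseteq> I" using spn_superset C by blast
 then have "\<forall>c\<in>C. \<exists>m. m \<in> M \<and> (\<exists>x\<in>spn A B. m = c \<otimes> b \<oplus> x)" unfolding I_def by blast
 then obtain f where f: "\<And>c. c \<in> C ==> f c \<in> M \<and> (\<exists>x\<in>spn A B. f c = c \<otimes> b \<oplus> x)" by metis
 have "fg A (M \<inter> spn A B)" using insert.IH[OF B smod_Int[OF M N]] by blast
 then obtain B' where B': "finite B'" "B' \<subseteq> carrier R" "M \<inter> spn A B = spn A B'" unfolding fg_def by blast
 have B'M: "B' \<subseteq> M" using spn_superset[of B' A] B'(3) by blast
 let ?G = "B' \<union> f ` C"
 have G: "finite ?G" "?G \<subseteq> M" "?G \<subseteq> carrier R" using B' B'M C f smodD(1)[OF M] by auto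
 let ?N = "spn A ?G"
 have NS: "smod A ?N" by (rule spn_smod[OF A G(3)])
 have NM: "?N \<subseteq> M" by (rule spn_least[OF M G(2)])
 have "M \<subseteq> ?N"
 proof
  fix m assume m: "m \<in> M"
  then obtain c x where cx: "c \<in> A" "x \<in> spn A B" "m = c \<otimes> b \<oplus> x"
   using insert.prems(3) spn_insert[OF A B b] by blast
  have "c \<in> I" unfolding I_def using cx m by blast
  also have "I \<subseteq> {c \<in> A. \<exists>m\<in>?N. \<exists>x\<in>spn A B. m = c \<otimes> b \<oplus> x}"
   unfolding C(3)
  proof (rule spn_least[OF smod_coeffs[OF A NS N b]])
   show "C \<subseteq> {c \<in> A. \<exists>m\<in>?N. \<exists>x\<in>spn A B. m = c \<otimes> b \<oplus> x}"
   proof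
    fix c assume c: "c \<in> C"
    have "f c \<in> ?N" using spn_superset[of ?G A] c by auto
    moreover have "c \<in> A" using CI c unfolding I_def by auto
    ultimately show "c \<in> {c \<in> A. \<exists>m\<in>?N. \<exists>x\<in>spn A B. m = c \<otimes> b \<oplus> x}" using f[OF c] by blast
   qed
  qed
  finally obtain n y where ny: "n \<in> ?N" "y \<in> spn A B" "n = c \<otimes> b \<oplus> y" by blast
  have R: "x \<in> carrier R" "y \<in> carrier R" "c \<in> carrier R" "n \<in> carrier R" "m \<in> carrier R"
   using smodD(1)[OF N] smodD(1)[OF M] cx ny m subringE(1)[OF A] NM by auto
  have "m \<ominus> n = x \<ominus> y" unfolding cx(3) ny(3) using R(1,2,3) b by algebra
  then have "m \<ominus> n \<in> spn A B" using smod_minus(2)[OF N A cx(2) ny(2)] by simp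
  moreover have "m \<ominus> n \<in> M" using smod_minus(2)[OF M A m] ny NM by blast
  ultimately have "m \<ominus> n \<in> spn A B'" using B'(3) by blast
  then have "m \<ominus> n \<in> ?N" using spn_mono[OF A G(3), of B'] spn_superset[of ?G A] by blast
  moreover have "m = (m \<ominus> n) \<oplus> n" using R(4,5) by algebra
  ultimately show "m \<in> ?N" using smodD(3)[OF NS _ ny(1)] by metis
 qed
 then show ?case unfolding fg_def using G NM by blast
qed

lemma noeth_fg: "[|subring A R; noeth A; fg A L; smod A M; M \<subseteq> L|] ==> fg A M"
 using noeth_spn[of A] unfolding fg_def by blast

lemma fg_smult: "[|subring A R; d \<in> carrier R; fg A L|] ==> fg A ((\<lambda>x. d \<otimes> x) ` L)"
proof -
 assume A: "subring A R" and d: "d \<in> carrier R" and f: "fg A L"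
 obtain B where B: "finite B" "B \<subseteq> carrier R" "L = spn A B" using f unfolding fg_def by blast
 note L = fg_smod[OF A f] and AR = subringE(1)[OF A]
 let ?D = "\<lambda>x. d \<otimes> x"
 have dB: "?D ` B \<subseteq> carrier R" using B d by auto
 have 1: "smod A (?D ` L)"
 proof (rule smodI)
  show "?D ` L \<subseteq> carrier R" using smodD(1)[OF L] d by auto
  show "\<zero> \<in> ?D ` L" using smodD(2)[OF L] d by force
  show "x \<oplus> y \<in> ?D ` L" if xy: "x \<in> ?D ` L" "y \<in> ?D ` L" for x y
  proof -
   obtain u where u: "u \<in> L" "x = d \<otimes> u" using xy(1) by blast
   obtain v where v: "v \<in> L" "y = d \<otimes> v" using xy(2) by blast
   have "x \<oplus> y = d \<otimes> (u \<oplus> v)" using u v d smodD(1)[OF L] by (simp add: r_distr)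
   then show ?thesis using smodD(3)[OF L u(1) v(1)] by blast
  qed
  show "a \<otimes> x \<in> ?D ` L" if ax: "a \<in> A" "x \<in> ?D ` L" for a x
  proof -
   obtain u where u: "u \<in> L" "x = d \<otimes> u" using ax(2) by blast
   have "a \<otimes> x = d \<otimes> (a \<otimes> u)" unfolding u(2) by (rule m_lcomm) (use u ax AR d smodD(1)[OF L] in auto)
   then show ?thesis using smodD(4)[OF L ax(1) u(1)] by blast
  qed
 qed
 have 2: "smod A {x \<in> carrier R. d \<otimes> x \<in> spn A (?D ` B)}"
 proof (rule smodI)
  note S = spn_smod[OF A dB]
  show "\<zero> \<in> {x \<in> carrier R. d \<otimes> x \<in> spn A (?D ` B)}" using smodD(2)[OF S] d by simp
  show "x \<oplus> y \<in> {x \<in> carrier R. d \<otimes> x \<in> spn A (?D ` B)}"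
   if "x \<in> {x \<in> carrier R. d \<otimes> x \<in> spn A (?D ` B)}" "y \<in> {x \<in> carrier R. d \<otimes> x \<in> spn A (?D ` B)}" for x y
   using that smodD(3)[OF S] d by (simp add: r_distr)
  show "a \<otimes> x \<in> {x \<in> carrier R. d \<otimes> x \<in> spn A (?D ` B)}"
   if "a \<in> A" "x \<in> {x \<in> carrier R. d \<otimes> x \<in> spn A (?D ` B)}" for a x
  proof -
   have aR: "a \<in> carrier R" using that AR by blast
   have "d \<otimes> (a \<otimes> x) = a \<otimes> (d \<otimes> x)" by (rule m_lcomm) (use that aR d in auto)
   then show ?thesis using that smodD(4)[OF S] aR by simp
  qed
 qed blast
 have "L \<subseteq> {x \<in> carrier R. d \<otimes> x \<in> spn A (?D ` B)}"
  unfolding B(3) by (rule spn_least[OF 2]) (use B spn_superset[of "?D ` B" A] in auto)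
 moreover have "spn A (?D ` B) \<subseteq> ?D ` L" by (rule spn_least[OF 1]) (use B spn_superset[of B A] in auto)
 ultimately have "?D ` L = spn A (?D ` B)" by blast
 then show ?thesis using B dB unfolding fg_def by blast
qed

lemma cring_sub: "subring A R ==> cring (R\<lparr>carrier := A\<rparr>)"
 using subcring_iff subcringI' subringE(1) by blast

lemma ideal_smod: "subring A R ==> ideal I (R\<lparr>carrier := A\<rparr>) \<longleftrightarrow> smod A I \<and> I \<subseteq> A"
proof
 assume A: "subring A R"
 interpret S: cring "R\<lparr>carrier := A\<rparr>" by (rule cring_sub[OF A])
 {
  assume I: "ideal I (R\<lparr>carrier := A\<rparr>)"
  interpret I: ideal I "R\<lparr>carrier := A\<rparr>" by fact
  have "I \<subseteq> A" using I.a_subset by simp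
  moreover have "smod A I"
   by (rule smodI) (use calculation subringE(1)[OF A] I.zero_closed I.a_closed I.I_l_closed in auto)
  ultimately show "smod A I \<and> I \<subseteq> A" by simp
 }
 assume I: "smod A I \<and> I \<subseteq> A"
 show "ideal I (R\<lparr>carrier := A\<rparr>)"
 proof (rule idealI[OF S.ring_axioms])
  have "\<ominus>\<^bsub>R\<lparr>carrier := A\<rparr>\<^esub> x \<in> I" if "x \<in> I" for x
  proof -
   have "\<ominus>\<^bsub>R\<lparr>carrier := A\<rparr>\<^esub> x = (\<ominus>\<^bsub>R\<lparr>carrier := A\<rparr>\<^esub> \<one>) \<otimes> x"
    using S.l_minus[of \<one> x] that I subringE(3)[OF A] smodD(1)[of A I x] by auto
   moreover have "\<ominus>\<^bsub>R\<lparr>carrier := A\<rparr>\<^esub> \<one> \<in> A" using S.a_inv_closed[of \<one>] subringE(3)[OF A] by simp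
   ultimately show ?thesis using I smodD(4)[of A I] that by auto
  qed
  then show "subgroup I (add_monoid (R\<lparr>carrier := A\<rparr>))"
   by (intro S.add.subgroupI) (use I smodD[of A I] in \<open>auto simp: a_inv_def\<close>)
  fix u v assume uv: "u \<in> I" "v \<in> carrier (R\<lparr>carrier := A\<rparr>)"
  then show "v \<otimes>\<^bsub>R\<lparr>carrier := A\<rparr>\<^esub> u \<in> I" using I smodD(4)[of A I] by auto
  then show "u \<otimes>\<^bsub>R\<lparr>carrier := A\<rparr>\<^esub> v \<in> I"
   using S.m_comm[of u v] uv I by auto
 qed
qed

lemma genideal_eq_spn:
 assumes A: "subring A R" and B: "B \<subseteq> A"
 shows "genideal (R\<lparr>carrier := A\<rparr>) B = spn A B"
proof
 interpret S: cring "R\<lparr>carrier := A\<rparr>" by (rule cring_sub[OF A])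
 have BR: "B \<subseteq> carrier R" using B subringE(1)[OF A] by blast
 have "spn A B \<subseteq> A" by (rule spn_least[OF smod_self[OF A] B])
 then have "ideal (spn A B) (R\<lparr>carrier := A\<rparr>)" using ideal_smod[OF A] spn_smod[OF A BR] by blast
 then show "genideal (R\<lparr>carrier := A\<rparr>) B \<subseteq> spn A B" by (rule S.genideal_minimal[OF _ spn_superset])
 have "ideal (genideal (R\<lparr>carrier := A\<rparr>) B) (R\<lparr>carrier := A\<rparr>)" by (rule S.genideal_ideal) (use B in simp)
 then show "spn A B \<subseteq> genideal (R\<lparr>carrier := A\<rparr>) B"
  using ideal_smod[OF A] S.genideal_self[of B] B by (intro spn_least) auto
qed

lemma noetherian_ring_iff: "subring A R ==> noetherian_ring (R\<lparr>carrier := A\<rparr>) \<longleftrightarrow> noeth A"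
proof
 assume A: "subring A R"
 interpret S: cring "R\<lparr>carrier := A\<rparr>" by (rule cring_sub[OF A])
 {
  assume N: "noetherian_ring (R\<lparr>carrier := A\<rparr>)"
  show "noeth A"
   unfolding noeth_def
  proof (intro allI impI)
   fix I assume "smod A I \<and> I \<subseteq> A"
   then have "ideal I (R\<lparr>carrier := A\<rparr>)" using ideal_smod[OF A] by blast
   then obtain B where "B \<subseteq> carrier (R\<lparr>carrier := A\<rparr>)" "finite B" "I = genideal (R\<lparr>carrier := A\<rparr>) B"
    using noetherian_ring.finetely_gen[OF N] by blast
   then have "finite B \<and> B \<subseteq> carrier R \<and> I = spn A B" using genideal_eq_spn[OF A, of B] subringE(1)[OF A] by auto
   then show "fg A I" unfolding fg_def by (rule exI)
  qed
 }
 assume N: "noeth A"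
 show "noetherian_ring (R\<lparr>carrier := A\<rparr>)"
 proof (rule noetherian_ring.intro[OF S.ring_axioms noetherian_ring_axioms.intro])
  fix I assume "ideal I (R\<lparr>carrier := A\<rparr>)"
  then have I: "smod A I" "I \<subseteq> A" using ideal_smod[OF A] by auto
  then obtain B where B: "finite B" "B \<subseteq> carrier R" "I = spn A B" using N unfolding noeth_def fg_def by blast
  then have "B \<subseteq> A" using I spn_superset by blast
  then show "\<exists>B\<subseteq>carrier (R\<lparr>carrier := A\<rparr>). finite B \<and> I = genideal (R\<lparr>carrier := A\<rparr>) B"
   using genideal_eq_spn[OF A] B by auto
 qed
qed

lemma noeth_over:
 assumes A: "subring A R" "noeth A" and B: "subring B R" "A \<subseteq> B" "fg A B"
 shows "noeth B"
 unfolding noeth_def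
proof (intro allI impI)
 fix I assume I: "smod B I \<and> I \<subseteq> B"
 then have "fg A I" using noeth_fg[OF A B(3)] smod_mono[OF _ B(2)] by blast
 then show "fg B I" using fg_change[OF A(1) B(1,2)] I by blast
qed

lemma fg_directed:
 assumes A: "subring A R" and M: "fg A M"
  and F: "\<And>n::nat. smod A (F n)" "\<And>n. F n \<subseteq> F (Suc n)" "M = (\<Union>n. F n)"
 shows "\<exists>n. M = F n"
proof -
 obtain B where B: "finite B" "B \<subseteq> carrier R" "M = spn A B" using M unfolding fg_def by blast
 have "\<exists>n. B' \<subseteq> F n" if "B' \<subseteq> B" for B'
  using finite_subset[OF that B(1)] that
 proof (induction B')
  case (insert b B')
  then obtain n where n: "B' \<subseteq> F n" by blast
  have "b \<in> M" using insert B spn_superset by blast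
  then obtain m where m: "b \<in> F m" using F by blast
  have "F n \<subseteq> F (max n m)" "F m \<subseteq> F (max n m)" using lift_Suc_mono_le[of F, OF F(2)] by auto
  then show ?case using n m by blast
 qed simp
 then obtain n where "B \<subseteq> F n" by blast
 then have "M \<subseteq> F n" unfolding B(3) by (rule spn_least[OF F(1)])
 then show ?thesis using F(3) by blast
qed

end

context cring
begin

section \<open>Bases of quotients of submodules\<close>

definition mxi where "mxi A I \<longleftrightarrow> subring A R \<and> maximalideal I (R\<lparr>carrier := A\<rparr>)"

lemma mxi_D:
 assumes "mxi A I"
 shows "subring A R" "smod A I" "I \<subseteq> A" "\<one> \<notin> I" "A \<subseteq> carrier R"
  "[|x \<in> A; x \<notin> I|] ==> \<exists>y\<in>A. \<exists>q\<in>I. x \<otimes> y = \<one> \<oplus> q"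
  "[|x \<in> A; y \<in> A; x \<otimes> y \<in> I|] ==> x \<in> I \<or> y \<in> I"
proof -
 show A: "subring A R" using assms unfolding mxi_def by simp
 show AR: "A \<subseteq> carrier R" by (rule subringE(1)[OF A])
 have max: "maximalideal I (R\<lparr>carrier := A\<rparr>)" using assms unfolding mxi_def by simp
 have cr: "cring (R\<lparr>carrier := A\<rparr>)" by (rule cring_sub[OF A])
 have cp: "completed I (R\<lparr>carrier := A\<rparr>)" by (rule completed.intro[OF max cr])
 have pr: "primeideal I (R\<lparr>carrier := A\<rparr>)" by (rule cring.maximalideal_prime[OF cr max])
 have "ideal I (R\<lparr>carrier := A\<rparr>)" using max by (rule maximalideal.axioms(1))
 then show I: "smod A I" "I \<subseteq> A" using ideal_smod[OF A] by auto
 show "\<one> \<notin> I"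
  using ideal.one_imp_carrier[OF \<open>ideal I (R\<lparr>carrier := A\<rparr>)\<close>] maximalideal.I_notcarr[OF max] by auto
 show "[|x \<in> A; x \<notin> I|] ==> \<exists>y\<in>A. \<exists>q\<in>I. x \<otimes> y = \<one> \<oplus> q"
  using completed.inv_mod_P[OF cp, of x] by simp
 show "[|x \<in> A; y \<in> A; x \<otimes> y \<in> I|] ==> x \<in> I \<or> y \<in> I"
  using primeideal.I_prime[OF pr, of x y] by simp
qed

lemma rbasis_iff: "rbasis R A I M N J b \<longleftrightarrow> finite J \<and> (\<forall>i\<in>J. b i \<in> M) \<and>
  (\<forall>x\<in>M. \<exists>c n. (\<forall>i\<in>J. c i \<in> A) \<and> n \<in> N \<and> x = lsum J c b \<oplus> n) \<and>
  (\<forall>c. (\<forall>i\<in>J. c i \<in> A) \<and> lsum J c b \<in> N --> (\<forall>i\<in>J. c i \<in> I))"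
proof -
 have 1: "(\<exists>c\<in>J \<rightarrow> A. \<exists>n\<in>N. x = lsum J c b \<oplus> n) \<longleftrightarrow> (\<exists>c n. (\<forall>i\<in>J. c i \<in> A) \<and> n \<in> N \<and> x = lsum J c b \<oplus> n)" for x
  unfolding Pi_iff Bex_def by blast
 have 2: "(\<forall>c\<in>J \<rightarrow> A. lsum J c b \<in> N --> (\<forall>i\<in>J. c i \<in> I)) \<longleftrightarrow> (\<forall>c. (\<forall>i\<in>J. c i \<in> A) \<and> lsum J c b \<in> N --> (\<forall>i\<in>J. c i \<in> I))"
  unfolding Pi_iff Ball_def by blast
 show ?thesis unfolding rbasis_def lsum_def[symmetric] 1 2 Pi_iff by blast
qed

lemma rbasis_D:
 assumes "rbasis R A I M N J b"
 shows "finite J" "\<And>i. i \<in> J ==> b i \<in> M"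
  "\<And>x. x \<in> M ==> \<exists>c n. (\<forall>i\<in>J. c i \<in> A) \<and> n \<in> N \<and> x = lsum J c b \<oplus> n"
  "\<And>c i. [|\<And>i. i \<in> J ==> c i \<in> A; lsum J c b \<in> N; i \<in> J|] ==> c i \<in> I"
 using assms unfolding rbasis_iff by blast+

lemma rbasis_I:
 assumes "finite J" "\<And>i. i \<in> J ==> b i \<in> M"
  "\<And>x. x \<in> M ==> \<exists>c n. (\<forall>i\<in>J. c i \<in> A) \<and> n \<in> N \<and> x = lsum J c b \<oplus> n"
  "\<And>c i. [|\<And>i. i \<in> J ==> c i \<in> A; lsum J c b \<in> N; i \<in> J|] ==> c i \<in> I"
 shows "rbasis R A I M N J b"
 using assms unfolding rbasis_iff by blast

text \<open>These conditions make M/N a vector space over the field A/I.\<close>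

definition qp where
 "qp A I M N \<longleftrightarrow> mxi A I \<and> smod A M \<and> smod A N \<and> N \<subseteq> M \<and> (\<forall>a\<in>I. \<forall>x\<in>M. a \<otimes> x \<in> N)"

lemma finsum_sub_module:
 assumes am: "abelian_monoid (sub_module R M)" and M: "M \<subseteq> carrier R" and f: "finite J" "\<And>i. i \<in> J ==> f i \<in> M"
 shows "finsum (sub_module R M) f J = finsum R f J"
proof -
 interpret S: abelian_monoid "sub_module R M" by (rule am)
 show ?thesis using f
 proof (induction J rule: finite_induct)
  case empty then show ?case by simp
 next
  case (insert j J)
  have "finsum (sub_module R M) f (insert j J) = f j \<oplus> finsum (sub_module R M) f J"
   using S.finsum_insert[of J j f] insert by (auto simp: Pi_iff)
  moreover have "finsum R f (insert j J) = f j \<oplus> finsum R f J"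
   by (rule finsum_insert) (use insert M in auto)
  ultimately show ?case using insert by simp
 qed
qed

theorem quotient_dim_eq:
 assumes qp: "qp A I M N" and rb: "rbasis R A I M N J b"
 shows "quotient_dim R A I M N = card J"
proof -
 have mx: "mxi A I" and M: "smod A M" and N: "smod A N" "N \<subseteq> M" and an: "\<And>a x. [|a \<in> I; x \<in> M|] ==> a \<otimes> x \<in> N"
  using qp unfolding qp_def by auto
 note A = mxi_D(1)[OF mx] and AR = mxi_D(5)[OF mx]
 have MR: "M \<subseteq> carrier R" using smodD(1)[OF M] by blast
 have m1: "\<ominus> \<one> \<in> A" using subringE(3,5)[OF A] by blast
 have mod: "module (R\<lparr>carrier := A\<rparr>) (sub_module R M)"
  by (rule sub_module_module[OF MR smodD(2,3)[OF M] cring_sub[OF A] AR m1 smodD(4)[OF M]])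
 have ab: "abelian_monoid (sub_module R M)"
  using module.axioms(2)[OF mod] by (simp add: abelian_group_def)
 have rq: "residue_quotient (R\<lparr>carrier := A\<rparr>) (sub_module R M) I N"
  by (rule residue_quotient.intro[OF mod _ residue_quotient_axioms.intro])
   (use mx N smodD[OF N(1)] an in \<open>auto simp: mxi_def\<close>)
 have sums: "(\<Oplus>\<^bsub>sub_module R M\<^esub>i\<in>J. c i \<odot>\<^bsub>sub_module R M\<^esub> b i) = lsum J c b" if c: "\<And>i. i \<in> J ==> c i \<in> A" for c
  unfolding lsum_def sub_module_simps
  by (rule finsum_sub_module[OF ab MR rbasis_D(1)[OF rb]]) (use c rbasis_D(2)[OF rb] smodD(4)[OF M] in blast)
 have "rel_basis (R\<lparr>carrier := A\<rparr>) I (sub_module R M) N J b"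
  unfolding rel_basis_def
 proof (intro conjI ballI impI)
  show "finite J" by (rule rbasis_D(1)[OF rb])
  show "b \<in> J \<rightarrow> carrier (sub_module R M)" using rbasis_D(2)[OF rb] by simp
  fix x assume "x \<in> carrier (sub_module R M)"
  then have "x \<in> M" by simp
  then obtain c n where c: "\<forall>i\<in>J. c i \<in> A" "n \<in> N" "x = lsum J c b \<oplus> n" using rbasis_D(3)[OF rb] by blast
  then have "c \<in> J \<rightarrow> carrier (R\<lparr>carrier := A\<rparr>)"
   "x = (\<Oplus>\<^bsub>sub_module R M\<^esub>i\<in>J. c i \<odot>\<^bsub>sub_module R M\<^esub> b i) \<oplus>\<^bsub>sub_module R M\<^esub> n"
   using sums[of c] by auto
  then show "\<exists>c\<in>J \<rightarrow> carrier (R\<lparr>carrier := A\<rparr>). \<exists>n\<in>N. x = (\<Oplus>\<^bsub>sub_module R M\<^esub>i\<in>J. c i \<odot>\<^bsub>sub_module R M\<^esub> b i) \<oplus>\<^bsub>sub_module R M\<^esub> n"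
   using c(2) by blast
 next
  fix c i assume c: "c \<in> J \<rightarrow> carrier (R\<lparr>carrier := A\<rparr>)" "(\<Oplus>\<^bsub>sub_module R M\<^esub>i\<in>J. c i \<odot>\<^bsub>sub_module R M\<^esub> b i) \<in> N"
   and i: "i \<in> J"
  have cA: "\<And>i. i \<in> J ==> c i \<in> A" using c(1) by auto
  show "c i \<in> I" by (rule rbasis_D(4)[OF rb cA _ i]) (use c(2) sums[OF cA] in auto)
 qed
 then show ?thesis unfolding quotient_dim_def by (rule residue_quotient.residue_dim_eq[OF rq])
qed

lemma rbasis_card_unique:
 "[|qp A I M N; rbasis R A I M N J b; rbasis R A I M N J' b'|] ==> card J = card J'"
 using quotient_dim_eq by metis

text \<open>A generating subfamily of least size is independent: a relation with a coefficient
  outside I, which is invertible modulo I, would express that generator through the others modulo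
  N.\<close>

lemma rbasis_exists:
 assumes qp: "qp A I M N" and J: "finite J" "\<And>i. i \<in> J ==> b i \<in> M"
  and span: "\<And>x. x \<in> M ==> \<exists>c n. (\<forall>i\<in>J. c i \<in> A) \<and> n \<in> N \<and> x = lsum J c b \<oplus> n"
 shows "\<exists>J'\<subseteq>J. rbasis R A I M N J' b"
proof -
 have mx: "mxi A I" and M: "smod A M" and N: "smod A N" "N \<subseteq> M" and an: "\<And>a x. [|a \<in> I; x \<in> M|] ==> a \<otimes> x \<in> N"
  using qp unfolding qp_def by auto
 note A = mxi_D(1)[OF mx] and AR = mxi_D(5)[OF mx]
 define T where "T J' \<longleftrightarrow> J' \<subseteq> J \<and> (\<forall>x\<in>M. \<exists>c n. (\<forall>i\<in>J'. c i \<in> A) \<and> n \<in> N \<and> x = lsum J' c b \<oplus> n)" for J'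
 have "T J" unfolding T_def using span by blast
 then obtain J' where T: "T J'" and min: "\<And>L. T L ==> card J' \<le> card L"
  using ex_has_least_nat[of T J card] by blast
 have sub: "J' \<subseteq> J" using T unfolding T_def by blast
 have fin: "finite J'" using sub J(1) finite_subset by blast
 have bM: "b i \<in> M" if "i \<in> J'" for i using J(2) sub that by blast
 have bR: "b i \<in> carrier R" if "i \<in> J'" for i using bM[OF that] smodD(1)[OF M] by blast
 have "rbasis R A I M N J' b"
 proof (rule rbasis_I[OF fin bM])
  show "\<exists>c n. (\<forall>i\<in>J'. c i \<in> A) \<and> n \<in> N \<and> x = lsum J' c b \<oplus> n" if "x \<in> M" for x
   using T that unfolding T_def by blast
  fix c j assume c: "\<And>i. i \<in> J' ==> c i \<in> A" "lsum J' c b \<in> N" and j: "j \<in> J'"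
  show "c j \<in> I"
  proof (rule ccontr)
   assume "c j \<notin> I"
   then obtain y q where y: "y \<in> A" "q \<in> I" "c j \<otimes> y = \<one> \<oplus> q" using mxi_D(6)[OF mx c(1)[OF j]] by blast
   let ?L = "J' - {j}"
   have R: "y \<in> carrier R" "q \<in> carrier R" "c j \<in> carrier R" "b j \<in> carrier R"
    using y AR mxi_D(3)[OF mx] c(1)[OF j] bR[OF j] by auto
   have LR: "lsum ?L c b \<in> carrier R" by (rule lsum_closed) (use c AR bR in auto)
   have split: "lsum J' d b = d j \<otimes> b j \<oplus> lsum ?L d b" if "\<And>i. i \<in> J' ==> d i \<in> A" for d
    by (rule lsum_remove[OF fin j]) (use that AR bR in auto)
   \<comment> \<open>The relation scaled so that its coefficient at j becomes 1: y inverts c j up to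
     q in I, and q b j is in N. The result is in N and equals b j plus a combination of the
     others.\<close>
   define m where "m = y \<otimes> lsum J' c b \<ominus> q \<otimes> b j"
   have "y \<otimes> lsum J' c b \<in> N" using smodD(4)[OF N(1) y(1) c(2)] .
   then have mN: "m \<in> N" unfolding m_def using smod_minus(2)[OF N(1) A] an[OF y(2) bM[OF j]] by blast
   have mR: "m \<in> carrier R" using smodD(1)[OF N(1) mN] .
   have "m = y \<otimes> (c j \<otimes> b j \<oplus> lsum ?L c b) \<ominus> q \<otimes> b j"
    unfolding m_def using split[of c, OF c(1)] by simp
   also have "\<dots> = (c j \<otimes> y) \<otimes> b j \<ominus> q \<otimes> b j \<oplus> y \<otimes> lsum ?L c b" using R LR by algebra
   also have "\<dots> = b j \<oplus> y \<otimes> lsum ?L c b" unfolding y(3) using R LR by algebra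
   finally have m: "m = b j \<oplus> y \<otimes> lsum ?L c b" .
   have bj: "b j = m \<ominus> y \<otimes> lsum ?L c b" unfolding m using R LR by algebra
   have "T ?L" unfolding T_def
   proof (intro conjI ballI)
    show "?L \<subseteq> J" using sub by blast
    fix x assume "x \<in> M"
    then obtain d n where d: "\<forall>i\<in>J'. d i \<in> A" "n \<in> N" "x = lsum J' d b \<oplus> n" using T unfolding T_def by blast
    have dA: "d j \<in> A" using d j by blast
    have dR: "d j \<in> carrier R" using dA AR by blast
    have LdR: "lsum ?L d b \<in> carrier R" by (rule lsum_closed) (use d AR bR in auto)
    have nR: "n \<in> carrier R" using smodD(1)[OF N(1) d(2)] .
    \<comment> \<open>The coefficients after b j has been replaced by means of
      \<open>bj\<close>.\<close>
    let ?e = "\<lambda>i. d i \<oplus> (\<ominus> (d j \<otimes> y)) \<otimes> c i"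
    have yd: "\<ominus> (d j \<otimes> y) \<in> A" using subringE(5,6)[OF A] dA y(1) by blast
    have ydR: "\<ominus> (d j \<otimes> y) \<in> carrier R" using yd AR by blast
    have "lsum ?L ?e b = lsum ?L d b \<oplus> lsum ?L (\<lambda>i. (\<ominus> (d j \<otimes> y)) \<otimes> c i) b"
     by (rule lsum_add[symmetric]) (use d c AR bR ydR in auto)
    also have "lsum ?L (\<lambda>i. (\<ominus> (d j \<otimes> y)) \<otimes> c i) b = (\<ominus> (d j \<otimes> y)) \<otimes> lsum ?L c b"
     by (rule lsum_smult[symmetric]) (use fin c AR bR ydR in auto)
    finally have e: "lsum ?L ?e b = lsum ?L d b \<oplus> (\<ominus> (d j \<otimes> y)) \<otimes> lsum ?L c b" .
    have "x = d j \<otimes> b j \<oplus> lsum ?L d b \<oplus> n" using d split[of d] by simp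
    also have "\<dots> = d j \<otimes> (m \<ominus> y \<otimes> lsum ?L c b) \<oplus> lsum ?L d b \<oplus> n" by (subst bj) (rule refl)
    also have "\<dots> = (lsum ?L d b \<oplus> (\<ominus> (d j \<otimes> y)) \<otimes> lsum ?L c b) \<oplus> (d j \<otimes> m \<oplus> n)"
     using dR mR R LR LdR nR by algebra
    finally have "x = lsum ?L ?e b \<oplus> (d j \<otimes> m \<oplus> n)" unfolding e .
    moreover have "d j \<otimes> m \<oplus> n \<in> N" using smodD(3)[OF N(1) smodD(4)[OF N(1) dA mN] d(2)] .
    moreover have "\<forall>i\<in>?L. ?e i \<in> A" using d c yd subringE(6,7)[OF A] by auto
    ultimately show "\<exists>c n. (\<forall>i\<in>?L. c i \<in> A) \<and> n \<in> N \<and> x = lsum ?L c b \<oplus> n" by (intro exI[of _ ?e]) blast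
   qed
   then have "card J' \<le> card ?L" by (rule min)
   then show False using card_Diff1_less[OF fin j] by simp
  qed
 qed
 then show ?thesis using sub by blast
qed

lemma lsum_prod:
 assumes "finite J" "finite L" "\<And>i l. [|i \<in> J; l \<in> L|] ==> z (i, l) \<in> carrier R"
  "\<And>i. i \<in> J ==> b i \<in> carrier R" "\<And>l. l \<in> L ==> v l \<in> carrier R"
 shows "lsum (J \<times> L) z (\<lambda>x. v (snd x) \<otimes> b (fst x)) = lsum J (\<lambda>i. lsum L (\<lambda>l. z (i, l)) v) b"
 using assms(1,3,4)
proof (induction J rule: finite_induct)
 case empty then show ?case by (simp add: lsum_empty)
next
 case (insert j J)
 let ?f = "\<lambda>x. z x \<otimes> (v (snd x) \<otimes> b (fst x))"
 have L: "\<And>i. i \<in> insert j J ==> lsum L (\<lambda>l. z (i, l)) v \<in> carrier R"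
  by (rule lsum_closed) (use insert assms in auto)
 have un: "insert j J \<times> L = Pair j ` L \<union> J \<times> L" by auto
 have "lsum (insert j J \<times> L) z (\<lambda>x. v (snd x) \<otimes> b (fst x)) = (\<Oplus>x\<in>Pair j ` L. ?f x) \<oplus> (\<Oplus>x\<in>J \<times> L. ?f x)"
  unfolding lsum_def un by (rule finsum_Un_disjoint) (use insert assms in \<open>auto simp: Pi_iff\<close>)
 also have "(\<Oplus>x\<in>Pair j ` L. ?f x) = (\<Oplus>l\<in>L. ?f (j, l))"
  by (rule finsum_reindex) (use insert assms in \<open>auto simp: Pi_iff inj_on_def\<close>)
 also have "\<dots> = (\<Oplus>l\<in>L. z (j, l) \<otimes> v l \<otimes> b j)"
  by (rule finsum_cong') (use insert assms in \<open>auto simp: Pi_iff m_assoc\<close>)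
 also have "\<dots> = lsum L (\<lambda>l. z (j, l)) v \<otimes> b j" unfolding lsum_def
  by (rule finsum_ldistr[symmetric]) (use insert assms in \<open>auto simp: Pi_iff\<close>)
 also have "(\<Oplus>x\<in>J \<times> L. ?f x) = lsum J (\<lambda>i. lsum L (\<lambda>l. z (i, l)) v) b"
  using insert unfolding lsum_def by simp
 also have "lsum L (\<lambda>l. z (j, l)) v \<otimes> b j \<oplus> lsum J (\<lambda>i. lsum L (\<lambda>l. z (i, l)) v) b =
   lsum (insert j J) (\<lambda>i. lsum L (\<lambda>l. z (i, l)) v) b"
  by (rule lsum_insert[symmetric]) (use insert L in auto)
 finally show ?case .
qed

text \<open>The basis of a tower: passing from S/P down to A/p multiplies the dimension of M/N by
  [S/P : A/p]. This lets a comparison over Z/p decide one over S/P.\<close>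

lemma rbasis_prod:
 assumes qp: "qp S P M N" and rM: "rbasis R S P M N J b" and mA: "mxi A p" and AS: "A \<subseteq> S"
  and rS: "rbasis R A p S P L v"
 shows "rbasis R A p M N (J \<times> L) (\<lambda>x. v (snd x) \<otimes> b (fst x))"
proof -
 have mx: "mxi S P" and M: "smod S M" and N: "smod S N" "N \<subseteq> M" and an: "\<And>a x. [|a \<in> P; x \<in> M|] ==> a \<otimes> x \<in> N"
  using qp unfolding qp_def by auto
 note SR = mxi_D(5)[OF mx] and J = rbasis_D[OF rM] and L = rbasis_D[OF rS]
 have bR: "b i \<in> carrier R" if "i \<in> J" for i using J(2)[OF that] smodD(1)[OF M] by blast
 have vR: "v l \<in> carrier R" if "l \<in> L" for l using L(2)[OF that] SR by blast
 note Ss = smod_mono[OF smod_self[OF mxi_D(1)[OF mx]] AS]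
 have AR: "A \<subseteq> carrier R" using AS SR by blast
 have prod: "lsum (J \<times> L) z (\<lambda>x. v (snd x) \<otimes> b (fst x)) = lsum J (\<lambda>i. lsum L (\<lambda>l. z (i, l)) v) b"
  if "\<And>i l. [|i \<in> J; l \<in> L|] ==> z (i, l) \<in> A" for z
  by (rule lsum_prod[OF J(1) L(1) _ bR vR]) (use AR that in blast)+
 show ?thesis
 proof (rule rbasis_I)
  show "finite (J \<times> L)" using J(1) L(1) by blast
  show "v (snd x) \<otimes> b (fst x) \<in> M" if "x \<in> J \<times> L" for x
   using that J(2) L(2) smodD(4)[OF M] by auto
  fix x assume "x \<in> M"
  then obtain s n where s: "\<forall>i\<in>J. s i \<in> S" "n \<in> N" "x = lsum J s b \<oplus> n" using J(3) by blast
  have "\<forall>i\<in>J. \<exists>z q. (\<forall>l\<in>L. z l \<in> A) \<and> q \<in> P \<and> s i = lsum L z v \<oplus> q" using s L(3) by blast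
  then obtain z q where zq: "\<And>i. i \<in> J ==> (\<forall>l\<in>L. z i l \<in> A) \<and> q i \<in> P \<and> s i = lsum L (z i) v \<oplus> q i"
   by metis
  have zv: "lsum L (z i) v \<in> S" if "i \<in> J" for i
   by (rule lsum_mem[OF Ss L(1)]) (use zq[OF that] L(2) AS SR in auto)
  have qS: "q i \<in> S" if "i \<in> J" for i using zq[OF that] mxi_D(3)[OF mx] by blast
  have "lsum J s b = lsum J (\<lambda>i. lsum L (z i) v \<oplus> q i) b"
   by (rule lsum_cong) (use zq s SR bR in auto)
  also have "\<dots> = lsum J (\<lambda>i. lsum L (z i) v) b \<oplus> lsum J q b"
   by (rule lsum_add[symmetric]) (use zv qS SR bR in auto)
  finally have e: "lsum J s b = lsum (J \<times> L) (\<lambda>x. z (fst x) (snd x)) (\<lambda>x. v (snd x) \<otimes> b (fst x)) \<oplus> lsum J q b"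
   using prod[of "\<lambda>x. z (fst x) (snd x)"] zq by simp
  \<comment> \<open>The remainders q i are in P, and P M lies in N, so they contribute nothing
    modulo N. Writing the sum with coefficients 1 and vectors q i b i makes this visible.\<close>
  have qb: "lsum J q b \<in> N" unfolding lsum_def
  proof -
   have "lsum J (\<lambda>_. \<one>) (\<lambda>i. q i \<otimes> b i) \<in> N"
    by (rule lsum_mem[OF N(1) J(1)]) (use subringE(3)[OF mxi_D(1)[OF mx]] zq an J(2) SR in auto)
   moreover have "lsum J (\<lambda>_. \<one>) (\<lambda>i. q i \<otimes> b i) = lsum J q b"
    by (rule lsum_cong) (use qS SR bR in \<open>auto simp: subset_iff\<close>)
   ultimately show "(\<Oplus>i\<in>J. q i \<otimes> b i) \<in> N" unfolding lsum_def by simp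
  qed
  have R: "lsum J q b \<in> carrier R" "n \<in> carrier R" using smodD(1)[OF N(1)] qb s(2) by auto
  have zR: "z i l \<in> carrier R" if "i \<in> J" "l \<in> L" for i l using zq[OF that(1)] that(2) AR by blast
  have R2: "lsum (J \<times> L) (\<lambda>x. z (fst x) (snd x)) (\<lambda>x. v (snd x) \<otimes> b (fst x)) \<in> carrier R"
   by (rule lsum_closed) (use zR bR vR in auto)
  have "x = lsum (J \<times> L) (\<lambda>x. z (fst x) (snd x)) (\<lambda>x. v (snd x) \<otimes> b (fst x)) \<oplus> (lsum J q b \<oplus> n)"
   unfolding s(3) e using R R2 by (simp add: a_assoc)
  moreover have "lsum J q b \<oplus> n \<in> N" using smodD(3)[OF N(1) qb s(2)] .
  moreover have "\<forall>x\<in>J \<times> L. z (fst x) (snd x) \<in> A" using zq by auto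
  ultimately show "\<exists>c n. (\<forall>i\<in>J \<times> L. c i \<in> A) \<and> n \<in> N \<and> x = lsum (J \<times> L) c (\<lambda>x. v (snd x) \<otimes> b (fst x)) \<oplus> n"
   by (intro exI[of _ "\<lambda>x. z (fst x) (snd x)"]) blast
 next
  fix z x assume z: "\<And>x. x \<in> J \<times> L ==> z x \<in> A" "lsum (J \<times> L) z (\<lambda>x. v (snd x) \<otimes> b (fst x)) \<in> N" and x: "x \<in> J \<times> L"
  obtain i l where il: "x = (i, l)" "i \<in> J" "l \<in> L" using x by blast
  have S: "lsum L (\<lambda>l. z (i, l)) v \<in> S" if "i \<in> J" for i
   by (rule lsum_mem[OF Ss L(1)]) (use z(1) that L(2) AS SR in auto)
  have N: "lsum J (\<lambda>i. lsum L (\<lambda>l. z (i, l)) v) b \<in> N" using z(2) prod[of z] z(1) by simp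
  have "lsum L (\<lambda>l. z (i, l)) v \<in> P" by (rule J(4)[OF S N il(2)])
  then show "z x \<in> p" using L(4)[of "\<lambda>l. z (i, l)" l] z(1) il by blast
 qed
qed

text \<open>Gaussian elimination over the field A/I, carried out with representatives: a homogeneous
  system with fewer equations than unknowns has a solution that is non-zero modulo I.\<close>

lemma linear_system:
 assumes mx: "mxi A I"
 shows "[|finite E; finite U; card E < card U; \<And>e u. [|e \<in> E; u \<in> U|] ==> B e u \<in> A|] ==>
  \<exists>z. (\<forall>u\<in>U. z u \<in> A) \<and> (\<exists>u\<in>U. z u \<notin> I) \<and> (\<forall>e\<in>E. lsum U z (B e) \<in> I)"
proof (induction E arbitrary: U B rule: finite_induct)
 case empty
 note A = mxi_D[OF mx]
 have "U \<noteq> {}" using empty by auto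
 then show ?case using subringE(3)[OF A(1)] A(4) by (intro exI[of _ "\<lambda>_. \<one>"]) auto
next
 case (insert e E)
 note A = mxi_D[OF mx] and cl = subringE(5,6,7)[OF mxi_D(1)[OF mx]]
 have AR: "x \<in> A ==> x \<in> carrier R" for x using A(5) by blast
 show ?case
 proof (cases "\<forall>u\<in>U. B e u \<in> I")
  case True
  have "card E < card U" using insert by simp
  then obtain z where z: "\<forall>u\<in>U. z u \<in> A" "\<exists>u\<in>U. z u \<notin> I" "\<forall>e\<in>E. lsum U z (B e) \<in> I"
   using insert.IH[of U B] insert.prems by blast
  have "lsum U z (B e) \<in> I"
   by (rule lsum_mem[OF A(2) insert.prems(1)]) (use z True A(5) in auto)
  then show ?thesis using z by blast
 next
  case False
  then obtain w where w: "w \<in> U" "B e w \<notin> I" by blast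
  have BeA: "B f u \<in> A" if "f \<in> insert e E" "u \<in> U" for f u using insert.prems that by blast
  obtain y q where y: "y \<in> A" "q \<in> I" "B e w \<otimes> y = \<one> \<oplus> q" using A(6)[OF BeA[of e w]] w by blast
  let ?U = "U - {w}"
  \<comment> \<open>The unknown w is eliminated from the other equations by means of the equation e,
    whose coefficient at w has the inverse y modulo I.\<close>
  let ?C = "\<lambda>f u. B f u \<oplus> (\<ominus> (B f w \<otimes> y)) \<otimes> B e u"
  have cA: "\<ominus> (B f w \<otimes> y) \<in> A" if "f \<in> insert e E" for f by (rule cl(1)[OF cl(2)[OF BeA[OF that w(1)] y(1)]])
  have "card E < card ?U" using insert w by (simp add: card_Diff_singleton)
  moreover have "?C f u \<in> A" if "f \<in> E" "u \<in> ?U" for f u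
   by (rule cl(3)[OF BeA cl(2)[OF cA BeA]]) (use that in auto)
  ultimately obtain z where z: "\<forall>u\<in>?U. z u \<in> A" "\<exists>u\<in>?U. z u \<notin> I" "\<forall>f\<in>E. lsum ?U z (?C f) \<in> I"
   using insert.IH[of ?U ?C] insert.prems by blast
  define s where "s = lsum ?U z (B e)"
  have sA: "s \<in> A" unfolding s_def
   by (rule lsum_mem[OF smod_self[OF A(1)]]) (use insert.prems z BeA A(5) in auto)
  \<comment> \<open>The value at w that solves the equation e modulo I; s is the contribution of the
    other unknowns.\<close>
  define z' where "z' = z(w := \<ominus> (y \<otimes> s))"
  have z'w: "z' w \<in> A" unfolding z'_def using cl(1)[OF cl(2)[OF y(1) sA]] by simp
  have eqs: "lsum U z' (B f) = (\<ominus> (y \<otimes> s)) \<otimes> B f w \<oplus> lsum ?U z (B f)" if f: "f \<in> insert e E" for f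
  proof -
   have "lsum U z' (B f) = z' w \<otimes> B f w \<oplus> lsum ?U z' (B f)"
    by (rule lsum_remove[OF insert.prems(1) w(1)]) (use z z'w BeA[OF f] AR in \<open>auto simp: z'_def\<close>)
   also have "lsum ?U z' (B f) = lsum ?U z (B f)"
    by (rule lsum_cong) (use z BeA[OF f] AR in \<open>auto simp: z'_def\<close>)
   moreover have "z' w = \<ominus> (y \<otimes> s)" by (simp add: z'_def)
   ultimately show ?thesis by simp
  qed
  have R: "y \<in> carrier R" "s \<in> carrier R" "q \<in> carrier R" using y sA A(3) AR by auto
  have Bew: "B e w \<in> carrier R" by (rule AR[OF BeA]) (use w in auto)
  have "lsum U z' (B f) \<in> I" if f: "f \<in> insert e E" for f
  proof (cases "f = e")
   case True
   have "lsum U z' (B e) = (\<ominus> (y \<otimes> s)) \<otimes> B e w \<oplus> s" using eqs[of e] unfolding s_def by simp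
   also have "\<dots> = s \<ominus> (B e w \<otimes> y) \<otimes> s" using R Bew by algebra
   also have "\<dots> = (\<ominus> s) \<otimes> q" unfolding y(3) using R by algebra
   finally show ?thesis using True smodD(4)[OF A(2)] cl(1)[OF sA] y(2) by simp
  next
   case False
   then have fE: "f \<in> E" using f by blast
   have "lsum ?U z (?C f) = lsum ?U (\<lambda>u. \<one>) (\<lambda>u. z u \<otimes> B f u \<oplus> (\<ominus> (B f w \<otimes> y)) \<otimes> (z u \<otimes> B e u))"
    by (rule lsum_cong) (use z BeA[OF f] BeA[of e] cA[OF f] AR in \<open>auto simp: r_distr m_lcomm\<close>)
   also have "\<dots> = (\<Oplus>u\<in>?U. z u \<otimes> B f u \<oplus> (\<ominus> (B f w \<otimes> y)) \<otimes> (z u \<otimes> B e u))"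
    unfolding lsum_def by (rule finsum_cong') (use z BeA[OF f] BeA[of e] cA[OF f] AR in auto)
   also have "\<dots> = lsum ?U z (B f) \<oplus> (\<Oplus>u\<in>?U. (\<ominus> (B f w \<otimes> y)) \<otimes> (z u \<otimes> B e u))"
    unfolding lsum_def by (rule finsum_addf) (use z BeA[OF f] BeA[of e] cA[OF f] AR in auto)
   also have "(\<Oplus>u\<in>?U. (\<ominus> (B f w \<otimes> y)) \<otimes> (z u \<otimes> B e u)) = (\<ominus> (B f w \<otimes> y)) \<otimes> s"
    unfolding s_def lsum_def
    by (rule finsum_rdistr[symmetric]) (use insert.prems z BeA[of e] AR[OF cA[OF f]] AR in auto)
   finally have e: "lsum ?U z (?C f) = lsum ?U z (B f) \<oplus> (\<ominus> (B f w \<otimes> y)) \<otimes> s" .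
   have zR: "lsum ?U z (B f) \<in> carrier R" by (rule lsum_closed) (use z BeA[OF f] AR in auto)
   have "(\<ominus> (y \<otimes> s)) \<otimes> B f w = (\<ominus> (B f w \<otimes> y)) \<otimes> s" using R AR[OF BeA[OF f w(1)]] by algebra
   then have "lsum U z' (B f) = lsum ?U z (?C f)" unfolding e eqs[OF f]
    using zR R AR[OF BeA[OF f w(1)]] by (simp add: a_comm)
   then show ?thesis using z(3) fE by simp
  qed
  moreover have "\<forall>u\<in>U. z' u \<in> A" using z z'w unfolding z'_def by auto
  moreover have "\<exists>u\<in>U. z' u \<notin> I" using z(2) unfolding z'_def by auto
  ultimately show ?thesis by blast
 qed
qed

text \<open>If J' were larger than J, some combination w of the b', non-trivial modulo p, would be
  orthogonal modulo p to all b i. Then w is orthogonal to M, so it is in N', against the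
  independence of the b'. Applied in both directions this gives equal dimensions.\<close>

lemma pairing_card_le:
 assumes mx: "mxi A p"
  and rM: "rbasis R A p M N J b" and rM': "rbasis R A p M' N' J' b'"
  and BA: "\<And>u w. [|u \<in> M; w \<in> M'|] ==> B u w \<in> A"
  and M': "\<And>c. (\<And>j. j \<in> J' ==> c j \<in> A) ==> lsum J' c b' \<in> M'"
  and Bw: "\<And>u c. [|u \<in> M; \<And>j. j \<in> J' ==> c j \<in> A|] ==> B u (lsum J' c b') = lsum J' c (\<lambda>j. B u (b' j))"
  and Bu: "\<And>c n w. [|\<And>i. i \<in> J ==> c i \<in> A; n \<in> N; w \<in> M'|] ==> B (lsum J c b \<oplus> n) w = lsum J c (\<lambda>i. B (b i) w) \<oplus> B n w"
  and BN: "\<And>n w. [|n \<in> N; w \<in> M'|] ==> B n w \<in> p"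
  and nd: "\<And>w. [|w \<in> M'; \<And>u. u \<in> M ==> B u w \<in> p|] ==> w \<in> N'"
 shows "card J' \<le> card J"
proof (rule ccontr)
 assume "\<not> card J' \<le> card J"
 then have lt: "card J < card J'" by simp
 note J = rbasis_D[OF rM] and J' = rbasis_D[OF rM'] and A = mxi_D[OF mx]
 obtain z where z: "\<forall>j\<in>J'. z j \<in> A" "\<exists>j\<in>J'. z j \<notin> p" "\<forall>i\<in>J. lsum J' z (\<lambda>j. B (b i) (b' j)) \<in> p"
  using linear_system[OF mx J(1) J'(1) lt, of "\<lambda>i j. B (b i) (b' j)"] BA J(2) J'(2) by blast
 define w where "w = lsum J' z b'"
 have zA: "\<And>j. j \<in> J' ==> z j \<in> A" using z(1) by blast
 have w: "w \<in> M'" unfolding w_def by (rule M'[OF zA])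
 have Bb: "B (b i) w \<in> p" if "i \<in> J" for i unfolding w_def using Bw[OF J(2)[OF that] zA] z(3) that by simp
 have "w \<in> N'"
 proof (rule nd[OF w])
  fix u assume u: "u \<in> M"
  then obtain c n where c: "\<forall>i\<in>J. c i \<in> A" "n \<in> N" "u = lsum J c b \<oplus> n" using J(3) by blast
  have "B u w = lsum J c (\<lambda>i. B (b i) w) \<oplus> B n w" unfolding c(3) by (rule Bu) (use c w in auto)
  moreover have "lsum J c (\<lambda>i. B (b i) w) \<in> p" by (rule lsum_mem[OF A(2) J(1)]) (use c Bb A(5) in auto)
  ultimately show "B u w \<in> p" using BN[OF c(2) w] smodD(3)[OF A(2)] by simp
 qed
 then have "lsum J' z b' \<in> N'" unfolding w_def .
 then have "z j \<in> p" if "j \<in> J'" for j using J'(4)[of z j] zA that \<open>lsum J' z b' \<in> N'\<close> by blast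
 then show False using z(2) by blast
qed

end

section \<open>Lattices over a Dedekind domain\<close>

lemma (in noetherian_ring) exists_maximal_above:
 assumes I: "ideal I R" "I \<noteq> carrier R"
 shows "\<exists>m. maximalideal m R \<and> I \<subseteq> m"
proof -
 define F where "F = {J. ideal J R \<and> I \<subseteq> J \<and> J \<noteq> carrier R}"
 have "\<exists>M\<in>F. \<forall>J\<in>F. M \<subseteq> J --> J = M"
 proof (rule subset_Zorn_nonempty)
  show "F \<noteq> {}" unfolding F_def using I by blast
  fix C assume C: "C \<noteq> {}" "subset.chain F C"
  have CF: "C \<subseteq> F" using C(2) by (simp add: subset_chain_def)
  have "F \<subseteq> {I. ideal I R}" unfolding F_def by blast
  then have "subset.chain {I. ideal I R} C" using C(2) CF by (auto simp: subset_chain_def)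
  then have "\<Union>C \<in> C" by (rule ideal_chain_is_trivial[OF C(1)])
  then show "\<Union>C \<in> F" using CF by (rule rev_subsetD)
 qed
 then obtain m where mF: "m \<in> F" and mx: "\<forall>J\<in>F. m \<subseteq> J --> J = m" by blast
 have m: "ideal m R" "I \<subseteq> m" "m \<noteq> carrier R" using mF unfolding F_def by auto
 have "maximalideal m R"
 proof (rule maximalidealI[OF m(1)])
  show "carrier R \<noteq> m" using m(3) by simp
  fix J assume J: "ideal J R" "m \<subseteq> J" "J \<subseteq> carrier R"
  show "J = m \<or> J = carrier R"
  proof (rule ccontr)
   assume n: "\<not> (J = m \<or> J = carrier R)"
   then have "J \<in> F" unfolding F_def using J m(2) by simp
   then show False using mx J(2) n by blast
  qed
 qed
 then show ?thesis using m(2) by blast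
qed

lemma (in cring) ball_prod_notin:
 assumes mx: "mxi A I" and "finite B" "\<And>v. v \<in> B ==> \<exists>r\<in>A. r \<notin> I \<and> T r v"
  and "\<And>r s v. [|r \<in> A; s \<in> A; v \<in> B; T r v|] ==> T (s \<otimes> r) v"
 shows "\<exists>r\<in>A. r \<notin> I \<and> (\<forall>v\<in>B. T r v)"
 using assms(2-)
proof (induction B rule: finite_induct)
 case empty then show ?case using mxi_D(4)[OF mx] subringE(3)[OF mxi_D(1)[OF mx]] by blast
next
 case (insert b B)
 note T = insert.prems(2)
 have "\<exists>r\<in>A. r \<notin> I \<and> (\<forall>v\<in>B. T r v)" by (rule insert.IH) (use insert.prems in auto)
 then obtain r where r: "r \<in> A" "r \<notin> I" "\<forall>v\<in>B. T r v" by blast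
 obtain s where s: "s \<in> A" "s \<notin> I" "T s b" using insert.prems by blast
 have AR: "r \<in> carrier R" "s \<in> carrier R" using r s mxi_D(5)[OF mx] by auto
 have sr: "s \<otimes> r \<in> A" by (rule subringE(6)[OF mxi_D(1)[OF mx] s(1) r(1)])
 have "s \<otimes> r \<notin> I" using mxi_D(7)[OF mx s(1) r(1)] r(2) s(2) by blast
 moreover have "T (s \<otimes> r) v" if "v \<in> insert b B" for v
 proof (cases "v = b")
  case True
  then show ?thesis using T[OF s(1) r(1) _ s(3)] m_comm[OF AR] by simp
 next
  case False
  then show ?thesis using T[OF r(1) s(1) that] r(3) that by blast
 qed
 ultimately show ?case using sr by blast
qed

locale dedekind_algebra = cring K for K (structure) +
 fixes Q Z
 assumes dk: "dedekind_with_fractions K Q Z"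
begin

lemma Qf: "subfield Q K" and Zs: "subring Z K" and ZQ: "Z \<subseteq> Q"
 and frac: "x \<in> Q ==> \<exists>a\<in>Z. \<exists>b\<in>Z - {\<zero>}. x \<otimes> b = a"
 and noethZ': "noetherian_domain (K\<lparr>carrier := Z\<rparr>)"
 and intcl: "[|x \<in> Q; integral_over K Z x|] ==> x \<in> Z"
 and prime_max: "[|primeideal P (K\<lparr>carrier := Z\<rparr>); P \<noteq> {\<zero>}|] ==> maximalideal P (K\<lparr>carrier := Z\<rparr>)"
 and Z_notfield: "\<not> field (K\<lparr>carrier := Z\<rparr>)"
 using dk unfolding dedekind_with_fractions_def by blast+

lemma noethZ: "noeth Z"
 using noethZ' noetherian_ring_iff[OF Zs] by (simp add: noetherian_domain_def)

lemma ZK: "Z \<subseteq> carrier K" by (rule subringE(1)[OF Zs])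
lemma Qs: "subring Q K" by (rule subfieldE(1)[OF Qf])
lemma QK: "Q \<subseteq> carrier K" by (rule subringE(1)[OF Qs])
lemma ZK': "z \<in> Z ==> z \<in> carrier K" using ZK by blast
lemma QK': "z \<in> Q ==> z \<in> carrier K" using QK by blast
lemma ZQ': "z \<in> Z ==> z \<in> Q" using ZQ by blast
lemmas Zcl = subringE(2,3,5,6,7)[OF Zs]
lemmas Qcl = subringE(2,3,5,6,7)[OF Qs]

lemma one_nz: "\<one> \<noteq> \<zero>"
 using domain.one_not_zero[OF field.axioms(1)[OF subfield_iff(2)[OF Qf]]] by simp

lemma Q_inv: "[|x \<in> Q; x \<noteq> \<zero>|] ==> \<exists>y\<in>Q. y \<noteq> \<zero> \<and> x \<otimes> y = \<one>"
 using subfield_m_inv[OF Qf, of x] by blast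

lemma nz_cancel: "[|d \<in> Q; d \<noteq> \<zero>; x \<in> carrier K; y \<in> carrier K; d \<otimes> x = d \<otimes> y|] ==> x = y"
proof -
 assume d: "d \<in> Q" "d \<noteq> \<zero>" and x: "x \<in> carrier K" "y \<in> carrier K" and e: "d \<otimes> x = d \<otimes> y"
 obtain i where i: "i \<in> Q" "d \<otimes> i = \<one>" using Q_inv[OF d] by blast
 have dR: "d \<in> carrier K" "i \<in> carrier K" using d i QK by auto
 have "x = (d \<otimes> i) \<otimes> x" using x i by simp
 also have "\<dots> = i \<otimes> (d \<otimes> x)" using x dR by (simp add: m_ac)
 also have "\<dots> = (d \<otimes> i) \<otimes> y" unfolding e using x dR by (simp add: m_ac)
 finally show "x = y" using x i by simp
qed

lemma Q_nz_mult: "[|d \<in> Q; d \<noteq> \<zero>; x \<in> carrier K; d \<otimes> x = \<zero>|] ==> x = \<zero>"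
 using nz_cancel[of d x \<zero>] QK by auto

lemma Z_nz_mult: "[|d \<in> Z; d \<noteq> \<zero>; e \<in> Z; e \<noteq> \<zero>|] ==> d \<otimes> e \<in> Z \<and> d \<otimes> e \<noteq> \<zero>"
 using Q_nz_mult[of d e] Zcl(4) ZQ ZK by blast

lemma common_den:
 "[|finite J; \<And>i. i \<in> J ==> c i \<in> Q|] ==> \<exists>d\<in>Z. d \<noteq> \<zero> \<and> (\<forall>i\<in>J. d \<otimes> c i \<in> Z)"
proof (induction J rule: finite_induct)
 case empty then show ?case using Zcl(2) one_nz by blast
next
 case (insert j J)
 obtain d where d: "d \<in> Z" "d \<noteq> \<zero>" "\<forall>i\<in>J. d \<otimes> c i \<in> Z" using insert by blast
 obtain a b where ab: "a \<in> Z" "b \<in> Z" "b \<noteq> \<zero>" "c j \<otimes> b = a" using frac[of "c j"] insert.prems by blast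
 have R: "d \<in> carrier K" "b \<in> carrier K" "\<And>i. i \<in> insert j J ==> c i \<in> carrier K" using d ab ZK QK insert.prems by auto
 have "(d \<otimes> b) \<otimes> c i \<in> Z" if i: "i \<in> insert j J" for i
 proof (cases "i = j")
  case True
  have "(d \<otimes> b) \<otimes> c j = d \<otimes> a" unfolding ab(4)[symmetric] using R by (simp add: m_ac)
  then show ?thesis using True Zcl(4)[OF d(1) ab(1)] by simp
 next
  case False
  then have "(d \<otimes> b) \<otimes> c i = b \<otimes> (d \<otimes> c i)" using R i by (simp add: m_ac)
  moreover have "d \<otimes> c i \<in> Z" using d(3) i False by blast
  ultimately show ?thesis using Zcl(4)[OF ab(2)] by simp
 qed
 then show ?case using Z_nz_mult[OF d(1,2) ab(2,3)] by blast
qed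

subsection \<open>Integral elements\<close>

definition pspan where "pspan x n = spn Z ((\<lambda>i. x [^] i) ` {..<n::nat})"

lemma pspan_smod: "x \<in> carrier K ==> smod Z (pspan x n)"
 unfolding pspan_def by (rule spn_smod[OF Zs]) auto

lemma pspan_Suc: "x \<in> carrier K ==> pspan x (Suc n) = {c \<otimes> x [^] n \<oplus> y | c y. c \<in> Z \<and> y \<in> pspan x n}"
 unfolding pspan_def lessThan_Suc image_insert by (rule spn_insert[OF Zs]) auto

lemma pspan_mono: "x \<in> carrier K ==> pspan x n \<subseteq> pspan x (Suc n)"
 unfolding pspan_def by (rule spn_mono[OF Zs]) (use spn_superset[of "(\<lambda>i. x [^] i) ` {..<Suc n}" Z] in fastforce)+

lemma pspan_eval: "x \<in> carrier K ==> pspan x n = {eval p x | p. length p = n \<and> set p \<subseteq> Z}"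
proof (induction n)
 case 0 then show ?case using spn_empty[OF Zs] by (auto simp: pspan_def)
next
 case (Suc n)
 have "{c \<otimes> x [^] n \<oplus> y | c y. c \<in> Z \<and> y \<in> pspan x n} = {eval p x | p. length p = Suc n \<and> set p \<subseteq> Z}" (is "?l = ?r")
 proof (intro equalityI subsetI)
  fix u assume "u \<in> ?l"
  then obtain c p where "c \<in> Z" "length p = n" "set p \<subseteq> Z" "u = c \<otimes> x [^] n \<oplus> eval p x"
   unfolding Suc.IH[OF Suc.prems] by blast
  then have "u = eval (c # p) x" "length (c # p) = Suc n" "set (c # p) \<subseteq> Z" by auto
  then show "u \<in> ?r" by blast
 next
  fix u assume "u \<in> ?r"
  then obtain p where p: "length p = Suc n" "set p \<subseteq> Z" "u = eval p x" by blast
  then obtain c p' where cp: "p = c # p'" by (cases p) auto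
  then have "u = c \<otimes> x [^] n \<oplus> eval p' x" "c \<in> Z" "length p' = n" "set p' \<subseteq> Z" using p by auto
  then show "u \<in> ?l" unfolding Suc.IH[OF Suc.prems] by blast
 qed
 then show ?case using pspan_Suc[OF Suc.prems] by simp
qed

text \<open>A monic equation expresses a power of x through the lower ones. In this form integrality
  concerns spans of powers and can be derived from finite generation without determinants.\<close>

lemma integral_iff: "x \<in> carrier K ==> integral_over K Z x \<longleftrightarrow> (\<exists>n. x [^] n \<in> pspan x n)"
proof
 assume x: "x \<in> carrier K" and "integral_over K Z x"
 then obtain p where p: "p \<in> carrier (univ_poly K Z)" "p \<noteq> []" "hd p = \<one>" "eval p x = \<zero>"
  unfolding integral_over_def by blast
 obtain q where q: "p = \<one> # q" using p(2,3) by (cases p) auto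
 have "set p \<subseteq> Z" using p(1,2) unfolding univ_poly_def polynomial_def by auto
 then have qZ: "set q \<subseteq> Z" using q by auto
 have e: "eval q x \<in> pspan x (length q)" unfolding pspan_eval[OF x] using qZ by blast
 have eR: "eval q x \<in> carrier K" using smodD(1)[OF pspan_smod[OF x] e] .
 have "x [^] length q \<oplus> eval q x = \<zero>" using p(4) x unfolding q by simp
 then have "x [^] length q = \<ominus> eval q x" using x eR by (simp add: sum_zero_eq_neg)
 then show "\<exists>n. x [^] n \<in> pspan x n" using smod_minus(1)[OF pspan_smod[OF x] Zs e] by metis
next
 assume x: "x \<in> carrier K" and "\<exists>n. x [^] n \<in> pspan x n"
 then obtain n where n: "x [^] n \<in> pspan x n" by blast
 then have "\<ominus> (x [^] n) \<in> pspan x n" by (rule smod_minus(1)[OF pspan_smod[OF x] Zs])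
 then obtain q where q: "\<ominus> (x [^] n) = eval q x" "length q = n" "set q \<subseteq> Z" unfolding pspan_eval[OF x] by blast
 have "eval (\<one> # q) x = \<zero>" using q x by (simp flip: q(1) add: r_neg)
 moreover have "\<one> # q \<in> carrier (univ_poly K Z)"
  unfolding univ_poly_def polynomial_def using q(3) Zcl(2) one_nz by auto
 ultimately show "integral_over K Z x" unfolding integral_over_def by (intro bexI[of _ "\<one> # q"]) auto
qed

text \<open>After division by d the module contains 1 and hence all powers of x. By the Noetherian
  property the spans of the first n powers become stationary, which is an integral equation.\<close>

lemma integralI:
 assumes x: "x \<in> carrier K" and L: "fg Z L" "\<And>y. y \<in> L ==> x \<otimes> y \<in> L" and d: "d \<in> L" "d \<in> Q" "d \<noteq> \<zero>"
 shows "integral_over K Z x"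
proof -
 note Ls = fg_smod[OF Zs L(1)]
 obtain e where e: "e \<in> Q" "d \<otimes> e = \<one>" using Q_inv[OF d(2,3)] by blast
 have R: "e \<in> carrier K" "d \<in> carrier K" using e d QK by auto
 have pow: "x [^] (n::nat) \<otimes> d \<in> L" for n
 proof (induction n)
  case (Suc n)
  have "x [^] Suc n \<otimes> d = x \<otimes> (x [^] n \<otimes> d)" using x R by (simp add: m_ac)
  then show ?case using L(2)[OF Suc] by simp
 qed (use d R in simp)
 \<comment> \<open>L divided by d, where e is the inverse of d in Q.\<close>
 let ?L = "(\<lambda>y. e \<otimes> y) ` L"
 have fL: "fg Z ?L" by (rule fg_smult[OF Zs R(1) L(1)])
 have powL: "x [^] (n::nat) \<in> ?L" for n
 proof -
  have "x [^] n = e \<otimes> (x [^] n \<otimes> d)"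
  proof -
   have "e \<otimes> (x [^] n \<otimes> d) = (d \<otimes> e) \<otimes> x [^] n" using x R by (simp add: m_ac)
   then show ?thesis using e x by simp
  qed
  then show ?thesis using pow by blast
 qed
 have sub: "pspan x n \<subseteq> ?L" for n
  unfolding pspan_def by (rule spn_least[OF fg_smod[OF Zs fL]]) (use powL in auto)
 let ?M = "\<Union>n. pspan x n"
 have mono: "pspan x m \<subseteq> pspan x n" if "m \<le> n" for m n
  using lift_Suc_mono_le[of "pspan x", OF pspan_mono[OF x] that] .
 have sM: "smod Z ?M"
 proof (rule smodI)
  show "?M \<subseteq> carrier K" using smodD(1)[OF pspan_smod[OF x]] by blast
  show "\<zero> \<in> ?M" using smodD(2)[OF pspan_smod[OF x, of 0]] by blast
  show "u \<oplus> v \<in> ?M" if uv: "u \<in> ?M" "v \<in> ?M" for u v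
  proof -
   obtain m n where mn: "u \<in> pspan x m" "v \<in> pspan x n" using uv by blast
   then have "u \<in> pspan x (max m n)" "v \<in> pspan x (max m n)" using mono[of m "max m n"] mono[of n "max m n"] by auto
   then show ?thesis using smodD(3)[OF pspan_smod[OF x]] by blast
  qed
  show "a \<otimes> u \<in> ?M" if "a \<in> Z" "u \<in> ?M" for a u using that smodD(4)[OF pspan_smod[OF x]] by blast
 qed
 have "fg Z ?M" by (rule noeth_fg[OF Zs noethZ fL sM]) (use sub in blast)
 then obtain n where n: "?M = pspan x n"
  using fg_directed[where F = "pspan x" and M = ?M, OF Zs _ pspan_smod[OF x] pspan_mono[OF x] refl] by blast
 have "x [^] n \<in> pspan x (Suc n)" unfolding pspan_def using spn_superset[of "(\<lambda>i. x [^] i) ` {..<Suc n}" Z] by auto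
 then have "x [^] n \<in> pspan x n" using n by blast
 then show ?thesis using integral_iff[OF x] by blast
qed

lemma smod_mult_vimage: "[|smod Z M; w \<in> carrier K|] ==> smod Z {v \<in> carrier K. w \<otimes> v \<in> M}"
proof (rule smodI)
 assume M: "smod Z M" and w: "w \<in> carrier K"
 show "\<zero> \<in> {v \<in> carrier K. w \<otimes> v \<in> M}" using w smodD(2)[OF M] by simp
 show "x \<oplus> y \<in> {v \<in> carrier K. w \<otimes> v \<in> M}"
  if "x \<in> {v \<in> carrier K. w \<otimes> v \<in> M}" "y \<in> {v \<in> carrier K. w \<otimes> v \<in> M}" for x y
  using that w smodD(3)[OF M] by (simp add: r_distr)
 show "a \<otimes> x \<in> {v \<in> carrier K. w \<otimes> v \<in> M}" if "a \<in> Z" "x \<in> {v \<in> carrier K. w \<otimes> v \<in> M}" for a x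
 proof -
  have "w \<otimes> (a \<otimes> x) = a \<otimes> (w \<otimes> x)" using that w ZK by (intro m_lcomm) auto
  then show ?thesis using that smodD(4)[OF M] ZK by auto
 qed
qed blast

text \<open>The module spanned by the monomials in x and y below the degrees of the two equations is
  stable under both, which yields integrality of sums and products.\<close>

lemma integral_pair:
 assumes x: "x \<in> carrier K" "integral_over K Z x" and y: "y \<in> carrier K" "integral_over K Z y"
 shows "\<exists>L. fg Z L \<and> \<one> \<in> L \<and> (\<forall>u\<in>L. x \<otimes> u \<in> L \<and> y \<otimes> u \<in> L)"
proof -
 obtain n m where n: "x [^] n \<in> pspan x n" and m: "y [^] m \<in> pspan y m"
  using integral_iff x y by blast
 \<comment> \<open>The degrees are positive because 1 \<noteq> 0; this is what puts the monomial 1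
   among the generators.\<close>
 have pos: "k > 0" if "z \<in> carrier K" "z [^] k \<in> pspan z k" for z and k :: nat
 proof (rule ccontr)
  assume "\<not> k > 0"
  then show False using that spn_empty[OF Zs] one_nz unfolding pspan_def by simp
 qed
 let ?B = "(\<lambda>(i, j). x [^] i \<otimes> y [^] j) ` ({..<n} \<times> {..<m})"
 define L where "L = spn Z ?B"
 have B: "finite ?B" "?B \<subseteq> carrier K" using x y by auto
 have Ls: "smod Z L" unfolding L_def by (rule spn_smod[OF Zs B(2)])
 have BL: "x [^] i \<otimes> y [^] j \<in> L" if "i < n" "j < m" for i j
  unfolding L_def using spn_superset[of ?B Z] that by auto
 have xn: "x [^] n \<otimes> y [^] j \<in> L" if j: "j < m" for j
 proof -
  have "pspan x n \<subseteq> {v \<in> carrier K. y [^] j \<otimes> v \<in> L}"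
   unfolding pspan_def by (rule spn_least[OF smod_mult_vimage[OF Ls]]) (use x y BL j in \<open>auto simp: m_comm\<close>)
  then show ?thesis using n x y by (auto simp: m_comm)
 qed
 have ym: "x [^] i \<otimes> y [^] m \<in> L" if i: "i < n" for i
 proof -
  have "pspan y m \<subseteq> {v \<in> carrier K. x [^] i \<otimes> v \<in> L}"
   unfolding pspan_def by (rule spn_least[OF smod_mult_vimage[OF Ls]]) (use x y BL i in auto)
  then show ?thesis using m by auto
 qed
 have "L \<subseteq> {v \<in> carrier K. x \<otimes> v \<in> L}"
  unfolding L_def[of]
 proof (rule spn_least[OF smod_mult_vimage[OF Ls[unfolded L_def] x(1)]], rule subsetI)
  fix u assume "u \<in> ?B"
  then obtain i j where ij: "i < n" "j < m" "u = x [^] i \<otimes> y [^] j" by auto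
  have "x \<otimes> u = x [^] Suc i \<otimes> y [^] j" unfolding ij(3) using x y by (simp add: m_ac)
  moreover have "x [^] Suc i \<otimes> y [^] j \<in> L"
   using BL[of "Suc i" j] xn[of j] ij by (cases "Suc i = n") (auto simp del: nat_pow_Suc)
  ultimately show "u \<in> {v \<in> carrier K. x \<otimes> v \<in> spn Z ?B}" unfolding L_def using ij x y by auto
 qed
 moreover have "L \<subseteq> {v \<in> carrier K. y \<otimes> v \<in> L}"
  unfolding L_def[of]
 proof (rule spn_least[OF smod_mult_vimage[OF Ls[unfolded L_def] y(1)]], rule subsetI)
  fix u assume "u \<in> ?B"
  then obtain i j where ij: "i < n" "j < m" "u = x [^] i \<otimes> y [^] j" by auto
  have "y \<otimes> u = x [^] i \<otimes> y [^] Suc j" unfolding ij(3) using x y by (simp add: m_ac)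
  moreover have "x [^] i \<otimes> y [^] Suc j \<in> L"
   using BL[of i "Suc j"] ym[of i] ij by (cases "Suc j = m") (auto simp del: nat_pow_Suc)
  ultimately show "u \<in> {v \<in> carrier K. y \<otimes> v \<in> spn Z ?B}" unfolding L_def using ij x y by auto
 qed
 moreover have "\<one> \<in> L" using BL[of 0 0] pos[OF x(1) n] pos[OF y(1) m] by simp
 moreover have "fg Z L" unfolding fg_def L_def using B by blast
 ultimately show ?thesis by blast
qed

abbreviation OK where "OK \<equiv> maximal_order K Z"

lemma OK_iff: "x \<in> OK \<longleftrightarrow> x \<in> carrier K \<and> integral_over K Z x" by (simp add: maximal_order_def)

lemma one_Q: "\<one> \<in> Q" by (rule Qcl(2))

lemma OK_subring: "subring OK K"
proof (rule subringI)
 show "OK \<subseteq> carrier K" by (auto simp: OK_iff)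
 have fZ: "fg Z Z" using noethZ smod_self[OF Zs] unfolding noeth_def by blast
 have Z: "z \<in> OK" if "z \<in> Z" for z
  unfolding OK_iff using integralI[OF ZK'[OF that] fZ _ Zcl(2) one_Q one_nz] Zcl(4)[OF that] ZK'[OF that] by blast
 show "\<one> \<in> OK" using Z Zcl(2) by blast
 have two: "u \<oplus> v \<in> OK \<and> u \<otimes> v \<in> OK" if uv: "u \<in> OK" "v \<in> OK" for u v
 proof -
  have R: "u \<in> carrier K" "v \<in> carrier K" using uv by (auto simp: OK_iff)
  obtain L where L: "fg Z L" "\<one> \<in> L" "\<forall>w\<in>L. u \<otimes> w \<in> L \<and> v \<otimes> w \<in> L"
   using integral_pair[of u v] uv unfolding OK_iff by blast
  note Ls = fg_smod[OF Zs L(1)]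
  have "(u \<oplus> v) \<otimes> w \<in> L" if "w \<in> L" for w
   using L(3) that smodD(3)[OF Ls] smodD(1)[OF Ls that] R by (simp add: l_distr)
  moreover have "(u \<otimes> v) \<otimes> w \<in> L" if "w \<in> L" for w
   using L(3) that smodD(1)[OF Ls that] R by (simp add: m_assoc)
  ultimately show ?thesis unfolding OK_iff using integralI[OF _ L(1) _ L(2) one_Q one_nz] R by (meson a_closed m_closed)
 qed
 show "u \<oplus> v \<in> OK" "u \<otimes> v \<in> OK" if "u \<in> OK" "v \<in> OK" for u v using two that by auto
 show "\<ominus> u \<in> OK" if u: "u \<in> OK" for u
 proof -
  have "\<ominus> \<one> \<in> OK" using Z Zcl(2,3) by blast
  then have "\<ominus> \<one> \<otimes> u \<in> OK" using two u by blast
  then show ?thesis using u by (simp add: OK_iff l_minus)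
 qed
qed

lemma Z_OK: "Z \<subseteq> OK"
proof
 fix z assume z: "z \<in> Z"
 have "fg Z Z" using noethZ smod_self[OF Zs] unfolding noeth_def by blast
 then show "z \<in> OK"
  unfolding OK_iff using integralI[OF ZK'[OF z] _ _ Zcl(2) one_Q one_nz] Zcl(4)[OF z] ZK'[OF z] by blast
qed

lemma OK_Q: "x \<in> OK ==> x \<in> Q ==> x \<in> Z" using intcl by (auto simp: OK_iff)

subsection \<open>Localization at a prime of the base\<close>

definition bp where "bp p \<longleftrightarrow> p \<in> base_primes K Z"

lemma bp_mxi: "bp p ==> mxi Z p"
 unfolding bp_def base_primes_def mxi_def using Zs prime_max by blast

lemma bp_nz: "bp p ==> \<exists>a\<in>p. a \<noteq> \<zero>"
proof -
 assume p: "bp p"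
 have "\<zero> \<in> p" using smodD(2)[OF mxi_D(2)[OF bp_mxi[OF p]]] .
 then show ?thesis using p unfolding bp_def base_primes_def by blast
qed

lemma completed_Z: "bp p ==> completed p (K\<lparr>carrier := Z\<rparr>)"
 by (rule completed.intro) (use bp_mxi cring_sub[OF Zs] in \<open>auto simp: mxi_def\<close>)

text \<open>Non-zero primes of Z are maximal, so no prime other than p contains a and lies inside
  p.\<close>

lemma power_dvd_Z:
 assumes p: "bp p" and a: "a \<in> p" "a \<noteq> \<zero>"
 shows "\<exists>t\<in>Z. t \<notin> p \<and> (\<exists>n. \<forall>x\<in>completed.Pn p (K\<lparr>carrier := Z\<rparr>) n. \<exists>y\<in>Z. t \<otimes> x = a \<otimes> y)"
proof -
 note A = mxi_D[OF bp_mxi[OF p]]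
 have max: "maximalideal p (K\<lparr>carrier := Z\<rparr>)" using bp_mxi[OF p] unfolding mxi_def by blast
 have "\<not> q \<subseteq> p" if q: "primeideal q (K\<lparr>carrier := Z\<rparr>)" "a \<in> q" "q \<noteq> p" for q
 proof
  assume s: "q \<subseteq> p"
  have "maximalideal q (K\<lparr>carrier := Z\<rparr>)" using prime_max[OF q(1)] q(2) a(2) by blast
  moreover have "ideal p (K\<lparr>carrier := Z\<rparr>)" "p \<noteq> carrier (K\<lparr>carrier := Z\<rparr>)"
   using maximalideal.axioms(1)[OF max] maximalideal.I_notcarr[OF max] by auto
  ultimately show False using maximalideal.I_maximal[of q "K\<lparr>carrier := Z\<rparr>" p] s q(3) A(3) by auto
 qed
 then show ?thesis
  using completed.power_dvd_locally[OF completed_Z[OF p], of a] noetherian_ring_iff[OF Zs] noethZ a A(3) by auto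
qed

text \<open>A socle element x modulo \<open>a0\<close> gives \<beta> = x/a0 outside Z with \<beta> p
  inside Z. Not all of \<beta> p lies in p, for otherwise \<beta> would be integral and hence in Z.
  So some a in p has s = \<beta> a outside p, and s x = a (\<beta> x) for every x in p.\<close>

lemma local_generator:
 assumes p: "bp p"
 shows "\<exists>a\<in>p. \<exists>s\<in>Z. s \<notin> p \<and> a \<noteq> \<zero> \<and> (\<forall>x\<in>p. \<exists>y\<in>Z. s \<otimes> x = a \<otimes> y)"
proof -
 note A = mxi_D[OF bp_mxi[OF p]]
 obtain a0 where a0: "a0 \<in> p" "a0 \<noteq> \<zero>" using bp_nz[OF p] by blast
 have a0Z: "a0 \<in> Z" "a0 \<in> Q" "a0 \<in> carrier K" using a0 A(3) ZQ ZK by auto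
 obtain t n where t: "t \<in> Z" "t \<notin> p" "\<forall>x\<in>completed.Pn p (K\<lparr>carrier := Z\<rparr>) n. \<exists>y\<in>Z. t \<otimes> x = a0 \<otimes> y"
  using power_dvd_Z[OF p a0] by blast
 have cn: "completed_nzd p (K\<lparr>carrier := Z\<rparr>) a0 t n"
  by (rule completed_nzd.intro[OF completed_Z[OF p] completed_nzd_axioms.intro])
   (use a0 t Q_nz_mult[OF a0Z(2) a0(2)] ZK in auto)
 note rx = completed_nzd.residue_ext_R[OF cn]
 obtain x where x: "x \<in> residue_ext.cm p (K\<lparr>carrier := Z\<rparr>) a0" "x \<notin> residue_ext.pa (K\<lparr>carrier := Z\<rparr>) a0"
  using completed_nzd.socle_nontrivial[OF cn] by blast
 have xZ: "x \<in> Z" using residue_ext.cm_R[OF rx x(1)] by simp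
 have xp: "\<exists>z\<in>Z. x \<otimes> y = a0 \<otimes> z" if "y \<in> p" for y
  using residue_ext.cm_mult[OF rx x(1) that] residue_ext.pa_iff[OF rx] by simp
 have xn: "\<not> (\<exists>z\<in>Z. x = a0 \<otimes> z)" using x(2) residue_ext.pa_iff[OF rx] by simp
 obtain e where e: "e \<in> Q" "a0 \<otimes> e = \<one>" using Q_inv[OF a0Z(2) a0(2)] by blast
 define \<beta> where "\<beta> = x \<otimes> e"
 have \<beta>Q: "\<beta> \<in> Q" unfolding \<beta>_def using Qcl(4) ZQ xZ e by blast
 have R: "x \<in> carrier K" "e \<in> carrier K" "\<beta> \<in> carrier K" using xZ ZK e QK \<beta>Q by auto
 have a\<beta>: "a0 \<otimes> \<beta> = x"
 proof -
  have "a0 \<otimes> \<beta> = (a0 \<otimes> e) \<otimes> x" unfolding \<beta>_def using R a0Z by (simp add: m_ac)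
  then show ?thesis using e R by simp
 qed
 have \<beta>Z: "\<beta> \<notin> Z" using xn a\<beta> by blast
 have \<beta>p: "\<beta> \<otimes> y \<in> Z" if y: "y \<in> p" for y
 proof -
  obtain z where z: "z \<in> Z" "x \<otimes> y = a0 \<otimes> z" using xp[OF y] by blast
  have yR: "y \<in> carrier K" using y A(3) ZK by auto
  have "a0 \<otimes> (\<beta> \<otimes> y) = a0 \<otimes> z" using z(2) a\<beta> R(3) yR a0Z by (metis m_assoc)
  then have "\<beta> \<otimes> y = z" using nz_cancel[OF a0Z(2) a0(2)] R(3) yR ZK'[OF z(1)] by blast
  then show ?thesis using z by simp
 qed
 have "\<not> (\<forall>y\<in>p. \<beta> \<otimes> y \<in> p)"
 proof
  assume "\<forall>y\<in>p. \<beta> \<otimes> y \<in> p"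
  moreover have "fg Z p" using noethZ A(2,3) unfolding noeth_def by blast
  ultimately have "integral_over K Z \<beta>" using integralI[OF R(3) _ _ a0(1) a0Z(2) a0(2)] by blast
  then show False using intcl[OF \<beta>Q] \<beta>Z by blast
 qed
 then obtain a where a: "a \<in> p" "\<beta> \<otimes> a \<notin> p" by blast
 define s where "s = \<beta> \<otimes> a"
 have aR: "a \<in> carrier K" using a(1) A(3) ZK by auto
 have "a \<noteq> \<zero>" using a(2) R(3) smodD(2)[OF A(2)] by auto
 moreover have "\<exists>y\<in>Z. s \<otimes> x = a \<otimes> y" if "x \<in> p" for x
 proof -
  have "x \<in> carrier K" using that A(3) ZK by auto
  then have "s \<otimes> x = a \<otimes> (\<beta> \<otimes> x)" unfolding s_def using R aR by (simp add: m_ac)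
  then show ?thesis using \<beta>p[OF that] by blast
 qed
 ultimately show ?thesis using a \<beta>p[OF a(1)] unfolding s_def by blast
qed

lemma pow_nat_Pn: "bp p ==> a \<in> p ==> a [^] (n::nat) \<in> completed.Pn p (K\<lparr>carrier := Z\<rparr>) n"
proof (induction n)
 case 0
 then show ?case using completed.Pn_0[OF completed_Z] Zcl(2) by auto
next
 case (Suc n)
 then have "a [^] n \<otimes>\<^bsub>K\<lparr>carrier := Z\<rparr>\<^esub> a \<in> ideal_prod (K\<lparr>carrier := Z\<rparr>) (completed.Pn p (K\<lparr>carrier := Z\<rparr>) n) p"
  by (intro ideal_prod.prod) auto
 then show ?case using completed.Pn_Suc[OF completed_Z[OF Suc.prems(1)]] by simp
qed

text \<open>Locally p is generated by one element a, as in a discrete valuation ring; a common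
  factor a is cancelled from x and y until one of them leaves p.\<close>

lemma valuation:
 assumes p: "bp p" and x: "x \<in> Z" and y: "y \<in> Z"
 shows "\<exists>r\<in>Z. r \<notin> p \<and> ((\<exists>u\<in>Z. r \<otimes> x = y \<otimes> u) \<or> (\<exists>u\<in>Z. r \<otimes> y = x \<otimes> u))"
proof (cases "x = \<zero>")
 case True
 have "\<one> \<otimes> x = y \<otimes> \<zero>" using True y ZK' by simp
 then show ?thesis using Zcl(1,2) mxi_D(4)[OF bp_mxi[OF p]] by blast
next
 case False
 note A = mxi_D[OF bp_mxi[OF p]]
 obtain a s where as: "a \<in> p" "s \<in> Z" "s \<notin> p" "a \<noteq> \<zero>" "\<And>x. x \<in> p ==> \<exists>y\<in>Z. s \<otimes> x = a \<otimes> y"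
  using local_generator[OF p] by blast
 have aZ: "a \<in> Z" "a \<in> Q" "a \<in> carrier K" "s \<in> carrier K" using as A(3) ZQ ZK by auto
 \<comment> \<open>The equation bounds the valuation of x at p by k, so it provides the measure for
   the induction.\<close>
 have step: "[|x \<in> Z; t \<in> Z; t \<notin> p; c \<in> Z; t \<otimes> a [^] (k::nat) = x \<otimes> c; y \<in> Z|] ==>
  \<exists>r\<in>Z. r \<notin> p \<and> ((\<exists>u\<in>Z. r \<otimes> x = y \<otimes> u) \<or> (\<exists>u\<in>Z. r \<otimes> y = x \<otimes> u))" for x y t c k
 proof (induction k arbitrary: x y t c)
  case 0
  have "t \<otimes> y = x \<otimes> (c \<otimes> y)" using 0 ZK' by (simp add: m_assoc)
  then show ?case using 0 Zcl(4) by blast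
 next
  case (Suc k)
  consider "x \<notin> p" | "y \<notin> p" | "x \<in> p" "y \<in> p" by blast
  then show ?case
  proof cases
   case 1 then show ?thesis using Suc.prems by blast
  next
   case 2 then show ?thesis using Suc.prems by blast
  next
   case 3
   obtain x1 where x1: "x1 \<in> Z" "s \<otimes> x = a \<otimes> x1" using as(5)[OF 3(1)] by blast
   obtain y1 where y1: "y1 \<in> Z" "s \<otimes> y = a \<otimes> y1" using as(5)[OF 3(2)] by blast
   have R: "x \<in> carrier K" "y \<in> carrier K" "x1 \<in> carrier K" "y1 \<in> carrier K" "t \<in> carrier K" "c \<in> carrier K"
    using Suc.prems x1 y1 ZK by auto
   have ak: "a [^] k \<in> carrier K" using aZ by simp
   have "a \<otimes> ((s \<otimes> t) \<otimes> a [^] k) = s \<otimes> (t \<otimes> a [^] Suc k)" using R ak aZ by (simp add: m_ac)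
   also have "\<dots> = (s \<otimes> x) \<otimes> c" unfolding Suc.prems(5) using R aZ by (simp add: m_assoc)
   also have "\<dots> = a \<otimes> (x1 \<otimes> c)" unfolding x1(2) using R aZ by (simp add: m_assoc)
   finally have "(s \<otimes> t) \<otimes> a [^] k = x1 \<otimes> c"
    by (rule nz_cancel[OF aZ(2) as(4), rotated 2]) (use R ak aZ in auto)
   moreover have "s \<otimes> t \<in> Z" "s \<otimes> t \<notin> p" using Zcl(4)[OF as(2) Suc.prems(2)] A(7)[OF as(2) Suc.prems(2)] as(3) Suc.prems(3) by auto
   ultimately obtain r where r: "r \<in> Z" "r \<notin> p" "(\<exists>u\<in>Z. r \<otimes> x1 = y1 \<otimes> u) \<or> (\<exists>u\<in>Z. r \<otimes> y1 = x1 \<otimes> u)"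
    using Suc.IH[OF x1(1) _ _ Suc.prems(4) _ y1(1), of "s \<otimes> t"] by blast
   have rR: "r \<in> carrier K" using r ZK by auto
   have rs: "r \<otimes> s \<in> Z" "r \<otimes> s \<notin> p" using Zcl(4)[OF r(1) as(2)] A(7)[OF r(1) as(2)] as(3) r(2) by auto
   have key: "(r \<otimes> s) \<otimes> v = w \<otimes> (s \<otimes> u)" if "v \<in> carrier K" "w \<in> carrier K" "v1 \<in> carrier K" "w1 \<in> carrier K" "u \<in> carrier K"
    "s \<otimes> v = a \<otimes> v1" "s \<otimes> w = a \<otimes> w1" "r \<otimes> v1 = w1 \<otimes> u" for v w v1 w1 u
   proof -
    have "(r \<otimes> s) \<otimes> v = r \<otimes> (s \<otimes> v)" using that(1-5) rR aZ(3,4) by (simp add: m_assoc)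
    also have "\<dots> = a \<otimes> (r \<otimes> v1)" unfolding that(6) using that(3) rR aZ(3,4) by (simp add: m_lcomm)
    also have "\<dots> = (s \<otimes> w) \<otimes> u" unfolding that(8) that(7) using that(1-5) aZ(3,4) by (simp add: m_assoc)
    also have "\<dots> = w \<otimes> (s \<otimes> u)" using that(1-5) aZ(3,4) by (simp add: m_ac)
    finally show ?thesis .
   qed
   show ?thesis using r(3)
   proof
    assume "\<exists>u\<in>Z. r \<otimes> x1 = y1 \<otimes> u"
    then obtain u where u: "u \<in> Z" "r \<otimes> x1 = y1 \<otimes> u" by blast
    show ?thesis using key[OF R(1,2,3,4) ZK'[OF u(1)] x1(2) y1(2) u(2)] rs Zcl(4)[OF as(2) u(1)] by blast
   next
    assume "\<exists>u\<in>Z. r \<otimes> y1 = x1 \<otimes> u"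
    then obtain u where u: "u \<in> Z" "r \<otimes> y1 = x1 \<otimes> u" by blast
    show ?thesis using key[OF R(2,1,4,3) ZK'[OF u(1)] y1(2) x1(2) u(2)] rs Zcl(4)[OF as(2) u(1)] by blast
   qed
  qed
 qed
 show ?thesis
 proof (cases "x \<in> p")
  case True
  obtain t n where t: "t \<in> Z" "t \<notin> p" "\<forall>z\<in>completed.Pn p (K\<lparr>carrier := Z\<rparr>) n. \<exists>y\<in>Z. t \<otimes> z = x \<otimes> y"
   using power_dvd_Z[OF p True False] by blast
  then obtain c where "c \<in> Z" "t \<otimes> a [^] n = x \<otimes> c" using pow_nat_Pn[OF p as(1)] by blast
  then show ?thesis using step[OF x t(1,2) _ _ y] by blast
 next
  case xp: False
  then show ?thesis using x y by blast
 qed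
qed

lemma min_valuation:
 assumes p: "bp p" and "finite B" "B \<noteq> {}" "\<And>v. v \<in> B ==> z v \<in> Z"
 shows "\<exists>b\<in>B. \<forall>v\<in>B. \<exists>r\<in>Z. r \<notin> p \<and> (\<exists>u\<in>Z. r \<otimes> z v = z b \<otimes> u)"
 using assms(2-)
proof (induction B rule: finite_ne_induct)
 case (singleton v)
 have "\<one> \<otimes> z v = z v \<otimes> \<one>" using singleton ZK' by simp
 then show ?case using Zcl(2) mxi_D(4)[OF bp_mxi[OF p]] by blast
next
 case (insert w B)
 note A = mxi_D[OF bp_mxi[OF p]]
 obtain b where b: "b \<in> B" "\<forall>v\<in>B. \<exists>r\<in>Z. r \<notin> p \<and> (\<exists>u\<in>Z. r \<otimes> z v = z b \<otimes> u)" using insert by blast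
 have zZ: "z w \<in> Z" "z b \<in> Z" using insert.prems b by auto
 have refl: "\<exists>r\<in>Z. r \<notin> p \<and> (\<exists>u\<in>Z. r \<otimes> z w = z w \<otimes> u)"
 proof -
  have "\<one> \<otimes> z w = z w \<otimes> \<one>" using zZ ZK' by simp
  then show ?thesis using Zcl(2) A(4) by blast
 qed
 obtain r where r: "r \<in> Z" "r \<notin> p" "(\<exists>u\<in>Z. r \<otimes> z w = z b \<otimes> u) \<or> (\<exists>u\<in>Z. r \<otimes> z b = z w \<otimes> u)"
  using valuation[OF p zZ] by blast
 show ?case using r(3)
 proof
  assume "\<exists>u\<in>Z. r \<otimes> z w = z b \<otimes> u"
  then show ?thesis using b r(1,2) by blast
 next
  assume "\<exists>u\<in>Z. r \<otimes> z b = z w \<otimes> u"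
  then obtain u where u: "u \<in> Z" "r \<otimes> z b = z w \<otimes> u" by blast
  have "\<exists>r\<in>Z. r \<notin> p \<and> (\<exists>u\<in>Z. r \<otimes> z v = z w \<otimes> u)" if v: "v \<in> B" for v
  proof -
   obtain r' u' where r': "r' \<in> Z" "r' \<notin> p" "u' \<in> Z" "r' \<otimes> z v = z b \<otimes> u'" using b(2) v by blast
   have R: "r \<in> carrier K" "r' \<in> carrier K" "u \<in> carrier K" "u' \<in> carrier K" "z v \<in> carrier K" "z b \<in> carrier K" "z w \<in> carrier K"
    using r(1) r' u zZ insert.prems v ZK by auto
   have "(r \<otimes> r') \<otimes> z v = r \<otimes> (r' \<otimes> z v)" using R by (simp add: m_assoc)
   also have "\<dots> = (r \<otimes> z b) \<otimes> u'" unfolding r'(4) using R by (simp add: m_assoc)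
   also have "\<dots> = z w \<otimes> (u \<otimes> u')" unfolding u(2) using R by (simp add: m_assoc)
   finally show ?thesis
    using Zcl(4)[OF r(1) r'(1)] Zcl(4)[OF u(1) r'(3)] A(7)[OF r(1) r'(1)] r(2) r'(2) by blast
  qed
  then show ?thesis using refl by blast
 qed
qed

section \<open>Local freeness of finitely generated modules\<close>

definition Qind where "Qind B \<longleftrightarrow> (\<forall>c. (\<forall>v\<in>B. c v \<in> Q) \<and> lsum B c (\<lambda>v. v) = \<zero> --> (\<forall>v\<in>B. c v = \<zero>))"

lemma local_basis:
 assumes p: "bp p" and L: "fg Z L"
 shows "\<exists>B s. finite B \<and> B \<subseteq> L \<and> s \<in> Z \<and> s \<notin> p \<and> (\<forall>x\<in>L. s \<otimes> x \<in> spn Z B) \<and> Qind B"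
proof -
 note A = mxi_D[OF bp_mxi[OF p]] and Ls = fg_smod[OF Zs L]
 define T where "T B \<longleftrightarrow> finite B \<and> B \<subseteq> L \<and> (\<exists>s\<in>Z. s \<notin> p \<and> (\<forall>x\<in>L. s \<otimes> x \<in> spn Z B))" for B
 obtain B0 where B0: "finite B0" "B0 \<subseteq> carrier K" "L = spn Z B0" using L unfolding fg_def by blast
 have "T B0" unfolding T_def
 proof (intro conjI bexI[of _ \<one>] ballI)
  show "B0 \<subseteq> L" unfolding B0(3) by (rule spn_superset)
  show "\<one> \<otimes> x \<in> spn Z B0" if "x \<in> L" for x using that B0(3) smodD(1)[OF Ls that] by simp
 qed (use B0 A(4) Zcl(2) in auto)
 then obtain B where T: "T B" and min: "\<And>B'. T B' ==> card B \<le> card B'"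
  using ex_has_least_nat[of T B0 card] by blast
 have fin: "finite B" and BL: "B \<subseteq> L" using T unfolding T_def by auto
 obtain s where s: "s \<in> Z" "s \<notin> p" "\<And>x. x \<in> L ==> s \<otimes> x \<in> spn Z B" using T unfolding T_def by blast
 have BR: "v \<in> carrier K" if "v \<in> B" for v using that BL smodD(1)[OF Ls] by blast
 have "Qind B" unfolding Qind_def
 proof (intro allI impI, rule ccontr)
  fix c assume c: "(\<forall>v\<in>B. c v \<in> Q) \<and> lsum B c (\<lambda>v. v) = \<zero>" and "\<not> (\<forall>v\<in>B. c v = \<zero>)"
  then obtain v0 where v0: "v0 \<in> B" "c v0 \<noteq> \<zero>" by blast
  have cR: "c v \<in> carrier K" if "v \<in> B" for v using c that QK by blast
  obtain d where d: "d \<in> Z" "d \<noteq> \<zero>" "\<forall>v\<in>B. d \<otimes> c v \<in> Z" using common_den[OF fin, of c] c by blast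
  have dR: "d \<in> carrier K" "d \<in> Q" using d ZK ZQ by auto
  \<comment> \<open>The relation cleared of denominators. Below, b carries the coefficient of least
    valuation, r is a common multiplier outside p, and u is r times the relation divided by z b, so
    that u b = r.\<close>
  define z where "z v = d \<otimes> c v" for v
  have zZ: "z v \<in> Z" if "v \<in> B" for v using d(3) that unfolding z_def by blast
  have zR: "z v \<in> carrier K" if "v \<in> B" for v using zZ[OF that] ZK by blast
  have z0: "lsum B z (\<lambda>v. v) = \<zero>"
  proof -
   have "lsum B z (\<lambda>v. v) = d \<otimes> lsum B c (\<lambda>v. v)"
    unfolding z_def by (rule lsum_smult[symmetric]) (use fin dR cR BR in auto)
   then show ?thesis using c dR by simp
  qed
  have zv0: "z v0 \<noteq> \<zero>" unfolding z_def using Q_nz_mult[OF dR(2) d(2)] cR v0 by blast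
  obtain b where b: "b \<in> B" "\<forall>v\<in>B. \<exists>r\<in>Z. r \<notin> p \<and> (\<exists>u\<in>Z. r \<otimes> z v = z b \<otimes> u)"
   using min_valuation[OF p fin, of z] zZ v0 by blast
  have "\<exists>r\<in>Z. r \<notin> p \<and> (\<forall>v\<in>B. \<exists>u\<in>Z. r \<otimes> z v = z b \<otimes> u)"
  proof (rule ball_prod_notin[OF bp_mxi[OF p] fin])
   show "\<exists>r\<in>Z. r \<notin> p \<and> (\<exists>u\<in>Z. r \<otimes> z v = z b \<otimes> u)" if "v \<in> B" for v using b(2) that by blast
   show "\<exists>u\<in>Z. s \<otimes> r \<otimes> z v = z b \<otimes> u" if rs: "r \<in> Z" "s \<in> Z" "v \<in> B" "\<exists>u\<in>Z. r \<otimes> z v = z b \<otimes> u" for r s v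
   proof -
    obtain u where u: "u \<in> Z" "r \<otimes> z v = z b \<otimes> u" using rs(4) by blast
    have "s \<otimes> r \<otimes> z v = s \<otimes> (r \<otimes> z v)" using rs(1,2) zR[OF rs(3)] ZK' by (simp add: m_assoc)
    also have "\<dots> = z b \<otimes> (s \<otimes> u)" unfolding u(2) using rs(2) zR[OF b(1)] u(1) ZK' by (simp add: m_lcomm)
    finally show ?thesis using Zcl(4)[OF rs(2) u(1)] by blast
   qed
  qed
  then obtain r where r: "r \<in> Z" "r \<notin> p" "\<forall>v\<in>B. \<exists>u\<in>Z. r \<otimes> z v = z b \<otimes> u" by blast
  then obtain u where u: "\<And>v. v \<in> B ==> u v \<in> Z \<and> r \<otimes> z v = z b \<otimes> u v" by metis
  have uR: "u v \<in> carrier K" if "v \<in> B" for v using u[OF that] ZK by blast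
  have rR: "r \<in> carrier K" "r \<in> Q" "r \<noteq> \<zero>" using r(1,2) ZK ZQ smodD(2)[OF A(2)] by auto
  have zb: "z b \<noteq> \<zero>"
  proof
   assume "z b = \<zero>"
   then have "r \<otimes> z v0 = \<zero>" using u[OF v0(1)] uR[OF v0(1)] by simp
   then show False using Q_nz_mult[OF rR(2,3) zR[OF v0(1)]] zv0 by blast
  qed
  have zbQ: "z b \<in> Q" using zZ[OF b(1)] ZQ by blast
  have "z b \<otimes> lsum B u (\<lambda>v. v) = lsum B (\<lambda>v. z b \<otimes> u v) (\<lambda>v. v)"
   by (rule lsum_smult) (use fin zR b uR BR in auto)
  also have "\<dots> = lsum B (\<lambda>v. r \<otimes> z v) (\<lambda>v. v)"
   by (rule lsum_cong) (use u uR zR b BR in auto)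
  also have "\<dots> = r \<otimes> lsum B z (\<lambda>v. v)"
   by (rule lsum_smult[symmetric]) (use fin rR zR BR in auto)
  also have "\<dots> = \<zero>" using z0 rR by simp
  finally have u0: "lsum B u (\<lambda>v. v) = \<zero>"
   by (rule Q_nz_mult[OF zbQ zb, rotated]) (rule lsum_closed, use uR BR in auto)
  have ub: "u b = r"
  proof (rule nz_cancel[OF zbQ zb uR[OF b(1)] rR(1)])
   show "z b \<otimes> u b = z b \<otimes> r" using u[OF b(1)] m_comm[OF rR(1) zR[OF b(1)]] by simp
  qed
  let ?B = "B - {b}"
  have sB: "smod Z (spn Z ?B)" by (rule spn_smod[OF Zs]) (use BR in auto)
  have lB: "lsum ?B w (\<lambda>v. v) \<in> spn Z ?B" if "\<And>v. v \<in> B ==> w v \<in> Z" for w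
   by (rule lsum_mem[OF sB]) (use fin that spn_superset[of ?B Z] ZK in auto)
  have "lsum B u (\<lambda>v. v) = u b \<otimes> b \<oplus> lsum ?B u (\<lambda>v. v)"
   by (rule lsum_remove[OF fin b(1)]) (use uR BR in auto)
  then have "r \<otimes> b \<oplus> lsum ?B u (\<lambda>v. v) = \<zero>" using u0 ub by simp
  then have "r \<otimes> b = \<ominus> lsum ?B u (\<lambda>v. v)"
   by (rule sum_zero_eq_neg[rotated 2]) (use rR BR[OF b(1)] smodD(1)[OF sB lB] u in auto)
  then have rb: "r \<otimes> b \<in> spn Z ?B" using smod_minus(1)[OF sB Zs lB] u by simp
  have "(r \<otimes> s) \<otimes> x \<in> spn Z ?B" if x: "x \<in> L" for x
  proof -
   obtain c where c: "\<forall>v\<in>B. c v \<in> Z" "s \<otimes> x = lsum B c (\<lambda>v. v)"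
    using spn_lsum[OF Zs fin _ s(3)[OF x]] BR by blast
   have cR: "c v \<in> carrier K" if "v \<in> B" for v using c(1) that ZK by blast
   have lR: "lsum ?B c (\<lambda>v. v) \<in> carrier K" by (rule lsum_closed) (use cR BR in auto)
   have sp: "lsum B c (\<lambda>v. v) = c b \<otimes> b \<oplus> lsum ?B c (\<lambda>v. v)"
    by (rule lsum_remove[OF fin b(1)]) (use cR BR in auto)
   have "(r \<otimes> s) \<otimes> x = r \<otimes> (s \<otimes> x)" using rR s(1) ZK' smodD(1)[OF Ls x] by (simp add: m_assoc)
   also have "\<dots> = c b \<otimes> (r \<otimes> b) \<oplus> r \<otimes> lsum ?B c (\<lambda>v. v)"
    unfolding c(2) sp using rR lR cR[OF b(1)] BR[OF b(1)] by (simp add: r_distr m_lcomm)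
   also have "\<dots> \<in> spn Z ?B"
    using smodD(3)[OF sB smodD(4)[OF sB _ rb] smodD(4)[OF sB r(1) lB]] c(1) b(1) by blast
   finally show ?thesis .
  qed
  moreover have "r \<otimes> s \<in> Z" "r \<otimes> s \<notin> p" using Zcl(4)[OF r(1) s(1)] A(7)[OF r(1) s(1)] r(2) s(2) by auto
  ultimately have "T ?B" unfolding T_def using fin BL by blast
  then have "card B \<le> card ?B" by (rule min)
  then show False using card_Diff1_less[OF fin b(1)] by simp
 qed
 then show ?thesis using fin BL s by blast
qed

end

section \<open>The trace form\<close>

context dedekind_algebra
begin

text \<open>A basis of K over Q is a relative basis for the field Q with maximal ideal {0} and N =
  {0}; the uniqueness of the number of elements then comes from
  \<open>rbasis_card_unique\<close>.\<close>

definition qb where "qb J b \<longleftrightarrow> rbasis K Q {\<zero>} (carrier K) {\<zero>} J b"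

lemma mxi_Q: "mxi Q {\<zero>}"
proof -
 have "field (K\<lparr>carrier := Q\<rparr>)" by (rule subfield_iff(2)[OF Qf])
 then have "maximalideal {\<zero>\<^bsub>K\<lparr>carrier := Q\<rparr>\<^esub>} (K\<lparr>carrier := Q\<rparr>)" by (rule field.zeromaximalideal)
 then show ?thesis unfolding mxi_def using Qs by simp
qed

lemma qp_Q: "qp Q {\<zero>} (carrier K) {\<zero>}"
 unfolding qp_def using mxi_Q smod_carrier[OF Qs] QK by (auto simp: smod_def)

lemma qb_D:
 assumes "qb J b"
 shows "finite J" "\<And>i. i \<in> J ==> b i \<in> carrier K"
  "\<And>x. x \<in> carrier K ==> \<exists>c. (\<forall>i\<in>J. c i \<in> Q) \<and> x = lsum J c b"
  "\<And>c i. [|\<And>i. i \<in> J ==> c i \<in> Q; lsum J c b = \<zero>; i \<in> J|] ==> c i = \<zero>"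
proof -
 note D = rbasis_D[OF assms[unfolded qb_def]]
 show 1: "finite J" "\<And>i. i \<in> J ==> b i \<in> carrier K" by (rule D(1), rule D(2))
 show "\<exists>c. (\<forall>i\<in>J. c i \<in> Q) \<and> x = lsum J c b" if x: "x \<in> carrier K" for x
 proof -
  obtain c n where c: "\<forall>i\<in>J. c i \<in> Q" "n \<in> {\<zero>}" "x = lsum J c b \<oplus> n" using D(3)[OF x] by blast
  have "lsum J c b \<in> carrier K" by (rule lsum_closed) (use c QK' 1 in auto)
  then show ?thesis using c by auto
 qed
 show "c i = \<zero>" if "\<And>i. i \<in> J ==> c i \<in> Q" "lsum J c b = \<zero>" "i \<in> J" for c i
  using D(4)[of c i] that by blast
qed

lemma qb_I:
 assumes "finite J" "\<And>i. i \<in> J ==> b i \<in> carrier K"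
  "\<And>x. x \<in> carrier K ==> \<exists>c. (\<forall>i\<in>J. c i \<in> Q) \<and> x = lsum J c b"
  "\<And>c i. [|\<And>i. i \<in> J ==> c i \<in> Q; lsum J c b = \<zero>; i \<in> J|] ==> c i = \<zero>"
 shows "qb J b"
 unfolding qb_def
proof (rule rbasis_I[OF assms(1,2)])
 fix x assume x: "x \<in> carrier K"
 obtain c where c: "\<forall>i\<in>J. c i \<in> Q" "x = lsum J c b" using assms(3)[OF x] by blast
 then show "\<exists>c n. (\<forall>i\<in>J. c i \<in> Q) \<and> n \<in> {\<zero>} \<and> x = lsum J c b \<oplus> n" using x by (intro exI[of _ c] exI[of _ \<zero>]) auto
next
 fix c i assume "\<And>i. i \<in> J ==> c i \<in> Q" "lsum J c b \<in> {\<zero>}" "i \<in> J"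
 then show "c i \<in> {\<zero>}" using assms(4)[of c i] by auto
qed

definition co where "co J b x = (SOME c. (\<forall>i\<in>J. c i \<in> Q) \<and> x = lsum J c b)"

lemma co:
 assumes "qb J b" "x \<in> carrier K"
 shows "i \<in> J ==> co J b x i \<in> Q" "lsum J (co J b x) b = x"
proof -
 have "(\<forall>i\<in>J. co J b x i \<in> Q) \<and> x = lsum J (co J b x) b"
  unfolding co_def by (rule someI_ex[OF qb_D(3)[OF assms]])
 then show "i \<in> J ==> co J b x i \<in> Q" "lsum J (co J b x) b = x" by auto
qed

lemma co_unique:
 assumes qb: "qb J b" and c: "\<And>i. i \<in> J ==> c i \<in> Q" and x: "x = lsum J c b" and i: "i \<in> J"
 shows "co J b x i = c i"
proof -
 note D = qb_D[OF qb]
 have cR: "c i \<in> carrier K" if "i \<in> J" for i using c[OF that] QK' by blast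
 have xR: "x \<in> carrier K" unfolding x by (rule lsum_closed) (use cR D in auto)
 note C = co[OF qb xR]
 have CR: "co J b x i \<in> carrier K" if "i \<in> J" for i using C(1)[OF that] QK' by blast
 have "lsum J (\<lambda>i. co J b x i \<oplus> (\<ominus> \<one>) \<otimes> c i) b = lsum J (co J b x) b \<oplus> lsum J (\<lambda>i. (\<ominus> \<one>) \<otimes> c i) b"
  by (rule lsum_add[symmetric]) (use CR cR D in auto)
 also have "lsum J (\<lambda>i. (\<ominus> \<one>) \<otimes> c i) b = (\<ominus> \<one>) \<otimes> lsum J c b"
  by (rule lsum_smult[symmetric]) (use cR D in auto)
 finally have "lsum J (\<lambda>i. co J b x i \<oplus> (\<ominus> \<one>) \<otimes> c i) b = \<zero>"
  unfolding C(2) x[symmetric] using xR by (simp add: l_minus r_neg)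
 moreover have "co J b x i \<oplus> (\<ominus> \<one>) \<otimes> c i \<in> Q" if "i \<in> J" for i
  by (rule Qcl(5)[OF C(1)[OF that] Qcl(4)[OF Qcl(3)[OF Qcl(2)] c[OF that]]])
 ultimately have "co J b x i \<oplus> (\<ominus> \<one>) \<otimes> c i = \<zero>" using D(4)[of "\<lambda>i. co J b x i \<oplus> (\<ominus> \<one>) \<otimes> c i"] i by blast
 moreover have "co J b x i = (co J b x i \<oplus> (\<ominus> \<one>) \<otimes> c i) \<oplus> c i" using CR[OF i] cR[OF i] by algebra
 ultimately show ?thesis using cR[OF i] by simp
qed

definition lin where "lin f \<longleftrightarrow> (\<forall>x\<in>carrier K. f x \<in> Q) \<and>
 (\<forall>x\<in>carrier K. \<forall>y\<in>carrier K. f (x \<oplus> y) = f x \<oplus> f y) \<and> (\<forall>q\<in>Q. \<forall>x\<in>carrier K. f (q \<otimes> x) = q \<otimes> f x)"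

lemma lin_D:
 assumes "lin f"
 shows "x \<in> carrier K ==> f x \<in> Q" "x \<in> carrier K ==> f x \<in> carrier K"
  "[|x \<in> carrier K; y \<in> carrier K|] ==> f (x \<oplus> y) = f x \<oplus> f y"
  "[|q \<in> Q; x \<in> carrier K|] ==> f (q \<otimes> x) = q \<otimes> f x"
 using assms QK unfolding lin_def by blast+

lemma lin_zero: "lin f ==> f \<zero> = \<zero>"
 using lin_D(4)[of f \<zero> \<zero>] lin_D(2)[of f \<zero>] Qcl(1) by simp

lemma lin_lsum:
 assumes f: "lin f" and J: "finite J" "\<And>i. i \<in> J ==> c i \<in> Q" "\<And>i. i \<in> J ==> v i \<in> carrier K"
 shows "f (lsum J c v) = lsum J c (\<lambda>i. f (v i))"
 using J
proof (induction J rule: finite_induct)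
 case empty then show ?case using lin_zero[OF f] by (simp add: lsum_empty)
next
 case (insert j J)
 have R: "c i \<in> carrier K" if "i \<in> insert j J" for i using insert.prems(1)[OF that] QK' by blast
 have lR: "lsum J c v \<in> carrier K" by (rule lsum_closed) (use insert R in auto)
 have "f (lsum (insert j J) c v) = f (c j \<otimes> v j \<oplus> lsum J c v)"
  by (subst lsum_insert) (use insert R in auto)
 also have "\<dots> = c j \<otimes> f (v j) \<oplus> f (lsum J c v)"
  using lin_D(3)[OF f _ lR] lin_D(4)[OF f] insert.prems R by simp
 also have "f (lsum J c v) = lsum J c (\<lambda>i. f (v i))" using insert by simp
 also have "c j \<otimes> f (v j) \<oplus> lsum J c (\<lambda>i. f (v i)) = lsum (insert j J) c (\<lambda>i. f (v i))"
  by (rule lsum_insert[symmetric]) (use insert R lin_D(2)[OF f] in auto)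
 finally show ?case .
qed

lemma lin_mult: "lin f ==> w \<in> carrier K ==> lin (\<lambda>x. f (x \<otimes> w))"
proof -
 assume f: "lin f" and w: "w \<in> carrier K"
 have "f (q \<otimes> x \<otimes> w) = q \<otimes> f (x \<otimes> w)" if "q \<in> Q" "x \<in> carrier K" for q x
  using lin_D(4)[OF f that(1), of "x \<otimes> w"] that w QK' by (simp add: m_assoc)
 then show ?thesis using lin_D[OF f] w unfolding lin_def by (simp add: l_distr)
qed

lemma lin_co: assumes qb: "qb J b" and i: "i \<in> J" shows "lin (\<lambda>x. co J b x i)"
proof -
 note D = qb_D[OF qb]
 have add: "co J b (x \<oplus> y) i = co J b x i \<oplus> co J b y i" if "x \<in> carrier K" "y \<in> carrier K" for x y
 proof (rule co_unique[OF qb _ _ i])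
  note x = co[OF qb that(1)] and y = co[OF qb that(2)]
  show "co J b x i \<oplus> co J b y i \<in> Q" if "i \<in> J" for i by (rule Qcl(5)[OF x(1)[OF that] y(1)[OF that]])
  have "lsum J (co J b x) b \<oplus> lsum J (co J b y) b = lsum J (\<lambda>i. co J b x i \<oplus> co J b y i) b"
   by (rule lsum_add) (use x(1) y(1) QK' D in auto)
  then show "x \<oplus> y = lsum J (\<lambda>i. co J b x i \<oplus> co J b y i) b" unfolding x(2) y(2) .
 qed
 have sm: "co J b (q \<otimes> x) i = q \<otimes> co J b x i" if q: "q \<in> Q" and "x \<in> carrier K" for q x
 proof (rule co_unique[OF qb _ _ i])
  note x = co[OF qb that(2)]
  show "q \<otimes> co J b x i \<in> Q" if "i \<in> J" for i by (rule Qcl(4)[OF q x(1)[OF that]])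
  have "q \<otimes> lsum J (co J b x) b = lsum J (\<lambda>i. q \<otimes> co J b x i) b"
   by (rule lsum_smult) (use x(1) q QK' D in auto)
  then show "q \<otimes> x = lsum J (\<lambda>i. q \<otimes> co J b x i) b" unfolding x(2) .
 qed
 show ?thesis unfolding lin_def using co(1)[OF qb _ i] add sm by blast
qed

definition tr where "tr J b x = (\<Oplus>i\<in>J. co J b (x \<otimes> b i) i)"

text \<open>Expanding the b i in the basis b' and exchanging the sums is the identity of the traces
  of AB and BA.\<close>

lemma tr_basis:
 assumes qb: "qb J b" and qb': "qb J' b'" and x: "x \<in> carrier K"
 shows "tr J b x = tr J' b' x"
proof -
 note D = qb_D[OF qb] and D' = qb_D[OF qb']
 have xb: "x \<otimes> b i \<in> carrier K" if "i \<in> J" for i using x D(2)[OF that] by simp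
 have xb': "x \<otimes> b' j \<in> carrier K" if "j \<in> J'" for j using x D'(2)[OF that] by simp
 have c': "co J' b' (b i) j \<in> Q" if "i \<in> J" "j \<in> J'" for i j using co(1)[OF qb' D(2)[OF that(1)] that(2)] .
 have c: "co J b (x \<otimes> b' j) i \<in> Q" if "i \<in> J" "j \<in> J'" for i j using co(1)[OF qb xb'[OF that(2)] that(1)] .
 have 1: "co J b (x \<otimes> b i) i = (\<Oplus>j\<in>J'. co J' b' (b i) j \<otimes> co J b (x \<otimes> b' j) i)" if i: "i \<in> J" for i
 proof -
  have "x \<otimes> b i = x \<otimes> lsum J' (co J' b' (b i)) b'" using co(2)[OF qb' D(2)[OF i]] by simp
  also have "\<dots> = lsum J' (co J' b' (b i)) (\<lambda>j. x \<otimes> b' j)"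
   by (rule lsum_smult_vec) (use x D' c'[OF i] QK' in auto)
  finally have "co J b (x \<otimes> b i) i = lsum J' (co J' b' (b i)) (\<lambda>j. co J b (x \<otimes> b' j) i)"
   using lin_lsum[OF lin_co[OF qb i] D'(1), of "co J' b' (b i)" "\<lambda>j. x \<otimes> b' j"] c'[OF i] xb' by simp
  then show ?thesis unfolding lsum_def .
 qed
 have "tr J b x = (\<Oplus>i\<in>J. \<Oplus>j\<in>J'. co J' b' (b i) j \<otimes> co J b (x \<otimes> b' j) i)"
  unfolding tr_def by (rule finsum_cong') (use 1 c c' QK' in \<open>auto intro!: finsum_closed\<close>)
 also have "\<dots> = (\<Oplus>j\<in>J'. \<Oplus>i\<in>J. co J' b' (b i) j \<otimes> co J b (x \<otimes> b' j) i)"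
  by (rule finsum_swap) (use D D' c c' QK' in auto)
 also have "\<dots> = tr J' b' x" unfolding tr_def
 proof (rule finsum_cong')
  fix j assume j: "j \<in> J'"
  have "co J' b' (x \<otimes> b' j) j = co J' b' (lsum J (co J b (x \<otimes> b' j)) b) j"
   using co(2)[OF qb xb'[OF j]] by simp
  also have "\<dots> = lsum J (co J b (x \<otimes> b' j)) (\<lambda>i. co J' b' (b i) j)"
   by (rule lin_lsum[OF lin_co[OF qb' j] D(1)]) (use c[OF _ j] D in auto)
  also have "\<dots> = (\<Oplus>i\<in>J. co J' b' (b i) j \<otimes> co J b (x \<otimes> b' j) i)"
   unfolding lsum_def by (rule finsum_cong') (use c[OF _ j] c'[OF _ j] QK' in \<open>auto simp: m_comm\<close>)
  finally show "(\<Oplus>i\<in>J. co J' b' (b i) j \<otimes> co J b (x \<otimes> b' j) i) = co J' b' (x \<otimes> b' j) j" by simp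
 next
  show "(\<lambda>j. co J' b' (x \<otimes> b' j) j) \<in> J' \<rightarrow> carrier K" using co(1)[OF qb' xb'] QK' by auto
 qed simp
 finally show ?thesis .
qed

lemma combine_lsum:
 assumes "length Ks = length Us" "set Ks \<subseteq> carrier K" "set Us \<subseteq> carrier K"
 shows "combine Ks Us = lsum {..<length Us} ((!) Ks) ((!) Us)"
 using assms
proof (induction Ks Us rule: list_induct2)
 case Nil then show ?case by (simp add: lsum_empty)
next
 case (Cons k Ks u Us)
 let ?n = "length Us"
 have R: "\<And>i. i < ?n ==> Ks ! i \<in> carrier K" "\<And>i. i < ?n ==> Us ! i \<in> carrier K" "k \<in> carrier K" "u \<in> carrier K"
  using Cons by (auto simp: subset_iff)
 have R': "\<And>i. i < Suc ?n ==> (k # Ks) ! i \<in> carrier K" "\<And>i. i < Suc ?n ==> (u # Us) ! i \<in> carrier K"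
  using R by (auto simp: nth_Cons split: nat.splits)
 have "lsum (insert 0 (Suc ` {..<?n})) ((!) (k # Ks)) ((!) (u # Us)) =
   (k # Ks) ! 0 \<otimes> (u # Us) ! 0 \<oplus> lsum (Suc ` {..<?n}) ((!) (k # Ks)) ((!) (u # Us))"
  by (rule lsum_insert) (use R' in auto)
 also have "lsum (Suc ` {..<?n}) ((!) (k # Ks)) ((!) (u # Us)) = (\<Oplus>i\<in>{..<?n}. (k # Ks) ! Suc i \<otimes> (u # Us) ! Suc i)"
  unfolding lsum_def by (rule finsum_reindex) (use R in auto)
 also have "\<dots> = lsum {..<?n} ((!) Ks) ((!) Us)" unfolding lsum_def by simp
 finally show ?case using Cons by (simp add: lessThan_Suc_eq_insert_0)
qed

lemma basis_qb:
 assumes "basis_over K Q Us"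
 shows "set Us \<subseteq> carrier K" "qb {..<length Us} ((!) Us)"
proof -
 have ind: "independent Q Us" and sp: "Span Q Us = carrier K" using assms unfolding basis_over_def by auto
 show UsK: "set Us \<subseteq> carrier K" by (rule independent_in_carrier[OF ind])
 have UK: "Us ! i \<in> carrier K" if "i < length Us" for i using UsK that by auto
 show "qb {..<length Us} ((!) Us)"
 proof (rule qb_I)
  show "Us ! i \<in> carrier K" if "i \<in> {..<length Us}" for i using UK that by simp
  fix x assume "x \<in> carrier K"
  then have "x \<in> Span Q Us" using sp by simp
  then obtain Ks where Ks: "x = combine Ks Us" "length Ks = length Us" "set Ks \<subseteq> Q"
   using Span_eq_combine_set_length_version[OF Qf UsK] by blast
  then have "x = lsum {..<length Us} ((!) Ks) ((!) Us)" using combine_lsum[OF Ks(2) _ UsK] QK by auto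
  moreover have "\<forall>i\<in>{..<length Us}. Ks ! i \<in> Q" using Ks by auto
  ultimately show "\<exists>c. (\<forall>i\<in>{..<length Us}. c i \<in> Q) \<and> x = lsum {..<length Us} c ((!) Us)" by blast
 next
  fix c i assume c: "\<And>i. i \<in> {..<length Us} ==> c i \<in> Q" "lsum {..<length Us} c ((!) Us) = \<zero>" and i: "i \<in> {..<length Us}"
  let ?Ks = "map c [0..<length Us]"
  have KsQ: "set ?Ks \<subseteq> Q" using c(1) by auto
  have "combine ?Ks Us = lsum {..<length Us} ((!) ?Ks) ((!) Us)"
   by (rule combine_lsum) (use KsQ QK UsK in auto)
  also have "\<dots> = lsum {..<length Us} c ((!) Us)"
   by (rule lsum_cong) (use c(1) QK' UK in auto)
  finally have "combine ?Ks Us = \<zero>" using c(2) by simp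
  then have "set (take (length Us) ?Ks) \<subseteq> {\<zero>}" by (rule independent_imp_trivial_combine[OF Qf ind KsQ])
  then show "c i = \<zero>" using i by (auto simp: subset_iff)
 qed simp
qed

lemma basis_scale:
 assumes b: "basis_over K Q Us" and d: "d \<in> Q" "d \<noteq> \<zero>"
 shows "basis_over K Q (map (\<lambda>u. d \<otimes> u) Us)"
proof -
 obtain e where e: "e \<in> Q" "d \<otimes> e = \<one>" using Q_inv[OF d] by blast
 have R: "d \<in> carrier K" "e \<in> carrier K" using d e QK' by auto
 have Sp: "Span Q (map (\<lambda>u. d \<otimes> u) Vs) = Span Q Vs" if V: "set Vs \<subseteq> carrier K" for Vs
 proof -
  have dV: "set (map (\<lambda>u. d \<otimes> u) Vs) \<subseteq> carrier K" using V R by auto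
  have "u \<in> spn Q (set (map (\<lambda>u. d \<otimes> u) Vs))" if u: "u \<in> set Vs" for u
  proof -
   have uR: "u \<in> carrier K" using u V by blast
   have "e \<otimes> (d \<otimes> u) = (d \<otimes> e) \<otimes> u" using uR R by (simp add: m_ac)
   then have eq: "e \<otimes> (d \<otimes> u) = u" using e uR by simp
   have "d \<otimes> u \<in> spn Q (set (map (\<lambda>u. d \<otimes> u) Vs))"
    using spn_superset[of "set (map (\<lambda>u. d \<otimes> u) Vs)" Q] u by auto
   then have "e \<otimes> (d \<otimes> u) \<in> spn Q (set (map (\<lambda>u. d \<otimes> u) Vs))" by (rule smodD(4)[OF spn_smod[OF Qs dV] e(1)])
   then show ?thesis unfolding eq .
  qed
  then have "spn Q (set Vs) \<subseteq> spn Q (set (map (\<lambda>u. d \<otimes> u) Vs))" by (intro spn_mono[OF Qs dV]) blast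
  moreover have "d \<otimes> u \<in> spn Q (set Vs)" if "u \<in> set Vs" for u
   using smodD(4)[OF spn_smod[OF Qs V] d(1)] spn_superset[of "set Vs" Q] that by blast
  then have "spn Q (set (map (\<lambda>u. d \<otimes> u) Vs)) \<subseteq> spn Q (set Vs)" by (intro spn_mono[OF Qs V]) auto
  ultimately show ?thesis unfolding Span_eq_spn[OF Qs V] Span_eq_spn[OF Qs dV] by blast
 qed
 have ind: "independent Q Us" using b unfolding basis_over_def by blast
 have "independent Q (map (\<lambda>u. d \<otimes> u) Us)"
  using ind
 proof (induction Us rule: list.induct)
  case Nil then show ?case by simp
 next
  case (Cons u Us)
  note li = independent_backwards[OF Cons.prems]
  have V: "set Us \<subseteq> carrier K" using independent_in_carrier[OF li(2)] .
  have "d \<otimes> u \<notin> Span Q Us"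
  proof
   assume "d \<otimes> u \<in> Span Q Us"
   then have "e \<otimes> (d \<otimes> u) \<in> Span Q Us"
    unfolding Span_eq_spn[OF Qs V] by (rule smodD(4)[OF spn_smod[OF Qs V] e(1)])
   moreover have "e \<otimes> (d \<otimes> u) = (d \<otimes> e) \<otimes> u" using li(3) R by (simp add: m_ac)
   ultimately show False using li(1,3) e by (simp del: Span.simps)
  qed
  then have "d \<otimes> u \<notin> Span Q (map (\<lambda>u. d \<otimes> u) Us)" unfolding Sp[OF V] .
  then show ?case using Cons.IH[OF li(2)] li(3) R by (simp del: Span.simps add: independent.li_Cons)
 qed
 then show ?thesis using b Sp independent_in_carrier[OF ind] unfolding basis_over_def by simp
qed

text \<open>The columns A j are forced to be the coordinates of x Us ! j, so a basis determines its
  candidate for t, and \<open>tr_basis\<close> shows that all bases give the same one.\<close>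

lemma algebra_trace_eq:
 assumes Us: "basis_over K Q Us" and qb: "qb J b" and x: "x \<in> carrier K"
 shows "algebra_trace K Q x = tr J b x"
 unfolding algebra_trace_def
proof (rule the_equality)
 note B = basis_qb[OF Us]
 let ?n = "length Us"
 let ?A = "\<lambda>j. map (co {..<?n} ((!) Us) (x \<otimes> Us ! j)) [0..<?n]"
 have UK: "Us ! i \<in> carrier K" if "i < ?n" for i using B(1) that by auto
 have c: "co {..<?n} ((!) Us) (x \<otimes> Us ! j) i \<in> Q" if "j < ?n" "i < ?n" for i j
  using co(1)[OF B(2)] x UK that by simp
 have "set (?A j) \<subseteq> Q \<and> length (?A j) = ?n \<and> x \<otimes> Us ! j = combine (?A j) Us" if j: "j < ?n" for j
 proof (intro conjI)
  show AQ: "set (?A j) \<subseteq> Q" using c[OF j] by auto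
  have "combine (?A j) Us = lsum {..<?n} ((!) (?A j)) ((!) Us)"
   by (rule combine_lsum) (use AQ QK B in auto)
  also have "\<dots> = lsum {..<?n} (co {..<?n} ((!) Us) (x \<otimes> Us ! j)) ((!) Us)"
   by (rule lsum_cong) (use c[OF j] QK' UK in auto)
  also have "\<dots> = x \<otimes> Us ! j" using co(2)[OF B(2), of "x \<otimes> Us ! j"] x UK[OF j] by simp
  finally show "x \<otimes> Us ! j = combine (?A j) Us" by simp
 qed simp
 moreover have "tr J b x = (\<Oplus>j\<in>{..<?n}. ?A j ! j)"
 proof -
  have "tr J b x = (\<Oplus>j\<in>{..<?n}. co {..<?n} ((!) Us) (x \<otimes> Us ! j) j)"
   using tr_basis[OF qb B(2) x] unfolding tr_def .
  also have "\<dots> = (\<Oplus>j\<in>{..<?n}. ?A j ! j)" by (rule finsum_cong') (use c QK' in auto)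
  finally show ?thesis .
 qed
 ultimately show "\<exists>Us A. basis_over K Q Us \<and> (\<forall>j<length Us. set (A j) \<subseteq> Q \<and> length (A j) = length Us \<and>
   x \<otimes> Us ! j = combine (A j) Us) \<and> tr J b x = (\<Oplus>j\<in>{..<length Us}. A j ! j)"
  using Us by (intro exI[of _ Us] exI[of _ ?A] conjI allI impI) simp_all
next
 fix t assume "\<exists>Us A. basis_over K Q Us \<and> (\<forall>j<length Us. set (A j) \<subseteq> Q \<and> length (A j) = length Us \<and>
   x \<otimes> Us ! j = combine (A j) Us) \<and> t = (\<Oplus>j\<in>{..<length Us}. A j ! j)"
 then obtain Us A where Us: "basis_over K Q Us"
  and A: "\<And>j. j < length Us ==> set (A j) \<subseteq> Q \<and> length (A j) = length Us \<and> x \<otimes> Us ! j = combine (A j) Us"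
  and t: "t = (\<Oplus>j\<in>{..<length Us}. A j ! j)" by blast
 note B = basis_qb[OF Us]
 let ?n = "length Us"
 have AQ: "A j ! i \<in> Q" if "j < ?n" "i < ?n" for i j using A[OF that(1)] that(2) by auto
 have "co {..<?n} ((!) Us) (x \<otimes> Us ! j) j = A j ! j" if j: "j < ?n" for j
 proof (rule co_unique[OF B(2), where c = "(!) (A j)"])
  show "A j ! i \<in> Q" if "i \<in> {..<?n}" for i using AQ[OF j] that by simp
  show "x \<otimes> Us ! j = lsum {..<?n} ((!) (A j)) ((!) Us)"
   using A[OF j] combine_lsum[of "A j" Us] B(1) QK by auto
 qed (use j in simp)
 then have "tr {..<?n} ((!) Us) x = t" unfolding tr_def t
  by (intro finsum_cong') (use AQ QK' in auto)
 then show "t = tr J b x" using tr_basis[OF qb B(2) x] by simp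
qed

lemma tr_Q: "qb J b ==> x \<in> carrier K ==> tr J b x \<in> Q"
proof -
 assume qb: "qb J b" and x: "x \<in> carrier K"
 have "lsum J (\<lambda>_. \<one>) (\<lambda>i. co J b (x \<otimes> b i) i) \<in> Q"
  by (rule lsum_mem[OF smod_self[OF Qs]]) (use qb_D[OF qb] co(1)[OF qb] x Qcl QK in auto)
 moreover have "lsum J (\<lambda>_. \<one>) (\<lambda>i. co J b (x \<otimes> b i) i) = tr J b x"
  unfolding lsum_def tr_def by (rule finsum_cong') (use qb_D[OF qb] co(1)[OF qb] x QK' in auto)
 ultimately show ?thesis by simp
qed

lemma tr_lin: "qb J b ==> lin (tr J b)"
proof -
 assume qb: "qb J b"
 note D = qb_D[OF qb]
 have cR: "co J b y i \<in> carrier K" if "y \<in> carrier K" "i \<in> J" for y i using co(1)[OF qb that] QK' by blast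
 have add: "tr J b (x \<oplus> y) = tr J b x \<oplus> tr J b y" if xy: "x \<in> carrier K" "y \<in> carrier K" for x y
 proof -
  have "tr J b (x \<oplus> y) = (\<Oplus>i\<in>J. co J b (x \<otimes> b i) i \<oplus> co J b (y \<otimes> b i) i)"
   unfolding tr_def by (rule finsum_cong') (use xy D lin_D(3)[OF lin_co[OF qb]] cR in \<open>auto simp: l_distr\<close>)
  also have "\<dots> = tr J b x \<oplus> tr J b y" unfolding tr_def by (rule finsum_addf) (use xy D cR in auto)
  finally show ?thesis .
 qed
 have sm: "tr J b (q \<otimes> x) = q \<otimes> tr J b x" if q: "q \<in> Q" and x: "x \<in> carrier K" for q x
 proof -
  have "tr J b (q \<otimes> x) = (\<Oplus>i\<in>J. q \<otimes> co J b (x \<otimes> b i) i)"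
   unfolding tr_def by (rule finsum_cong') (use q x D lin_D(4)[OF lin_co[OF qb] q] cR QK' in \<open>auto simp: m_assoc\<close>)
  also have "\<dots> = q \<otimes> tr J b x" unfolding tr_def by (rule finsum_rdistr[symmetric]) (use x q D cR QK' in auto)
  finally show ?thesis .
 qed
 show ?thesis unfolding lin_def using tr_Q[OF qb] add sm by blast
qed

subsection \<open>Separability elements\<close>

text \<open>A list of pairs \<open>(a, b)\<close> stands for the tensor \<open>\<Sum> a \<otimes> b\<close> of \<open>K \<otimes>\<^sub>Q K\<close>, and \<open>tact l f\<close> is its
 image under \<open>id \<otimes> f\<close>.\<close>

primrec tact where
 "tact [] f = \<zero>"
| "tact (p # l) f = fst p \<otimes> f (snd p) \<oplus> tact l f"

primrec tmul where
 "tmul [] = \<zero>"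
| "tmul (p # l) = fst p \<otimes> snd p \<oplus> tmul l"

abbreviation KK where "KK l \<equiv> set l \<subseteq> carrier K \<times> carrier K"

lemma tact_closed: "KK l ==> (\<And>x. x \<in> carrier K ==> f x \<in> carrier K) ==> tact l f \<in> carrier K"
 by (induction l) auto

lemma tmul_closed: "KK l ==> tmul l \<in> carrier K"
 by (induction l) auto

lemma tact_append: "KK l ==> KK l' ==> (\<And>x. x \<in> carrier K ==> f x \<in> carrier K) ==>
  tact (l @ l') f = tact l f \<oplus> tact l' f"
 by (induction l) (auto simp: a_assoc tact_closed)

lemma tmul_append: "KK l ==> KK l' ==> tmul (l @ l') = tmul l \<oplus> tmul l'"
 by (induction l) (auto simp: a_assoc tmul_closed)

text \<open>Multiplication by u \<otimes> w in K \<otimes> K.\<close>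

definition tscale where "tscale u w l = map (\<lambda>p. (u \<otimes> fst p, snd p \<otimes> w)) l"

lemma tscale_KK: "KK l ==> u \<in> carrier K ==> w \<in> carrier K ==> KK (tscale u w l)"
 by (auto simp: tscale_def)

lemma tact_tscale: "KK l ==> u \<in> carrier K ==> w \<in> carrier K ==> (\<And>x. x \<in> carrier K ==> f x \<in> carrier K) ==>
  tact (tscale u w l) f = u \<otimes> tact l (\<lambda>b. f (b \<otimes> w))"
 by (induction l) (auto simp: tscale_def r_distr m_assoc tact_closed)

lemma tmul_tscale: "KK l ==> u \<in> carrier K ==> w \<in> carrier K ==> tmul (tscale u w l) = (u \<otimes> w) \<otimes> tmul l"
 by (induction l) (auto simp: tscale_def r_distr m_ac tmul_closed)

lemma tact_cong: "KK l ==> (\<And>x. x \<in> carrier K ==> f x = g x) ==> tact l f = tact l g"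
 by (induction l) auto

lemma tact_add: "KK l ==> (\<And>x. x \<in> carrier K ==> f x \<in> carrier K) ==> (\<And>x. x \<in> carrier K ==> g x \<in> carrier K) ==>
  tact l (\<lambda>b. f b \<oplus> g b) = tact l f \<oplus> tact l g"
proof (induction l)
 case (Cons p l)
 have "tact l f \<in> carrier K" "tact l g \<in> carrier K" using Cons.prems by (auto intro: tact_closed)
 then show ?case using Cons by (auto simp: r_distr a_ac)
qed simp

lemma tact_smult: "KK l ==> c \<in> carrier K ==> (\<And>x. x \<in> carrier K ==> f x \<in> carrier K) ==>
  tact l (\<lambda>b. c \<otimes> f b) = c \<otimes> tact l f"
proof (induction l)
 case (Cons p l)
 have "tact l f \<in> carrier K" using Cons.prems by (auto intro: tact_closed)
 then show ?case using Cons by (auto simp: r_distr m_lcomm)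
qed simp

primrec tprod where
 "tprod l [] = []"
| "tprod l (p # e) = tscale (fst p) (snd p) l @ tprod l e"

lemma tprod_KK: "KK l ==> KK e ==> KK (tprod l e)"
 by (induction e) (auto simp: tscale_def)

lemma tact_tprod: "KK l ==> KK e ==> (\<And>x. x \<in> carrier K ==> f x \<in> carrier K) ==>
  tact (tprod l e) f = tact e (\<lambda>b'. tact l (\<lambda>b. f (b \<otimes> b')))"
proof (induction e)
 case (Cons p e)
 have p: "fst p \<in> carrier K" "snd p \<in> carrier K" "KK e" using Cons.prems(2) by auto
 note k = tscale_KK[OF Cons.prems(1) p(1,2)] tprod_KK[OF Cons.prems(1) p(3)]
 have "tact (tprod l (p # e)) f = tact (tscale (fst p) (snd p) l) f \<oplus> tact (tprod l e) f"
  unfolding tprod.simps by (rule tact_append[OF k Cons.prems(3)])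
 also have "tact (tscale (fst p) (snd p) l) f = fst p \<otimes> tact l (\<lambda>b. f (b \<otimes> snd p))"
  by (rule tact_tscale[OF Cons.prems(1) p(1,2) Cons.prems(3)])
 finally show ?case using Cons.IH[OF Cons.prems(1) p(3) Cons.prems(3)] by simp
qed simp

lemma tmul_tprod: "KK l ==> KK e ==> tmul (tprod l e) = tmul l \<otimes> tmul e"
proof (induction e)
 case Nil then show ?case by (simp add: tmul_closed)
next
 case (Cons p e)
 have p: "fst p \<in> carrier K" "snd p \<in> carrier K" "KK e" using Cons.prems(2) by auto
 note k = tscale_KK[OF Cons.prems(1) p(1,2)] tprod_KK[OF Cons.prems(1) p(3)]
 have "tmul (tprod l (p # e)) = tmul (tscale (fst p) (snd p) l) \<oplus> tmul (tprod l e)"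
  unfolding tprod.simps by (rule tmul_append[OF k])
 also have "tmul (tscale (fst p) (snd p) l) = (fst p \<otimes> snd p) \<otimes> tmul l"
  by (rule tmul_tscale[OF Cons.prems(1) p(1,2)])
 also have "tmul (tprod l e) = tmul l \<otimes> tmul e" by (rule Cons.IH[OF Cons.prems(1) p(3)])
 finally show ?case using p tmul_closed[OF Cons.prems(1)] tmul_closed[OF p(3)] by (simp add: r_distr m_comm)
qed

lemma tact_swap: "KK l ==> KK e ==> (\<And>x y. x \<in> carrier K ==> y \<in> carrier K ==> F x y \<in> carrier K) ==>
  tact e (\<lambda>y. tact l (\<lambda>x. F x y)) = tact l (\<lambda>x. tact e (\<lambda>y. F x y))"
proof (induction e)
 case Nil
 have "tact l (\<lambda>x. \<zero>) = \<zero>" using Nil(1) by (induction l) auto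
 then show ?case by simp
next
 case (Cons p e)
 have p: "fst p \<in> carrier K" "snd p \<in> carrier K" "KK e" using Cons.prems by auto
 have "tact l (\<lambda>x. tact (p # e) (\<lambda>y. F x y)) = tact l (\<lambda>x. fst p \<otimes> F x (snd p) \<oplus> tact e (\<lambda>y. F x y))" by simp
 also have "\<dots> = tact l (\<lambda>x. fst p \<otimes> F x (snd p)) \<oplus> tact l (\<lambda>x. tact e (\<lambda>y. F x y))"
  by (rule tact_add) (use Cons.prems p in \<open>auto intro: tact_closed\<close>)
 also have "tact l (\<lambda>x. fst p \<otimes> F x (snd p)) = fst p \<otimes> tact l (\<lambda>x. F x (snd p))"
  by (rule tact_smult) (use Cons.prems p in auto)
 finally show ?case using Cons.IH[OF Cons.prems(1) p(3) Cons.prems(3)] by simp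
qed

text \<open>The equation (1 \<otimes> y) e = (y \<otimes> 1) e in K \<otimes> K. Different lists may
  stand for the same tensor, so the two sides are compared by their images under id \<otimes> f for
  all functionals f.\<close>

definition tcomm where "tcomm y l \<longleftrightarrow> (\<forall>f. lin f --> tact l (\<lambda>b. f (b \<otimes> y)) = y \<otimes> tact l f)"

text \<open>The product of tensors is commutative, so y can be moved into whichever factor satisfies
  the equation. In terms of lists this means evaluating that factor first, after an exchange of the
  two sums if necessary.\<close>

lemma tcomm_tprod:
 assumes l: "KK l" and e: "KK e" and y: "y \<in> carrier K" and c: "tcomm y l \<or> tcomm y e"
 shows "tcomm y (tprod l e)"
 unfolding tcomm_def
proof (intro allI impI)
 fix f assume f: "lin f"
 note fR = lin_D(2)[OF f]
 have R: "f (b \<otimes> b') \<in> carrier K" if "b \<in> carrier K" "b' \<in> carrier K" for b b' using fR that by simp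
 have 0: "tact (tprod l e) (\<lambda>b. f (b \<otimes> y)) = tact e (\<lambda>b'. tact l (\<lambda>b. f ((b \<otimes> b') \<otimes> y)))"
  by (rule tact_tprod) (use l e fR y in auto)
 have 1: "tact (tprod l e) f = tact e (\<lambda>b'. tact l (\<lambda>b. f (b \<otimes> b')))" by (rule tact_tprod[OF l e fR])
 show "tact (tprod l e) (\<lambda>b. f (b \<otimes> y)) = y \<otimes> tact (tprod l e) f"
  using c
 proof
  assume c: "tcomm y l"
  have "tact e (\<lambda>b'. tact l (\<lambda>b. f ((b \<otimes> b') \<otimes> y))) = tact e (\<lambda>b'. y \<otimes> tact l (\<lambda>b. f (b \<otimes> b')))"
  proof (rule tact_cong[OF e])
   fix b' assume b': "b' \<in> carrier K"
   have "tact l (\<lambda>b. f ((b \<otimes> b') \<otimes> y)) = tact l (\<lambda>b. f ((b \<otimes> y) \<otimes> b'))"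
    by (rule tact_cong[OF l]) (use b' y in \<open>simp add: m_ac\<close>)
   also have "\<dots> = y \<otimes> tact l (\<lambda>b. f (b \<otimes> b'))"
    using c lin_mult[OF f b'] unfolding tcomm_def by blast
   finally show "tact l (\<lambda>b. f ((b \<otimes> b') \<otimes> y)) = y \<otimes> tact l (\<lambda>b. f (b \<otimes> b'))" .
  qed
  also have "\<dots> = y \<otimes> tact e (\<lambda>b'. tact l (\<lambda>b. f (b \<otimes> b')))"
   by (rule tact_smult[OF e y]) (use l R in \<open>auto intro: tact_closed\<close>)
  finally show ?thesis unfolding 0 1 .
 next
  assume c: "tcomm y e"
  have "tact e (\<lambda>b'. tact l (\<lambda>b. f ((b \<otimes> b') \<otimes> y))) = tact l (\<lambda>b. tact e (\<lambda>b'. f ((b \<otimes> b') \<otimes> y)))"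
   by (rule tact_swap[OF l e]) (use fR y in auto)
  also have "\<dots> = tact l (\<lambda>b. y \<otimes> tact e (\<lambda>b'. f (b \<otimes> b')))"
  proof (rule tact_cong[OF l])
   fix b assume b: "b \<in> carrier K"
   have "tact e (\<lambda>b'. f ((b \<otimes> b') \<otimes> y)) = tact e (\<lambda>b'. f ((b' \<otimes> y) \<otimes> b))"
    by (rule tact_cong[OF e]) (use b y in \<open>simp add: m_ac\<close>)
   also have "\<dots> = y \<otimes> tact e (\<lambda>b'. f (b' \<otimes> b))"
    using c lin_mult[OF f b] unfolding tcomm_def by blast
   also have "tact e (\<lambda>b'. f (b' \<otimes> b)) = tact e (\<lambda>b'. f (b \<otimes> b'))"
    by (rule tact_cong[OF e]) (use b in \<open>simp add: m_comm\<close>)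
   finally show "tact e (\<lambda>b'. f ((b \<otimes> b') \<otimes> y)) = y \<otimes> tact e (\<lambda>b'. f (b \<otimes> b'))" .
  qed
  also have "\<dots> = y \<otimes> tact l (\<lambda>b. tact e (\<lambda>b'. f (b \<otimes> b')))"
   by (rule tact_smult[OF l y]) (use e R in \<open>auto intro: tact_closed\<close>)
  also have "tact l (\<lambda>b. tact e (\<lambda>b'. f (b \<otimes> b'))) = tact e (\<lambda>b'. tact l (\<lambda>b. f (b \<otimes> b')))"
   by (rule tact_swap[OF l e R, symmetric])
  finally show ?thesis unfolding 0 1 .
 qed
qed

text \<open>For a fixed tensor and functional both sides are Q-linear in y, so a basis of K
  suffices.\<close>

lemma tcomm_span:
 assumes l: "KK l" and qb: "qb J b" and c: "\<And>i. i \<in> J ==> tcomm (b i) l" and y: "y \<in> carrier K"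
 shows "tcomm y l"
 unfolding tcomm_def
proof (intro allI impI)
 fix f assume f: "lin f"
 note D = qb_D[OF qb] and fR = lin_D(2)[OF f]
 have tR: "tact l f \<in> carrier K" by (rule tact_closed[OF l fR])
 have "tact l (\<lambda>x. f (x \<otimes> lsum I q b)) = lsum I q b \<otimes> tact l f"
  if "I \<subseteq> J" and q: "\<And>i. i \<in> J ==> q i \<in> Q" for I q
  using finite_subset[OF that(1) D(1)] that(1)
 proof (induction I)
  case empty
  have "tact l (\<lambda>x. f (x \<otimes> \<zero>)) = tact l (\<lambda>x. \<zero> \<otimes> f x)"
   by (rule tact_cong[OF l]) (use lin_zero[OF f] fR in auto)
  also have "\<dots> = \<zero> \<otimes> tact l f" by (rule tact_smult[OF l _ fR]) auto
  finally show ?case by (simp add: lsum_empty)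
 next
  case (insert i I)
  have qi: "q i \<in> Q" "q i \<in> carrier K" "b i \<in> carrier K" using q QK' insert.prems D(2) by auto
  have lR: "lsum I q b \<in> carrier K" by (rule lsum_closed) (use q QK' insert.prems D(2) in auto)
  have ls: "lsum (insert i I) q b = q i \<otimes> b i \<oplus> lsum I q b"
   by (rule lsum_insert) (use insert q QK' D(2) in auto)
  have "tact l (\<lambda>x. f (x \<otimes> lsum (insert i I) q b)) = tact l (\<lambda>x. q i \<otimes> f (x \<otimes> b i) \<oplus> f (x \<otimes> lsum I q b))"
  proof (rule tact_cong[OF l])
   fix x assume x: "x \<in> carrier K"
   have "x \<otimes> (q i \<otimes> b i \<oplus> lsum I q b) = q i \<otimes> (x \<otimes> b i) \<oplus> x \<otimes> lsum I q b"
    using x qi lR by (simp add: r_distr m_lcomm)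
   then show "f (x \<otimes> lsum (insert i I) q b) = q i \<otimes> f (x \<otimes> b i) \<oplus> f (x \<otimes> lsum I q b)"
    unfolding ls using lin_D(3,4)[OF f] x qi lR by simp
  qed
  also have "\<dots> = tact l (\<lambda>x. q i \<otimes> f (x \<otimes> b i)) \<oplus> tact l (\<lambda>x. f (x \<otimes> lsum I q b))"
   by (rule tact_add[OF l]) (use fR qi lR in auto)
  also have "tact l (\<lambda>x. q i \<otimes> f (x \<otimes> b i)) = q i \<otimes> tact l (\<lambda>x. f (x \<otimes> b i))"
   by (rule tact_smult[OF l]) (use fR qi in auto)
  also have "tact l (\<lambda>x. f (x \<otimes> b i)) = b i \<otimes> tact l f" using c[of i] f insert.prems unfolding tcomm_def by blast
  also have "tact l (\<lambda>x. f (x \<otimes> lsum I q b)) = lsum I q b \<otimes> tact l f" using insert by blast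
  finally show ?case unfolding ls using qi lR tR by (simp add: l_distr m_assoc)
 qed
 from this[OF subset_refl, of "co J b y"] show "tact l (\<lambda>b. f (b \<otimes> y)) = y \<otimes> tact l f"
  using co[OF qb y] by auto
qed

text \<open>Let the tensor be the sum of a \<otimes> b and c the sum of a f(b). Moving x b i through
  the tensor shows that multiplication by x c sends b i to the sum of a f(b x b i). The trace of
  this map is the sum of f(b x a), which is f(x) because the tensor has product 1.\<close>

theorem trace_represents:
 assumes l: "KK l" and qb: "qb J b" and c: "\<And>y. y \<in> carrier K ==> tcomm y l" and m: "tmul l = \<one>" and f: "lin f"
  and x: "x \<in> carrier K"
 shows "tr J b (x \<otimes> tact l f) = f x"
proof -
 note D = qb_D[OF qb] and fR = lin_D(2)[OF f]
 have tR: "tact l f \<in> carrier K" by (rule tact_closed[OF l fR])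
 \<comment> \<open>For any tensor, the map sending u to the sum of a f(b x u) has trace f applied to
   the product of the tensor times x. Each pair contributes a map of rank at most one.\<close>
 have key: "(\<Oplus>i\<in>J. co J b (tact e (\<lambda>u. f (u \<otimes> (x \<otimes> b i)))) i) = f (tmul e \<otimes> x)" if "KK e" for e
  using that
 proof (induction e)
  case Nil
  have "(\<Oplus>i\<in>J. co J b \<zero> i) = (\<Oplus>i\<in>J. \<zero>)" by (rule finsum_cong') (use lin_zero[OF lin_co[OF qb]] in auto)
  then show ?case using lin_zero[OF f] x by simp
 next
  case (Cons p e)
  have p: "fst p \<in> carrier K" "snd p \<in> carrier K" "KK e" using Cons.prems by auto
  have eR: "tact e (\<lambda>u. f (u \<otimes> (x \<otimes> b i))) \<in> carrier K" if "i \<in> J" for i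
   by (rule tact_closed[OF p(3)]) (use fR x D(2)[OF that] in auto)
  have fQ: "f (snd p \<otimes> (x \<otimes> b i)) \<in> Q" if "i \<in> J" for i using lin_D(1)[OF f] p x D(2)[OF that] by simp
  have cR: "co J b y i \<in> carrier K" if "y \<in> carrier K" "i \<in> J" for y i using co(1)[OF qb that] QK' by blast
  have 1: "co J b (tact (p # e) (\<lambda>u. f (u \<otimes> (x \<otimes> b i)))) i =
    co J b (fst p) i \<otimes> f (snd p \<otimes> (x \<otimes> b i)) \<oplus> co J b (tact e (\<lambda>u. f (u \<otimes> (x \<otimes> b i)))) i" if i: "i \<in> J" for i
  proof -
   have "fst p \<otimes> f (snd p \<otimes> (x \<otimes> b i)) = f (snd p \<otimes> (x \<otimes> b i)) \<otimes> fst p"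
    using p fQ[OF i] QK' by (intro m_comm) auto
   then show ?thesis
    using lin_D(3)[OF lin_co[OF qb i] _ eR[OF i], of "f (snd p \<otimes> (x \<otimes> b i)) \<otimes> fst p"]
     lin_D(4)[OF lin_co[OF qb i] fQ[OF i] p(1)] p fQ[OF i] QK' cR[OF p(1) i] by (simp add: m_comm)
  qed
  have "(\<Oplus>i\<in>J. co J b (tact (p # e) (\<lambda>u. f (u \<otimes> (x \<otimes> b i)))) i) =
   (\<Oplus>i\<in>J. co J b (fst p) i \<otimes> f (snd p \<otimes> (x \<otimes> b i)) \<oplus> co J b (tact e (\<lambda>u. f (u \<otimes> (x \<otimes> b i)))) i)"
   by (rule finsum_cong') (use 1 cR eR p fQ QK' in auto)
  also have "\<dots> = (\<Oplus>i\<in>J. co J b (fst p) i \<otimes> f (snd p \<otimes> (x \<otimes> b i))) \<oplus> f (tmul e \<otimes> x)"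
   unfolding Cons.IH[OF p(3), symmetric] by (rule finsum_addf) (use cR eR p fQ QK' in auto)
  also have "(\<Oplus>i\<in>J. co J b (fst p) i \<otimes> f (snd p \<otimes> (x \<otimes> b i))) = f (lsum J (co J b (fst p)) (\<lambda>i. snd p \<otimes> (x \<otimes> b i)))"
   using lin_lsum[OF f D(1), of "co J b (fst p)" "\<lambda>i. snd p \<otimes> (x \<otimes> b i)"] co(1)[OF qb p(1)] p(2) x D(2)
   by (simp add: lsum_def)
  also have "lsum J (co J b (fst p)) (\<lambda>i. snd p \<otimes> (x \<otimes> b i)) = (snd p \<otimes> x) \<otimes> lsum J (co J b (fst p)) b"
  proof -
   have "(snd p \<otimes> x) \<otimes> lsum J (co J b (fst p)) b = lsum J (co J b (fst p)) (\<lambda>i. (snd p \<otimes> x) \<otimes> b i)"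
    by (rule lsum_smult_vec) (use D p x cR in auto)
   also have "\<dots> = lsum J (co J b (fst p)) (\<lambda>i. snd p \<otimes> (x \<otimes> b i))"
    by (rule lsum_cong) (use D p x cR in \<open>auto simp: m_assoc\<close>)
   finally show ?thesis by simp
  qed
  also have "\<dots> = (fst p \<otimes> snd p) \<otimes> x" unfolding co(2)[OF qb p(1)] using p x by (simp add: m_ac)
  also have "f ((fst p \<otimes> snd p) \<otimes> x) \<oplus> f (tmul e \<otimes> x) = f (tmul (p # e) \<otimes> x)"
   using lin_D(3)[OF f] p x tmul_closed[OF p(3)] by (simp add: l_distr)
  finally show ?case .
 qed
 have "tr J b (x \<otimes> tact l f) = (\<Oplus>i\<in>J. co J b (tact l (\<lambda>u. f (u \<otimes> (x \<otimes> b i)))) i)"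
  unfolding tr_def
 proof (rule finsum_cong')
  fix i assume i: "i \<in> J"
  have "x \<otimes> tact l f \<otimes> b i = (x \<otimes> b i) \<otimes> tact l f" using x tR D(2)[OF i] by (simp add: m_ac)
  also have "\<dots> = tact l (\<lambda>u. f (u \<otimes> (x \<otimes> b i)))"
   using c[of "x \<otimes> b i"] f x D(2)[OF i] unfolding tcomm_def by simp
  finally show "co J b (x \<otimes> tact l f \<otimes> b i) i = co J b (tact l (\<lambda>u. f (u \<otimes> (x \<otimes> b i)))) i" by simp
  have "tact l (\<lambda>u. f (u \<otimes> (x \<otimes> b i))) \<in> carrier K"
   by (rule tact_closed[OF l]) (use fR x D(2)[OF i] in auto)
 next
  show "(\<lambda>i. co J b (tact l (\<lambda>u. f (u \<otimes> (x \<otimes> b i)))) i) \<in> J \<rightarrow> carrier K"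
  proof
   fix i assume i: "i \<in> J"
   have "tact l (\<lambda>u. f (u \<otimes> (x \<otimes> b i))) \<in> carrier K"
    by (rule tact_closed[OF l]) (use fR x D(2)[OF i] in auto)
   then show "co J b (tact l (\<lambda>u. f (u \<otimes> (x \<otimes> b i)))) i \<in> carrier K" using co(1)[OF qb _ i] QK' by blast
  qed
 qed simp
 also have "\<dots> = f x" unfolding key[OF l] m using x by simp
 finally show ?thesis .
qed

end

section \<open>Separability\<close>

lemma RDirProd_list_nth_aux:
 "as \<in> carrier (RDirProd_list Rs) ==> bs \<in> carrier (RDirProd_list Rs) ==> i < length Rs ==>
  (as \<otimes>\<^bsub>RDirProd_list Rs\<^esub> bs) ! i = (as ! i) \<otimes>\<^bsub>Rs ! i\<^esub> (bs ! i) \<and>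
  (as \<oplus>\<^bsub>RDirProd_list Rs\<^esub> bs) ! i = (as ! i) \<oplus>\<^bsub>Rs ! i\<^esub> (bs ! i)"
proof (induction Rs arbitrary: as bs i)
 case (Cons R Rs)
 obtain a as' b bs' where ab: "as = a # as'" "bs = b # bs'" "a \<in> carrier R" "b \<in> carrier R"
  "as' \<in> carrier (RDirProd_list Rs)" "bs' \<in> carrier (RDirProd_list Rs)"
  using Cons.prems by (auto simp: RDirProd_list_carrier)
 note iso = RDirProd_list_iso1[of R Rs]
 have m: "(a, as') \<in> carrier (RDirProd R (RDirProd_list Rs))" "(b, bs') \<in> carrier (RDirProd R (RDirProd_list Rs))"
  using ab by (auto simp: RDirProd_carrier)
 have 1: "as \<otimes>\<^bsub>RDirProd_list (R # Rs)\<^esub> bs = (a \<otimes>\<^bsub>R\<^esub> b) # (as' \<otimes>\<^bsub>RDirProd_list Rs\<^esub> bs')"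
  using ring_iso_memE(2)[OF iso m] ab by (simp add: RDirProd_def DirProd_def monoid.defs)
 have 2: "as \<oplus>\<^bsub>RDirProd_list (R # Rs)\<^esub> bs = (a \<oplus>\<^bsub>R\<^esub> b) # (as' \<oplus>\<^bsub>RDirProd_list Rs\<^esub> bs')"
  using ring_iso_memE(3)[OF iso m] ab by (simp add: RDirProd_def DirProd_def monoid.defs)
 show ?case
  unfolding 1 2 using Cons.IH[OF ab(5,6)] Cons.prems(3) ab(1,2) by (cases i) auto
qed simp

lemmas RDirProd_list_nth = RDirProd_list_nth_aux[THEN conjunct1] RDirProd_list_nth_aux[THEN conjunct2]

lemma RDirProd_list_one_nth: "i < length Rs ==> \<one>\<^bsub>RDirProd_list Rs\<^esub> ! i = \<one>\<^bsub>Rs ! i\<^esub>"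
 unfolding RDirProd_list_one by (induction Rs arbitrary: i) (auto simp: nth_Cons split: nat.splits)

text \<open>The projections to the factor fields, characterized by being jointly injective and
  surjective; in this form the list product need not be mentioned again.\<close>

lemma etale_factors:
 fixes K :: "('a, 'm) ring_scheme" and Q :: "'a set"
 assumes "etale_algebra K Q"
 shows "\<exists>(n::nat) (L :: nat \<Rightarrow> 'a ring) \<theta>.
  (\<forall>i<n. finite_separable_extension (L i) (\<theta> i ` Q) \<and> \<theta> i \<in> ring_hom K (L i)) \<and>
  (\<forall>x\<in>carrier K. \<forall>y\<in>carrier K. (\<forall>i<n. \<theta> i x = \<theta> i y) --> x = y) \<and>
  (\<forall>a. (\<forall>i<n. a i \<in> carrier (L i)) --> (\<exists>x\<in>carrier K. \<forall>i<n. \<theta> i x = a i))"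
proof -
 obtain Ls :: "'a ring list" and \<phi> where phi: "\<phi> \<in> ring_iso K (RDirProd_list Ls)"
  and sep: "\<forall>i < length Ls. finite_separable_extension (Ls ! i) ((\<lambda>q. \<phi> q ! i) ` Q)"
  using assms unfolding etale_algebra_def by blast
 let ?P = "RDirProd_list Ls"
 note hom = ring_iso_memE[OF phi]
 note mem = RDirProd_list_carrier_mem[OF hom(1)]
 have bij: "bij_betw \<phi> (carrier K) (carrier ?P)" using hom(5) .
 have 1: "(\<lambda>x. \<phi> x ! i) \<in> ring_hom K (Ls ! i)" if i: "i < length Ls" for i
  by (rule ring_hom_memI)
   (use i hom mem RDirProd_list_nth[OF hom(1) hom(1) i] RDirProd_list_one_nth[OF i] in auto)
 have 2: "x = y" if x: "x \<in> carrier K" "y \<in> carrier K" and eq: "\<forall>i<length Ls. \<phi> x ! i = \<phi> y ! i" for x y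
 proof -
  have "\<phi> x = \<phi> y" by (rule nth_equalityI) (use mem x eq in auto)
  then show ?thesis using bij x unfolding bij_betw_def inj_on_def by blast
 qed
 have 3: "\<exists>x\<in>carrier K. \<forall>i<length Ls. \<phi> x ! i = a i" if a: "\<forall>i<length Ls. a i \<in> carrier (Ls ! i)" for a
 proof -
  have "map a [0..<length Ls] \<in> carrier ?P" by (rule RDirProd_list_carrier_memI) (use a in auto)
  then obtain x where x: "x \<in> carrier K" "\<phi> x = map a [0..<length Ls]" using bij unfolding bij_betw_def by (metis imageE)
  then show ?thesis by (intro bexI[of _ x]) auto
 qed
 show ?thesis
  by (rule exI[of _ "length Ls"], rule exI[of _ "(!) Ls"], rule exI[of _ "\<lambda>i x. \<phi> x ! i"])
   (use sep 1 2 3 in blast)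
qed

section \<open>Values of derivatives and separable points\<close>

primrec dmon where
 "dmon R x 0 = \<zero>\<^bsub>R\<^esub>"
| "dmon R x (Suc m) = x [^]\<^bsub>R\<^esub> m \<oplus>\<^bsub>R\<^esub> x \<otimes>\<^bsub>R\<^esub> dmon R x m"

text \<open>\<open>dmon\<close> is the derivative of a monomial at x in the recursive form given by
  the product rule, and \<open>dval\<close> extends it to polynomials. The recursion agrees term by
  term with the product of the difference quotient tensors \<open>tpow\<close> and
  \<open>tder\<close>.\<close>

primrec dval where
 "dval R [] x = \<zero>\<^bsub>R\<^esub>"
| "dval R (a # p) x = a \<otimes>\<^bsub>R\<^esub> dmon R x (length p) \<oplus>\<^bsub>R\<^esub> dval R p x"

lemma (in cring) dmon_pow:
 fixes m :: nat
 assumes "x \<in> carrier R" shows "dmon R x (Suc m) = [Suc m] \<cdot> (x [^] m)"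
proof (induction m)
 case 0 then show ?case using assms by simp
next
 case (Suc m)
 have "x \<otimes> ([Suc m] \<cdot> (x [^] m)) = [Suc m] \<cdot> (x [^] Suc m)"
  using assms add_pow_rdistr[where k = "Suc m", of x "x [^] m"] by (simp add: nat_pow_Suc m_comm del: add.nat_pow_Suc)
 then show ?case unfolding dmon.simps(2)[of R x "Suc m"] Suc using assms
  by (simp add: add.nat_pow_Suc[where n = "Suc m"] a_comm del: add.nat_pow_Suc dmon.simps)
qed

lemma (in cring) dmon_closed: "x \<in> carrier R ==> dmon R x m \<in> carrier R"
 by (induction m) auto

lemma (in cring) dval_closed: "x \<in> carrier R ==> set p \<subseteq> carrier R ==> dval R p x \<in> carrier R"
 by (induction p) (auto simp: dmon_closed)

lemma (in cring) eval_poly_deriv: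
 assumes p: "set p \<subseteq> carrier R" and x: "x \<in> carrier R"
 shows "eval (poly_deriv R p) x = dval R p x"
proof -
 let ?D = "\<lambda>p. map (\<lambda>i::nat. [i] \<cdot> coeff p i) (rev [1..<length p])"
 have D: "set (?D p) \<subseteq> carrier R" if "set p \<subseteq> carrier R" for p using that coeff_in_carrier by auto
 have "eval (?D p) x = dval R p x" using p
 proof (induction p)
  case (Cons a p)
  then have a: "a \<in> carrier R" "set p \<subseteq> carrier R" by auto
  show ?case
  proof (cases "length p")
   case 0 then show ?thesis using a by simp
  next
   case (Suc m)
   have "rev [1..<length (a # p)] = Suc m # rev [1..<length p]" using Suc by simp
   moreover have "map (\<lambda>i::nat. [i] \<cdot> coeff (a # p) i) (rev [1..<length p]) = ?D p"
    by (rule map_cong) auto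
   moreover have "coeff (a # p) (Suc m) = a" using Suc by simp
   ultimately have "?D (a # p) = ([Suc m] \<cdot> a) # ?D p" by (simp only: list.map)
   then have "eval (?D (a # p)) x = ([Suc m] \<cdot> a) \<otimes> x [^] m \<oplus> eval (?D p) x" using Suc by (simp del: add.nat_pow_Suc upt_Suc)
   also have "([Suc m] \<cdot> a) \<otimes> x [^] m = a \<otimes> dmon R x (length p)"
    unfolding Suc dmon_pow[OF x] using a x add_pow_ldistr[where k = "Suc m", of a "x [^] m"] add_pow_rdistr[where k = "Suc m", of a "x [^] m"]
    by (simp del: add.nat_pow_Suc)
   finally show ?thesis using Cons.IH a by simp
  qed
 qed simp
 then show ?thesis unfolding poly_deriv_def using eval_normalize[OF D[OF p] x] by simp
qed

lemma dval_hom: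
 assumes "ring_hom_ring R S h" "x \<in> carrier R" "set p \<subseteq> carrier R" "cring R"
 shows "h (dval R p x) = dval S (map h p) (h x)"
proof -
 interpret ring_hom_ring R S h by fact
 interpret Rc: cring R by fact
 have 1: "h (dmon R x m) = dmon S (h x) m" for m
  using assms(2) by (induction m) (auto simp: hom_nat_pow Rc.dmon_closed)
 show ?thesis using assms(3) by (induction p) (auto simp: 1 Rc.dmon_closed Rc.dval_closed assms(2))
qed

text \<open>Take the minimal polynomial f of x. The Bezout identity for f and its derivative,
  evaluated at x, says that the derivative is invertible there.\<close>

lemma (in field) separable_point:
 assumes sep: "finite_separable_extension R F" and x: "x \<in> carrier R"
 shows "\<exists>f v. set f \<subseteq> F \<and> v \<in> carrier R \<and> ring.eval R f x = \<zero>\<^bsub>R\<^esub> \<and> dval R f x \<otimes>\<^bsub>R\<^esub> v = \<one>\<^bsub>R\<^esub>"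
proof -
 have F: "subfield F R" and fd: "finite_dimension F (carrier R)"
  and se: "separable_poly R F (Irr F x)"
  using sep x unfolding finite_separable_extension_def by auto
 note Fr = subfieldE(1)[OF F]
 have alg: "(algebraic over F) x" by (rule finite_dimension_imp_algebraic[OF F carrier_is_subring fd x])
 let ?f = "Irr F x"
 note f = IrrE[OF F x alg]
 obtain u v where uv: "u \<in> carrier (univ_poly R F)" "v \<in> carrier (univ_poly R F)"
  "(u \<otimes>\<^bsub>univ_poly R F\<^esub> ?f) \<oplus>\<^bsub>univ_poly R F\<^esub> (v \<otimes>\<^bsub>univ_poly R F\<^esub> poly_deriv R ?f) = \<one>\<^bsub>univ_poly R F\<^esub>"
  using se unfolding separable_poly_def by blast
 have sF: "set p \<subseteq> F" if "p \<in> carrier (univ_poly R F)" for p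
  using polynomial_incl that univ_poly_carrier by blast
 have FL: "F \<subseteq> carrier R" using subringE(1)[OF Fr] .
 have fL: "set ?f \<subseteq> carrier R" using sF[OF f(1)] FL by blast
 have "set (poly_deriv R ?f) \<subseteq> carrier R"
  unfolding poly_deriv_def by (rule normalize_in_carrier) (use coeff_in_carrier[OF fL] in auto)
 note dL = this
 have uL: "set u \<subseteq> carrier R" "set v \<subseteq> carrier R" using sF uv FL by blast+
 have "eval (poly_add (poly_mult u ?f) (poly_mult v (poly_deriv R ?f))) x = eval [\<one>] x"
  using uv(3) unfolding univ_poly_def by simp
 then have "eval u x \<otimes> eval ?f x \<oplus> eval v x \<otimes> eval (poly_deriv R ?f) x = \<one>"
  using eval_poly_add[OF poly_mult_in_carrier[OF uL(1) fL] poly_mult_in_carrier[OF uL(2) dL] x]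
   eval_poly_mult[OF uL(1) fL x] eval_poly_mult[OF uL(2) dL x] x by simp
 then have "dval R ?f x \<otimes> eval v x = \<one>"
  unfolding f(4) eval_poly_deriv[OF fL x] using eval_in_carrier[OF uL(1) x] eval_in_carrier[OF uL(2) x] dval_closed[OF x fL]
  by (simp add: m_comm)
 then show ?thesis using sF[OF f(1)] f(4) eval_in_carrier[OF uL(2) x] by blast
qed

section \<open>Separability elements from difference quotients\<close>

context dedekind_algebra
begin

text \<open>The quotient of y^m \<otimes> 1 - 1 \<otimes> y^m by y \<otimes> 1 - 1 \<otimes> y as an
  explicit sum of monomials; \<open>tder\<close> is the corresponding quotient for a polynomial in
  place of the m-th power.\<close>

primrec tpow where
 "tpow y 0 = []"
| "tpow y (Suc m) = (y [^] m, \<one>) # tscale \<one> y (tpow y m)"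

primrec tder where
 "tder y [] = []"
| "tder y (a # p) = tscale a \<one> (tpow y (length p)) @ tder y p"

lemma tpow_KK: "y \<in> carrier K ==> KK (tpow y m)"
proof (induction m)
 case (Suc m)
 then have "KK (tscale \<one> y (tpow y m))" by (intro tscale_KK) auto
 then show ?case using Suc.prems by simp
qed simp

lemma tmul_tpow: "y \<in> carrier K ==> tmul (tpow y m) = dmon K y m"
 by (induction m) (simp_all add: tmul_tscale tpow_KK dmon_closed)

text \<open>The defining equation of the difference quotient after id \<otimes> f, arranged without
  subtraction. The functional varies in the induction, because the factor 1 \<otimes> y of the
  recursion replaces f by f(b y).\<close>

lemma tact_tpow:
 assumes "lin f" "y \<in> carrier K"
 shows "tact (tpow y m) (\<lambda>b. f (b \<otimes> y)) \<oplus> y [^] m \<otimes> f \<one> = y \<otimes> tact (tpow y m) f \<oplus> f (y [^] m)"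
 using assms(1)
proof (induction m arbitrary: f)
 case 0 then show ?case using lin_D(2)[OF 0, of \<one>] assms(2) by simp
next
 case (Suc m)
 note fR = lin_D(2)[OF Suc.prems] and M = tpow_KK[OF assms(2), of m]
 let ?g = "\<lambda>b. f (b \<otimes> y)"
 have g: "lin ?g" by (rule lin_mult[OF Suc.prems assms(2)])
 note gR = lin_D(2)[OF g]
 have R: "tact (tpow y m) (\<lambda>b. ?g (b \<otimes> y)) \<in> carrier K" "tact (tpow y m) ?g \<in> carrier K"
  by (rule tact_closed[OF M], use fR assms(2) in simp)+
 have 1: "tact (tpow y (Suc m)) ?g = y [^] m \<otimes> ?g \<one> \<oplus> tact (tpow y m) (\<lambda>b. ?g (b \<otimes> y))"
  using tact_tscale[OF M one_closed assms(2) gR] R by simp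
 have 2: "tact (tpow y (Suc m)) f = y [^] m \<otimes> f \<one> \<oplus> tact (tpow y m) ?g"
  using tact_tscale[OF M one_closed assms(2) fR] R by simp
 have IH: "tact (tpow y m) (\<lambda>b. ?g (b \<otimes> y)) \<oplus> y [^] m \<otimes> ?g \<one> = y \<otimes> tact (tpow y m) ?g \<oplus> ?g (y [^] m)"
  by (rule Suc.IH[OF g])
 define A B where "A = tact (tpow y m) (\<lambda>b. ?g (b \<otimes> y))" and "B = tact (tpow y m) ?g"
 have AB: "A \<in> carrier K" "B \<in> carrier K" using R by (simp_all add: A_def B_def)
 have c: "y \<in> carrier K" "y [^] m \<in> carrier K" "f \<one> \<in> carrier K" "f y \<in> carrier K" "f (y [^] m \<otimes> y) \<in> carrier K"
  using fR assms(2) by auto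
 have IH': "A \<oplus> y [^] m \<otimes> f y = y \<otimes> B \<oplus> f (y [^] m \<otimes> y)" using IH assms(2) unfolding A_def B_def by simp
 have "y [^] m \<otimes> f y \<oplus> A \<oplus> y [^] m \<otimes> y \<otimes> f \<one> = (A \<oplus> y [^] m \<otimes> f y) \<oplus> y [^] m \<otimes> y \<otimes> f \<one>"
  using AB c by algebra
 also have "\<dots> = y \<otimes> (y [^] m \<otimes> f \<one> \<oplus> B) \<oplus> f (y [^] m \<otimes> y)"
  unfolding IH' using AB c by algebra
 finally show ?case unfolding 1 2 A_def[symmetric] B_def[symmetric] using assms(2) by simp
qed

lemma tder_KK: "y \<in> carrier K ==> set p \<subseteq> carrier K ==> KK (tder y p)"
proof (induction p)
 case (Cons a p)
 then have "KK (tscale a \<one> (tpow y (length p)))" by (intro tscale_KK tpow_KK) auto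
 then show ?case using Cons by simp
qed simp

lemma tmul_tder: "y \<in> carrier K ==> set p \<subseteq> carrier K ==> tmul (tder y p) = dval K p y"
proof (induction p)
 case (Cons a p)
 then have "KK (tscale a \<one> (tpow y (length p)))" by (intro tscale_KK tpow_KK) auto
 then show ?case using Cons by (simp add: tmul_append tder_KK tmul_tscale tpow_KK tmul_tpow)
qed simp

text \<open>Once the terms with \<open>eval p y\<close> are removed, this says that the tensor
  commutes with y; in the application an idempotent kills \<open>eval p y\<close>.\<close>

lemma tact_tder:
 assumes f: "lin f" and y: "y \<in> carrier K" and p: "set p \<subseteq> Q"
 shows "tact (tder y p) (\<lambda>b. f (b \<otimes> y)) \<oplus> eval p y \<otimes> f \<one> = y \<otimes> tact (tder y p) f \<oplus> f (eval p y)"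
 using p
proof (induction p)
 case Nil then show ?case using lin_D(2)[OF f, of \<one>] lin_zero[OF f] y by simp
next
 case (Cons a p)
 let ?m = "length p"
 let ?g = "\<lambda>b. f (b \<otimes> y)"
 note fR = lin_D(2)[OF f] and gR = lin_D(2)[OF lin_mult[OF f y]] and M = tpow_KK[OF y, of ?m]
 have a: "a \<in> Q" "a \<in> carrier K" "set p \<subseteq> carrier K" using Cons.prems QK by auto
 have k: "KK (tscale a \<one> (tpow y ?m))" "KK (tder y p)" using tscale_KK[OF M a(2)] tder_KK[OF y a(3)] by auto
 have t: "tact (tder y (a # p)) h = a \<otimes> tact (tpow y ?m) h \<oplus> tact (tder y p) h"
  if h: "\<And>x. x \<in> carrier K ==> h x \<in> carrier K" for h
 proof -
  have "tact (tpow y ?m) (\<lambda>b. h (b \<otimes> \<one>)) = tact (tpow y ?m) h" by (rule tact_cong[OF M]) simp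
  then show ?thesis using tact_append[OF k h] tact_tscale[OF M a(2) one_closed h] by simp
 qed
 define A B A' B' where "A = tact (tpow y ?m) ?g" and "B = tact (tpow y ?m) f"
  and "A' = tact (tder y p) ?g" and "B' = tact (tder y p) f"
 have AB: "A \<in> carrier K" "B \<in> carrier K" "A' \<in> carrier K" "B' \<in> carrier K"
  unfolding A_def B_def A'_def B'_def using tact_closed[OF M] tact_closed[OF k(2)] fR gR by auto
 define u e where "u = y [^] ?m" and "e = eval p y"
 have c: "u \<in> carrier K" "e \<in> carrier K" using y eval_in_carrier[OF a(3) y] by (auto simp: u_def e_def)
 have c': "f \<one> \<in> carrier K" "f u \<in> carrier K" "f e \<in> carrier K" using fR c by auto
 have 1: "A \<oplus> u \<otimes> f \<one> = y \<otimes> B \<oplus> f u" using tact_tpow[OF f y, of ?m] by (simp add: A_def B_def u_def)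
 have 2: "A' \<oplus> e \<otimes> f \<one> = y \<otimes> B' \<oplus> f e" using Cons by (simp add: A'_def B'_def e_def)
 have fe: "f (a \<otimes> u \<oplus> e) = a \<otimes> f u \<oplus> f e" using lin_D(3,4)[OF f] a c by simp
 have "(a \<otimes> A \<oplus> A') \<oplus> (a \<otimes> u \<oplus> e) \<otimes> f \<one> = a \<otimes> (A \<oplus> u \<otimes> f \<one>) \<oplus> (A' \<oplus> e \<otimes> f \<one>)"
  using AB c c' a(2) by algebra
 also have "\<dots> = y \<otimes> (a \<otimes> B \<oplus> B') \<oplus> f (a \<otimes> u \<oplus> e)" unfolding 1 2 fe using AB c c' a(2) y by algebra
 finally show ?case using t[of ?g, OF gR] t[of f, OF fR] by (simp del: tder.simps add: A_def B_def A'_def B'_def u_def e_def)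
qed

text \<open>The difference quotient of q, multiplied by v \<epsilon> \<otimes> \<epsilon>. Its
  product is the value of the derivative times v \<epsilon>, that is \<epsilon>, and it commutes
  with y since \<epsilon> annihilates q(y).\<close>

lemma separating_element:
 assumes y: "y \<in> carrier K" and q: "set q \<subseteq> Q" and v: "v \<in> carrier K" and \<epsilon>: "\<epsilon> \<in> carrier K" "\<epsilon> \<otimes> \<epsilon> = \<epsilon>"
  and z: "eval q y \<otimes> \<epsilon> = \<zero>" and d: "dval K q y \<otimes> v \<otimes> \<epsilon> = \<epsilon>"
 shows "\<exists>e. KK e \<and> tmul e = \<epsilon> \<and> tcomm y e"
proof -
 have qK: "set q \<subseteq> carrier K" using q QK by blast
 note D = tder_KK[OF y qK]
 let ?e = "tscale (v \<otimes> \<epsilon>) \<epsilon> (tder y q)"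
 have e: "KK ?e" by (rule tscale_KK[OF D]) (use v \<epsilon> in auto)
 have "tmul ?e = ((v \<otimes> \<epsilon>) \<otimes> \<epsilon>) \<otimes> dval K q y"
  using tmul_tscale[OF D _ \<epsilon>(1), of "v \<otimes> \<epsilon>"] v \<epsilon> tmul_tder[OF y qK] by simp
 also have "\<dots> = dval K q y \<otimes> v \<otimes> (\<epsilon> \<otimes> \<epsilon>)" using v \<epsilon>(1) dval_closed[OF y qK] by (simp add: m_ac)
 finally have m: "tmul ?e = \<epsilon>" using \<epsilon> d by simp
 have "tact ?e (\<lambda>b. f (b \<otimes> y)) = y \<otimes> tact ?e f" if f: "lin f" for f
 proof -
  let ?g = "\<lambda>b. f (b \<otimes> \<epsilon>)"
  have g: "lin ?g" by (rule lin_mult[OF f \<epsilon>(1)])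
  note gR = lin_D(2)[OF g] and fR = lin_D(2)[OF f] and fyR = lin_D(2)[OF lin_mult[OF f y]]
  have eR: "eval q y \<in> carrier K" by (rule eval_in_carrier[OF qK y])
  have tR: "tact (tder y q) ?g \<in> carrier K" "tact (tder y q) (\<lambda>b. ?g (b \<otimes> y)) \<in> carrier K"
   by (rule tact_closed[OF D], use gR y in simp)+
  have ve: "v \<otimes> \<epsilon> \<in> carrier K" using v \<epsilon> by simp
  have key: "tact (tder y q) (\<lambda>b. ?g (b \<otimes> y)) \<oplus> eval q y \<otimes> ?g \<one> = y \<otimes> tact (tder y q) ?g"
   using tact_tder[OF g y q] z lin_zero[OF f] tR y by simp
  have z': "v \<otimes> \<epsilon> \<otimes> (eval q y \<otimes> ?g \<one>) = \<zero>"
  proof -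
   have "v \<otimes> \<epsilon> \<otimes> (eval q y \<otimes> ?g \<one>) = v \<otimes> ?g \<one> \<otimes> (eval q y \<otimes> \<epsilon>)"
    using v \<epsilon>(1) eR gR[OF one_closed] by (simp add: m_ac)
   then show ?thesis using z v gR[OF one_closed] by simp
  qed
  have "tact ?e (\<lambda>b. f (b \<otimes> y)) = v \<otimes> \<epsilon> \<otimes> tact (tder y q) (\<lambda>b. f (b \<otimes> \<epsilon> \<otimes> y))"
   by (rule tact_tscale[OF D ve \<epsilon>(1) fyR])
  also have "tact (tder y q) (\<lambda>b. f (b \<otimes> \<epsilon> \<otimes> y)) = tact (tder y q) (\<lambda>b. ?g (b \<otimes> y))"
   by (rule tact_cong[OF D]) (use y \<epsilon> in \<open>simp add: m_ac\<close>)
  also have "v \<otimes> \<epsilon> \<otimes> \<dots> = v \<otimes> \<epsilon> \<otimes> (tact (tder y q) (\<lambda>b. ?g (b \<otimes> y)) \<oplus> eval q y \<otimes> ?g \<one>)"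
   using z' tR ve eR gR[OF one_closed] by (simp add: r_distr)
  also have "\<dots> = y \<otimes> (v \<otimes> \<epsilon> \<otimes> tact (tder y q) ?g)" unfolding key using ve y tR by (simp add: m_lcomm)
  also have "v \<otimes> \<epsilon> \<otimes> tact (tder y q) ?g = tact ?e f" by (rule tact_tscale[OF D ve \<epsilon>(1) fR, symmetric])
  finally show ?thesis .
 qed
 then have "tcomm y ?e" unfolding tcomm_def by blast
 then show ?thesis using e m by blast
qed

text \<open>The tensors for the single elements are multiplied together: a product commutes with
  whatever one of its factors commutes with, and products of tensors multiply to powers of the
  idempotent \<epsilon>.\<close>

lemma separating_elements:
 assumes \<epsilon>: "\<epsilon> \<in> carrier K" "\<epsilon> \<otimes> \<epsilon> = \<epsilon>" and Y: "finite Y" "Y \<subseteq> carrier K"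
  and one: "\<And>y. y \<in> Y ==> \<exists>e. KK e \<and> tmul e = \<epsilon> \<and> tcomm y e"
 shows "\<exists>e. KK e \<and> tmul e = \<epsilon> \<and> (\<forall>y\<in>Y. tcomm y e)"
 using Y one
proof (induction Y rule: finite_induct)
 case empty
 have "KK [(\<epsilon>, \<epsilon>)] \<and> tmul [(\<epsilon>, \<epsilon>)] = \<epsilon>" using \<epsilon> by simp
 then show ?case by blast
next
 case (insert y Y)
 obtain e where e: "KK e" "tmul e = \<epsilon>" "\<forall>y\<in>Y. tcomm y e" using insert by blast
 obtain e' where e': "KK e'" "tmul e' = \<epsilon>" "tcomm y e'" using insert by blast
 have "tmul (tprod e e') = \<epsilon>" using tmul_tprod[OF e(1) e'(1)] e(2) e'(2) \<epsilon> by simp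
 moreover have "\<forall>z\<in>insert y Y. tcomm z (tprod e e')"
  using tcomm_tprod[OF e(1) e'(1)] e(3) e'(3) insert.prems by blast
 ultimately show ?case using tprod_KK[OF e(1) e'(1)] by blast
qed

text \<open>Nondegeneracy of the trace form, in the shape in which it is used: every functional is
  the trace form with some c. Separability elements of the factors add up to one of K, and
  \<open>trace_represents\<close> turns it into c.\<close>

lemma trace_dualizing:
 assumes et: "etale_algebra K Q" and qb: "qb J b" and f: "lin f"
 shows "\<exists>c\<in>carrier K. \<forall>x\<in>carrier K. tr J b (x \<otimes> c) = f x"
proof -
 note D = qb_D[OF qb]
 obtain n :: nat and L :: "nat \<Rightarrow> 'a ring" and \<theta> where
  fac: "\<forall>i<n. finite_separable_extension (L i) (\<theta> i ` Q) \<and> \<theta> i \<in> ring_hom K (L i)"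
   "\<forall>x\<in>carrier K. \<forall>y\<in>carrier K. (\<forall>i<n. \<theta> i x = \<theta> i y) --> x = y"
   "\<forall>a. (\<forall>i<n. a i \<in> carrier (L i)) --> (\<exists>x\<in>carrier K. \<forall>i<n. \<theta> i x = a i)"
  using etale_factors[OF et] by blast
 have sep: "finite_separable_extension (L i) (\<theta> i ` Q)" and hom: "\<theta> i \<in> ring_hom K (L i)" if "i < n" for i
  using fac(1) that by auto
 have inj: "x = y" if "x \<in> carrier K" "y \<in> carrier K" "\<And>i. i < n ==> \<theta> i x = \<theta> i y" for x y
  using fac(2) that by blast
 have surj: "\<exists>x\<in>carrier K. \<forall>i<n. \<theta> i x = a i" if "\<And>i. i < n ==> a i \<in> carrier (L i)" for a
  using fac(3) that by blast
 have fL: "field (L i)" if "i < n" for i using sep[OF that] unfolding finite_separable_extension_def by blast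
 have cL: "cring (L i)" if "i < n" for i using fL[OF that] unfolding field_def domain_def by blast
 have rL: "ring (L i)" if "i < n" for i using cL[OF that] unfolding cring_def by blast
 have hr: "ring_hom_ring K (L i) (\<theta> i)" if "i < n" for i
  by (rule ring_hom_ringI2[OF ring_axioms rL[OF that] hom[OF that]])
 \<comment> \<open>The idempotent that belongs to the i-th factor. The minimal polynomial of an
   element changes from factor to factor, so the construction is made for each factor
   separately.\<close>
 have "\<forall>i. \<exists>\<epsilon>\<in>carrier K. i < n --> (\<forall>j<n. \<theta> j \<epsilon> = (if j = i then \<one>\<^bsub>L j\<^esub> else \<zero>\<^bsub>L j\<^esub>))"
 proof
  fix i
  have "\<exists>x\<in>carrier K. \<forall>j<n. \<theta> j x = (if j = i then \<one>\<^bsub>L j\<^esub> else \<zero>\<^bsub>L j\<^esub>)"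
   by (rule surj) (use ring.ring_simprules(2,6)[OF rL] in auto)
  then show "\<exists>\<epsilon>\<in>carrier K. i < n --> (\<forall>j<n. \<theta> j \<epsilon> = (if j = i then \<one>\<^bsub>L j\<^esub> else \<zero>\<^bsub>L j\<^esub>))" by blast
 qed
 then obtain \<epsilon> where e: "\<And>i. \<epsilon> i \<in> carrier K"
  and e1: "\<And>i. i < n ==> \<theta> i (\<epsilon> i) = \<one>\<^bsub>L i\<^esub>" and e0: "\<And>i j. i < n ==> j < n ==> j \<noteq> i ==> \<theta> j (\<epsilon> i) = \<zero>\<^bsub>L j\<^esub>"
  by metis
 have hmult: "\<theta> j (x \<otimes> y) = \<theta> j x \<otimes>\<^bsub>L j\<^esub> \<theta> j y" and hadd: "\<theta> j (x \<oplus> y) = \<theta> j x \<oplus>\<^bsub>L j\<^esub> \<theta> j y"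
  and hcl: "\<theta> j x \<in> carrier (L j)"
  if "j < n" "x \<in> carrier K" "y \<in> carrier K" for j x y
  using ring_hom_memE[OF hom[OF that(1)]] that by auto
 have hz: "\<theta> j \<zero> = \<zero>\<^bsub>L j\<^esub>" and hone: "\<theta> j \<one> = \<one>\<^bsub>L j\<^esub>" if "j < n" for j
  using ring_hom_zero[OF hom[OF that] ring_axioms rL[OF that]] ring_hom_memE(4)[OF hom[OF that]] by auto
 have L0: "z \<otimes>\<^bsub>L j\<^esub> \<zero>\<^bsub>L j\<^esub> = \<zero>\<^bsub>L j\<^esub>" "z \<otimes>\<^bsub>L j\<^esub> \<one>\<^bsub>L j\<^esub> = z" "\<zero>\<^bsub>L j\<^esub> \<oplus>\<^bsub>L j\<^esub> z = z" "z \<oplus>\<^bsub>L j\<^esub> \<zero>\<^bsub>L j\<^esub> = z"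
  if "j < n" "z \<in> carrier (L j)" for j z
 proof -
  interpret Lj: ring "L j" by (rule rL[OF that(1)])
  show "z \<otimes>\<^bsub>L j\<^esub> \<zero>\<^bsub>L j\<^esub> = \<zero>\<^bsub>L j\<^esub>" "z \<otimes>\<^bsub>L j\<^esub> \<one>\<^bsub>L j\<^esub> = z"
   "\<zero>\<^bsub>L j\<^esub> \<oplus>\<^bsub>L j\<^esub> z = z" "z \<oplus>\<^bsub>L j\<^esub> \<zero>\<^bsub>L j\<^esub> = z"
   using that(2) by simp_all
 qed
 have L01: "\<zero>\<^bsub>L j\<^esub> \<in> carrier (L j)" "\<one>\<^bsub>L j\<^esub> \<in> carrier (L j)" if "j < n" for j
  using ring.ring_simprules(2,6)[OF rL[OF that]] by auto
 \<comment> \<open>Multiplication by \<epsilon> i keeps the i-th component and kills the others;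
   this turns equations in the i-th field into equations in K.\<close>
 have vanish: "x \<otimes> \<epsilon> i = y" if "i < n" "x \<in> carrier K" "y \<in> carrier K" "\<theta> i x = \<theta> i y" "\<And>j. j < n ==> j \<noteq> i ==> \<theta> j y = \<zero>\<^bsub>L j\<^esub>" for i x y
 proof (rule inj)
  fix j assume j: "j < n"
  have "\<theta> j (x \<otimes> \<epsilon> i) = \<theta> j x \<otimes>\<^bsub>L j\<^esub> \<theta> j (\<epsilon> i)" by (rule hmult[OF j that(2) e])
  then show "\<theta> j (x \<otimes> \<epsilon> i) = \<theta> j y"
   by (cases "j = i") (use j that e0[OF that(1) j] e1[OF that(1)] hcl[OF j that(2) e] L0(1,2)[OF j] in auto)
 qed (use that e in auto)
 have idem: "\<epsilon> i \<otimes> \<epsilon> i = \<epsilon> i" if "i < n" for i by (rule vanish) (use that e e0 in auto)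
 have one: "\<exists>t. KK t \<and> tmul t = \<epsilon> i \<and> tcomm y t" if i: "i < n" and y: "y \<in> carrier K" for i y
 proof -
  interpret h: ring_hom_ring K "L i" "\<theta> i" by (rule hr[OF i])
  have "\<theta> i y \<in> carrier (L i)" using hcl[OF i y y] .
  then obtain p w where p: "set p \<subseteq> \<theta> i ` Q" "w \<in> carrier (L i)" "ring.eval (L i) p (\<theta> i y) = \<zero>\<^bsub>L i\<^esub>"
   "dval (L i) p (\<theta> i y) \<otimes>\<^bsub>L i\<^esub> w = \<one>\<^bsub>L i\<^esub>"
   using field.separable_point[OF fL[OF i] sep[OF i]] by blast
  have "\<exists>q. set q \<subseteq> Q \<and> map (\<theta> i) q = p" using p(1)
  proof (induction p)
   case (Cons a p)
   then obtain q where "set q \<subseteq> Q" "map (\<theta> i) q = p" by auto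
   moreover obtain c where "c \<in> Q" "a = \<theta> i c" using Cons.prems by auto
   ultimately show ?case by (intro exI[of _ "c # q"]) auto
  qed simp
  then obtain q where q: "set q \<subseteq> Q" "map (\<theta> i) q = p" by blast
  have qK: "set q \<subseteq> carrier K" using q(1) QK by blast
  have "\<exists>x\<in>carrier K. \<forall>j<n. \<theta> j x = (if j = i then w else \<zero>\<^bsub>L j\<^esub>)"
   by (rule surj) (use p(2) L01 in auto)
  then obtain v where v: "v \<in> carrier K" "\<theta> i v = w" using i by auto
  have eK: "eval q y \<in> carrier K" by (rule eval_in_carrier[OF qK y])
  have dK: "dval K q y \<in> carrier K" by (rule dval_closed[OF y qK])
  have "\<theta> i (eval q y) = \<zero>\<^bsub>L i\<^esub>" using h.eval_hom'[OF y qK] q(2) p(3) by simp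
  then have z: "eval q y \<otimes> \<epsilon> i = \<zero>" by (intro vanish[OF i eK]) (use hz i in auto)
  have "\<theta> i (dval K q y \<otimes> v) = \<one>\<^bsub>L i\<^esub>"
   using hmult[OF i dK v(1)] dval_hom[OF hr[OF i] y qK cring_axioms] q(2) v(2) p(4) by simp
  then have d: "dval K q y \<otimes> v \<otimes> \<epsilon> i = \<epsilon> i" by (intro vanish[OF i]) (use dK v e e1[OF i] e0[OF i] in auto)
  show ?thesis by (rule separating_element[OF y q(1) v(1) e idem[OF i] z d])
 qed
 let ?Y = "b ` J"
 have Y: "finite ?Y" "?Y \<subseteq> carrier K" using D(1,2) by auto
 \<comment> \<open>Tensors for the first k factors are added up, so that the product is 1 in these
   factors and 0 in the remaining ones.\<close>
 have "\<exists>l. KK l \<and> (\<forall>y\<in>?Y. tcomm y l) \<and> (\<forall>j<n. \<theta> j (tmul l) = (if j < k then \<one>\<^bsub>L j\<^esub> else \<zero>\<^bsub>L j\<^esub>))"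
  if "k \<le> n" for k using that
 proof (induction k)
  case 0
  have "tcomm y []" if "y \<in> ?Y" for y unfolding tcomm_def using that Y by auto
  then show ?case using hz by (intro exI[of _ "[]"]) auto
 next
  case (Suc k)
  obtain l where l: "KK l" "\<forall>y\<in>?Y. tcomm y l" "\<forall>j<n. \<theta> j (tmul l) = (if j < k then \<one>\<^bsub>L j\<^esub> else \<zero>\<^bsub>L j\<^esub>)"
   using Suc by auto
  have k: "k < n" using Suc by simp
  obtain t where t: "KK t" "tmul t = \<epsilon> k" "\<forall>y\<in>?Y. tcomm y t"
   using separating_elements[OF e[of k] idem[OF k] Y one[OF k]] Y(2) by blast
  have "tcomm y (l @ t)" if "y \<in> ?Y" for y
   unfolding tcomm_def
  proof (intro allI impI)
   fix g assume g: "lin g"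
   have y: "y \<in> carrier K" using that Y(2) by blast
   note gR = lin_D(2)[OF g] and gyR = lin_D(2)[OF lin_mult[OF g y]]
   have "tact l (\<lambda>b. g (b \<otimes> y)) = y \<otimes> tact l g" "tact t (\<lambda>b. g (b \<otimes> y)) = y \<otimes> tact t g"
    using l(2) t(3) that g unfolding tcomm_def by blast+
   then show "tact (l @ t) (\<lambda>b. g (b \<otimes> y)) = y \<otimes> tact (l @ t) g"
    using tact_append[OF l(1) t(1) gR] tact_append[OF l(1) t(1) gyR] y tact_closed[OF l(1) gR] tact_closed[OF t(1) gR]
    by (simp add: r_distr)
  qed
  moreover have "\<theta> j (tmul (l @ t)) = (if j < Suc k then \<one>\<^bsub>L j\<^esub> else \<zero>\<^bsub>L j\<^esub>)" if j: "j < n" for j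
  proof -
   have "\<theta> j (tmul (l @ t)) = \<theta> j (tmul l) \<oplus>\<^bsub>L j\<^esub> \<theta> j (\<epsilon> k)"
    using tmul_append[OF l(1) t(1)] hadd[OF j tmul_closed[OF l(1)] e] t(2) by simp
   then show ?thesis using l(3) j e1[OF k] e0[OF k j] L0(3,4)[OF j] L01[OF j] by (cases "j = k") auto
  qed
  ultimately show ?case using l(1) t(1) by (intro exI[of _ "l @ t"]) auto
 qed
 from this[OF order_refl] obtain l where l: "KK l" "\<forall>y\<in>?Y. tcomm y l" "\<forall>j<n. \<theta> j (tmul l) = \<one>\<^bsub>L j\<^esub>" by auto
 have "tmul l = \<one>" by (rule inj) (use tmul_closed[OF l(1)] l(3) hone in auto)
 moreover have "tcomm y l" if "y \<in> carrier K" for y by (rule tcomm_span[OF l(1) qb _ that]) (use l(2) in auto)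
 ultimately have "\<forall>x\<in>carrier K. tr J b (x \<otimes> tact l f) = f x"
  using trace_represents[OF l(1) qb _ _ f] by blast
 then show ?thesis by (rule bexI) (rule tact_closed[OF l(1)], rule lin_D(2)[OF f])
qed

end

section \<open>Lattices and their trace duals\<close>

lemma (in cring) mxiI:
 assumes A: "subring A R" and I: "smod A I" "I \<subseteq> A" "\<one> \<notin> I"
  and inv: "\<And>x. [|x \<in> A; x \<notin> I|] ==> \<exists>y\<in>A. \<exists>q\<in>I. x \<otimes> y = \<one> \<oplus> q"
 shows "mxi A I"
proof -
 have AR: "A \<subseteq> carrier R" by (rule subringE(1)[OF A])
 have one: "\<one> \<in> A" by (rule subringE(3)[OF A])
 have id: "ideal I (R\<lparr>carrier := A\<rparr>)" using ideal_smod[OF A] I by blast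
 have "maximalideal I (R\<lparr>carrier := A\<rparr>)"
 proof (rule maximalidealI[OF id])
  show "carrier (R\<lparr>carrier := A\<rparr>) \<noteq> I" using one I(3) by auto
  fix J assume J: "ideal J (R\<lparr>carrier := A\<rparr>)" "I \<subseteq> J" "J \<subseteq> carrier (R\<lparr>carrier := A\<rparr>)"
  have sJ: "smod A J" using ideal_smod[OF A] J(1) by blast
  have JA: "J \<subseteq> A" using J(3) by simp
  have "J = A" if ne: "J \<noteq> I"
  proof -
   obtain x where x: "x \<in> J" "x \<notin> I" using ne J(2) by blast
   obtain y q where y: "y \<in> A" "q \<in> I" "x \<otimes> y = \<one> \<oplus> q" using inv[of x] x JA by blast
   have R: "x \<in> carrier R" "y \<in> carrier R" "q \<in> carrier R" using x y JA I AR by auto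
   have "y \<otimes> x \<in> J" by (rule smodD(4)[OF sJ y(1) x(1)])
   then have "y \<otimes> x \<ominus> q \<in> J" using smod_minus(2)[OF sJ A] J(2) y(2) by blast
   moreover have "y \<otimes> x \<ominus> q = \<one>" using y(3) R by (simp add: m_comm minus_eq a_assoc r_neg)
   ultimately have 1: "\<one> \<in> J" by simp
   have "z \<in> J" if "z \<in> A" for z using smodD(4)[OF sJ that 1] that AR by auto
   then show ?thesis using JA by blast
  qed
  then show "J = I \<or> J = carrier (R\<lparr>carrier := A\<rparr>)" by auto
 qed
 then show ?thesis unfolding mxi_def using A by simp
qed

lemma (in cring) ideal_prod_smod:
 assumes A: "A \<subseteq> carrier R" and I: "I \<subseteq> carrier R" "\<zero> \<in> I" and M: "smod A M"
 shows "smod A (ideal_prod R I M)"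
proof (rule smodI)
 have M0: "M \<subseteq> carrier R" using smodD(1)[OF M] by blast
 show R: "ideal_prod R I M \<subseteq> carrier R"
 proof
  fix x assume "x \<in> ideal_prod R I M"
  then show "x \<in> carrier R" by (induction rule: ideal_prod.induct) (use I M0 in auto)
 qed
 have "\<zero> \<otimes> \<zero> \<in> ideal_prod R I M" by (rule ideal_prod.prod[OF I(2) smodD(2)[OF M]])
 then show "\<zero> \<in> ideal_prod R I M" by simp
 show "x \<oplus> y \<in> ideal_prod R I M" if "x \<in> ideal_prod R I M" "y \<in> ideal_prod R I M" for x y
  by (rule ideal_prod.sum[OF that])
 show "a \<otimes> x \<in> ideal_prod R I M" if a: "a \<in> A" "x \<in> ideal_prod R I M" for a x
  using a(2)
 proof (induction rule: ideal_prod.induct)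
  case (prod i j)
  have "i \<otimes> (a \<otimes> j) \<in> ideal_prod R I M" by (rule ideal_prod.prod[OF prod(1) smodD(4)[OF M a(1) prod(2)]])
  moreover have "a \<otimes> (i \<otimes> j) = i \<otimes> (a \<otimes> j)"
   using prod I M0 A a(1) by (intro m_lcomm) auto
  ultimately show ?case by simp
 next
  case (sum x y)
  have "a \<otimes> (x \<oplus> y) = a \<otimes> x \<oplus> a \<otimes> y" using sum.hyps R A a(1) by (intro r_distr) auto
  then show ?case using ideal_prod.sum[OF sum.IH] by simp
 qed
qed

lemma (in cring) ideal_prod_subset:
 assumes N: "smod A N" and IM: "\<And>i x. [|i \<in> I; x \<in> M|] ==> i \<otimes> x \<in> N"
 shows "ideal_prod R I M \<subseteq> N"
proof
 fix x assume "x \<in> ideal_prod R I M"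
 then show "x \<in> N" by (induction rule: ideal_prod.induct) (use IM smodD(3)[OF N] in auto)
qed

lemma (in cring) rbasis_exists_fg:
 assumes qp: "qp A I M N" and fg: "fg A M"
 shows "\<exists>J (b :: 'a \<Rightarrow> 'a). rbasis R A I M N J b"
proof -
 have A: "subring A R" and N: "smod A N" and M: "smod A M" using qp mxi_D(1) unfolding qp_def by blast+
 obtain B where B: "finite B" "B \<subseteq> carrier R" "M = spn A B" using fg unfolding fg_def by blast
 have "\<exists>J'\<subseteq>B. rbasis R A I M N J' (\<lambda>v. v)"
 proof (rule rbasis_exists[OF qp B(1)])
  show "v \<in> M" if "v \<in> B" for v using that spn_superset[of B A] B(3) by blast
  fix x assume x: "x \<in> M"
  obtain c where c: "\<forall>v\<in>B. c v \<in> A" "x = lsum B c (\<lambda>v. v)" using spn_lsum[OF A B(1,2)] x B(3) by blast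
  then show "\<exists>c n. (\<forall>i\<in>B. c i \<in> A) \<and> n \<in> N \<and> x = lsum B c (\<lambda>v. v) \<oplus> n"
   using smodD(2)[OF N] smodD(1)[OF M x] by (intro exI[of _ c] exI[of _ \<zero>]) auto
 qed
 then show ?thesis by blast
qed

context dedekind_algebra
begin

text \<open>For finitely generated L this amounts to containing a basis of K over Q, see
  \<open>lattice_iff\<close>. It mentions no basis and passes to larger sets at once.\<close>

definition full where "full L \<longleftrightarrow> (\<forall>x\<in>carrier K. \<exists>d\<in>Z. d \<noteq> \<zero> \<and> d \<otimes> x \<in> L)"

lemma full_mono: "full L ==> L \<subseteq> M ==> full M" unfolding full_def by blast

lemma full_nz:
 assumes L: "full L" shows "\<exists>d\<in>L. d \<in> Z \<and> d \<noteq> \<zero>"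
proof -
 obtain d where "d \<in> Z" "d \<noteq> \<zero>" "d \<otimes> \<one> \<in> L" using L unfolding full_def by (meson one_closed)
 then show ?thesis using ZK' by auto
qed

lemma full_scale:
 assumes L: "full L" and d: "d \<in> Z" "d \<noteq> \<zero>" and M: "\<And>x. x \<in> L ==> d \<otimes> x \<in> M"
 shows "full M"
 unfolding full_def
proof
 fix x assume x: "x \<in> carrier K"
 obtain e where e: "e \<in> Z" "e \<noteq> \<zero>" "e \<otimes> x \<in> L" using L x unfolding full_def by blast
 have "d \<otimes> e \<otimes> x \<in> M" using M[OF e(3)] d e x ZK' by (simp add: m_assoc)
 then show "\<exists>d\<in>Z. d \<noteq> \<zero> \<and> d \<otimes> x \<in> M" using Z_nz_mult[OF d e(1,2)] by blast
qed

lemma full_finite: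
 assumes L: "full L" "smod Z L"
 shows "finite B ==> B \<subseteq> carrier K ==> \<exists>d\<in>Z. d \<noteq> \<zero> \<and> (\<forall>x\<in>B. d \<otimes> x \<in> L)"
proof (induction B rule: finite_induct)
 case empty then show ?case using Zcl(2) one_nz by blast
next
 case (insert b B)
 obtain d where d: "d \<in> Z" "d \<noteq> \<zero>" "\<forall>x\<in>B. d \<otimes> x \<in> L" using insert by blast
 obtain e where e: "e \<in> Z" "e \<noteq> \<zero>" "e \<otimes> b \<in> L" using L(1) insert.prems unfolding full_def by blast
 have R: "d \<in> carrier K" "e \<in> carrier K" "b \<in> carrier K" using d e ZK' insert.prems by auto
 have "d \<otimes> e \<otimes> b \<in> L" using smodD(4)[OF L(2) d(1) e(3)] R by (simp add: m_assoc)
 moreover have "d \<otimes> e \<otimes> x \<in> L" if "x \<in> B" for x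
 proof -
  have "x \<in> carrier K" using that insert.prems by blast
  then have "d \<otimes> e \<otimes> x = e \<otimes> (d \<otimes> x)" using R by (simp add: m_ac)
  then show ?thesis using smodD(4)[OF L(2) e(1)] d(3) that by simp
 qed
 ultimately show ?case using Z_nz_mult[OF d(1,2) e(1,2)] by blast
qed

lemma full_fg:
 assumes L: "full L" "smod Z L" and M: "fg Z M"
 shows "\<exists>d\<in>Z. d \<noteq> \<zero> \<and> (\<forall>x\<in>M. d \<otimes> x \<in> L)"
proof -
 obtain B where B: "finite B" "B \<subseteq> carrier K" "M = spn Z B" using M unfolding fg_def by blast
 obtain d where d: "d \<in> Z" "d \<noteq> \<zero>" "\<forall>x\<in>B. d \<otimes> x \<in> L" using full_finite[OF L B(1,2)] by blast
 have "M \<subseteq> {v \<in> carrier K. d \<otimes> v \<in> L}"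
  unfolding B(3) by (rule spn_least[OF smod_mult_vimage[OF L(2) ZK'[OF d(1)]]]) (use B(2) d(3) in blast)
 then show ?thesis using d by blast
qed

lemma qb_full:
 assumes qb: "qb J b" and L: "smod Z L" "\<And>i. i \<in> J ==> b i \<in> L"
 shows "full L"
 unfolding full_def
proof
 fix x assume x: "x \<in> carrier K"
 note D = qb_D[OF qb] and C = co[OF qb x]
 have CK: "\<And>i. i \<in> J ==> co J b x i \<in> carrier K" using C(1) QK' by blast
 obtain d where d: "d \<in> Z" "d \<noteq> \<zero>" "\<forall>i\<in>J. d \<otimes> co J b x i \<in> Z" using common_den[where c = "co J b x", OF D(1) C(1)] by blast
 have "d \<otimes> lsum J (co J b x) b = lsum J (\<lambda>i. d \<otimes> co J b x i) b"
  by (rule lsum_smult) (use D CK ZK' d in auto)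
 moreover have "lsum J (\<lambda>i. d \<otimes> co J b x i) b \<in> L"
  by (rule lsum_mem[OF L(1) D(1) _ L(2) ZK]) (use d in auto)
 ultimately show "\<exists>d\<in>Z. d \<noteq> \<zero> \<and> d \<otimes> x \<in> L" using C(2) d by auto
qed

lemma lattice_iff:
 assumes U: "basis_over K Q U"
 shows "lattice_in K Q Z L \<longleftrightarrow> fg Z L \<and> full L"
proof
 assume "lattice_in K Q Z L"
 then obtain Us where L: "fg Z L" and Us: "set Us \<subseteq> L" "basis_over K Q Us"
  unfolding lattice_in_def fg_submodule_iff[OF Zs] by blast
 have "full L" by (rule qb_full[OF basis_qb(2)[OF Us(2)] fg_smod[OF Zs L]]) (use Us(1) in auto)
 then show "fg Z L \<and> full L" using L by blast
next
 assume L: "fg Z L \<and> full L"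
 obtain d where d: "d \<in> Z" "d \<noteq> \<zero>" "\<forall>x\<in>set U. d \<otimes> x \<in> L"
  using full_finite[of L "set U"] L fg_smod[OF Zs] basis_qb(1)[OF U] by blast
 have "basis_over K Q (map (\<lambda>u. d \<otimes> u) U)" by (rule basis_scale[OF U ZQ'[OF d(1)] d(2)])
 then show "lattice_in K Q Z L"
  unfolding lattice_in_def fg_submodule_iff[OF Zs] using L d(3)
  by (intro conjI exI[of _ "map (\<lambda>u. d \<otimes> u) U"]) auto
qed

lemma base_maximal:
 assumes I: "smod Z I" "I \<subseteq> Z" "\<one> \<notin> I" and d: "d \<in> I" "d \<noteq> \<zero>"
 shows "\<exists>p. bp p \<and> I \<subseteq> p"
proof -
 interpret N: noetherian_ring "K\<lparr>carrier := Z\<rparr>" using noetherian_ring_iff[OF Zs] noethZ by blast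
 interpret Zc: cring "K\<lparr>carrier := Z\<rparr>" by (rule cring_sub[OF Zs])
 have "ideal I (K\<lparr>carrier := Z\<rparr>)" using ideal_smod[OF Zs] I by blast
 moreover have "I \<noteq> carrier (K\<lparr>carrier := Z\<rparr>)" using I(3) Zcl(2) by auto
 ultimately obtain p where p: "maximalideal p (K\<lparr>carrier := Z\<rparr>)" "I \<subseteq> p" using N.exists_maximal_above by blast
 have "primeideal p (K\<lparr>carrier := Z\<rparr>)" by (rule Zc.maximalideal_prime[OF p(1)])
 then have "bp p" unfolding bp_def base_primes_def using p(2) d by blast
 then show ?thesis using p(2) by blast
qed

text \<open>The z in Z with z x in L form an ideal that contains d. If it were proper it would lie
  in some prime p, against the multiplier outside p.\<close>

lemma local_mem:
 assumes L: "smod Z L" and x: "x \<in> carrier K" and d: "d \<in> Z" "d \<noteq> \<zero>" "d \<otimes> x \<in> L"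
  and loc: "\<And>p. bp p ==> \<exists>s\<in>Z. s \<notin> p \<and> s \<otimes> x \<in> L"
 shows "x \<in> L"
proof (rule ccontr)
 assume nx: "x \<notin> L"
 let ?I = "{z \<in> Z. z \<otimes> x \<in> L}"
 have "smod Z ?I"
 proof (rule smodI)
  show "?I \<subseteq> carrier K" using ZK by blast
  show "\<zero> \<in> ?I" using Zcl(1) x smodD(2)[OF L] by simp
  show "a \<oplus> b \<in> ?I" if "a \<in> ?I" "b \<in> ?I" for a b
   using that Zcl(5)[of a b] smodD(3)[OF L] ZK' x by (simp add: l_distr)
  show "a \<otimes> b \<in> ?I" if "a \<in> Z" "b \<in> ?I" for a b
   using that Zcl(4)[of a b] smodD(4)[OF L] ZK' x by (simp add: m_assoc)
 qed
 moreover have "\<one> \<notin> ?I" using nx x by simp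
 ultimately obtain p where p: "bp p" "?I \<subseteq> p" using base_maximal[of ?I d] d by blast
 then show False using loc[OF p(1)] by blast
qed

lemma local_qb:
 assumes p: "bp p" and L: "fg Z L" "full L"
 shows "\<exists>B s. qb B (\<lambda>v. v) \<and> B \<subseteq> L \<and> s \<in> Z \<and> s \<notin> p \<and>
  (\<forall>x\<in>L. \<exists>c. (\<forall>v\<in>B. c v \<in> Z) \<and> s \<otimes> x = lsum B c (\<lambda>v. v))"
proof -
 obtain B s where B: "finite B" "B \<subseteq> L" "s \<in> Z" "s \<notin> p" "\<forall>x\<in>L. s \<otimes> x \<in> spn Z B" "Qind B"
  using local_basis[OF p L(1)] by blast
 have LK: "L \<subseteq> carrier K" using smodD(1)[OF fg_smod[OF Zs L(1)]] by blast
 have BK: "B \<subseteq> carrier K" using B(2) LK by blast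
 have sp: "\<exists>c. (\<forall>v\<in>B. c v \<in> Z) \<and> s \<otimes> x = lsum B c (\<lambda>v. v)" if "x \<in> L" for x
  using spn_lsum[OF Zs B(1) BK] B(5) that by blast
 have snz: "s \<noteq> \<zero>" using smodD(2)[OF mxi_D(2)[OF bp_mxi[OF p]]] B(4) by auto
 have "qb B (\<lambda>v. v)"
 proof (rule qb_I[OF B(1)])
  show "v \<in> carrier K" if "v \<in> B" for v using that BK by blast
  fix x assume x: "x \<in> carrier K"
  obtain d where d: "d \<in> Z" "d \<noteq> \<zero>" "d \<otimes> x \<in> L" using L(2) x unfolding full_def by blast
  obtain c where c: "\<forall>v\<in>B. c v \<in> Z" "s \<otimes> (d \<otimes> x) = lsum B c (\<lambda>v. v)" using sp[OF d(3)] by blast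
  have sd: "s \<otimes> d \<in> Z" "s \<otimes> d \<noteq> \<zero>" using Z_nz_mult[OF B(3) snz d(1,2)] by auto
  obtain i where i: "i \<in> Q" "s \<otimes> d \<otimes> i = \<one>" using Q_inv[OF ZQ'[OF sd(1)] sd(2)] by blast
  have R: "s \<in> carrier K" "d \<in> carrier K" "i \<in> carrier K" using B(3) d i ZK' QK' by auto
  have "x = (s \<otimes> d \<otimes> i) \<otimes> x" using i x by simp
  also have "\<dots> = i \<otimes> (s \<otimes> (d \<otimes> x))" using R x by (simp add: m_ac)
  also have "\<dots> = lsum B (\<lambda>v. i \<otimes> c v) (\<lambda>v. v)"
   unfolding c(2) by (rule lsum_smult) (use B(1) R c(1) ZK' BK in auto)
  finally have "x = lsum B (\<lambda>v. i \<otimes> c v) (\<lambda>v. v)" .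
  moreover have "\<forall>v\<in>B. i \<otimes> c v \<in> Q" using Qcl(4)[OF i(1)] c(1) ZQ' by blast
  ultimately show "\<exists>c. (\<forall>i\<in>B. c i \<in> Q) \<and> x = lsum B c (\<lambda>v. v)" by (intro exI[of _ "\<lambda>v. i \<otimes> c v"]) blast
 next
  fix c i assume "\<And>i. i \<in> B ==> c i \<in> Q" "lsum B c (\<lambda>v. v) = \<zero>" "i \<in> B"
  then show "c i = \<zero>" using B(6) unfolding Qind_def by blast
 qed
 then show ?thesis using B sp by blast
qed

lemma local_coord:
 assumes qb: "qb B (\<lambda>v. v)" and s: "s \<in> Z" and v: "v \<in> B" and x: "x \<in> carrier K"
  and sp: "\<exists>c. (\<forall>v\<in>B. c v \<in> Z) \<and> s \<otimes> x = lsum B c (\<lambda>v. v)"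
 shows "s \<otimes> co B (\<lambda>v. v) x v \<in> Z"
proof -
 obtain c where c: "\<forall>v\<in>B. c v \<in> Z" "s \<otimes> x = lsum B c (\<lambda>v. v)" using sp by blast
 have "co B (\<lambda>v. v) (s \<otimes> x) v = c v" by (rule co_unique[OF qb _ c(2) v]) (use c(1) ZQ' in blast)
 then show ?thesis using lin_D(4)[OF lin_co[OF qb v] ZQ'[OF s] x] c(1) v by simp
qed

text \<open>At some prime p no multiplier outside p moves x into L. In a local basis of L at p, some
  coordinate of x times the multiplier s is then not in Z, although s clears that coordinate for
  every element of L. This scaled coordinate is the functional.\<close>

lemma separating_functional:
 assumes L: "fg Z L" "full L" and x: "x \<in> carrier K" "x \<notin> L"
 shows "\<exists>f. lin f \<and> (\<forall>y\<in>L. f y \<in> Z) \<and> f x \<notin> Z"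
proof -
 have sL: "smod Z L" by (rule fg_smod[OF Zs L(1)])
 obtain d where d: "d \<in> Z" "d \<noteq> \<zero>" "d \<otimes> x \<in> L" using L(2) x unfolding full_def by blast
 obtain p where p: "bp p" "\<And>s. s \<in> Z ==> s \<notin> p ==> s \<otimes> x \<notin> L" using local_mem[OF sL x(1) d] x(2) by blast
 obtain B s where B: "qb B (\<lambda>v. v)" "B \<subseteq> L" "s \<in> Z" "s \<notin> p"
  "\<forall>x\<in>L. \<exists>c. (\<forall>v\<in>B. c v \<in> Z) \<and> s \<otimes> x = lsum B c (\<lambda>v. v)"
  using local_qb[OF p(1) L] by blast
 have BK: "B \<subseteq> carrier K" using B(2) smodD(1)[OF sL] by blast
 have sK: "s \<in> carrier K" by (rule ZK'[OF B(3)])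
 note fin = qb_D(1)[OF B(1)]
 have "\<exists>v\<in>B. s \<otimes> co B (\<lambda>v. v) x v \<notin> Z"
 proof (rule ccontr)
  assume "\<not> (\<exists>v\<in>B. s \<otimes> co B (\<lambda>v. v) x v \<notin> Z)"
  then have a: "\<And>v. v \<in> B ==> s \<otimes> co B (\<lambda>v. v) x v \<in> Z" by blast
  have "s \<otimes> lsum B (co B (\<lambda>v. v) x) (\<lambda>v. v) = lsum B (\<lambda>v. s \<otimes> co B (\<lambda>v. v) x v) (\<lambda>v. v)"
   by (rule lsum_smult) (use fin sK co(1)[OF B(1) x(1)] QK' BK in auto)
  also have "\<dots> \<in> L" by (rule lsum_mem[OF sL fin _ _ ZK]) (use a B(2) in auto)
  finally show False using p(2)[OF B(3,4)] co(2)[OF B(1) x(1)] by simp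
 qed
 then obtain v where v: "v \<in> B" "s \<otimes> co B (\<lambda>v. v) x v \<notin> Z" by blast
 note lc = lin_co[OF B(1) v(1)]
 have eq: "co B (\<lambda>v. v) (y \<otimes> s) v = s \<otimes> co B (\<lambda>v. v) y v" if "y \<in> carrier K" for y
  using lin_D(4)[OF lc ZQ'[OF B(3)] that] that sK by (simp add: m_comm)
 have "lin (\<lambda>y. co B (\<lambda>v. v) (y \<otimes> s) v)" by (rule lin_mult[OF lc sK])
 moreover have "co B (\<lambda>v. v) (y \<otimes> s) v \<in> Z" if y: "y \<in> L" for y
 proof -
  have "y \<in> carrier K" using smodD(1)[OF sL y] .
  then show ?thesis using local_coord[OF B(1,3) v(1)] B(5) y eq by simp
 qed
 moreover have "co B (\<lambda>v. v) (x \<otimes> s) v \<notin> Z" using eq[OF x(1)] v(2) by simp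
 ultimately show ?thesis by blast
qed

end

text \<open>The basis \<open>U\<close> serves to compute the trace, and the order \<open>S0\<close>
  bounds the maximal order by its trace dual.\<close>

locale etale_order = dedekind_algebra +
 fixes S0 U
 assumes etale: "etale_algebra K Q" and S0: "order_in K Q Z S0" and U: "basis_over K Q U"
begin

abbreviation T where "T \<equiv> tr {..<length U} ((!) U)"
abbreviation dual where "dual \<equiv> trace_dual K Q Z"

lemmas U_qb = basis_qb(2)[OF U]

lemma T_lin: "lin T" by (rule tr_lin[OF U_qb])

lemma dual_iff: "x \<in> dual L \<longleftrightarrow> x \<in> carrier K \<and> (\<forall>y\<in>L. T (x \<otimes> y) \<in> Z)" if "L \<subseteq> carrier K"
 unfolding trace_dual_def using algebra_trace_eq[OF U U_qb] that by (auto simp: subset_iff)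

lemma dim_eq: "qb J b ==> card J = dim Q (carrier K)"
proof -
 assume qb: "qb J b"
 have "dimension (length U) Q (Span Q U)" by (rule dimension_independent) (use U in \<open>simp add: basis_over_def\<close>)
 then have "dimension (length U) Q (carrier K)" using U by (simp add: basis_over_def)
 then have "dim Q (carrier K) = length U" using dimI[OF Qf] by (simp add: over_def)
 moreover have "card J = card {..<length U}"
  by (rule rbasis_card_unique[OF qp_Q]) (use qb U_qb in \<open>simp_all add: qb_def\<close>)
 ultimately show ?thesis by simp
qed

lemma dual_smod:
 assumes S: "subring S K" and L: "smod S L" "smod Z L"
 shows "smod S (dual L)"
proof -
 have LK: "L \<subseteq> carrier K" using smodD(1)[OF L(1)] by blast
 note di = dual_iff[OF LK]
 have SK: "S \<subseteq> carrier K" by (rule subringE(1)[OF S])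
 show ?thesis
 proof (rule smodI)
  show "dual L \<subseteq> carrier K" using di by blast
  show "\<zero> \<in> dual L" using lin_zero[OF T_lin] LK Zcl(1) di by auto
  show "x \<oplus> y \<in> dual L" if "x \<in> dual L" "y \<in> dual L" for x y
   unfolding di
  proof (intro conjI ballI)
   show "x \<oplus> y \<in> carrier K" using that di by blast
   fix l assume l: "l \<in> L"
   have "T ((x \<oplus> y) \<otimes> l) = T (x \<otimes> l) \<oplus> T (y \<otimes> l)"
    using that l LK di lin_D(3)[OF T_lin, of "x \<otimes> l" "y \<otimes> l"] by (auto simp: l_distr subset_iff)
   then show "T ((x \<oplus> y) \<otimes> l) \<in> Z" using that l di Zcl(5) by simp
  qed
  show "a \<otimes> x \<in> dual L" if "a \<in> S" "x \<in> dual L" for a x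
   unfolding di
  proof (intro conjI ballI)
   have R: "a \<in> carrier K" "x \<in> carrier K" using that SK di by blast+
   then show "a \<otimes> x \<in> carrier K" by simp
   fix l assume l: "l \<in> L"
   then have "a \<otimes> x \<otimes> l = x \<otimes> (a \<otimes> l)" using R LK by (simp add: m_ac subset_iff)
   then show "T (a \<otimes> x \<otimes> l) \<in> Z" using smodD(4)[OF L(1) that(1) l] that(2) di by simp
  qed
 qed
qed

lemma trace_smod: assumes x: "x \<in> carrier K" shows "smod Z {v \<in> carrier K. T (x \<otimes> v) \<in> Z}"
proof (rule smodI)
 show "\<zero> \<in> {v \<in> carrier K. T (x \<otimes> v) \<in> Z}" using x lin_zero[OF T_lin] Zcl(1) by simp
 show "v \<oplus> w \<in> {v \<in> carrier K. T (x \<otimes> v) \<in> Z}"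
  if "v \<in> {v \<in> carrier K. T (x \<otimes> v) \<in> Z}" "w \<in> {v \<in> carrier K. T (x \<otimes> v) \<in> Z}" for v w
  using that x lin_D(3)[OF T_lin, of "x \<otimes> v" "x \<otimes> w"] Zcl(5) by (simp add: r_distr)
 show "a \<otimes> v \<in> {v \<in> carrier K. T (x \<otimes> v) \<in> Z}"
  if "a \<in> Z" "v \<in> {v \<in> carrier K. T (x \<otimes> v) \<in> Z}" for a v
  using that x lin_D(4)[OF T_lin ZQ'[OF that(1)], of "x \<otimes> v"] Zcl(4)[OF that(1)] ZK' by (simp add: m_lcomm)
qed blast

lemma dual_full:
 assumes L: "fg Z L" shows "full (dual L)"
 unfolding full_def
proof
 fix x assume x: "x \<in> carrier K"
 obtain B where B: "finite B" "B \<subseteq> carrier K" "L = spn Z B" using L unfolding fg_def by blast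
 have LK: "L \<subseteq> carrier K" using smodD(1)[OF fg_smod[OF Zs L]] by blast
 have TQ: "T (x \<otimes> v) \<in> Q" if "v \<in> B" for v using lin_D(1)[OF T_lin] x B(2) that by blast
 obtain d where d: "d \<in> Z" "d \<noteq> \<zero>" "\<forall>v\<in>B. d \<otimes> T (x \<otimes> v) \<in> Z" using common_den[where c = "\<lambda>v. T (x \<otimes> v)", OF B(1) TQ] by blast
 have dx: "d \<otimes> x \<in> carrier K" using d x ZK' by simp
 have "v \<in> {v \<in> carrier K. T (d \<otimes> x \<otimes> v) \<in> Z}" if v: "v \<in> B" for v
 proof -
  have vK: "v \<in> carrier K" using v B(2) by blast
  have "T (d \<otimes> (x \<otimes> v)) = d \<otimes> T (x \<otimes> v)" by (rule lin_D(4)[OF T_lin ZQ'[OF d(1)]]) (use x vK in simp)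
  then show ?thesis using d v vK x ZK' by (simp add: m_assoc)
 qed
 then have "L \<subseteq> {v \<in> carrier K. T (d \<otimes> x \<otimes> v) \<in> Z}"
  unfolding B(3) by (intro spn_least[OF trace_smod[OF dx]]) blast
 then have "d \<otimes> x \<in> dual L" unfolding dual_iff[OF LK] using dx by blast
 then show "\<exists>d\<in>Z. d \<noteq> \<zero> \<and> d \<otimes> x \<in> dual L" using d by blast
qed

lemma fg_unscale:
 assumes d: "d \<in> Z" "d \<noteq> \<zero>" and M: "smod Z M" and L: "fg Z L" "\<And>x. x \<in> M ==> d \<otimes> x \<in> L"
 shows "fg Z M"
proof -
 obtain i where i: "i \<in> Q" "d \<otimes> i = \<one>" using Q_inv[OF ZQ'[OF d(1)] d(2)] by blast
 have R: "d \<in> carrier K" "i \<in> carrier K" using d i ZK' QK' by auto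
 have "M \<subseteq> (\<lambda>x. i \<otimes> x) ` L"
 proof
  fix x assume x: "x \<in> M"
  have xK: "x \<in> carrier K" by (rule smodD(1)[OF M x])
  have "x = (d \<otimes> i) \<otimes> x" using i xK by simp
  also have "\<dots> = i \<otimes> (d \<otimes> x)" using R xK by (simp add: m_ac)
  finally show "x \<in> (\<lambda>x. i \<otimes> x) ` L" using L(2)[OF x] by blast
 qed
 then show ?thesis by (rule noeth_fg[OF Zs noethZ fg_smult[OF Zs R(2) L(1)] M])
qed

text \<open>Let w i represent the i-th coordinate functional of a basis inside L, and let d move all
  w i into L. For x in the dual, d times each coordinate of x is Tr(x d w i), hence in Z, so d x
  lies in L.\<close>

lemma dual_fg:
 assumes L: "fg Z L" "full L" shows "fg Z (dual L)"
proof -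
 have sL: "smod Z L" by (rule fg_smod[OF Zs L(1)])
 have LK: "L \<subseteq> carrier K" using smodD(1)[OF sL] by blast
 obtain V where V: "set V \<subseteq> L" "basis_over K Q V"
  using L lattice_iff[OF U, of L] unfolding lattice_in_def by blast
 let ?J = "{..<length V}"
 note qbV = basis_qb(2)[OF V(2)]
 have "\<forall>i. \<exists>c\<in>carrier K. i < length V --> (\<forall>x\<in>carrier K. T (x \<otimes> c) = co ?J ((!) V) x i)"
 proof
  fix i
  show "\<exists>c\<in>carrier K. i < length V --> (\<forall>x\<in>carrier K. T (x \<otimes> c) = co ?J ((!) V) x i)"
   using trace_dualizing[OF etale U_qb lin_co[OF qbV, of i]] by (cases "i < length V") auto
 qed
 then obtain w where w: "\<And>i. w i \<in> carrier K"
  and wT: "\<And>i x. i < length V ==> x \<in> carrier K ==> T (x \<otimes> w i) = co ?J ((!) V) x i" by metis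
 obtain d where d: "d \<in> Z" "d \<noteq> \<zero>" "\<forall>x\<in>w ` ?J. d \<otimes> x \<in> L"
  using full_finite[OF L(2) sL, of "w ` ?J"] w by blast
 have dK: "d \<in> carrier K" using d ZK' by blast
 show ?thesis
 proof (rule fg_unscale[OF d(1,2) dual_smod[OF Zs sL sL] L(1)])
  fix x assume x: "x \<in> dual L"
  have xK: "x \<in> carrier K" using x dual_iff[OF LK] by blast
  have "d \<otimes> co ?J ((!) V) x i \<in> Z" if i: "i \<in> ?J" for i
  proof -
   have "T (x \<otimes> (d \<otimes> w i)) \<in> Z" using x d(3) i unfolding dual_iff[OF LK] by blast
   moreover have "x \<otimes> (d \<otimes> w i) = d \<otimes> (x \<otimes> w i)" using xK w dK by (simp add: m_lcomm)
   ultimately show ?thesis using lin_D(4)[OF T_lin ZQ'[OF d(1)], of "x \<otimes> w i"] wT[of i x] i xK w by simp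
  qed
  then have "lsum ?J (\<lambda>i. d \<otimes> co ?J ((!) V) x i) ((!) V) \<in> L"
   by (intro lsum_mem[OF sL _ _ _ ZK]) (use V(1) in auto)
  moreover have "d \<otimes> lsum ?J (co ?J ((!) V) x) ((!) V) = lsum ?J (\<lambda>i. d \<otimes> co ?J ((!) V) x i) ((!) V)"
   by (rule lsum_smult) (use dK co(1)[OF qbV xK] QK' qb_D(2)[OF qbV] in auto)
  ultimately show "d \<otimes> x \<in> L" using co(2)[OF qbV xK] by simp
 qed
qed

text \<open>A functional that is integral on L but not at x is of the form Tr(c y); then c is in the
  dual and contradicts the hypothesis on x.\<close>

lemma dual_dual:
 assumes L: "fg Z L" "full L" and x: "x \<in> carrier K" and xT: "\<And>w. w \<in> dual L ==> T (x \<otimes> w) \<in> Z"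
 shows "x \<in> L"
proof (rule ccontr)
 assume "x \<notin> L"
 then obtain f where f: "lin f" "\<forall>y\<in>L. f y \<in> Z" "f x \<notin> Z" using separating_functional[OF L x] by blast
 obtain c where c: "c \<in> carrier K" "\<forall>x\<in>carrier K. T (x \<otimes> c) = f x"
  using trace_dualizing[OF etale U_qb f(1)] by blast
 have LK: "L \<subseteq> carrier K" using smodD(1)[OF fg_smod[OF Zs L(1)]] by blast
 have "T (c \<otimes> y) \<in> Z" if "y \<in> L" for y
 proof -
  have "y \<in> carrier K" using that LK by blast
  then show ?thesis using c f(2) that m_comm[of c y] by simp
 qed
 then have "c \<in> dual L" unfolding dual_iff[OF LK] using c by blast
 then show False using xT[of c] c(2) f(3) x by simp
qed

text \<open>A finitely generated module stable under x and containing 1, multiplied by a basis of K,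
  becomes a lattice that is still stable under x.\<close>

lemma stable_lattice:
 assumes x: "x \<in> OK"
 shows "\<exists>M. fg Z M \<and> full M \<and> (\<forall>m\<in>M. x \<otimes> m \<in> M)"
proof -
 have xK: "x \<in> carrier K" and xi: "integral_over K Z x" using x by (simp_all add: OK_iff)
 obtain L where L: "fg Z L" "\<one> \<in> L" "\<forall>u\<in>L. x \<otimes> u \<in> L" using integral_pair[OF xK xi xK xi] by blast
 obtain B where B: "finite B" "B \<subseteq> carrier K" "L = spn Z B" using L(1) unfolding fg_def by blast
 let ?G = "(\<lambda>(v, u). u \<otimes> v) ` (B \<times> set U)"
 let ?M = "spn Z ?G"
 have UK: "set U \<subseteq> carrier K" by (rule basis_qb(1)[OF U])
 have GK: "?G \<subseteq> carrier K" using B(2) UK by auto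
 have M: "smod Z ?M" by (rule spn_smod[OF Zs GK])
 have LM: "L \<subseteq> {v \<in> carrier K. u \<otimes> v \<in> ?M}" if u: "u \<in> set U" for u
  unfolding B(3)
 proof (rule spn_least[OF smod_mult_vimage[OF M]])
  show "u \<in> carrier K" using u UK by blast
  have "u \<otimes> v \<in> ?M" if "v \<in> B" for v
  proof -
   have "(v, u) \<in> B \<times> set U" using that u by blast
   then have "(\<lambda>(v, u). u \<otimes> v) (v, u) \<in> ?G" by (rule imageI)
   then show ?thesis using spn_superset[of ?G Z] by auto
  qed
  then show "B \<subseteq> {v \<in> carrier K. u \<otimes> v \<in> ?M}" using B(2) by blast
 qed
 have finG: "finite ?G" using B(1) by simp
 have "fg Z ?M" unfolding fg_def by (rule exI[of _ ?G]) (use finG GK in simp)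
 moreover have "full ?M"
 proof (rule qb_full[OF U_qb M])
  fix i assume i: "i \<in> {..<length U}"
  then have "U ! i \<otimes> \<one> \<in> ?M" using LM[of "U ! i"] L(2) by auto
  then show "U ! i \<in> ?M" using i UK by (auto simp: subset_iff)
 qed
 moreover have "?M \<subseteq> {v \<in> carrier K. x \<otimes> v \<in> ?M}"
 proof (rule spn_least[OF smod_mult_vimage[OF M xK]], safe)
  fix v u assume vu: "v \<in> B" "u \<in> set U"
  have R: "v \<in> carrier K" "u \<in> carrier K" using vu B(2) UK by auto
  then show "u \<otimes> v \<in> carrier K" by simp
  have "x \<otimes> v \<in> L" using L(3) B(3) spn_superset[of B Z] vu(1) by blast
  then have "u \<otimes> (x \<otimes> v) \<in> ?M" using LM[OF vu(2)] by blast
  then show "x \<otimes> (u \<otimes> v) \<in> ?M" using R xK by (simp add: m_lcomm)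
 qed
 ultimately show ?thesis by blast
qed

text \<open>Locally at a prime p a stable lattice is free, and in a local basis the diagonal entries
  of the matrix of x are integral up to a multiplier outside p. \<open>local_mem\<close> combines
  the primes.\<close>

lemma trace_integral:
 assumes x: "x \<in> OK" shows "T x \<in> Z"
proof -
 have xK: "x \<in> carrier K" using x by (simp add: OK_iff)
 obtain M where M: "fg Z M" "full M" "\<forall>m\<in>M. x \<otimes> m \<in> M" using stable_lattice[OF x] by blast
 have TQ: "T x \<in> Q" by (rule lin_D(1)[OF T_lin xK])
 have TK: "T x \<in> carrier K" using TQ QK' by blast
 obtain e d where d: "e \<in> Z" "d \<in> Z - {\<zero>}" "T x \<otimes> d = e" using frac[OF TQ] by blast
 show ?thesis
 proof (rule local_mem[OF smod_self[OF Zs] TK, of d])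
  show "d \<in> Z" "d \<noteq> \<zero>" using d by auto
  show "d \<otimes> T x \<in> Z" using d TK ZK' by (simp add: m_comm)
  fix p assume p: "bp p"
  obtain B s where B: "qb B (\<lambda>v. v)" "B \<subseteq> M" "s \<in> Z" "s \<notin> p"
   "\<forall>x\<in>M. \<exists>c. (\<forall>v\<in>B. c v \<in> Z) \<and> s \<otimes> x = lsum B c (\<lambda>v. v)"
   using local_qb[OF p M(1,2)] by blast
  have MK: "M \<subseteq> carrier K" using smodD(1)[OF fg_smod[OF Zs M(1)]] by blast
  have sK: "s \<in> carrier K" by (rule ZK'[OF B(3)])
  have xB: "x \<otimes> v \<in> M" "x \<otimes> v \<in> carrier K" if "v \<in> B" for v using M(3) B(2) MK that by auto
  let ?c = "\<lambda>v. co B (\<lambda>v. v) (x \<otimes> v) v"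
  have cK: "?c v \<in> carrier K" if "v \<in> B" for v using co(1)[OF B(1) xB(2)[OF that] that] QK' by blast
  have cZ: "s \<otimes> ?c v \<in> Z" if "v \<in> B" for v
   by (rule local_coord[OF B(1,3) that xB(2)[OF that]]) (use B(5) xB(1)[OF that] in blast)
  have "tr B (\<lambda>v. v) x = lsum B (\<lambda>_. \<one>) ?c"
   unfolding tr_def lsum_def by (rule finsum_cong') (use cK in auto)
  then have "s \<otimes> T x = s \<otimes> lsum B (\<lambda>_. \<one>) ?c" unfolding tr_basis[OF U_qb B(1) xK] by (rule arg_cong)
  also have "\<dots> = lsum B (\<lambda>_. \<one>) (\<lambda>v. s \<otimes> ?c v)"
   by (rule lsum_smult_vec) (use qb_D(1)[OF B(1)] sK cK in auto)
  also have "\<dots> \<in> Z" by (rule lsum_mem[OF smod_self[OF Zs] qb_D(1)[OF B(1)] _ _ ZK]) (use cZ Zcl(2) in auto)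
  finally show "\<exists>s\<in>Z. s \<notin> p \<and> s \<otimes> T x \<in> Z" using B(3,4) by blast
 qed
qed

section \<open>Orders and the maximal order\<close>

definition ord where "ord S \<longleftrightarrow> subring S K \<and> fg Z S \<and> full S"

lemma ord_iff: "order_in K Q Z S \<longleftrightarrow> ord S"
 unfolding order_in_def ord_def lattice_iff[OF U] by blast

lemma ord_D:
 assumes "ord S"
 shows "subring S K" "fg Z S" "full S" "smod Z S" "S \<subseteq> carrier K" "Z \<subseteq> S" "noeth S" "\<one> \<in> S"
proof -
 show 1: "subring S K" "fg Z S" "full S" using assms unfolding ord_def by auto
 show 2: "smod Z S" by (rule fg_smod[OF Zs 1(2)])
 show "S \<subseteq> carrier K" by (rule subringE(1)[OF 1(1)])
 show 3: "\<one> \<in> S" by (rule subringE(3)[OF 1(1)])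
 show 4: "Z \<subseteq> S"
 proof
  fix z assume "z \<in> Z"
  then show "z \<in> S" using smodD(4)[OF 2, of z \<one>] 3 ZK'[of z] by simp
 qed
 show "noeth S" by (rule noeth_over[OF Zs noethZ 1(1) 4 1(2)])
qed

lemma ord_OK: "ord S ==> S \<subseteq> OK"
proof
 fix x assume S: "ord S" and x: "x \<in> S"
 note D = ord_D[OF S]
 have xK: "x \<in> carrier K" using x D(5) by blast
 have "integral_over K Z x"
  by (rule integralI[OF xK D(2) _ D(8) one_Q one_nz]) (use subringE(6)[OF D(1)] x in blast)
 then show "x \<in> OK" unfolding OK_iff using xK by blast
qed

text \<open>Traces of integral elements are in Z, so the maximal order is contained in the trace
  dual of the given order. That dual is finitely generated, and Z is Noetherian.\<close>

lemma ord_OK_self: "ord OK"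
proof -
 have S: "ord S0" using S0 ord_iff by blast
 note D = ord_D[OF S]
 have OKK: "OK \<subseteq> carrier K" by (rule subringE(1)[OF OK_subring])
 have sm: "smod Z OK" by (rule smod_mono[OF smod_self[OF OK_subring] Z_OK])
 have "OK \<subseteq> dual S0"
 proof
  fix x assume x: "x \<in> OK"
  have "T (x \<otimes> y) \<in> Z" if "y \<in> S0" for y
   by (rule trace_integral[OF subringE(6)[OF OK_subring x]]) (use ord_OK[OF S] that in blast)
  then show "x \<in> dual S0" unfolding dual_iff[OF D(5)] using x OKK by blast
 qed
 then have "fg Z OK" by (rule noeth_fg[OF Zs noethZ dual_fg[OF D(2,3)] sm])
 then show ?thesis unfolding ord_def using OK_subring full_mono[OF D(3) ord_OK[OF S]] by blast
qed

end

section \<open>Primes of orders and their types\<close>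

lemma (in cring) colon_smod:
 assumes A: "A \<subseteq> carrier R" and I: "smod A I" and J: "J \<subseteq> carrier R"
 shows "smod A (colon R I J)"
proof (rule smodI)
 show "colon R I J \<subseteq> carrier R" by (auto simp: colon_def)
 show "\<zero> \<in> colon R I J" using J smodD(2)[OF I] by (auto simp: colon_def subset_iff)
 show "x \<oplus> y \<in> colon R I J" if "x \<in> colon R I J" "y \<in> colon R I J" for x y
  using that J smodD(3)[OF I] by (auto simp: colon_def l_distr subset_iff)
 show "a \<otimes> x \<in> colon R I J" if "a \<in> A" "x \<in> colon R I J" for a x
  using that A J smodD(4)[OF I] by (auto simp: colon_def m_assoc subset_iff)
qed

lemma (in cring) finsum_sub:
 assumes S: "subring S R" and J: "finite J"
 shows "(\<And>i. i \<in> J ==> f i \<in> S) ==> finsum (R\<lparr>carrier := S\<rparr>) f J = finsum R f J"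
 using J
proof (induction J rule: finite_induct)
 case empty
 interpret Sc: cring "R\<lparr>carrier := S\<rparr>" by (rule cring_sub[OF S])
 show ?case by simp
next
 case (insert j J)
 interpret Sc: cring "R\<lparr>carrier := S\<rparr>" by (rule cring_sub[OF S])
 have f: "f \<in> J \<rightarrow> S" "f j \<in> S" using insert by auto
 have "f \<in> J \<rightarrow> carrier R" "f j \<in> carrier R" using f subringE(1)[OF S] by auto
 then show ?case using insert f Sc.finsum_insert[of J j f] finsum_insert[of J j f] by simp
qed

context etale_order
begin

text \<open>For an order this describes exactly the members of \<open>order_primes\<close>: a full
  ideal meets Z outside 0, and conversely d in P makes P full because it contains d S.\<close>

definition op where "op S P \<longleftrightarrow> mxi S P \<and> (\<exists>d\<in>P. d \<in> Z \<and> d \<noteq> \<zero>)"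

text \<open>Look at the constant coefficient c of a polynomial relation for x modulo q. If c is in
  q, one factor x is cancelled, since q is prime. Otherwise c is invertible modulo q \<inter> Z, and
  solving the relation for c yields an inverse of x.\<close>

lemma mod_inverse:
 assumes S: "ord S" and q: "primeideal q (K\<lparr>carrier := S\<rparr>)" and p: "mxi Z (q \<inter> Z)"
  and x: "x \<in> S" "x \<notin> q"
 shows "set f \<subseteq> Z ==> \<not> set f \<subseteq> q ==> eval f x \<in> q ==> \<exists>y\<in>S. \<exists>r\<in>q. x \<otimes> y = \<one> \<oplus> r"
proof (induction f rule: rev_induct)
 case Nil then show ?case by simp
next
 case (snoc c f)
 note D = ord_D[OF S]
 interpret q: primeideal q "K\<lparr>carrier := S\<rparr>" by (rule q)
 have sq: "smod S q" "q \<subseteq> S" using ideal_smod[OF D(1)] q.is_ideal by blast+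
 have xK: "x \<in> carrier K" using x D(5) by blast
 have cf: "c \<in> Z" "set f \<subseteq> Z" using snoc.prems by auto
 have cK: "c \<in> carrier K" "set f \<subseteq> carrier K" using cf ZK by auto
 have "eval f x \<in> S" if "set f \<subseteq> Z" for f using that
 proof (induction f)
  case (Cons a f)
  have "x [^] n \<in> S" for n :: nat
   by (induction n) (use D(8) x subringE(6)[OF D(1)] in auto)
  then show ?case using Cons D(6) subringE(6,7)[OF D(1)] by auto
 qed (use smodD(2)[OF D(4)] in simp)
 note ev = this[OF cf(2)]
 have evK: "eval f x \<in> carrier K" using ev D(5) by blast
 have e: "eval (f @ [c]) x = eval f x \<otimes> x \<oplus> c" by (rule eval_append_aux[OF cK(2,1) xK])
 show ?case
 proof (cases "c \<in> q")
  case True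
  have h: "eval (f @ [c]) x \<ominus> c \<in> q" by (rule smod_minus(2)[OF sq(1) D(1) snoc.prems(3) True])
  have "eval (f @ [c]) x \<ominus> c = eval f x \<otimes> x" unfolding e using evK xK cK(1) by algebra
  with h have "eval f x \<otimes> x \<in> q" by simp
  then have "eval f x \<in> q" using q.I_prime[of "eval f x" x] ev x by auto
  moreover have "\<not> set f \<subseteq> q" using snoc.prems(2) True by simp
  ultimately show ?thesis using snoc.IH[OF cf(2)] by blast
 next
  case False
  obtain b r where b: "b \<in> Z" "r \<in> q \<inter> Z" "c \<otimes> b = \<one> \<oplus> r" using mxi_D(6)[OF p cf(1)] False by blast
  have R: "b \<in> carrier K" "r \<in> carrier K" using b ZK' by auto
  have bS: "b \<in> S" using b D(6) by blast
  let ?y = "\<ominus> (eval f x \<otimes> b)"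
  let ?r = "r \<ominus> b \<otimes> eval (f @ [c]) x"
  have "?y \<in> S" by (intro subringE(5,6)[OF D(1)] ev bS)
  moreover have "?r \<in> q"
   by (rule smod_minus(2)[OF sq(1) D(1)]) (use b(2) smodD(4)[OF sq(1) bS snoc.prems(3)] in auto)
  moreover have "x \<otimes> ?y = \<one> \<oplus> ?r"
  proof -
   have "\<one> \<oplus> ?r = (\<one> \<oplus> r) \<ominus> b \<otimes> (eval f x \<otimes> x \<oplus> c)" unfolding e using R evK xK cK(1) by algebra
   also have "\<dots> = c \<otimes> b \<ominus> b \<otimes> (eval f x \<otimes> x \<oplus> c)" using b(3) by simp
   also have "\<dots> = x \<otimes> ?y" using R evK xK cK(1) by algebra
   finally show ?thesis by simp
  qed
  ultimately show ?thesis by blast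
 qed
qed

lemma prime_contract:
 assumes S: "ord S" and q: "primeideal q (K\<lparr>carrier := S\<rparr>)" and d: "d \<in> q" "d \<in> Z" "d \<noteq> \<zero>"
 shows "bp (q \<inter> Z)"
proof -
 note D = ord_D[OF S]
 interpret q: primeideal q "K\<lparr>carrier := S\<rparr>" by (rule q)
 interpret Zc: cring "K\<lparr>carrier := Z\<rparr>" by (rule cring_sub[OF Zs])
 have sq: "smod S q" "q \<subseteq> S" using ideal_smod[OF D(1)] q.is_ideal by blast+
 have n1: "\<one> \<notin> q"
 proof
  assume "\<one> \<in> q"
  then have "S \<subseteq> q" using smodD(4)[OF sq(1), of _ \<one>] D(5) by fastforce
  then show False using q.I_notcarr sq(2) by auto
 qed
 have "smod Z (q \<inter> Z)" by (rule smod_Int[OF smod_mono[OF sq(1) D(6)] smod_self[OF Zs]])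
 then have id: "ideal (q \<inter> Z) (K\<lparr>carrier := Z\<rparr>)" using ideal_smod[OF Zs] by blast
 have "primeideal (q \<inter> Z) (K\<lparr>carrier := Z\<rparr>)"
 proof (rule primeidealI[OF id Zc.is_cring])
  show "carrier (K\<lparr>carrier := Z\<rparr>) \<noteq> q \<inter> Z" using n1 Zcl(2) by auto
  fix a b assume "a \<in> carrier (K\<lparr>carrier := Z\<rparr>)" "b \<in> carrier (K\<lparr>carrier := Z\<rparr>)" "a \<otimes>\<^bsub>K\<lparr>carrier := Z\<rparr>\<^esub> b \<in> q \<inter> Z"
  then show "a \<in> q \<inter> Z \<or> b \<in> q \<inter> Z" using q.I_prime[of a b] D(6) by auto
 qed
 then show ?thesis unfolding bp_def base_primes_def using d by blast
qed

text \<open>S/q is integral over the field Z/(q \<inter> Z). A monic equation of x has a coefficient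
  1 outside q, so \<open>mod_inverse\<close> applies to it.\<close>

lemma prime_mxi:
 assumes S: "ord S" and q: "primeideal q (K\<lparr>carrier := S\<rparr>)" and d: "d \<in> q" "d \<in> Z" "d \<noteq> \<zero>"
 shows "mxi S q"
proof -
 note D = ord_D[OF S]
 interpret q: primeideal q "K\<lparr>carrier := S\<rparr>" by (rule q)
 have sq: "smod S q" "q \<subseteq> S" using ideal_smod[OF D(1)] q.is_ideal by blast+
 note p = bp_mxi[OF prime_contract[OF assms]]
 have n1: "\<one> \<notin> q" using mxi_D(4)[OF p] Zcl(2) by blast
 show ?thesis
 proof (rule mxiI[OF D(1) sq n1])
  fix x assume x: "x \<in> S" "x \<notin> q"
  have "integral_over K Z x" using ord_OK[OF S] x by (auto simp: OK_iff)
  then obtain f where f: "f \<in> carrier (univ_poly K Z)" "f \<noteq> []" "hd f = \<one>" "eval f x = \<zero>"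
   unfolding integral_over_def by blast
  have "set f \<subseteq> Z" using f(1) polynomial_incl univ_poly_carrier by blast
  moreover have "\<not> set f \<subseteq> q" using f(2,3) n1 hd_in_set[of f] by auto
  moreover have "eval f x \<in> q" using f(4) smodD(2)[OF sq(1)] by simp
  ultimately show "\<exists>y\<in>S. \<exists>r\<in>q. x \<otimes> y = \<one> \<oplus> r" by (rule mod_inverse[OF S q p x])
 qed
qed

lemma mxi_prime: "mxi S P ==> primeideal P (K\<lparr>carrier := S\<rparr>)"
 using cring.maximalideal_prime[OF cring_sub] unfolding mxi_def by blast

lemma op_D:
 assumes S: "ord S" and P: "op S P"
 shows "mxi S P" "fg Z P" "full P" "smod Z P" "bp (P \<inter> Z)" "P \<subseteq> S" "P \<subseteq> carrier K"
proof -
 note D = ord_D[OF S]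
 show m: "mxi S P" using P unfolding op_def by blast
 obtain d where d: "d \<in> P" "d \<in> Z" "d \<noteq> \<zero>" using P unfolding op_def by blast
 show PS: "P \<subseteq> S" by (rule mxi_D(3)[OF m])
 then show "P \<subseteq> carrier K" using D(5) by blast
 show sP: "smod Z P" by (rule smod_mono[OF mxi_D(2)[OF m] D(6)])
 show "fg Z P" by (rule noeth_fg[OF Zs noethZ D(2) sP PS])
 show "bp (P \<inter> Z)" by (rule prime_contract[OF S mxi_prime[OF m] d])
 show "full P"
 proof (rule full_scale[OF D(3) d(2,3)])
  fix x assume x: "x \<in> S"
  then show "d \<otimes> x \<in> P" using smodD(4)[OF mxi_D(2)[OF m] x d(1)] m_comm[of d x] ZK'[OF d(2)] D(5) by auto
 qed
qed

lemma op_iff: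
 assumes S: "ord S"
 shows "P \<in> order_primes K Q Z S \<longleftrightarrow> op S P"
proof
 note D = ord_D[OF S]
 assume "P \<in> order_primes K Q Z S"
 then have P: "full P" "primeideal P (K\<lparr>carrier := S\<rparr>)"
  unfolding order_primes_def fractional_ideal_def lattice_iff[OF U] by auto
 obtain d where d: "d \<in> P" "d \<in> Z" "d \<noteq> \<zero>" using full_nz[OF P(1)] by blast
 then show "op S P" unfolding op_def using prime_mxi[OF S P(2) d] by blast
next
 note D = ord_D[OF S]
 assume P: "op S P"
 note E = op_D[OF S P]
 have "fg S P" using D(7) mxi_D(2)[OF E(1)] E(6) unfolding noeth_def by blast
 then show "P \<in> order_primes K Q Z S"
  unfolding order_primes_def fractional_ideal_def lattice_iff[OF U] fg_submodule_iff[OF D(1)]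
  using E(2,3) mxi_prime[OF E(1)] by blast
qed

lemma op_above:
 assumes S: "ord S" and I: "smod S I" "I \<subseteq> S" "\<one> \<notin> I" and d: "d \<in> I" "d \<in> Z" "d \<noteq> \<zero>"
 shows "\<exists>P. op S P \<and> I \<subseteq> P"
proof -
 note D = ord_D[OF S]
 interpret N: noetherian_ring "K\<lparr>carrier := S\<rparr>" using noetherian_ring_iff[OF D(1)] D(7) by blast
 have "ideal I (K\<lparr>carrier := S\<rparr>)" using ideal_smod[OF D(1)] I by blast
 moreover have "I \<noteq> carrier (K\<lparr>carrier := S\<rparr>)" using I(3) D(8) by auto
 ultimately obtain P where "maximalideal P (K\<lparr>carrier := S\<rparr>)" "I \<subseteq> P" using N.exists_maximal_above by blast
 then show ?thesis unfolding op_def mxi_def using D(1) d by blast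
qed

text \<open>As Z is not a field it has a non-zero non-unit d. It remains a non-unit in S, because an
  inverse of d is in Q and integral and therefore in Z; hence d S lies in a prime.\<close>

lemma op_exists:
 assumes S: "ord S" shows "\<exists>P. op S P"
proof -
 note D = ord_D[OF S]
 interpret Zc: cring "K\<lparr>carrier := Z\<rparr>" by (rule cring_sub[OF Zs])
 have "\<exists>d\<in>Z. d \<noteq> \<zero> \<and> \<not> (\<exists>e\<in>Z. d \<otimes> e = \<one>)"
 proof (rule ccontr)
  assume "\<not> ?thesis"
  then have a: "\<exists>e\<in>Z. d \<otimes> e = \<one>" if "d \<in> Z" "d \<noteq> \<zero>" for d using that by blast
  have "field (K\<lparr>carrier := Z\<rparr>)"
  proof (rule Zc.cring_fieldI2)
   show "\<zero>\<^bsub>K\<lparr>carrier := Z\<rparr>\<^esub> \<noteq> \<one>\<^bsub>K\<lparr>carrier := Z\<rparr>\<^esub>" using one_nz by simp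
  qed (use a in auto)
  then show False using Z_notfield by blast
 qed
 then obtain d where d: "d \<in> Z" "d \<noteq> \<zero>" "\<And>e. e \<in> Z ==> d \<otimes> e \<noteq> \<one>" by blast
 have dS: "d \<in> S" using d D(6) by blast
 have dK: "d \<in> carrier K" using d ZK' by blast
 let ?I = "(\<lambda>s. d \<otimes> s) ` S"
 have "smod S ?I"
 proof (rule smodI)
  show "?I \<subseteq> carrier K" using D(5) dK by auto
  show "\<zero> \<in> ?I" using smodD(2)[OF D(4)] dK by (intro image_eqI[of _ _ \<zero>]) auto
  show "x \<oplus> y \<in> ?I" if xy: "x \<in> ?I" "y \<in> ?I" for x y
  proof -
   obtain s t where "s \<in> S" "t \<in> S" "x = d \<otimes> s" "y = d \<otimes> t" using xy by blast
   then show ?thesis using dK D(5) subringE(7)[OF D(1)]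
    by (intro image_eqI[of _ _ "s \<oplus> t"]) (auto simp: r_distr subset_iff)
  qed
  show "a \<otimes> x \<in> ?I" if ax: "a \<in> S" "x \<in> ?I" for a x
  proof -
   obtain s where "s \<in> S" "x = d \<otimes> s" using ax by blast
   then show ?thesis using ax(1) dK D(5) subringE(6)[OF D(1)]
    by (intro image_eqI[of _ _ "a \<otimes> s"]) (auto simp: m_lcomm subset_iff)
  qed
 qed
 moreover have "?I \<subseteq> S" using subringE(6)[OF D(1) dS] by blast
 moreover have "\<one> \<notin> ?I"
 proof
  assume "\<one> \<in> ?I"
  then obtain s where s: "s \<in> S" "d \<otimes> s = \<one>" by auto
  have sK: "s \<in> carrier K" using s D(5) by blast
  obtain i where i: "i \<in> Q" "d \<otimes> i = \<one>" using Q_inv[OF ZQ'[OF d(1)] d(2)] by blast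
  have "s = i" by (rule nz_cancel[OF ZQ'[OF d(1)] d(2)]) (use sK i s QK' in auto)
  then have "s \<in> Z" using OK_Q ord_OK[OF S] s(1) i(1) by blast
  then show False using d(3) s(2) by blast
 qed
 moreover have "d \<in> ?I" using D(8) dK by (intro image_eqI[of _ _ \<one>]) auto
 ultimately show ?thesis using op_above[OF S] d by blast
qed

section \<open>Colon modules and the type at a prime\<close>

abbreviation col where "col \<equiv> colon K"

lemma colD: "x \<in> col I J ==> y \<in> J ==> x \<otimes> y \<in> I" "x \<in> col I J ==> x \<in> carrier K"
 by (auto simp: colon_def)

lemma colD': "x \<in> col I J ==> y \<in> J ==> y \<in> carrier K ==> y \<otimes> x \<in> I"
 using colD(1)[of x I J y] colD(2)[of x I J] m_comm[of y x] by simp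

lemma colon_props:
 assumes S: "ord S" and P: "op S P"
 shows "smod S (col S P)" "smod Z (col S P)" "S \<subseteq> col S P" "fg Z (col S P)" "fg S (col S P)" "qp S P (col S P) S"
  "smod S (col P P)" "S \<subseteq> col P P" "col P P \<subseteq> col S P" "fg Z (col P P)" "fg S (col P P)" "full (col P P)"
  "qp S P (col P P) P" "\<exists>J (b :: 'a \<Rightarrow> 'a). rbasis K S P (col S P) S J b"
proof -
 note D = ord_D[OF S] and E = op_D[OF S P]
 obtain d where d: "d \<in> P" "d \<in> Z" "d \<noteq> \<zero>" using P unfolding op_def by blast
 have sP: "smod S P" by (rule mxi_D(2)[OF E(1)])
 have sS: "smod S S" by (rule smod_self[OF D(1)])
 show 1: "smod S (col S P)" by (rule colon_smod[OF D(5) sS E(7)])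
 show 2: "smod Z (col S P)" by (rule smod_mono[OF 1 D(6)])
 show 7: "smod S (col P P)" by (rule colon_smod[OF D(5) sP E(7)])
 show 8: "S \<subseteq> col P P" using smodD(4)[OF sP] D(5) by (auto simp: colon_def)
 show 9: "col P P \<subseteq> col S P" using E(6) by (auto simp: colon_def)
 show 3: "S \<subseteq> col S P" using 8 9 by blast
 \<comment> \<open>Multiplication by the non-zero element d of P embeds (S : P) into S.\<close>
 show 4: "fg Z (col S P)"
  by (rule fg_unscale[OF d(2,3) 2 D(2)]) (rule colD'[OF _ d(1) ZK'[OF d(2)]])
 show fc: "fg S (col S P)" by (rule fg_change[OF Zs D(1,6) 1 4])
 show 10: "fg Z (col P P)" by (rule noeth_fg[OF Zs noethZ 4 smod_mono[OF 7 D(6)] 9])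
 show "fg S (col P P)" by (rule fg_change[OF Zs D(1,6) 7 10])
 show "full (col P P)" by (rule full_mono[OF D(3) 8])
 show q: "qp S P (col S P) S" unfolding qp_def
  using E(1,7) 1 sS 3 colD' by blast
 show "qp S P (col P P) P" unfolding qp_def
  using E(1,6,7) 7 sP 8 colD' by blast
 show "\<exists>J (b :: 'a \<Rightarrow> 'a). rbasis K S P (col S P) S J b" by (rule rbasis_exists_fg[OF q fc])
qed

lemma lsum_sub:
 assumes S: "subring S K" and J: "finite J" "\<And>i. i \<in> J ==> c i \<in> S" "\<And>i. i \<in> J ==> b i \<in> S"
 shows "cring.lsum (K\<lparr>carrier := S\<rparr>) J c b = lsum J c b"
proof -
 interpret Sc: cring "K\<lparr>carrier := S\<rparr>" by (rule cring_sub[OF S])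
 show ?thesis unfolding Sc.lsum_def lsum_def using finsum_sub[OF S J(1), of "\<lambda>i. c i \<otimes> b i"] subringE(6)[OF S] J by simp
qed

text \<open>A prime of S that contains the non-zero element a of Z is maximal, so P contains no
  other prime through a, and some power of P is divisible by a locally at P.\<close>

lemma op_completed:
 assumes S: "ord S" and P: "op S P"
 shows "\<exists>a t n. a \<in> P \<and> a \<in> Z \<and> a \<noteq> \<zero> \<and> completed_nzd P (K\<lparr>carrier := S\<rparr>) a t n"
proof -
 note D = ord_D[OF S] and E = op_D[OF S P]
 obtain a where a: "a \<in> P" "a \<in> Z" "a \<noteq> \<zero>" using P unfolding op_def by blast
 interpret Sc: cring "K\<lparr>carrier := S\<rparr>" by (rule cring_sub[OF D(1)])
 have mP: "maximalideal P (K\<lparr>carrier := S\<rparr>)" using E(1) unfolding mxi_def by blast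
 have c: "completed P (K\<lparr>carrier := S\<rparr>)" by (rule completed.intro[OF mP Sc.is_cring])
 have "\<not> q \<subseteq> P" if q: "primeideal q (K\<lparr>carrier := S\<rparr>)" "a \<in> q" "q \<noteq> P" for q
 proof
  assume s: "q \<subseteq> P"
  have "maximalideal q (K\<lparr>carrier := S\<rparr>)" using prime_mxi[OF S q(1,2) a(2,3)] unfolding mxi_def by blast
  then interpret mq: maximalideal q "K\<lparr>carrier := S\<rparr>" .
  have "ideal P (K\<lparr>carrier := S\<rparr>)" using mP unfolding maximalideal_def by blast
  then have "P = q \<or> P = carrier (K\<lparr>carrier := S\<rparr>)" using mq.I_maximal s E(6) by simp
  then show False using q(3) mxi_D(4)[OF E(1)] D(8) by auto
 qed
 then obtain t n where t: "t \<in> S" "t \<notin> P" "\<forall>x\<in>completed.Pn P (K\<lparr>carrier := S\<rparr>) n. \<exists>y\<in>S. t \<otimes> x = a \<otimes> y"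
  using completed.power_dvd_locally[OF c, of a] noetherian_ring_iff[OF D(1)] D(7) subsetD[OF D(6) a(2)] by auto
 have "completed_nzd P (K\<lparr>carrier := S\<rparr>) a t n"
 proof (rule completed_nzd.intro[OF c], rule completed_nzd_axioms.intro)
  show "y = \<zero>\<^bsub>K\<lparr>carrier := S\<rparr>\<^esub>"
   if "y \<in> carrier (K\<lparr>carrier := S\<rparr>)" "a \<otimes>\<^bsub>K\<lparr>carrier := S\<rparr>\<^esub> y = \<zero>\<^bsub>K\<lparr>carrier := S\<rparr>\<^esub>" for y
   using Q_nz_mult[OF ZQ'[OF a(2)] a(3), of y] that D(5) by auto
 qed (use a t in auto)
 then show ?thesis using a by blast
qed

text \<open>Multiplication by a carries (S : P) onto (aS : P) and S onto aS, so it turns the given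
  family into a relative basis of the socle, whose size the completion preserves.\<close>

lemma type_at_eq:
 assumes S: "ord S" and P: "op S P" and b: "rbasis K S P (col S P) S J b"
 shows "type_at K S P = card J"
proof -
 note D = ord_D[OF S] and E = op_D[OF S P] and B = rbasis_D[OF b]
 obtain a t n where a: "a \<in> P" "a \<in> Z" "a \<noteq> \<zero>" and c: "completed_nzd P (K\<lparr>carrier := S\<rparr>) a t n"
  using op_completed[OF S P] by blast
 interpret c: completed_nzd P "K\<lparr>carrier := S\<rparr>" a t n by (rule c)
 have aK: "a \<in> carrier K" and aQ: "a \<in> Q" and aS: "a \<in> S" using a ZK' ZQ' D(6) by auto
 have pa: "x \<in> c.Epa \<longleftrightarrow> (\<exists>y\<in>S. x = a \<otimes> y)" for x using c.E_pa_iff by simp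
 have cm: "x \<in> c.Ecm \<longleftrightarrow> x \<in> S \<and> (\<forall>y\<in>P. \<exists>s\<in>S. x \<otimes> y = a \<otimes> s)" for x using c.E_cm_def pa by simp
 have bK: "b i \<in> carrier K" if "i \<in> J" for i using B(2)[OF that] colD(2) by blast
 have acm: "a \<otimes> x \<in> c.Ecm" if x: "x \<in> col S P" for x
 proof -
  have xK: "x \<in> carrier K" by (rule colD(2)[OF x])
  have "a \<otimes> x \<in> S" using colD(1)[OF x a(1)] m_comm[OF aK xK] by simp
  moreover have "\<exists>s\<in>S. a \<otimes> x \<otimes> y = a \<otimes> s" if "y \<in> P" for y
   using colD(1)[OF x that] m_assoc[OF aK xK, of y] E(7) that by blast
  ultimately show ?thesis unfolding cm by blast
 qed
 have abS: "a \<otimes> b i \<in> S" if "i \<in> J" for i using acm[OF B(2)[OF that]] unfolding cm by blast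
 have ls: "c.lsum J c (\<lambda>i. a \<otimes> b i) = a \<otimes> lsum J c b" if c: "\<And>i. i \<in> J ==> c i \<in> S" for c
 proof -
  have "c.lsum J c (\<lambda>i. a \<otimes> b i) = lsum J c (\<lambda>i. a \<otimes> b i)" by (rule lsum_sub[OF D(1) B(1) c abS])
  also have "\<dots> = a \<otimes> lsum J c b" by (rule lsum_smult_vec[symmetric]) (use B(1) aK c D(5) bK in auto)
  finally show ?thesis .
 qed
 have lK: "lsum J c b \<in> carrier K" if c: "\<And>i. i \<in> J ==> c i \<in> S" for c
  by (rule lsum_closed) (use c D(5) bK in auto)
 have rb: "rbasis (K\<lparr>carrier := S\<rparr>) S P c.Ecm c.Epa J (\<lambda>i. a \<otimes> b i)"
 proof (rule c.rbasis_I[OF B(1)])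
  show "a \<otimes> b i \<in> c.Ecm" if "i \<in> J" for i by (rule acm[OF B(2)[OF that]])
  fix x assume x: "x \<in> c.Ecm"
  have xS: "x \<in> S" and xK: "x \<in> carrier K" using x cm D(5) by auto
  obtain i where i: "i \<in> Q" "a \<otimes> i = \<one>" using Q_inv[OF aQ a(3)] by blast
  have iK: "i \<in> carrier K" using i QK' by blast
  \<comment> \<open>Division of a socle element by a, which is possible in K because a is invertible
    in Q, leads back to (S : P).\<close>
  have x': "i \<otimes> x \<in> col S P"
   unfolding colon_def
  proof (clarsimp simp: iK xK)
   fix y assume y: "y \<in> P"
   obtain s where s: "s \<in> S" "x \<otimes> y = a \<otimes> s" using x y unfolding cm by blast
   have R: "y \<in> carrier K" "s \<in> carrier K" using y s E(7) D(5) by auto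
   have "i \<otimes> x \<otimes> y = (a \<otimes> i) \<otimes> s" using s(2) R iK xK aK by (simp add: m_assoc m_lcomm)
   then show "i \<otimes> x \<otimes> y \<in> S" using i R s by simp
  qed
  obtain c m where cm': "\<forall>i\<in>J. c i \<in> S" "m \<in> S" "i \<otimes> x = lsum J c b \<oplus> m" using B(3)[OF x'] by blast
  have mK: "m \<in> carrier K" using cm' D(5) by blast
  have "x = (a \<otimes> i) \<otimes> x" using i xK by simp
  also have "\<dots> = a \<otimes> (i \<otimes> x)" using aK iK xK by (simp add: m_assoc)
  also have "\<dots> = a \<otimes> lsum J c b \<oplus> a \<otimes> m" unfolding cm'(3) using aK mK lK[of c] cm'(1) by (simp add: r_distr)
  also have "a \<otimes> lsum J c b = c.lsum J c (\<lambda>i. a \<otimes> b i)" using ls[of c] cm'(1) by simp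
  finally have x2: "x = c.lsum J c (\<lambda>i. a \<otimes> b i) \<oplus>\<^bsub>K\<lparr>carrier := S\<rparr>\<^esub> (a \<otimes> m)" by simp
  have "a \<otimes> m \<in> c.Epa" unfolding pa by (rule bexI[OF refl cm'(2)])
  then have h: "(\<forall>i\<in>J. c i \<in> S) \<and> a \<otimes> m \<in> c.Epa \<and> x = c.lsum J c (\<lambda>i. a \<otimes> b i) \<oplus>\<^bsub>K\<lparr>carrier := S\<rparr>\<^esub> (a \<otimes> m)"
   by (rule conjI[OF cm'(1) conjI[OF _ x2]])
  show "\<exists>c n. (\<forall>i\<in>J. c i \<in> S) \<and> n \<in> c.Epa \<and> x = c.lsum J c (\<lambda>i. a \<otimes> b i) \<oplus>\<^bsub>K\<lparr>carrier := S\<rparr>\<^esub> n"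
   by (rule exI[of _ c], rule exI[of _ "a \<otimes> m"], rule h)
 next
  fix c i assume c: "\<And>i. i \<in> J ==> c i \<in> S" and l: "c.lsum J c (\<lambda>i. a \<otimes> b i) \<in> c.Epa" and i: "i \<in> J"
  from iffD1[OF pa l] obtain y where y: "y \<in> S" "c.lsum J c (\<lambda>i. a \<otimes> b i) = a \<otimes> y" by (rule bexE)
  note y2 = trans[OF ls[OF c, symmetric] y(2)]
  have yK: "y \<in> carrier K" using y(1) D(5) by blast
  have "lsum J c b = y" by (rule nz_cancel[OF aQ a(3) lK[OF c] yK y2])
  then have "lsum J c b \<in> S" using y(1) by simp
  from B(4)[OF c this i] show "c i \<in> P" .
 qed
 have cS: "carrier (K\<lparr>carrier := S\<rparr>) = S" by simp
 show ?thesis unfolding type_at_def by (rule c.local_type_completion[unfolded cS, OF rb])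
qed

text \<open>Dividing by a an element of the socle of S/aS that is not in aS gives such an x.\<close>

lemma colon_nontrivial:
 assumes S: "ord S" and P: "op S P"
 shows "\<exists>x\<in>col S P. x \<notin> S"
proof -
 note D = ord_D[OF S] and E = op_D[OF S P]
 obtain a t n where a: "a \<in> P" "a \<in> Z" "a \<noteq> \<zero>" and c: "completed_nzd P (K\<lparr>carrier := S\<rparr>) a t n"
  using op_completed[OF S P] by blast
 interpret c: completed_nzd P "K\<lparr>carrier := S\<rparr>" a t n by (rule c)
 have pa: "x \<in> c.Epa \<longleftrightarrow> (\<exists>y\<in>S. x = a \<otimes> y)" for x using c.E_pa_iff by simp
 have cm: "x \<in> c.Ecm \<longleftrightarrow> x \<in> S \<and> (\<forall>y\<in>P. \<exists>s\<in>S. x \<otimes> y = a \<otimes> s)" for x using c.E_cm_def pa by simp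
 obtain x where x: "x \<in> S" "\<forall>y\<in>P. \<exists>s\<in>S. x \<otimes> y = a \<otimes> s" "\<not> (\<exists>y\<in>S. x = a \<otimes> y)"
 proof -
  obtain x where xm: "x \<in> c.Ecm" and n: "x \<notin> c.Epa" using c.socle_nontrivial by blast
  from xm have "x \<in> S \<and> (\<forall>y\<in>P. \<exists>s\<in>S. x \<otimes> y = a \<otimes> s)" by (rule cm[THEN iffD1])
  moreover have "\<not> (\<exists>y\<in>S. x = a \<otimes> y)" by (rule contrapos_nn[OF n]) (rule pa[THEN iffD2])
  ultimately show ?thesis using that by blast
 qed
 obtain i where i: "i \<in> Q" "a \<otimes> i = \<one>" using Q_inv[OF ZQ'[OF a(2)] a(3)] by blast
 have R: "a \<in> carrier K" "i \<in> carrier K" "x \<in> carrier K" using a i x ZK' QK' D(5) by auto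
 have "i \<otimes> x \<otimes> y \<in> S" if y: "y \<in> P" for y
 proof -
  obtain s where s: "s \<in> S" "x \<otimes> y = a \<otimes> s" using x(2) y by blast
  have R': "y \<in> carrier K" "s \<in> carrier K" using y s E(7) D(5) by auto
  have "i \<otimes> x \<otimes> y = (a \<otimes> i) \<otimes> s" using s(2) R R' by (simp add: m_assoc m_lcomm)
  then show ?thesis using i R' s by simp
 qed
 then have "i \<otimes> x \<in> col S P" using R by (simp add: colon_def)
 moreover have "i \<otimes> x \<notin> S"
 proof
  assume s: "i \<otimes> x \<in> S"
  have "x = (a \<otimes> i) \<otimes> x" using i R by simp
  also have "\<dots> = a \<otimes> (i \<otimes> x)" using R by (simp add: m_assoc)
  finally show False using x(3) s by blast
 qed
 ultimately show ?thesis by blast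
qed

end

section \<open>The type and the trace dual\<close>

context etale_order
begin

text \<open>The form a Tr(uw) is symmetric, so linearity in the second argument is taken from the
  first. Exchanging the roles of the two modules gives the opposite inequality.\<close>

lemma trace_pairing_le:
 assumes p: "bp p" and a: "a \<in> carrier K" and M: "smod Z M" "smod Z M'" and N: "N \<subseteq> M"
  and rM: "rbasis K Z p M N J b" and rM': "rbasis K Z p M' N' J' b'"
  and BA: "\<And>u w. [|u \<in> M; w \<in> M'|] ==> T (u \<otimes> (a \<otimes> w)) \<in> Z"
  and BN: "\<And>u w. [|u \<in> N; w \<in> M'|] ==> T (u \<otimes> (a \<otimes> w)) \<in> p"
  and nd: "\<And>w. [|w \<in> M'; \<And>u. u \<in> M ==> T (u \<otimes> (a \<otimes> w)) \<in> p|] ==> w \<in> N'"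
 shows "card J' \<le> card J"
proof -
 note B = rbasis_D[OF rM] and B' = rbasis_D[OF rM']
 have MK: "M \<subseteq> carrier K" "M' \<subseteq> carrier K" using smodD(1)[OF M(1)] smodD(1)[OF M(2)] by blast+
 have bK: "b i \<in> carrier K" if "i \<in> J" for i using B(2)[OF that] MK by blast
 have bK': "b' i \<in> carrier K" if "i \<in> J'" for i using B'(2)[OF that] MK by blast
 have l1: "lin (\<lambda>u. T (u \<otimes> (a \<otimes> w)))" if "w \<in> carrier K" for w
  by (rule lin_mult[OF T_lin]) (use a that in simp)
 have sym: "T (u \<otimes> (a \<otimes> w)) = T (w \<otimes> (a \<otimes> u))" if "u \<in> carrier K" "w \<in> carrier K" for u w
 proof -
  have "u \<otimes> (a \<otimes> w) = w \<otimes> (a \<otimes> u)" using that a by (simp add: m_ac)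
  then show ?thesis by simp
 qed
 show ?thesis
 proof (rule pairing_card_le[OF bp_mxi[OF p] rM rM', where B = "\<lambda>u w. T (u \<otimes> (a \<otimes> w))"])
  show "T (u \<otimes> (a \<otimes> w)) \<in> Z" if "u \<in> M" "w \<in> M'" for u w by (rule BA[OF that])
  show lm: "lsum J' c b' \<in> M'" if "\<And>j. j \<in> J' ==> c j \<in> Z" for c
   by (rule lsum_mem[OF M(2) B'(1) that B'(2) ZK])
  show "T (u \<otimes> (a \<otimes> lsum J' c b')) = lsum J' c (\<lambda>j. T (u \<otimes> (a \<otimes> b' j)))"
   if u: "u \<in> M" and c: "\<And>j. j \<in> J' ==> c j \<in> Z" for u c
  proof -
   have uK: "u \<in> carrier K" using u MK by blast
   have lK: "lsum J' c b' \<in> carrier K" using lm[of c, OF c] MK by blast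
   have "T (u \<otimes> (a \<otimes> lsum J' c b')) = T (lsum J' c b' \<otimes> (a \<otimes> u))" by (rule sym[OF uK lK])
   also have "\<dots> = lsum J' c (\<lambda>j. T (b' j \<otimes> (a \<otimes> u)))"
    by (rule lin_lsum[OF l1[OF uK] B'(1)]) (use c ZQ' bK' in auto)
   also have "\<dots> = lsum J' c (\<lambda>j. T (u \<otimes> (a \<otimes> b' j)))"
    by (rule lsum_cong) (use c ZK' bK' uK a lin_D(2)[OF T_lin] sym in auto)
   finally show ?thesis .
  qed
  show "T ((lsum J c b \<oplus> n) \<otimes> (a \<otimes> w)) = lsum J c (\<lambda>i. T (b i \<otimes> (a \<otimes> w))) \<oplus> T (n \<otimes> (a \<otimes> w))"
   if c: "\<And>i. i \<in> J ==> c i \<in> Z" and n: "n \<in> N" and w: "w \<in> M'" for c n w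
  proof -
   have R: "w \<in> carrier K" "n \<in> carrier K" "lsum J c b \<in> carrier K"
    using w n MK N lsum_closed[of J c b] c ZK' bK by auto
   have "T ((lsum J c b \<oplus> n) \<otimes> (a \<otimes> w)) = T (lsum J c b \<otimes> (a \<otimes> w)) \<oplus> T (n \<otimes> (a \<otimes> w))"
    by (rule lin_D(3)[OF l1[OF R(1)] R(3,2)])
   also have "T (lsum J c b \<otimes> (a \<otimes> w)) = lsum J c (\<lambda>i. T (b i \<otimes> (a \<otimes> w)))"
    by (rule lin_lsum[OF l1[OF R(1)] B(1)]) (use c ZQ' bK in auto)
   finally show ?thesis .
  qed
  show "T (n \<otimes> (a \<otimes> w)) \<in> p" if "n \<in> N" "w \<in> M'" for n w by (rule BN[OF that])
  show "w \<in> N'" if "w \<in> M'" "\<And>u. u \<in> M ==> T (u \<otimes> (a \<otimes> w)) \<in> p" for w by (rule nd[OF that])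
 qed
qed

theorem type_eq_trace_dual:
 assumes S: "ord S" and P: "op S P"
 shows "type_at K S P = quotient_dim K S P (dual S) (ideal_prod K P (dual S))"
proof -
 note D = ord_D[OF S] and E = op_D[OF S P] and C = colon_props[OF S P]
 let ?p = "P \<inter> Z" and ?D = "dual S" and ?N = "ideal_prod K P (dual S)"
 have P0: "\<zero> \<in> P" by (rule smodD(2)[OF E(4)])
 have sP: "smod S P" by (rule mxi_D(2)[OF E(1)])
 have sD: "smod S ?D" by (rule dual_smod[OF D(1) smod_self[OF D(1)] D(4)])
 have zD: "smod Z ?D" by (rule smod_mono[OF sD D(6)])
 have fgD: "fg Z ?D" by (rule dual_fg[OF D(2,3)])
 have DK: "?D \<subseteq> carrier K" using smodD(1)[OF sD] by blast
 have sN: "smod S ?N" by (rule ideal_prod_smod[OF D(5) E(7) P0 sD])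
 have zN: "smod Z ?N" by (rule smod_mono[OF sN D(6)])
 have ND: "?N \<subseteq> ?D" by (rule ideal_prod_subset[OF sD]) (use smodD(4)[OF sD] E(6) in blast)
 have fgN: "fg Z ?N" by (rule noeth_fg[OF Zs noethZ fgD zN ND])
 obtain d where d: "d \<in> P" "d \<in> Z" "d \<noteq> \<zero>" using P unfolding op_def by blast
 have fuN: "full ?N" by (rule full_scale[OF dual_full[OF D(2)] d(2,3)]) (rule ideal_prod.prod[OF d(1)])
 have qpD: "qp S P ?D ?N" unfolding qp_def using E(1) sD sN ND ideal_prod.prod[of _ P _ ?D K] by blast
 have fgSD: "fg S ?D" by (rule fg_change[OF Zs D(1,6) sD fgD])
 obtain a s where a: "a \<in> P" "a \<in> Z" "a \<noteq> \<zero>" and s: "s \<in> Z" "s \<notin> ?p"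
  and gen: "\<forall>x\<in>?p. \<exists>y\<in>Z. s \<otimes> x = a \<otimes> y" using local_generator[OF E(5)] by blast
 have aK: "a \<in> carrier K" and sK: "s \<in> carrier K" using a s ZK' by auto
 have TZ: "T (u \<otimes> w) \<in> Z" if "u \<in> S" "w \<in> ?D" for u w
 proof -
  have "u \<otimes> w = w \<otimes> u" using that D(5) DK by (intro m_comm) auto
  then show ?thesis using that dual_iff[OF D(5)] by simp
 qed
 have Sdual: "x \<in> S" if "x \<in> carrier K" "\<And>w. w \<in> ?D ==> T (x \<otimes> w) \<in> Z" for x
  by (rule dual_dual[OF D(2,3) that])
 have av: "T (u \<otimes> (a \<otimes> w)) = a \<otimes> T (u \<otimes> w)" if "u \<in> carrier K" "w \<in> carrier K" for u w
 proof -
  have "u \<otimes> (a \<otimes> w) = a \<otimes> (u \<otimes> w)" using that aK by (simp add: m_lcomm)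
  then show ?thesis using lin_D(4)[OF T_lin ZQ'[OF a(2)], of "u \<otimes> w"] that by simp
 qed
 have cK: "u \<in> carrier K" if "u \<in> col S P" for u by (rule colD(2)[OF that])
 have BZ: "T (u \<otimes> (a \<otimes> w)) \<in> Z" if u: "u \<in> col S P" and w: "w \<in> ?D" for u w
 proof -
  have "u \<otimes> (a \<otimes> w) = (u \<otimes> a) \<otimes> w" using cK[OF u] w DK aK by (auto simp: m_assoc)
  then show ?thesis using TZ[OF colD(1)[OF u a(1)] w] by simp
 qed
 have pZ: "a \<otimes> t \<in> ?p" if "t \<in> Z" for t
  using smodD(4)[OF mxi_D(2)[OF bp_mxi[OF E(5)]] that, of a] a m_comm[OF aK ZK'[OF that]] by simp
 \<comment> \<open>Integrality of t is checked prime by prime. At a prime that does not contain p,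
   an element of p outside it clears t; at p itself, s does, since s a t is a times an element of Z
   and a cancels.\<close>
 have desc: "t \<in> Z" if tK: "t \<in> carrier K" and at: "a \<otimes> t \<in> ?p" and pt: "\<And>x. x \<in> ?p ==> x \<otimes> t \<in> Z" for t
 proof (rule local_mem[OF smod_self[OF Zs] tK a(2,3)])
  show "a \<otimes> t \<in> Z" using at by blast
  fix q assume q: "bp q"
  show "\<exists>r\<in>Z. r \<notin> q \<and> r \<otimes> t \<in> Z"
  proof (cases "?p \<subseteq> q")
   case False then show ?thesis using pt by blast
  next
   case True
   have "maximalideal ?p (K\<lparr>carrier := Z\<rparr>)" using bp_mxi[OF E(5)] unfolding mxi_def by blast
   then interpret mp: maximalideal ?p "K\<lparr>carrier := Z\<rparr>" .
   note mq = bp_mxi[OF q]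
   have "ideal q (K\<lparr>carrier := Z\<rparr>)" using ideal_smod[OF Zs] mxi_D(2,3)[OF mq] by blast
   then have "q = ?p" using mp.I_maximal True mxi_D(3)[OF mq] mxi_D(4)[OF mq] Zcl(2) by auto
   moreover obtain y where y: "y \<in> Z" "s \<otimes> (a \<otimes> t) = a \<otimes> y" using gen at by blast
   have "a \<otimes> (s \<otimes> t) = a \<otimes> y" using y(2) aK sK tK by (simp add: m_lcomm)
   then have "s \<otimes> t = y" by (rule nz_cancel[OF ZQ'[OF a(2)] a(3) m_closed[OF sK tK] ZK'[OF y(1)]])
   ultimately show ?thesis using s y(1) by blast
  qed
 qed
 \<comment> \<open>Every x in p multiplies u into S, so x Tr(uw) is integral. Hence an orthogonality
   relation modulo p forces Tr(uw) itself to be in Z.\<close>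
 have TZ': "T (u \<otimes> w) \<in> Z" if u: "u \<in> col S P" and w: "w \<in> ?D" and b: "T (u \<otimes> (a \<otimes> w)) \<in> ?p" for u w
 proof (rule desc)
  have R: "u \<in> carrier K" "w \<in> carrier K" using cK[OF u] w DK by auto
  show "T (u \<otimes> w) \<in> carrier K" using lin_D(2)[OF T_lin] R by simp
  show "a \<otimes> T (u \<otimes> w) \<in> ?p" using b av[OF R] by simp
  fix x assume x: "x \<in> ?p"
  have xK: "x \<in> carrier K" using x ZK' by blast
  have "x \<otimes> T (u \<otimes> w) = T (x \<otimes> (u \<otimes> w))" using lin_D(4)[OF T_lin, of x "u \<otimes> w"] x ZQ' R by simp
  also have "x \<otimes> (u \<otimes> w) = (u \<otimes> x) \<otimes> w" using xK R by (simp add: m_ac)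
  finally show "x \<otimes> T (u \<otimes> w) \<in> Z" using TZ[OF colD(1)[OF u] w] x by simp
 qed
 have B1: "T (u \<otimes> (a \<otimes> w)) \<in> ?p" if u: "u \<in> S" and w: "w \<in> ?D" for u w
  unfolding av[OF subsetD[OF D(5) u] subsetD[OF DK w]] by (rule pZ[OF TZ[OF u w]])
 have B2: "T (u \<otimes> (a \<otimes> w)) \<in> ?p" if u: "u \<in> col S P" and w: "w \<in> ?N" for u w
 proof -
  have "?N \<subseteq> {v \<in> carrier K. T (u \<otimes> v) \<in> Z}"
  proof (rule ideal_prod_subset[OF trace_smod[OF cK[OF u]]])
   fix i x assume ix: "i \<in> P" "x \<in> ?D"
   have R: "i \<in> carrier K" "x \<in> carrier K" using ix E(7) DK by auto
   have "u \<otimes> (i \<otimes> x) = (u \<otimes> i) \<otimes> x" using R cK[OF u] by (simp add: m_assoc)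
   then show "i \<otimes> x \<in> {v \<in> carrier K. T (u \<otimes> v) \<in> Z}" using TZ[OF colD(1)[OF u ix(1)] ix(2)] R by simp
  qed
  then have t: "T (u \<otimes> w) \<in> Z" using w by blast
  show ?thesis unfolding av[OF cK[OF u] subsetD[OF DK subsetD[OF ND w]]] by (rule pZ[OF t])
 qed
 \<comment> \<open>If v is in the dual of P times the dual of S, then v P pairs integrally with the
   dual of S and so lies in S. Thus v is in (S : P), and the double dual of the product puts w into
   it.\<close>
 have N1: "w \<in> ?N" if w: "w \<in> ?D" and b: "\<And>u. u \<in> col S P ==> T (u \<otimes> (a \<otimes> w)) \<in> ?p" for w
 proof (rule dual_dual[OF fgN fuN])
  show wK: "w \<in> carrier K" using w DK by blast
  fix v assume v: "v \<in> dual ?N"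
  have NK: "?N \<subseteq> carrier K" using ND DK by blast
  have vK: "v \<in> carrier K" using v dual_iff[OF NK] by blast
  have "v \<otimes> x \<in> S" if x: "x \<in> P" for x
  proof (rule Sdual)
   have xK: "x \<in> carrier K" using x E(7) by blast
   then show "v \<otimes> x \<in> carrier K" using vK by simp
   fix w' assume w': "w' \<in> ?D"
   have "v \<otimes> x \<otimes> w' = v \<otimes> (x \<otimes> w')" using vK xK w' DK by (intro m_assoc) auto
   moreover have "x \<otimes> w' \<in> ?N" by (rule ideal_prod.prod[OF x w'])
   ultimately show "T (v \<otimes> x \<otimes> w') \<in> Z" using v dual_iff[OF NK] by simp
  qed
  then have vc: "v \<in> col S P" using vK by (simp add: colon_def)
  show "T (w \<otimes> v) \<in> Z" using TZ'[OF vc w b[OF vc]] m_comm[OF wK vK] by simp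
 qed
 have N2: "u \<in> S" if u: "u \<in> col S P" and b: "\<And>w. w \<in> ?D ==> T (u \<otimes> (a \<otimes> w)) \<in> ?p" for u
  by (rule Sdual[OF cK[OF u]]) (rule TZ'[OF u _ b])
 have sym: "T (u \<otimes> (a \<otimes> w)) = T (w \<otimes> (a \<otimes> u))" if "u \<in> col S P" "w \<in> ?D" for u w
 proof -
  have "u \<otimes> (a \<otimes> w) = w \<otimes> (a \<otimes> u)" using cK[OF that(1)] that(2) DK aK by (auto simp: m_ac)
  then show ?thesis by simp
 qed
 obtain J and b :: "'a \<Rightarrow> 'a" where rM: "rbasis K S P (col S P) S J b" using C(14) by blast
 obtain J' and b' :: "'a \<Rightarrow> 'a" where rM': "rbasis K S P ?D ?N J' b'" using rbasis_exists_fg[OF qpD fgSD] by blast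
 have "a \<otimes> x \<in> P" if "a \<in> P" "x \<in> S" for a x
  using smodD(4)[OF sP that(2,1)] m_comm[OF subsetD[OF D(5) that(2)] subsetD[OF E(7) that(1)]] by simp
 then have "qp Z ?p S P" unfolding qp_def using bp_mxi[OF E(5)] D(4) E(4,6) by blast
 then obtain L and v :: "'a \<Rightarrow> 'a" where rS: "rbasis K Z ?p S P L v" using rbasis_exists_fg D(2) by blast
 \<comment> \<open>The degree [S/P : Z/p] is positive, so it can be cancelled at the end.\<close>
 have "L \<noteq> {}"
 proof
  assume "L = {}"
  then obtain c n where "n \<in> P" "\<one> = lsum {} c v \<oplus> n" using rbasis_D(3)[OF rS D(8)] by blast
  then show False using mxi_D(4)[OF E(1)] E(7) by (auto simp: lsum_empty)
 qed
 then have L: "card L > 0" using rbasis_D(1)[OF rS] by (simp add: card_gt_0_iff)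
 \<comment> \<open>Both relative bases are expanded over Z/p by the same basis of S/P, so both
   dimensions are multiplied by the same degree.\<close>
 note r1 = rbasis_prod[OF C(6) rM bp_mxi[OF E(5)] D(6) rS]
 note r2 = rbasis_prod[OF qpD rM' bp_mxi[OF E(5)] D(6) rS]
 have "card (J' \<times> L) \<le> card (J \<times> L)"
  by (rule trace_pairing_le[OF E(5) aK C(2) zD C(3) r1 r2 BZ B1 N1])
 moreover have "card (J \<times> L) \<le> card (J' \<times> L)"
 proof (rule trace_pairing_le[OF E(5) aK zD C(2) ND r2 r1])
  show "T (w \<otimes> (a \<otimes> u)) \<in> Z" if "w \<in> ?D" "u \<in> col S P" for u w
   using BZ[OF that(2,1)] sym[OF that(2,1)] by (rule back_subst[where P = "\<lambda>t. t \<in> Z"])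
  show "T (w \<otimes> (a \<otimes> u)) \<in> ?p" if "w \<in> ?N" "u \<in> col S P" for u w
   using B2[OF that(2,1)] sym[OF that(2) subsetD[OF ND that(1)]] by (rule back_subst[where P = "\<lambda>t. t \<in> ?p"])
  show "u \<in> S" if u: "u \<in> col S P" and b: "\<And>w. w \<in> ?D ==> T (w \<otimes> (a \<otimes> u)) \<in> ?p" for u
  proof (rule N2[OF u])
   fix w assume w: "w \<in> ?D"
   show "T (u \<otimes> (a \<otimes> w)) \<in> ?p" using b[OF w] sym[OF u w, symmetric] by (rule back_subst[where P = "\<lambda>t. t \<in> ?p"])
  qed
 qed
 ultimately have "card J = card J'" using L by (simp add: card_cartesian_product)
 then show ?thesis using type_at_eq[OF S P rM] quotient_dim_eq[OF qpD rM'] by simp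
qed

end

section \<open>The type and multiplicator rings of primes\<close>

lemma (in cring) lsum_single: "c j \<in> carrier R ==> b j \<in> carrier R ==> lsum {j} c b = c j \<otimes> b j"
 using lsum_insert[of "{}" j c b] by (simp add: lsum_empty)

lemma (in cring) mod_unit:
 assumes "x \<in> carrier R" "s \<in> carrier R" "r \<in> carrier R" "q \<in> carrier R" "s \<otimes> r = \<one> \<oplus> q"
 shows "x = r \<otimes> (s \<otimes> x) \<oplus> \<ominus> (q \<otimes> x)"
proof -
 have "r \<otimes> (s \<otimes> x) = (s \<otimes> r) \<otimes> x" using assms(1-3) by (simp add: m_ac)
 then show ?thesis unfolding assms(5) using assms(1,4) by (simp add: l_distr a_assoc r_neg)
qed

lemma (in cring) add_minus_cancels:
 assumes "a \<in> carrier R" "b \<in> carrier R"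
 shows "a \<oplus> b \<ominus> a = b" "a \<oplus> b \<ominus> b = a"
 using assms by algebra+

context etale_order
begin

abbreviation mdim where "mdim S P \<equiv> quotient_dim K S P (col P P) P"

text \<open>The multiplier s of a local basis at p has an inverse modulo p, and p M is contained in
  N because p lies in I. So modulo N the multiplier disappears, and the local basis spans all of
  M.\<close>

lemma local_span:
 assumes qp: "qp A I M N" and AZ: "Z \<subseteq> A" and p: "bp p" and M: "fg Z M" "full M" and pI: "p \<subseteq> I"
 shows "\<exists>B. qb B (\<lambda>v. v) \<and> B \<subseteq> M \<and> (\<exists>s\<in>Z. s \<notin> p \<and> (\<forall>x\<in>M. \<exists>c. (\<forall>v\<in>B. c v \<in> Z) \<and> s \<otimes> x = lsum B c (\<lambda>v. v))) \<and>
  (\<forall>x\<in>M. \<exists>c n. (\<forall>v\<in>B. c v \<in> A) \<and> n \<in> N \<and> x = lsum B c (\<lambda>v. v) \<oplus> n)"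
proof -
 have A: "mxi A I" and sM: "smod A M" and N: "smod A N" and IN: "\<And>a x. a \<in> I ==> x \<in> M ==> a \<otimes> x \<in> N"
  using qp unfolding qp_def by auto
 have MK: "M \<subseteq> carrier K" using smodD(1)[OF sM] by blast
 obtain B s where B: "qb B (\<lambda>v. v)" "B \<subseteq> M" "s \<in> Z" "s \<notin> p"
  and sp: "\<forall>x\<in>M. \<exists>c. (\<forall>v\<in>B. c v \<in> Z) \<and> s \<otimes> x = lsum B c (\<lambda>v. v)" using local_qb[OF p M] by blast
 note fin = qb_D(1)[OF B(1)]
 obtain r q where r: "r \<in> Z" "q \<in> p" "s \<otimes> r = \<one> \<oplus> q" using mxi_D(6)[OF bp_mxi[OF p] B(3,4)] by blast
 have qK: "q \<in> carrier K" using r(2) mxi_D(3)[OF bp_mxi[OF p]] ZK by blast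
 have R: "s \<in> carrier K" "r \<in> carrier K" using B(3) r ZK' by auto
 have BK: "B \<subseteq> carrier K" using B(2) MK by blast
 have "\<exists>c n. (\<forall>v\<in>B. c v \<in> A) \<and> n \<in> N \<and> x = lsum B c (\<lambda>v. v) \<oplus> n" if x: "x \<in> M" for x
 proof -
  have xK: "x \<in> carrier K" using x MK by blast
  obtain c where c: "\<forall>v\<in>B. c v \<in> Z" "s \<otimes> x = lsum B c (\<lambda>v. v)" using sp x by blast
  have e: "r \<otimes> (s \<otimes> x) = lsum B (\<lambda>v. r \<otimes> c v) (\<lambda>v. v)"
   unfolding c(2) by (rule lsum_smult) (use fin R c(1) ZK' BK in auto)
  have 1: "x = lsum B (\<lambda>v. r \<otimes> c v) (\<lambda>v. v) \<oplus> \<ominus> (q \<otimes> x)"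
   using mod_unit[OF xK R qK r(3)] unfolding e .
  have 2: "\<ominus> (q \<otimes> x) \<in> N" by (rule smod_minus(1)[OF N mxi_D(1)[OF A]]) (rule IN[OF subsetD[OF pI r(2)] x])
  have 3: "\<forall>v\<in>B. r \<otimes> c v \<in> A" using c(1) Zcl(4)[OF r(1)] AZ by blast
  show ?thesis by (rule exI[of _ "\<lambda>v. r \<otimes> c v"], rule exI[of _ "\<ominus> (q \<otimes> x)"]) (rule conjI[OF 3 conjI[OF 2 1]])
 qed
 then show ?thesis using B sp by blast
qed

text \<open>A local basis of (P : P) at P \<inter> Z is a basis of K over Q and spans (P : P) modulo
  P, so a relative basis can be extracted from it.\<close>

lemma mdim_le:
 assumes S: "ord S" and P: "op S P"
 shows "mdim S P \<le> dim Q (carrier K)"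
proof -
 note D = ord_D[OF S] and E = op_D[OF S P] and C = colon_props[OF S P]
 obtain B where B: "qb B (\<lambda>v. v)" "B \<subseteq> col P P"
  "\<forall>x\<in>col P P. \<exists>c n. (\<forall>v\<in>B. c v \<in> S) \<and> n \<in> P \<and> x = lsum B c (\<lambda>v. v) \<oplus> n"
  using local_span[OF C(13) D(6) E(5) C(10,12)] by blast
 obtain J where J: "J \<subseteq> B" "rbasis K S P (col P P) P J (\<lambda>v. v)"
  using rbasis_exists[OF C(13) qb_D(1)[OF B(1)], of "\<lambda>v. v"] B(2,3) by blast
 have "card J \<le> card B" by (rule card_mono[OF qb_D(1)[OF B(1)] J(1)])
 then show ?thesis using quotient_dim_eq[OF C(13) J(2)] dim_eq[OF B(1)] by simp
qed

lemma type_pos: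
 assumes S: "ord S" and P: "op S P"
 shows "type_at K S P > 0"
proof -
 note D = ord_D[OF S] and C = colon_props[OF S P]
 obtain J and b :: "'a \<Rightarrow> 'a" where b: "rbasis K S P (col S P) S J b" using C(14) by blast
 obtain x where x: "x \<in> col S P" "x \<notin> S" using colon_nontrivial[OF S P] by blast
 have "J \<noteq> {}"
 proof
  assume "J = {}"
  then obtain c n where "n \<in> S" "x = lsum {} c b \<oplus> n" using rbasis_D(3)[OF b x(1)] by blast
  then show False using x(2) D(5) by (auto simp: lsum_empty)
 qed
 then show ?thesis using type_at_eq[OF S P b] rbasis_D(1)[OF b] by (simp add: card_gt_0_iff)
qed

text \<open>The product (S : P) P is an ideal between P and S, and P is maximal. The product is P in
  the case described here; otherwise it is S and P is invertible.\<close>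

definition noninv where "noninv S P \<longleftrightarrow> (\<forall>y\<in>col S P. \<forall>x\<in>P. y \<otimes> x \<in> P)"

lemma noninv_type:
 assumes S: "ord S" and P: "op S P" and ni: "noninv S P"
 shows "type_at K S P + 1 = mdim S P"
proof -
 note D = ord_D[OF S] and E = op_D[OF S P] and C = colon_props[OF S P]
 have eq: "col S P = col P P" using ni C(9) unfolding noninv_def by (auto simp: colon_def)
 obtain J and b :: "'a \<Rightarrow> 'a" where b: "rbasis K S P (col S P) S J b" using C(14) by blast
 note B = rbasis_D[OF b]
 have colK: "col P P \<subseteq> carrier K" by (auto simp: colon_def)
 have bK: "b i \<in> carrier K" if "i \<in> J" for i using B(2)[OF that] eq colK by blast
 have sP: "smod S P" by (rule mxi_D(2)[OF E(1)])
 \<comment> \<open>The additional index carries 1, a basis of S/P; the others carry the relative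
   basis of (P : P) modulo S.\<close>
 let ?J = "insert None (Some ` J)" and ?b = "case_option \<one> b"
 have bK': "?b i \<in> carrier K" if "i \<in> ?J" for i using that bK by auto
 have split: "lsum ?J c ?b = c None \<oplus> lsum J (\<lambda>i. c (Some i)) b" if c: "\<And>i. i \<in> ?J ==> c i \<in> carrier K" for c
 proof -
  have "lsum ?J c ?b = c None \<otimes> ?b None \<oplus> lsum (Some ` J) c ?b"
   by (rule lsum_insert) (use B(1) c bK' in auto)
  also have "lsum (Some ` J) c ?b = (\<Oplus>i\<in>J. c (Some i) \<otimes> ?b (Some i))"
   unfolding lsum_def by (rule finsum_reindex) (use c bK in auto)
  also have "\<dots> = lsum J (\<lambda>i. c (Some i)) b" unfolding lsum_def by simp
  finally show ?thesis using c[of None] by simp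
 qed
 have rb: "rbasis K S P (col P P) P ?J ?b"
 proof (rule rbasis_I)
  show "finite ?J" using B(1) by simp
  have "\<one> \<in> col P P" using C(8) D(8) by blast
  then show "?b i \<in> col P P" if "i \<in> ?J" for i using that B(2) eq by auto
  fix x assume "x \<in> col P P"
  then obtain c n where c: "\<forall>i\<in>J. c i \<in> S" "n \<in> S" "x = lsum J c b \<oplus> n" using B(3)[of x] eq by blast
  let ?c = "case_option n c"
  have cS: "?c i \<in> S" if "i \<in> ?J" for i using that c(1,2) by auto
  have R: "n \<in> carrier K" "lsum J c b \<in> carrier K" using c(1,2) D(5) lsum_closed[of J c b] bK by auto
  have "lsum ?J ?c ?b = n \<oplus> lsum J c b" using split[of ?c] cS D(5) by auto
  then have "x = lsum ?J ?c ?b \<oplus> \<zero>" using c(3) R by (simp add: a_comm)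
  then show "\<exists>c n. (\<forall>i\<in>?J. c i \<in> S) \<and> n \<in> P \<and> x = lsum ?J c ?b \<oplus> n"
   using cS smodD(2)[OF sP] by blast
 next
  fix c i assume c: "\<And>i. i \<in> ?J ==> c i \<in> S" and l: "lsum ?J c ?b \<in> P" and i: "i \<in> ?J"
  let ?d = "\<lambda>i. c (Some i)"
  have cN: "c None \<in> S" "c None \<in> carrier K" using c[of None] D(5) by auto
  have dS: "?d i \<in> S" if "i \<in> J" for i using c that by blast
  have dK: "?d i \<in> carrier K" if "i \<in> J" for i using dS[OF that] D(5) by blast
  have lK: "lsum J ?d b \<in> carrier K" by (rule lsum_closed) (use dK bK in auto)
  have tot: "lsum ?J c ?b = c None \<oplus> lsum J ?d b" by (rule split) (use c D(5) in blast)
  have "lsum J ?d b = lsum ?J c ?b \<ominus> c None" unfolding tot by (rule add_minus_cancels(1)[OF cN(2) lK, symmetric])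
  also have "\<dots> \<in> S" by (rule smod_minus(2)[OF smod_self[OF D(1)] D(1)]) (use l E(6) cN in auto)
  finally have dP: "?d i \<in> P" if "i \<in> J" for i using B(4)[of ?d i] dS that by blast
  \<comment> \<open>With the roles of coefficients and vectors exchanged, this is a combination of
    elements of P with scalars in (P : P), hence it is in P.\<close>
  have "lsum J ?d b = lsum J b ?d" unfolding lsum_def by (rule finsum_cong') (use dK bK in \<open>auto simp: m_comm\<close>)
  also have "\<dots> \<in> P"
  proof (rule lsum_mem[where A = "col P P"])
   show "smod (col P P) P" using E(7) smodD[OF sP] by (intro smodI) (auto simp: colon_def)
  qed (use B(1,2) eq dP colK in auto)
  finally have lP: "lsum J ?d b \<in> P" .
  have "c None = lsum ?J c ?b \<ominus> lsum J ?d b" unfolding tot by (rule add_minus_cancels(2)[OF cN(2) lK, symmetric])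
  then have "c None \<in> P" using smod_minus(2)[OF sP D(1) l lP] by simp
  then show "c i \<in> P" using i dP by auto
 qed
 have "card ?J = Suc (card J)" using B(1) by (simp add: card_image)
 then show ?thesis using quotient_dim_eq[OF C(13) rb] type_at_eq[OF S P b] by simp
qed

text \<open>Some y in (S : P) and w in P have y w outside P, hence invertible modulo P with an
  inverse r. For z in (S : P) then z is congruent to r (w z) y modulo S, so y alone generates; and c
  y in S with c outside P would put y into S and y w into P.\<close>

lemma inv_type:
 assumes S: "ord S" and P: "op S P" and inv: "\<not> noninv S P"
 shows "type_at K S P = 1" "mdim S P = 1"
proof -
 note D = ord_D[OF S] and E = op_D[OF S P] and C = colon_props[OF S P]
 have sP: "smod S P" by (rule mxi_D(2)[OF E(1)])
 have sS: "smod S S" by (rule smod_self[OF D(1)])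
 obtain y w where y: "y \<in> col S P" and w: "w \<in> P" and yw: "y \<otimes> w \<notin> P" using inv unfolding noninv_def by blast
 have yK: "y \<in> carrier K" and wK: "w \<in> carrier K" using colD(2)[OF y] w E(7) by auto
 have sS': "y \<otimes> w \<in> S" by (rule colD(1)[OF y w])
 obtain r q where r: "r \<in> S" "q \<in> P" "(y \<otimes> w) \<otimes> r = \<one> \<oplus> q" using mxi_D(6)[OF E(1) sS' yw] by blast
 have R: "y \<otimes> w \<in> carrier K" "r \<in> carrier K" "q \<in> carrier K" using yK wK r D(5) E(7) by auto
 have y1: "rbasis K S P (col S P) S {()} (\<lambda>_. y)"
 proof (rule rbasis_I)
  show "y \<in> col S P" by (rule y)
  fix z assume z: "z \<in> col S P"
  have zK: "z \<in> carrier K" by (rule colD(2)[OF z])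
  have wz: "w \<otimes> z \<in> S" by (rule colD'[OF z w wK])
  have wzK: "w \<otimes> z \<in> carrier K" using wK zK by simp
  have "r \<otimes> (y \<otimes> w \<otimes> z) = (r \<otimes> (w \<otimes> z)) \<otimes> y" using R(2) yK wK zK by (simp add: m_ac)
  also have "\<dots> = lsum {()} (\<lambda>_. r \<otimes> (w \<otimes> z)) (\<lambda>_. y)"
   by (rule lsum_single[symmetric]) (use R(2) wzK yK in auto)
  finally have e: "r \<otimes> (y \<otimes> w \<otimes> z) = lsum {()} (\<lambda>_. r \<otimes> (w \<otimes> z)) (\<lambda>_. y)" .
  have 1: "z = lsum {()} (\<lambda>_. r \<otimes> (w \<otimes> z)) (\<lambda>_. y) \<oplus> \<ominus> (q \<otimes> z)"
   using mod_unit[OF zK R r(3)] unfolding e .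
  have 2: "\<ominus> (q \<otimes> z) \<in> S" by (rule smod_minus(1)[OF sS D(1)]) (rule colD'[OF z r(2) R(3)])
  have 3: "\<forall>i\<in>{()}. r \<otimes> (w \<otimes> z) \<in> S" using subringE(6)[OF D(1) r(1) wz] by blast
  show "\<exists>c n. (\<forall>i\<in>{()}. c i \<in> S) \<and> n \<in> S \<and> z = lsum {()} c (\<lambda>_. y) \<oplus> n"
   by (rule exI[of _ "\<lambda>_. r \<otimes> (w \<otimes> z)"], rule exI[of _ "\<ominus> (q \<otimes> z)"]) (rule conjI[OF 3 conjI[OF 2 1]])
 next
  fix c i assume c: "\<And>i. i \<in> {()} ==> c i \<in> S" and l: "lsum {()} c (\<lambda>_. y) \<in> S" and i: "i \<in> {()}"
  have cS: "c () \<in> S" and cK: "c () \<in> carrier K" using c D(5) by auto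
  have cy: "c () \<otimes> y \<in> S" using l lsum_single[of c "()" "\<lambda>_. y"] cK yK by simp
  have "c () \<in> P"
  proof (rule ccontr)
   assume "c () \<notin> P"
   then obtain e f where e: "e \<in> S" "f \<in> P" "c () \<otimes> e = \<one> \<oplus> f" using mxi_D(6)[OF E(1) cS] by blast
   have R': "e \<in> carrier K" "f \<in> carrier K" using e D(5) E(7) by auto
   have "e \<otimes> (c () \<otimes> y) \<oplus> \<ominus> (f \<otimes> y) \<in> S"
    by (intro subringE(5,6,7)[OF D(1)] e(1) cy colD'[OF y e(2) R'(2)])
   then have "y \<in> S" using mod_unit[OF yK cK R' e(3)] by simp
   then show False using yw smodD(4)[OF sP _ w] by blast
  qed
  then show "c i \<in> P" by simp
 qed simp
 show "type_at K S P = 1" using type_at_eq[OF S P y1] by simp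
 \<comment> \<open>For x in (P : P) the element y w x = y (w x) is in S. The inverse of y w modulo P
   recovers x up to q x, which is in P.\<close>
 have "col P P \<subseteq> S"
 proof
  fix x assume x: "x \<in> col P P"
  have xK: "x \<in> carrier K" by (rule colD(2)[OF x])
  have "y \<otimes> w \<otimes> x = y \<otimes> (w \<otimes> x)" using xK yK wK by (simp add: m_assoc)
  then have s: "y \<otimes> w \<otimes> x \<in> S" using colD(1)[OF y colD'[OF x w wK]] by simp
  have qx: "q \<otimes> x \<in> S" using colD'[OF x r(2) R(3)] E(6) by blast
  have "r \<otimes> (y \<otimes> w \<otimes> x) \<oplus> \<ominus> (q \<otimes> x) \<in> S"
   by (rule subringE(7)[OF D(1) subringE(6)[OF D(1) r(1) s] subringE(5)[OF D(1) qx]])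
  then show "x \<in> S" using mod_unit[OF xK R r(3)] by simp
 qed
 then have eq: "col P P = S" using C(8) by blast
 have "rbasis K S P S P {()} (\<lambda>_. \<one>)"
 proof (rule rbasis_I)
  show "\<one> \<in> S" by (rule D(8))
  fix x assume x: "x \<in> S"
  have h: "x = lsum {()} (\<lambda>_. x) (\<lambda>_. \<one>) \<oplus> \<zero>" using lsum_single[of "\<lambda>_. x" "()" "\<lambda>_. \<one>"] x D(5) by auto
  have "\<forall>i\<in>{()}. x \<in> S" using x by blast
  then show "\<exists>c n. (\<forall>i\<in>{()}. c i \<in> S) \<and> n \<in> P \<and> x = lsum {()} c (\<lambda>_. \<one>) \<oplus> n"
   by (intro exI[of _ "\<lambda>_. x"] exI[of _ \<zero>]) (rule conjI[OF _ conjI[OF smodD(2)[OF sP] h]])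
 next
  fix c i assume "\<And>i. i \<in> {()} ==> c i \<in> S" "lsum {()} c (\<lambda>_. \<one>) \<in> P"
  then show "c i \<in> P" using lsum_single[of c "()" "\<lambda>_. \<one>"] D(5) by auto
 qed simp
 then show "mdim S P = 1" using quotient_dim_eq[of S P S P "{()}" "\<lambda>_. \<one>"] C(13) eq by simp
qed

lemma mxi_pow:
 assumes m: "mxi S P" and x: "x \<in> S" "x [^] (n::nat) \<in> P"
 shows "x \<in> P"
 using x(2)
proof (induction n)
 case 0 then show ?case using mxi_D(4)[OF m] by simp
next
 case (Suc n)
 have "x [^] n \<in> S" for n :: nat
  by (induction n) (use subringE(3,6)[OF mxi_D(1)[OF m]] x(1) in auto)
 then show ?case using Suc mxi_D(7)[OF m, of "x [^] n" x] x(1) by auto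
qed

text \<open>A prime over the conductor \<open>f\<close> of \<open>OK\<close> is not invertible: an inverse \<open>y\<close> of an element
 of it satisfies \<open>y f \<subseteq> f\<close>, so it is integral.\<close>

lemma noninv_exists:
 assumes S: "ord S" and ne: "S \<noteq> OK"
 shows "\<exists>P. op S P \<and> noninv S P"
proof -
 note D = ord_D[OF S] and DO = ord_D[OF ord_OK_self]
 let ?f = "col S OK"
 have sf: "smod S ?f" by (rule colon_smod[OF D(5) smod_self[OF D(1)] DO(5)])
 have fK: "?f \<subseteq> carrier K" by (auto simp: colon_def)
 have fS: "?f \<subseteq> S"
 proof
  fix x assume x: "x \<in> ?f"
  then have "x \<otimes> \<one> \<in> S" using colD(1) DO(8) by blast
  then show "x \<in> S" using x fK by auto
 qed
 have "\<one> \<notin> ?f"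
 proof
  assume 1: "\<one> \<in> ?f"
  have "x \<in> S" if "x \<in> OK" for x using colD(1)[OF 1 that] that DO(5) by auto
  then show False using ne ord_OK[OF S] by blast
 qed
 moreover obtain d where d: "d \<in> Z" "d \<noteq> \<zero>" "\<forall>x\<in>OK. d \<otimes> x \<in> S" using full_fg[OF D(3,4) DO(2)] by blast
 have df: "d \<in> ?f" using d ZK' by (simp add: colon_def)
 ultimately obtain P where P: "op S P" "?f \<subseteq> P" using op_above[OF S sf fS _ df d(1,2)] by blast
 note E = op_D[OF S P(1)]
 have fg: "fg Z ?f" by (rule noeth_fg[OF Zs noethZ D(2) smod_mono[OF sf D(6)] fS])
 have fO: "g \<otimes> o1 \<in> ?f" if g: "g \<in> ?f" and o1: "o1 \<in> OK" for g o1
 proof -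
  have R: "g \<in> carrier K" "o1 \<in> carrier K" using g fK o1 DO(5) by auto
  have "g \<otimes> o1 \<otimes> x \<in> S" if x: "x \<in> OK" for x
  proof -
   have "g \<otimes> o1 \<otimes> x = g \<otimes> (o1 \<otimes> x)" using R x DO(5) by (intro m_assoc) auto
   then show ?thesis using colD(1)[OF g subringE(6)[OF OK_subring o1 x]] by simp
  qed
  then show ?thesis using R by (simp add: colon_def)
 qed
 have "noninv S P"
  unfolding noninv_def
 proof (intro ballI)
  fix y w assume y: "y \<in> col S P" and w: "w \<in> P"
  have yK: "y \<in> carrier K" and wK: "w \<in> carrier K" using colD(2)[OF y] w E(7) by auto
  have yf: "y \<otimes> g \<in> ?f" if g: "g \<in> ?f" for g
  proof -
   have gK: "g \<in> carrier K" using g fK by blast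
   have "y \<otimes> g \<otimes> x \<in> S" if x: "x \<in> OK" for x
   proof -
    have "y \<otimes> g \<otimes> x = y \<otimes> (g \<otimes> x)" using yK gK x DO(5) by (intro m_assoc) auto
    moreover have "g \<otimes> x \<in> P" using fO[OF g x] P(2) by blast
    ultimately show ?thesis using colD(1)[OF y] by simp
   qed
   then show ?thesis using yK gK by (simp add: colon_def)
  qed
  have "integral_over K Z y" by (rule integralI[OF yK fg yf df ZQ'[OF d(1)] d(2)])
  then obtain n where n: "y [^] n \<in> pspan y n" using integral_iff[OF yK] by blast
  let ?\<sigma> = "y \<otimes> w"
  have sS: "?\<sigma> \<in> S" by (rule colD(1)[OF y w])
  have sn: "?\<sigma> [^] i \<in> S" for i :: nat
   by (induction i) (use sS D(8) subringE(6)[OF D(1)] in auto)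
  have wn: "w [^] Suc i \<in> P" for i
  proof (induction i)
   case 0 then show ?case using w wK by simp
  next
   case (Suc i)
   then show ?case using smodD(4)[OF mxi_D(2)[OF E(1)], of "w [^] Suc i" w] w E(6) by auto
  qed
  \<comment> \<open>Here w^n y^i = (y w)^i w^(n-i) with at least one factor w left. The integral
    equation of y then puts (y w)^n into P, and P is prime.\<close>
  have pw: "w [^] n \<otimes> y [^] i \<in> P" if i: "i < n" for i
  proof -
   obtain k where k: "n = i + Suc k" using less_imp_Suc_add[OF i] by auto
   have "w [^] n = w [^] i \<otimes> w [^] Suc k" unfolding k by (rule nat_pow_mult[OF wK, symmetric])
   then have "w [^] n \<otimes> y [^] i = (y [^] i \<otimes> w [^] i) \<otimes> w [^] Suc k" using wK yK by (simp add: m_ac del: nat_pow_Suc)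
   also have "y [^] i \<otimes> w [^] i = ?\<sigma> [^] i" using nat_pow_distrib[OF yK wK] by simp
   finally show ?thesis using smodD(4)[OF mxi_D(2)[OF E(1)] sn wn[of k], of i] by simp
  qed
  have "pspan y n \<subseteq> {v \<in> carrier K. w [^] n \<otimes> v \<in> P}"
   unfolding pspan_def
   by (rule spn_least[OF smod_mult_vimage[OF E(4)]]) (use wK yK pw in auto)
  then have "w [^] n \<otimes> y [^] n \<in> P" using n by blast
  then have "?\<sigma> [^] n \<in> P" using nat_pow_distrib[OF yK wK] m_comm[of "w [^] n" "y [^] n"] wK yK by simp
  then show "?\<sigma> \<in> P" by (rule mxi_pow[OF E(1) sS])
 qed
 then show ?thesis using P(1) by blast
qed

text \<open>The 1 in the maximum accounts for invertible primes, which have type one even if K has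
  dimension one.\<close>

lemma type_bound: "ord S ==> op S P ==> type_at K S P \<le> max 1 (dim Q (carrier K) - 1)"
 using inv_type(1)[of S P] noninv_type[of S P] mdim_le[of S P] by (cases "noninv S P") auto

lemma type_finite:
 assumes S: "ord S"
 shows "finite (type_at K S ` order_primes K Q Z S)" "type_at K S ` order_primes K Q Z S \<noteq> {}"
proof -
 show "finite (type_at K S ` order_primes K Q Z S)"
  by (rule finite_subset[of _ "{..max 1 (dim Q (carrier K) - 1)}"]) (use type_bound[OF S] op_iff[OF S] in auto)
 show "type_at K S ` order_primes K Q Z S \<noteq> {}" using op_exists[OF S] op_iff[OF S] by auto
qed

theorem order_type_multiplicator:
 assumes S: "ord S" and ne: "S \<noteq> OK"
 shows "order_type K Q Z S + 1 = Max {mdim S P | P. P \<in> order_primes K Q Z S}"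
proof -
 let ?M = "order_type K Q Z S"
 note F = type_finite[OF S]
 have le: "type_at K S P \<le> ?M" if "op S P" for P
  unfolding order_type_def by (rule Max_ge[OF F(1)]) (use that op_iff[OF S] in blast)
 have "?M \<in> type_at K S ` order_primes K Q Z S" unfolding order_type_def by (rule Max_in[OF F])
 then obtain P where P: "op S P" "type_at K S P = ?M" using op_iff[OF S] by auto
 have "\<exists>P. op S P \<and> mdim S P = ?M + 1"
 proof (cases "noninv S P")
  case True then show ?thesis using noninv_type[OF S P(1)] P by auto
 next
  \<comment> \<open>If the largest type occurs at an invertible prime it is 1. A non-invertible
    prime exists, its type is positive, so it is 1 as well, and the chain of
    \<open>noninv_type\<close> applies there.\<close>
  case False
  obtain P' where P': "op S P'" "noninv S P'" using noninv_exists[OF S ne] by blast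
  have "type_at K S P' = 1" using le[OF P'(1)] type_pos[OF S P'(1)] inv_type(1)[OF S P(1) False] P(2) by simp
  then show ?thesis using noninv_type[OF S P'] P' inv_type(1)[OF S P(1) False] P(2) by auto
 qed
 then obtain P0 where P0: "op S P0" "mdim S P0 = ?M + 1" by blast
 have b: "mdim S P \<le> ?M + 1" if "op S P" for P
  using le[OF that] inv_type(2)[OF S that] noninv_type[OF S that] by (cases "noninv S P") auto
 have "Max {mdim S P | P. P \<in> order_primes K Q Z S} = ?M + 1"
 proof (rule Max_eqI)
  show "finite {mdim S P | P. P \<in> order_primes K Q Z S}"
   by (rule finite_subset[of _ "{..?M + 1}"]) (use b op_iff[OF S] in auto)
  show "y \<le> ?M + 1" if "y \<in> {mdim S P | P. P \<in> order_primes K Q Z S}" for y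
   using that b op_iff[OF S] by auto
  have "P0 \<in> order_primes K Q Z S" using P0(1) op_iff[OF S] by blast
  then show "?M + 1 \<in> {mdim S P | P. P \<in> order_primes K Q Z S}" using P0(2)[symmetric] by blast
 qed
 then show ?thesis by simp
qed

lemma order_type_le:
 assumes n: "dim Q (carrier K) > 1" and S: "ord S"
 shows "order_type K Q Z S \<le> dim Q (carrier K) - 1"
proof -
 have "type_at K S P \<le> dim Q (carrier K) - 1" if "op S P" for P
 proof -
  have "max 1 (dim Q (carrier K) - 1) = dim Q (carrier K) - 1" using n by (intro max_absorb2) simp
  then show ?thesis using type_bound[OF S that] by simp
 qed
 then have "\<forall>t \<in> type_at K S ` order_primes K Q Z S. t \<le> dim Q (carrier K) - 1" using op_iff[OF S] by auto
 then show ?thesis unfolding order_type_def using Max_le_iff[OF type_finite[OF S]] by blast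
qed

end

section \<open>An order of maximal type\<close>

context etale_order
begin

text \<open>W = p OK is a prime of R = Z + W with residue field Z/p and multiplicator ring OK. Since
  OK is locally free at p, OK/W has the full dimension of K over Q, and \<open>noninv_type\<close>
  lowers this by one to the type.\<close>

lemma conductor_order:
 assumes p: "bp p"
 defines "W \<equiv> ideal_prod K p OK"
 defines "R \<equiv> Z <+>\<^bsub>K\<^esub> W"
 shows "ord R" "dim Q (carrier K) > 1 ==> order_type K Q Z R = dim Q (carrier K) - 1"
proof -
 note DO = ord_D[OF ord_OK_self]
 note mp = bp_mxi[OF p]
 have pZ: "p \<subseteq> Z" and pK: "p \<subseteq> carrier K" using mxi_D(3)[OF mp] ZK by auto
 have p0: "\<zero> \<in> p" by (rule smodD(2)[OF mxi_D(2)[OF mp]])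
 obtain a s where a: "a \<in> p" "a \<noteq> \<zero>" and s: "s \<in> Z" "s \<notin> p"
  and gen: "\<forall>x\<in>p. \<exists>y\<in>Z. s \<otimes> x = a \<otimes> y" using local_generator[OF p] by blast
 have aZ: "a \<in> Z" using a pZ by blast
 have aK: "a \<in> carrier K" and sK: "s \<in> carrier K" using aZ s ZK' by auto
 have WO: "smod OK W" unfolding W_def by (rule ideal_prod_smod[OF DO(5) pK p0 smod_self[OF OK_subring]])
 have WZ: "smod Z W" by (rule smod_mono[OF WO DO(6)])
 have W_OK: "W \<subseteq> OK" unfolding W_def
  by (rule ideal_prod_subset[OF smod_self[OF OK_subring]]) (use subringE(6)[OF OK_subring] pZ DO(6) in blast)
 have WK: "W \<subseteq> carrier K" using W_OK DO(5) by blast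
 have pW: "x \<otimes> y \<in> W" if "x \<in> p" "y \<in> OK" for x y unfolding W_def by (rule ideal_prod.prod[OF that])
 have pW1: "x \<in> W" if "x \<in> p" for x using pW[OF that DO(8)] that pK by auto
 have Wloc: "\<exists>y\<in>OK. s \<otimes> x = a \<otimes> y" if x: "x \<in> W" for x
  using x unfolding W_def
 proof (induction rule: ideal_prod.induct)
  case (prod i j)
  obtain y where y: "y \<in> Z" "s \<otimes> i = a \<otimes> y" using gen prod(1) by blast
  have K: "i \<in> carrier K" "j \<in> carrier K" "y \<in> carrier K" using prod pK DO(5) y ZK' by auto
  have "s \<otimes> (i \<otimes> j) = (s \<otimes> i) \<otimes> j" using sK K by (simp add: m_assoc)
  also have "\<dots> = a \<otimes> (y \<otimes> j)" unfolding y(2) using aK K by (simp add: m_assoc)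
  finally show ?case using subringE(6)[OF OK_subring subsetD[OF DO(6) y(1)] prod(2)] by blast
 next
  case (sum x x')
  obtain y y' where y: "y \<in> OK" "s \<otimes> x = a \<otimes> y" "y' \<in> OK" "s \<otimes> x' = a \<otimes> y'" using sum.IH by blast
  have K: "x \<in> carrier K" "x' \<in> carrier K" "y \<in> carrier K" "y' \<in> carrier K"
   using sum.hyps WK y DO(5) unfolding W_def by auto
  have "s \<otimes> (x \<oplus> x') = s \<otimes> x \<oplus> s \<otimes> x'" using sK K by (simp add: r_distr)
  also have "\<dots> = a \<otimes> (y \<oplus> y')" unfolding y(2,4) using aK K by (simp add: r_distr)
  finally show ?case using subringE(7)[OF OK_subring y(1,3)] by blast
 qed
 \<comment> \<open>If 1 were in W, then s/a would be in OK and in Q, hence in Z, and s would be in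
   p.\<close>
 have W1: "\<one> \<notin> W"
 proof
  assume "\<one> \<in> W"
  then obtain y where y: "y \<in> OK" "s \<otimes> \<one> = a \<otimes> y" using Wloc by blast
  obtain i where i: "i \<in> Q" "a \<otimes> i = \<one>" using Q_inv[OF ZQ'[OF aZ] a(2)] by blast
  have K: "y \<in> carrier K" "i \<in> carrier K" using y i DO(5) QK' by auto
  have "y = (a \<otimes> i) \<otimes> y" using i K by simp
  also have "\<dots> = i \<otimes> (a \<otimes> y)" using aK K by (simp add: m_ac)
  also have "\<dots> = i \<otimes> s" unfolding y(2)[symmetric] using sK by simp
  finally have "y \<in> Q" using Qcl(4)[OF i(1) ZQ'[OF s(1)]] by simp
  then have "y \<in> Z" using OK_Q y(1) by blast
  then have "y \<otimes> a \<in> p" by (rule smodD(4)[OF mxi_D(2)[OF mp] _ a(1)])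
  then show False using s(2) y(2) m_comm[OF aK K(1)] sK by simp
 qed
 have R_iff: "x \<in> R \<longleftrightarrow> (\<exists>z\<in>Z. \<exists>w\<in>W. x = z \<oplus> w)" for x unfolding R_def set_add_def' by blast
 have RI: "z \<oplus> w \<in> R" if "z \<in> Z" "w \<in> W" for z w using R_iff that by blast
 have W0: "\<zero> \<in> W" by (rule smodD(2)[OF WO])
 have WR: "W \<subseteq> R"
 proof
  fix x assume x: "x \<in> W"
  show "x \<in> R" using RI[OF Zcl(1) x] subsetD[OF WK x] by simp
 qed
 have ZR: "Z \<subseteq> R"
 proof
  fix x assume x: "x \<in> Z"
  show "x \<in> R" using RI[OF x W0] ZK'[OF x] by simp
 qed
 have R_OK: "R \<subseteq> OK"
 proof
  fix x assume "x \<in> R"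
  then obtain z w where h: "z \<in> Z" "w \<in> W" "x = z \<oplus> w" using R_iff by blast
  show "x \<in> OK" unfolding h(3) by (rule subringE(7)[OF OK_subring subsetD[OF DO(6) h(1)] subsetD[OF W_OK h(2)]])
 qed
 have RK: "R \<subseteq> carrier K" using R_OK DO(5) by blast
 have Rs: "subring R K"
 proof (rule subringI[OF RK])
  show "\<one> \<in> R" using ZR Zcl(2) by blast
  show "\<ominus> h \<in> R" if "h \<in> R" for h
  proof -
   obtain z w where h: "z \<in> Z" "w \<in> W" "h = z \<oplus> w" using \<open>h \<in> R\<close> R_iff by blast
   have "\<ominus> h = \<ominus> z \<oplus> \<ominus> w" unfolding h(3) using h WK ZK' by (intro minus_add) auto
   then show ?thesis using RI[OF Zcl(3)[OF h(1)] smod_minus(1)[OF WO OK_subring h(2)]] by simp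
  qed
  fix h h' assume "h \<in> R" "h' \<in> R"
  then obtain z w z' w' where h: "z \<in> Z" "w \<in> W" "h = z \<oplus> w" "z' \<in> Z" "w' \<in> W" "h' = z' \<oplus> w'"
   using R_iff by blast
  have K: "z \<in> carrier K" "z' \<in> carrier K" "w \<in> carrier K" "w' \<in> carrier K" using h WK ZK' by auto
  have "h \<oplus> h' = (z \<oplus> z') \<oplus> (w \<oplus> w')" unfolding h using K by algebra
  then show "h \<oplus> h' \<in> R" using RI[OF Zcl(5)[OF h(1,4)] smodD(3)[OF WO h(2,5)]] by simp
  have "h \<otimes> h' = z \<otimes> z' \<oplus> (z \<otimes> w' \<oplus> (z' \<otimes> w \<oplus> w \<otimes> w'))" unfolding h using K by algebra
  moreover have "z \<otimes> w' \<oplus> (z' \<otimes> w \<oplus> w \<otimes> w') \<in> W"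
   by (rule smodD(3)[OF WO smodD(4)[OF WZ h(1,5)] smodD(3)[OF WO smodD(4)[OF WZ h(4,2)]
    smodD(4)[OF WO subsetD[OF W_OK h(2)] h(5)]]])
  ultimately show "h \<otimes> h' \<in> R" using RI[OF Zcl(4)[OF h(1,4)]] by simp
 qed
 have RZ: "smod Z R" by (rule smod_mono[OF smod_self[OF Rs] ZR])
 have fW: "full W" by (rule full_scale[OF DO(3) aZ a(2)]) (rule pW[OF a(1)])
 show oR: "ord R"
  unfolding ord_def using Rs noeth_fg[OF Zs noethZ DO(2) RZ R_OK] full_mono[OF fW WR] by blast
 note D = ord_D[OF oR]
 have WRm: "smod R W" by (rule smod_mono[OF WO R_OK])
 \<comment> \<open>An element of R outside W has its component in Z outside p, and an inverse of
   this component modulo p is an inverse modulo W.\<close>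
 have mW: "mxi R W"
 proof (rule mxiI[OF Rs WRm WR W1])
  fix x assume x: "x \<in> R" "x \<notin> W"
  obtain z w where h: "z \<in> Z" "w \<in> W" "x = z \<oplus> w" using x(1) R_iff by blast
  have "z \<notin> p" using h x(2) pW1 smodD(3)[OF WO] by blast
  then obtain y q where y: "y \<in> Z" "q \<in> p" "z \<otimes> y = \<one> \<oplus> q" using mxi_D(6)[OF mp h(1)] by blast
  have K: "z \<in> carrier K" "w \<in> carrier K" "y \<in> carrier K" "q \<in> carrier K" using h y WK ZK' pK by auto
  have "x \<otimes> y = z \<otimes> y \<oplus> y \<otimes> w" unfolding h(3) using K by algebra
  also have "\<dots> = \<one> \<oplus> (q \<oplus> y \<otimes> w)" unfolding y(3) using K by (simp add: a_assoc)
  finally show "\<exists>y\<in>R. \<exists>q\<in>W. x \<otimes> y = \<one> \<oplus> q"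
   using smodD(3)[OF WO pW1[OF y(2)] smodD(4)[OF WZ y(1) h(2)]] ZR y(1) by blast
 qed
 have oW: "op R W" unfolding op_def using mW pW1[OF a(1)] aZ a(2) by blast
 note C = colon_props[OF oR oW]
 \<comment> \<open>W is an OK-module, which gives one inclusion. For the other, an element that
   stabilizes the finitely generated module W, which contains the non-zero a of Z, is
   integral.\<close>
 have col: "col W W = OK"
 proof
  show "OK \<subseteq> col W W" using smodD(4)[OF WO] DO(5) by (auto simp: colon_def)
  have fgW: "fg Z W" by (rule noeth_fg[OF Zs noethZ DO(2) WZ W_OK])
  show "col W W \<subseteq> OK"
  proof
   fix x assume x: "x \<in> col W W"
   have "integral_over K Z x"
    by (rule integralI[OF colD(2)[OF x] fgW colD(1)[OF x] pW1[OF a(1)] ZQ'[OF aZ] a(2)])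
   then show "x \<in> OK" using colD(2)[OF x] OK_iff by blast
  qed
 qed
 have qp: "qp R W OK W" using C(13) unfolding col .
 obtain B t where B: "qb B (\<lambda>v. v)" "B \<subseteq> OK" and t: "t \<in> Z" "t \<notin> p"
  and tsp: "\<forall>x\<in>OK. \<exists>c. (\<forall>v\<in>B. c v \<in> Z) \<and> t \<otimes> x = lsum B c (\<lambda>v. v)"
  and sp: "\<forall>x\<in>OK. \<exists>c n. (\<forall>v\<in>B. c v \<in> R) \<and> n \<in> W \<and> x = lsum B c (\<lambda>v. v) \<oplus> n"
  using local_span[OF qp ZR p DO(2,3)] pW1 by blast
 have fin: "finite B" by (rule qb_D(1)[OF B(1)])
 have BK: "B \<subseteq> carrier K" using B(2) DO(5) by blast
 have tK: "t \<in> carrier K" using t ZK' by blast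
 have rb: "rbasis K R W OK W B (\<lambda>v. v)"
 proof (rule rbasis_I[OF fin])
  show "v \<in> OK" if "v \<in> B" for v using that B(2) by blast
  show "\<exists>c n. (\<forall>v\<in>B. c v \<in> R) \<and> n \<in> W \<and> x = lsum B c (\<lambda>v. v) \<oplus> n" if "x \<in> OK" for x
   using sp that by blast
  fix c v assume c: "\<And>v. v \<in> B ==> c v \<in> R" and l: "lsum B c (\<lambda>v. v) \<in> W" and v: "v \<in> B"
  \<comment> \<open>Only the components of the coefficients in Z matter modulo W. If their
    combination lies in W, then t s times it is a times an integral combination of B; comparing
    coordinates puts each t s z v into p.\<close>
  have "\<forall>v. \<exists>z w. v \<in> B --> z \<in> Z \<and> w \<in> W \<and> c v = z \<oplus> w" using c R_iff by blast
  then obtain z w where zw: "\<And>v. v \<in> B ==> z v \<in> Z" "\<And>v. v \<in> B ==> w v \<in> W"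
   "\<And>v. v \<in> B ==> c v = z v \<oplus> w v" by metis
  have zK: "z v \<in> carrier K" if "v \<in> B" for v using zw(1)[OF that] ZK' by blast
  have wK: "w v \<in> carrier K" if "v \<in> B" for v using zw(2)[OF that] WK by blast
  have lzK: "lsum B z (\<lambda>v. v) \<in> carrier K" "lsum B w (\<lambda>v. v) \<in> carrier K"
   by (rule lsum_closed, use zK wK BK in auto)+
  have wW: "lsum B w (\<lambda>v. v) \<in> W"
  proof -
   have "lsum B w (\<lambda>v. v) = lsum B (\<lambda>v. v) w"
    unfolding lsum_def by (rule finsum_cong') (use wK BK in \<open>auto simp: m_comm\<close>)
   also have "\<dots> \<in> W" by (rule lsum_mem[OF WO fin _ _ DO(5)]) (use B(2) zw(2) in auto)
   finally show ?thesis .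
  qed
  have "lsum B c (\<lambda>v. v) = lsum B (\<lambda>v. z v \<oplus> w v) (\<lambda>v. v)"
   by (rule lsum_cong) (use c RK zw(3) BK in auto)
  also have "\<dots> = lsum B z (\<lambda>v. v) \<oplus> lsum B w (\<lambda>v. v)"
   by (rule lsum_add[symmetric]) (use zK wK BK in auto)
  finally have e: "lsum B c (\<lambda>v. v) \<ominus> lsum B w (\<lambda>v. v) = lsum B z (\<lambda>v. v)"
   using add_minus_cancels(2)[OF lzK] by simp
  have zW: "lsum B z (\<lambda>v. v) \<in> W" using smod_minus(2)[OF WO OK_subring l wW] unfolding e .
  obtain y where y: "y \<in> OK" "s \<otimes> lsum B z (\<lambda>v. v) = a \<otimes> y" using Wloc[OF zW] by blast
  have yK: "y \<in> carrier K" using y DO(5) by blast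
  obtain u where u: "\<forall>v\<in>B. u v \<in> Z" "t \<otimes> y = lsum B u (\<lambda>v. v)" using tsp y(1) by blast
  have uK: "u v \<in> carrier K" if "v \<in> B" for v using u(1) that ZK' by blast
  have "(t \<otimes> s) \<otimes> lsum B z (\<lambda>v. v) = t \<otimes> (a \<otimes> y)" using tK sK lzK y(2) by (simp add: m_assoc)
  also have "\<dots> = a \<otimes> lsum B u (\<lambda>v. v)" unfolding u(2)[symmetric] using tK aK yK by (simp add: m_lcomm)
  also have "\<dots> = lsum B (\<lambda>v. a \<otimes> u v) (\<lambda>v. v)" by (rule lsum_smult) (use fin aK uK BK in auto)
  finally have E: "(t \<otimes> s) \<otimes> lsum B z (\<lambda>v. v) = lsum B (\<lambda>v. a \<otimes> u v) (\<lambda>v. v)" .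
  have E2: "(t \<otimes> s) \<otimes> lsum B z (\<lambda>v. v) = lsum B (\<lambda>v. t \<otimes> s \<otimes> z v) (\<lambda>v. v)"
   by (rule lsum_smult) (use fin tK sK zK BK in auto)
  have ts: "t \<otimes> s \<in> Z" by (rule Zcl(4)[OF t(1) s(1)])
  have "co B (\<lambda>v. v) ((t \<otimes> s) \<otimes> lsum B z (\<lambda>v. v)) v = t \<otimes> s \<otimes> z v"
   by (rule co_unique[OF B(1) _ E2 v]) (use Zcl(4)[OF ts] zw(1) ZQ' in blast)
  moreover have "co B (\<lambda>v. v) ((t \<otimes> s) \<otimes> lsum B z (\<lambda>v. v)) v = a \<otimes> u v"
   by (rule co_unique[OF B(1) _ E v]) (use Zcl(4)[OF aZ] u(1) ZQ' in blast)
  ultimately have "t \<otimes> s \<otimes> z v = a \<otimes> u v" by simp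
  also have "\<dots> = u v \<otimes> a" by (rule m_comm[OF aK uK[OF v]])
  also have "\<dots> \<in> p" using smodD(4)[OF mxi_D(2)[OF mp] _ a(1)] u(1) v by blast
  finally have "t \<otimes> s \<otimes> z v \<in> p" .
  then have "t \<otimes> s \<in> p \<or> z v \<in> p" by (rule mxi_D(7)[OF mp ts zw(1)[OF v]])
  moreover have "t \<otimes> s \<notin> p" using mxi_D(7)[OF mp t(1) s(1)] t(2) s(2) by blast
  ultimately have "z v \<in> W" using pW1 by blast
  then show "c v \<in> W" unfolding zw(3)[OF v] by (rule smodD(3)[OF WO _ zw(2)[OF v]])
 qed
 have md: "mdim R W = dim Q (carrier K)"
  unfolding col using quotient_dim_eq[OF qp rb] dim_eq[OF B(1)] by simp
 show "order_type K Q Z R = dim Q (carrier K) - 1" if n: "dim Q (carrier K) > 1"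
 proof (rule antisym)
  show "order_type K Q Z R \<le> dim Q (carrier K) - 1" by (rule order_type_le[OF n oR])
  \<comment> \<open>At an invertible prime the multiplicator quotient has dimension one, whereas
    here it has dimension dim K > 1.\<close>
  have "noninv R W" using inv_type(2)[OF oR oW] md n by auto
  then have "type_at K R W = dim Q (carrier K) - 1" using noninv_type[OF oR oW] md by simp
  moreover have "type_at K R W \<le> order_type K Q Z R"
   unfolding order_type_def by (rule Max_ge[OF type_finite(1)[OF oR]]) (use op_iff[OF oR] oW in blast)
  ultimately show "dim Q (carrier K) - 1 \<le> order_type K Q Z R" by simp
 qed
qed

end

theorem theorem1:
  fixes K :: "'a ring" and Q Z S :: "'a set"
  assumes "dedekind_with_fractions K Q Z"
    and "etale_algebra K Q"
    and "order_in K Q Z S"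
  shows
    "(\<forall>P \<in> order_primes K Q Z S.
        type_at K S P =
          quotient_dim K S P (trace_dual K Q Z S) (ideal_prod K P (trace_dual K Q Z S)))
     \<and>
     (S \<noteq> maximal_order K Z \<longrightarrow>
        order_type K Q Z S + 1 =
          Max {quotient_dim K S P (colon K P P) P | P. P \<in> order_primes K Q Z S})
     \<and>
     (ring.dim K Q (carrier K) > 1 \<longrightarrow>
        (\<forall>T. order_in K Q Z T \<longrightarrow> order_type K Q Z T \<le> ring.dim K Q (carrier K) - 1) \<and>
        (\<forall>p \<in> base_primes K Z.
           order_in K Q Z (Z <+>\<^bsub>K\<^esub> ideal_prod K p (maximal_order K Z)) \<and>
           order_type K Q Z (Z <+>\<^bsub>K\<^esub> ideal_prod K p (maximal_order K Z)) =
             ring.dim K Q (carrier K) - 1))"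
proof -
 have cr: "cring K" using assms(2) unfolding etale_algebra_def by blast
 obtain U where U: "basis_over K Q U" using assms(3) unfolding order_in_def lattice_in_def by blast
 interpret etale_order K Q Z S U
  by (rule etale_order.intro[OF dedekind_algebra.intro[OF cr dedekind_algebra_axioms.intro[OF assms(1)]]
   etale_order_axioms.intro[OF assms(2,3) U]])
 have S: "ord S" using assms(3) ord_iff by blast
 show ?thesis
 proof (intro conjI ballI impI allI)
  show "type_at K S P = quotient_dim K S P (dual S) (ideal_prod K P (dual S))"
   if "P \<in> order_primes K Q Z S" for P
   using type_eq_trace_dual[OF S] that op_iff[OF S] by blast
  show "order_type K Q Z S + 1 = Max {mdim S P | P. P \<in> order_primes K Q Z S}" if "S \<noteq> OK"
   by (rule order_type_multiplicator[OF S that])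
  assume n: "dim Q (carrier K) > 1"
  show "order_type K Q Z T \<le> dim Q (carrier K) - 1" if "order_in K Q Z T" for T
   using order_type_le[OF n] that ord_iff by blast
  fix p assume "p \<in> base_primes K Z"
  then have p: "bp p" by (simp add: bp_def)
  show "order_in K Q Z (Z <+>\<^bsub>K\<^esub> ideal_prod K p OK)" using conductor_order(1)[OF p] ord_iff by blast
  show "order_type K Q Z (Z <+>\<^bsub>K\<^esub> ideal_prod K p OK) = dim Q (carrier K) - 1"
   by (rule conductor_order(2)[OF p n])
 qed
qed

end
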